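(* Let $1<s<2$, let $N>2s$, and let $\Omega\subset\mathbb{R}^N$ be an open domain. Let $u\in\mathcal{D}^{s,2}(\mathbb{R}^N)$ be a nontrivial solution of $(-\Delta)^s u=0$ in $\Omega$. Assume also that $(-\Delta)^s u\in(\mathcal{D}^{s-1,2}(\mathbb{R}^N))^\star$, in the sense that the linear functional $$\varphi\mapsto\int_{\mathbb{R}^N}|\xi|^{2s}\,\widehat u(\xi)\,\overline{\widehat\varphi(\xi)}\,d\xi,\qquad \varphi\in C^\infty_c(\mathbb{R}^N),$$ is continuous with respect to the norm induced by $\mathcal{D}^{s-1,2}(\mathbb{R}^N)$. If there exists $x_0\in\Omega$ such that $u(x)=O(|x-x_0|^k)$ as $x\to x_0$ for any $k\in\mathbb{N}$, then $u\equiv0$ in $\Omega$.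
   Context: The Fourier transform is $\widehat u(\xi)=(2\pi)^{-N/2}\int_{\mathbb{R}^N}e^{-ix\cdot\xi}u(x)\,dx$. For $\gamma>0$ with $N>2\gamma$, $\mathcal{D}^{\gamma,2}(\mathbb{R}^N)$ is the completion of the space $C^\infty_c(\mathbb{R}^N)$ of real-valued smooth compactly supported functions with respect to the scalar product $(u,v)_{\mathcal{D}^{\gamma,2}(\mathbb{R}^N)}=\int_{\mathbb{R}^N}|\xi|^{2\gamma}\widehat u(\xi)\overline{\widehat v(\xi)}\,d\xi$; $(\mathcal{D}^{\gamma,2}(\mathbb{R}^N))^\star$ is its dual space. A solution of $(-\Delta)^su=0$ in $\Omega$ is a function $u\in\mathcal{D}^{s,2}(\mathbb{R}^N)$ such that $(u,\varphi)_{\mathcal{D}^{s,2}(\mathbb{R}^N)}=0$ for all $\varphi\in C^\infty_c(\Omega)$. *)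

theory Defs
  imports "HOL-Analysis.Analysis" "HOL-Library.Landau_Symbols"
begin

primrec C_k :: "nat \<Rightarrow> ('a::euclidean_space \<Rightarrow> real) \<Rightarrow> bool" where
  "C_k 0 f \<longleftrightarrow> continuous_on UNIV f"
| "C_k (Suc k) f \<longleftrightarrow>
     (\<forall>x. f differentiable (at x)) \<and>
     (\<forall>b\<in>Basis. C_k k (\<lambda>x. frechet_derivative f (at x) b))"

definition smooth :: "('a::euclidean_space \<Rightarrow> real) \<Rightarrow> bool" where
  "smooth f \<longleftrightarrow> (\<forall>k. C_k k f)"

definition test_functions :: "'a::euclidean_space set \<Rightarrow> ('a \<Rightarrow> real) set" where
  "test_functions \<Omega> =
     {\<phi>. smooth \<phi> \<and> compact (closure {x. \<phi> x \<noteq> 0}) \<and> closure {x. \<phi> x \<noteq> 0} \<subseteq> \<Omega>}"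

definition fourier :: "('a::euclidean_space \<Rightarrow> real) \<Rightarrow> 'a \<Rightarrow> complex" where
  "fourier u \<xi> =
     complex_of_real ((2 * pi) powr (- real DIM('a) / 2)) *
     (LINT x|lebesgue. exp (- \<i> * complex_of_real (x \<bullet> \<xi>)) * complex_of_real (u x))"

definition freq_inner ::
    "real \<Rightarrow> ('a::euclidean_space \<Rightarrow> complex) \<Rightarrow> ('a \<Rightarrow> complex) \<Rightarrow> complex" where
  "freq_inner \<gamma> g h =
     (LINT \<xi>|lebesgue. complex_of_real (norm \<xi> powr (2 * \<gamma>)) * g \<xi> * cnj (h \<xi>))"

text \<open>The norm of \<open>D\<^sup>\<gamma>\<^sup>,\<^sup>2\<close> on test functions. The imaginary part of the integral vanishes.\<close>

definition test_norm :: "real \<Rightarrow> ('a::euclidean_space \<Rightarrow> real) \<Rightarrow> real" where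
  "test_norm \<gamma> \<phi> = sqrt (Re (freq_inner \<gamma> (fourier \<phi>) (fourier \<phi>)))"

text \<open>
  The completion is realised as a space of functions. For \<open>0 < \<gamma>\<close> and \<open>2 * \<gamma> < N\<close> the Sobolev
  inequality bounds the norm of \<open>L\<^sup>p\<close>, \<open>p = 2 * N / (N - 2 * \<gamma>)\<close>, by \<open>test_norm \<gamma>\<close>, so that a Cauchy
  sequence of test functions has a limit in \<open>L\<^sup>p\<close>. This limit determines the element of the
  completion represented by the sequence. Elements are represented by functions that are
  determined only up to null sets; every function of the class belongs to \<open>D_space \<gamma>\<close>.
  The definitions are meaningful only for \<open>0 < \<gamma>\<close> and \<open>2 * \<gamma> < N\<close>.
\<close>

definition D_approx ::
    "real \<Rightarrow> (nat \<Rightarrow> 'a::euclidean_space \<Rightarrow> real) \<Rightarrow> ('a \<Rightarrow> real) \<Rightarrow> bool" where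
  "D_approx \<gamma> \<phi> u \<longleftrightarrow>
     (\<forall>n. \<phi> n \<in> test_functions UNIV) \<and>
     (\<forall>\<epsilon>>0. \<exists>M. \<forall>m\<ge>M. \<forall>n\<ge>M. test_norm \<gamma> (\<lambda>x. \<phi> m x - \<phi> n x) < \<epsilon>) \<and>
     (\<lambda>n. \<integral>\<^sup>+x. ennreal (\<bar>\<phi> n x - u x\<bar> powr (2 * real DIM('a) / (real DIM('a) - 2 * \<gamma>)))
            \<partial>lebesgue) \<longlonglongrightarrow> 0"

definition D_space :: "real \<Rightarrow> ('a::euclidean_space \<Rightarrow> real) set" where
  "D_space \<gamma> = {u. u \<in> borel_measurable lebesgue \<and> (\<exists>\<phi>. D_approx \<gamma> \<phi> u)}"

text \<open>
  The Fourier transform of an element of the completion, obtained from that of test functions by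
  continuity: the limit of the transforms of an approximating sequence in \<open>L\<^sup>2\<close> with weight
  \<open>norm \<xi> powr (2 * \<gamma>)\<close>. (An element of \<open>D_space \<gamma>\<close> need not be integrable, so \<open>fourier\<close> does not
  apply to it.) It is determined up to null sets, and the choice made by \<open>SOME\<close> has no effect on
  the integrals below. On test functions it agrees almost everywhere with \<open>fourier\<close>.
\<close>

definition is_D_fourier ::
    "real \<Rightarrow> ('a::euclidean_space \<Rightarrow> real) \<Rightarrow> ('a \<Rightarrow> complex) \<Rightarrow> bool" where
  "is_D_fourier \<gamma> u g \<longleftrightarrow>
     g \<in> borel_measurable lebesgue \<and>
     (\<exists>\<phi>. D_approx \<gamma> \<phi> u \<and>
        (\<lambda>n. \<integral>\<^sup>+\<xi>. ennreal (norm \<xi> powr (2 * \<gamma>) * (cmod (fourier (\<phi> n) \<xi> - g \<xi>))\<^sup>2)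
               \<partial>lebesgue) \<longlonglongrightarrow> 0)"

definition D_fourier :: "real \<Rightarrow> ('a::euclidean_space \<Rightarrow> real) \<Rightarrow> 'a \<Rightarrow> complex" where
  "D_fourier \<gamma> u = (SOME g. is_D_fourier \<gamma> u g)"

definition D_inner ::
    "real \<Rightarrow> ('a::euclidean_space \<Rightarrow> real) \<Rightarrow> ('a \<Rightarrow> real) \<Rightarrow> complex" where
  "D_inner \<gamma> u v = freq_inner \<gamma> (D_fourier \<gamma> u) (D_fourier \<gamma> v)"

definition frac_laplace_solution ::
    "real \<Rightarrow> 'a::euclidean_space set \<Rightarrow> ('a \<Rightarrow> real) \<Rightarrow> bool" where
  "frac_laplace_solution s \<Omega> u \<longleftrightarrow>
     u \<in> D_space s \<and> (\<forall>\<phi>\<in>test_functions \<Omega>. D_inner s u \<phi> = 0)"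

definition continuous_wrt_test_norm ::
    "real \<Rightarrow> (('a::euclidean_space \<Rightarrow> real) \<Rightarrow> complex) \<Rightarrow> bool" where
  "continuous_wrt_test_norm \<gamma> F \<longleftrightarrow>
     (\<forall>\<phi>\<in>test_functions UNIV. \<forall>\<epsilon>>0. \<exists>\<delta>>0. \<forall>\<psi>\<in>test_functions UNIV.
        test_norm \<gamma> (\<lambda>x. \<psi> x - \<phi> x) < \<delta> \<longrightarrow> cmod (F \<psi> - F \<phi>) < \<epsilon>)"

end

(*
  Solutions are real-analytic, so a zero of infinite order forces u to vanish near it, and
  connectedness spreads this over the domain. For analyticity let g be the frequency function of u
  and h(t, z) the inverse Fourier transform of exp(-t |xi|^2) g(xi) along a complex line, which is
  entire in z for t > 0. Let f(t, z) be the same with the weight |xi|^(2s). Then h(eps, z) is a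
  constant multiple of the integral of (t - eps)^(s - 1) f(t, z) over t > eps. At small t, f(t, z) is
  the pairing of u with a Gaussian under the scalar product; truncating the Gaussian to a
  product of cut-off functions supported in the domain gives a test function, against which u pairs
  to 0, and the remainder is exponentially small in 1/t, locally uniformly in complex z. Hence
  h(eps, z) converges uniformly as eps tends to 0, and its holomorphic limit is u on real points.
*)
theory Submission
  imports Defs "HOL-Probability.Probability" "HOL-Complex_Analysis.Complex_Analysis"
begin

text \<open>The transform of an element of the completion is only square integrable against |xi|^(2
  s), so it cannot be inverted pointwise, let alone at complex points. A Gaussian factor cures both;
  near 0 it is 2 s < N that keeps the integrals finite. The weight is then removed through Gamma(s)
  r^(-s) = integral of t^(s-1) exp (-r t) with r = |xi|^2, and the equation is needed for small t
  only: large t converges for every frequency function. A complex centre w with |w| <= rho costs a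
  factor exp (k rho^2 / 2) per coordinate, k = 1 / (2 t), against a gain exp (-k delta^2 / 4) from
  truncating at distance delta; this fixes rho in terms of delta and N. Gaussians factor over
  coordinates, so cut-offs, derivatives and transforms are treated in one variable; four derivatives
  per coordinate give the decay (1 + x^2)^(-2), which absorbs the weight because s < 2. Holomorphy
  is used only along complex lines through a point, since a ball is a union of rays. The radius on
  which u is found to vanish depends on the distance to the boundary and on N alone, which carries
  the vanishing from point to point.\<close>

section \<open>Functions of one real variable with k continuous derivatives\<close>

primrec Ck_real :: "nat \<Rightarrow> (real \<Rightarrow> 'b::real_normed_vector) \<Rightarrow> bool" where
  "Ck_real 0 f \<longleftrightarrow> continuous_on UNIV f"
| "Ck_real (Suc k) f \<longleftrightarrow> (\<exists>f'. (\<forall>x. (f has_vector_derivative f' x) (at x)) \<and> Ck_real k f')"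

lemma Ck_real_continuous: "Ck_real k f \<Longrightarrow> continuous_on UNIV f"
proof (cases k)
  case (Suc j)
  moreover assume "Ck_real k f"
  ultimately obtain f' where "\<And>x. (f has_vector_derivative f' x) (at x)" by auto
  then show ?thesis
    by (auto intro!: continuous_at_imp_continuous_on intro: has_vector_derivative_continuous)
qed auto

lemma Ck_real_SucI:
  "(\<And>x. (f has_vector_derivative f' x) (at x)) \<Longrightarrow> Ck_real k f' \<Longrightarrow> Ck_real (Suc k) f"
  by auto

lemma Ck_real_pred: "Ck_real (Suc k) f \<Longrightarrow> Ck_real k f"
proof (induction k arbitrary: f)
  case 0
  then show ?case using Ck_real_continuous[of "Suc 0" f] by simp
next
  case (Suc k)
  then show ?case by (metis Ck_real.simps(2))
qed

lemma Ck_real_const: "Ck_real k (\<lambda>x. c)"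
proof (induction k arbitrary: c)
  case (Suc k)
  then show ?case by (auto intro!: exI[of _ "\<lambda>_. 0"])
qed auto

lemma Ck_real_ident: "Ck_real k (\<lambda>x::real. x)"
  by (cases k) (auto intro!: exI[of _ "\<lambda>_. 1"] Ck_real_const simp: has_vector_derivative_id)

lemma Ck_real_add: "Ck_real k f \<Longrightarrow> Ck_real k g \<Longrightarrow> Ck_real k (\<lambda>x. f x + g x)"
proof (induction k arbitrary: f g)
  case 0
  then show ?case by (auto intro: continuous_on_add)
next
  case (Suc k)
  then obtain f' g' where "\<And>x. (f has_vector_derivative f' x) (at x)" "Ck_real k f'"
    "\<And>x. (g has_vector_derivative g' x) (at x)" "Ck_real k g'" by auto
  then show ?case using Suc.IH[of f' g']
    by (auto intro!: exI[of _ "\<lambda>x. f' x + g' x"] has_vector_derivative_add)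
qed

lemma Ck_real_mult:
  fixes f g :: "real \<Rightarrow> 'b::real_normed_algebra"
  shows "Ck_real k f \<Longrightarrow> Ck_real k g \<Longrightarrow> Ck_real k (\<lambda>x. f x * g x)"
proof (induction k arbitrary: f g)
  case 0
  then show ?case by (auto intro: continuous_on_mult)
next
  case (Suc k)
  then obtain f' g' where *: "\<And>x. (f has_vector_derivative f' x) (at x)" "Ck_real k f'"
    "\<And>x. (g has_vector_derivative g' x) (at x)" "Ck_real k g'" by auto
  have "Ck_real k (\<lambda>x. f x * g' x + f' x * g x)"
    by (intro Ck_real_add Suc.IH * Ck_real_pred[OF Suc.prems(1)] Ck_real_pred[OF Suc.prems(2)])
  moreover have "\<And>x. ((\<lambda>x. f x * g x) has_vector_derivative f x * g' x + f' x * g x) (at x)"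
    by (intro has_vector_derivative_mult *)
  ultimately show ?case by (rule Ck_real_SucI[rotated])
qed

lemma Ck_real_scaleR:
  fixes f :: "real \<Rightarrow> real" and g :: "real \<Rightarrow> 'b::real_normed_vector"
  shows "Ck_real k f \<Longrightarrow> Ck_real k g \<Longrightarrow> Ck_real k (\<lambda>x. f x *\<^sub>R g x)"
proof (induction k arbitrary: f g)
  case 0
  then show ?case by (auto intro: continuous_on_scaleR)
next
  case (Suc k)
  then obtain f' g' where *: "\<And>x. (f has_vector_derivative f' x) (at x)" "Ck_real k f'"
    "\<And>x. (g has_vector_derivative g' x) (at x)" "Ck_real k g'" by auto
  have "Ck_real k (\<lambda>x. f x *\<^sub>R g' x + f' x *\<^sub>R g x)"
    by (intro Ck_real_add Suc.IH * Ck_real_pred[OF Suc.prems(1)] Ck_real_pred[OF Suc.prems(2)])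
  moreover have "\<And>x. ((\<lambda>x. f x *\<^sub>R g x) has_vector_derivative f x *\<^sub>R g' x + f' x *\<^sub>R g x) (at x)"
    using * by (auto intro!: has_vector_derivative_scaleR simp: has_real_derivative_iff_has_vector_derivative)
  ultimately show ?case by (rule Ck_real_SucI[rotated])
qed

lemma Ck_real_compose:
  fixes g :: "real \<Rightarrow> real" and f :: "real \<Rightarrow> 'b::real_normed_vector"
  shows "Ck_real k f \<Longrightarrow> Ck_real k g \<Longrightarrow> Ck_real k (\<lambda>x. f (g x))"
proof (induction k arbitrary: f g)
  case 0
  then show ?case using continuous_on_compose2[of UNIV f UNIV g] by auto
next
  case (Suc k)
  then obtain f' g' where *: "\<And>x. (f has_vector_derivative f' x) (at x)" "Ck_real k f'"
    "\<And>x. (g has_vector_derivative g' x) (at x)" "Ck_real k g'" by auto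
  have "Ck_real k (\<lambda>x. g' x *\<^sub>R f' (g x))"
    using Ck_real_scaleR[OF *(4) Suc.IH[OF *(2) Ck_real_pred[OF Suc.prems(2)]]] .
  moreover have "\<And>x. ((\<lambda>x. f (g x)) has_vector_derivative g' x *\<^sub>R f' (g x)) (at x)"
    using vector_diff_chain_at[OF *(3) *(1)] by (simp add: o_def)
  ultimately show ?case by (rule Ck_real_SucI[rotated])
qed

lemma Ck_real_of_real:
  "Ck_real k f \<Longrightarrow> Ck_real k (\<lambda>x. of_real (f x) :: 'b::{real_normed_algebra_1})"
  using Ck_real_scaleR[of k f "\<lambda>_. 1::'b"] Ck_real_const[of k "1::'b"] by (simp add: of_real_def)

lemma Ck_real_power:
  fixes f :: "real \<Rightarrow> 'b::{real_normed_algebra_1}"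
  shows "Ck_real k f \<Longrightarrow> Ck_real k (\<lambda>x. f x ^ n)"
  by (induction n) (auto intro!: Ck_real_const Ck_real_mult)

lemma Ck_real_minus: "Ck_real k f \<Longrightarrow> Ck_real k (\<lambda>x. - f x)"
  using Ck_real_scaleR[of k "\<lambda>_. - 1" f] Ck_real_const[of k "-1::real"] by simp

lemma Ck_real_diff: "Ck_real k f \<Longrightarrow> Ck_real k g \<Longrightarrow> Ck_real k (\<lambda>x. f x - g x)"
  using Ck_real_add[of k f "\<lambda>x. - g x"] Ck_real_minus[of k g] by simp

lemma Ck_real_exp:
  fixes f :: "real \<Rightarrow> complex"
  shows "Ck_real k f \<Longrightarrow> Ck_real k (\<lambda>x. exp (f x))"
proof (induction k arbitrary: f)
  case 0
  then show ?case by (auto intro: continuous_on_exp)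
next
  case (Suc k)
  then obtain f' where *: "\<And>x. (f has_vector_derivative f' x) (at x)" "Ck_real k f'" by auto
  have "Ck_real k (\<lambda>x. f' x * exp (f x))"
    by (intro Ck_real_mult * Suc.IH Ck_real_pred[OF Suc.prems(1)])
  moreover have "((\<lambda>x. exp (f x)) has_vector_derivative f' x * exp (f x)) (at x)" for x
    using field_vector_diff_chain_at[OF *(1) DERIV_exp] by (simp add: o_def)
  ultimately show ?case by (rule Ck_real_SucI[rotated])
qed

section \<open>The flat function exp (-1 / x) and a smooth step\<close>

text \<open>A polynomial in 1 / x times exp (-1 / x), extended by 0: a family closed under
  differentiation. The polynomial is a parameter so that the induction on the order of
  differentiability can vary it.\<close>

definition flat_exp :: "real poly \<Rightarrow> real \<Rightarrow> real" where
  "flat_exp p x = (if x > 0 then poly p (1 / x) * exp (- 1 / x) else 0)"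

lemma flat_tendsto_0: "(flat_exp p \<longlongrightarrow> 0) (at 0)"
proof -
  have "((\<lambda>y. \<Sum>i\<le>degree p. coeff p i * (y ^ i / exp y)) \<longlongrightarrow> (\<Sum>i\<le>degree p. coeff p i * 0)) at_top"
    by (intro tendsto_sum tendsto_mult tendsto_const tendsto_power_div_exp_0)
  then have "((\<lambda>y. poly p y * exp (- y)) \<longlongrightarrow> 0) at_top"
    by (simp add: poly_altdef sum_divide_distrib exp_minus divide_inverse sum_distrib_right mult.assoc)
  then have "((\<lambda>x. poly p (inverse x) * exp (- inverse x)) \<longlongrightarrow> 0) (at_right 0)"
    by (rule filterlim_compose[OF _ filterlim_inverse_at_top_right])
  then have "(flat_exp p \<longlongrightarrow> 0) (at_right 0)"
    by (rule tendsto_cong[THEN iffD1, rotated])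
       (auto simp: eventually_at_filter flat_exp_def divide_inverse)
  moreover have "(flat_exp p \<longlongrightarrow> 0) (at_left 0)"
    by (rule tendsto_eventually) (auto simp: eventually_at_filter flat_exp_def)
  ultimately show ?thesis by (simp add: filterlim_split_at)
qed

text \<open>Differentiating through 1 / x brings out the factor 1 / x^2, hence
  \<open>[:0,0,1:]\<close>; the exponential contributes p and the inner derivative contributes -
  p'.\<close>

lemma flat_derivative: "(flat_exp p has_vector_derivative flat_exp ([:0,0,1:] * (p - pderiv p)) x) (at x)"
proof -
  consider "x < 0" | "x = 0" | "x > 0" by linarith
  then show ?thesis
  proof cases
    case 1
    have "((\<lambda>_. 0) has_vector_derivative 0) (at x)" by simp
    moreover have "flat_exp ([:0,0,1:] * (p - pderiv p)) x = 0" using 1 by (simp add: flat_exp_def)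
    ultimately show ?thesis
      using 1 has_vector_derivative_transform_within_open[of "\<lambda>_. 0" 0 x "{..<0}" "flat_exp p"]
      by (auto simp: flat_exp_def)
  next
    case 2
    \<comment> \<open>At 0 the difference quotient is again a member of the family: dividing by y
      multiplies the polynomial in 1 / y by its variable, which is \<open>pCons 0 p\<close>.\<close>
    have "((\<lambda>y. flat_exp (pCons 0 p) y) \<longlongrightarrow> 0) (at 0)" by (rule flat_tendsto_0)
    moreover have "flat_exp (pCons 0 p) y = (flat_exp p y - flat_exp p 0) / (y - 0)" if "y \<noteq> 0" for y
      using that by (auto simp: flat_exp_def)
    ultimately have "((\<lambda>y. (flat_exp p y - flat_exp p 0) / (y - 0)) \<longlongrightarrow> 0) (at 0)"
      by (subst tendsto_cong[where g="flat_exp (pCons 0 p)"]) (auto simp: eventually_at_filter)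
    then have "(flat_exp p has_field_derivative 0) (at 0)"
      by (simp add: has_field_derivative_iff)
    then show ?thesis using 2
      by (simp add: flat_exp_def has_real_derivative_iff_has_vector_derivative)
  next
    case 3
    have "((\<lambda>x. poly p (1/x) * exp (- 1 / x)) has_real_derivative
       poly ([:0,0,1:] * (p - pderiv p)) (1/x) * exp (- 1 / x)) (at x)"
      using 3 by (auto intro!: derivative_eq_intros DERIV_chain2[OF poly_DERIV]
          simp: field_simps power2_eq_square)
    then have "((\<lambda>x. poly p (1/x) * exp (- 1 / x)) has_vector_derivative
       flat_exp ([:0,0,1:] * (p - pderiv p)) x) (at x)"
      using 3 by (simp add: has_real_derivative_iff_has_vector_derivative flat_exp_def)
    then show ?thesis
      using 3 has_vector_derivative_transform_within_open[of "\<lambda>x. poly p (1/x) * exp (- 1 / x)" _ x "{0<..}" "flat_exp p"]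
      by (auto simp: flat_exp_def)
  qed
qed

lemma Ck_real_flat: "Ck_real k (flat_exp p)"
proof (induction k arbitrary: p)
  case 0
  show ?case using flat_derivative[of p]
    by (auto intro!: continuous_at_imp_continuous_on has_vector_derivative_continuous)
next
  case (Suc k)
  then show ?case using flat_derivative[of p] by auto
qed

text \<open>Composing the rescaled flat function with itself replaces the usual quotient f(x) /
  (f(x) + f(1 - x)), so that products and compositions are the only operations to be shown smooth.
  The factor \<open>exp 1\<close> makes the inner function pass through 1 at x = 1: from there on
  the outer argument is at most 0, where the flat function is identically 0.\<close>

definition step :: "real \<Rightarrow> real" where
  "step x = exp 1 * flat_exp 1 (1 - exp 1 * flat_exp 1 x)"

lemma Ck_real_step: "Ck_real k step"
  unfolding step_def[abs_def]
  by (intro Ck_real_mult Ck_real_const Ck_real_compose[OF Ck_real_flat] Ck_real_diff Ck_real_flat)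

lemma step_eq_1: "x \<le> 0 \<Longrightarrow> step x = 1"
  by (simp add: step_def flat_exp_def flip: exp_add)

lemma step_eq_0: assumes "x \<ge> 1" shows "step x = 0"
proof -
  have "1 + - 1 / x \<ge> 0" using assms by (simp add: field_simps)
  then have "exp 1 * exp (- 1 / x) \<ge> 1" by (simp flip: exp_add)
  then show ?thesis using assms by (simp add: step_def flat_exp_def)
qed

lemma step_nonneg: "0 \<le> step x"
  by (auto simp: step_def flat_exp_def)

lemma step_le_1: "step x \<le> 1"
proof -
  define y where "y = 1 - exp 1 * flat_exp 1 x"
  have "y \<le> 1" by (auto simp: y_def flat_exp_def)
  then have "y > 0 \<Longrightarrow> 1 + - 1 / y \<le> 0" by (simp add: field_simps)
  then have "y > 0 \<Longrightarrow> exp 1 * exp (- 1 / y) \<le> 1" by (simp flip: exp_add)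
  then show ?thesis unfolding step_def y_def[symmetric] by (auto simp: flat_exp_def)
qed

section \<open>Test functions of product form\<close>

text \<open>A partial derivative replaces one factor of the product by its derivative, so the class
  of such functions is closed under differentiation and the induction runs over families
  \<open>c\<close> of factors. The factors are complex because the Gaussians to be truncated have
  complex centres, while test functions are real.\<close>

lemma C_k_Re_prod:
  fixes c :: "'a::euclidean_space \<Rightarrow> real \<Rightarrow> complex"
  assumes "\<And>b. b \<in> Basis \<Longrightarrow> Ck_real k (c b)"
  shows "C_k k (\<lambda>x. Re (\<Prod>b\<in>Basis. c b (x \<bullet> b)))"
  using assms
proof (induction k arbitrary: c)
  case 0
  have "continuous_on UNIV (\<lambda>x. c b (x \<bullet> b))" if "b \<in> Basis" for b
    using 0[OF that] by (auto intro!: continuous_on_compose2[of UNIV "c b"] continuous_intros)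
  then show ?case by (auto intro!: continuous_intros)
next
  case (Suc k)
  then obtain c' where c': "\<And>b x. b \<in> Basis \<Longrightarrow> (c b has_vector_derivative c' b x) (at x)"
    "\<And>b. b \<in> Basis \<Longrightarrow> Ck_real k (c' b)"
    by (simp, metis)
  have D: "((\<lambda>x. \<Prod>b\<in>Basis. c b (x \<bullet> b)) has_derivative
     (\<lambda>h. \<Sum>b\<in>Basis. ((h \<bullet> b) *\<^sub>R c' b (x \<bullet> b)) * (\<Prod>j\<in>Basis - {b}. c j (x \<bullet> j)))) (at x)" for x
  proof (intro has_derivative_prod)
    fix b :: 'a assume b: "b \<in> Basis"
    have "((\<lambda>x. x \<bullet> b) has_derivative (\<lambda>h. h \<bullet> b)) (at x)"
      by (auto intro!: derivative_eq_intros)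
    from diff_chain_at[OF this, of "c b" "\<lambda>h. h *\<^sub>R c' b (x \<bullet> b)"] c'(1)[OF b, of "x \<bullet> b"]
    show "((\<lambda>x. c b (x \<bullet> b)) has_derivative (\<lambda>h. (h \<bullet> b) *\<^sub>R c' b (x \<bullet> b))) (at x)"
      by (simp add: has_vector_derivative_def o_def)
  qed
  have D': "((\<lambda>x. Re (\<Prod>b\<in>Basis. c b (x \<bullet> b))) has_derivative
     (\<lambda>h. Re (\<Sum>b\<in>Basis. ((h \<bullet> b) *\<^sub>R c' b (x \<bullet> b)) * (\<Prod>j\<in>Basis - {b}. c j (x \<bullet> j))))) (at x)" for x
    by (rule bounded_linear.has_derivative[OF bounded_linear_Re D])
  have "C_k k (\<lambda>x. frechet_derivative (\<lambda>x. Re (\<Prod>b\<in>Basis. c b (x \<bullet> b))) (at x) b)"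
    if b: "b \<in> Basis" for b
  proof -
    have "frechet_derivative (\<lambda>x. Re (\<Prod>b\<in>Basis. c b (x \<bullet> b))) (at x) b =
       Re (\<Prod>j\<in>Basis. (c(b := c' b)) j (x \<bullet> j))" for x
    proof -
      have "frechet_derivative (\<lambda>x. Re (\<Prod>b\<in>Basis. c b (x \<bullet> b))) (at x) b =
        Re (\<Sum>j\<in>Basis. ((b \<bullet> j) *\<^sub>R c' j (x \<bullet> j)) * (\<Prod>i\<in>Basis - {j}. c i (x \<bullet> i)))"
        by (simp add: frechet_derivative_at[OF D', symmetric])
      also have "(\<Sum>j\<in>Basis. ((b \<bullet> j) *\<^sub>R c' j (x \<bullet> j)) * (\<Prod>i\<in>Basis - {j}. c i (x \<bullet> i)))
         = (\<Sum>j\<in>Basis. if j = b then c' b (x \<bullet> b) * (\<Prod>i\<in>Basis - {b}. c i (x \<bullet> i)) else 0)"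
        using b by (intro sum.cong) (auto simp: inner_Basis)
      also have "\<dots> = c' b (x \<bullet> b) * (\<Prod>i\<in>Basis - {b}. c i (x \<bullet> i))"
        using b by simp
      also have "\<dots> = (\<Prod>j\<in>Basis. (c(b := c' b)) j (x \<bullet> j))"
        using b by (subst prod.remove[of Basis b]) (auto intro!: prod.cong)
      finally show ?thesis .
    qed
    moreover have "C_k k (\<lambda>x. Re (\<Prod>j\<in>Basis. (c(b := c' b)) j (x \<bullet> j)))"
      using Suc.prems c' by (intro Suc.IH) (auto simp del: Ck_real.simps intro: Ck_real_pred)
    ultimately show ?thesis by simp
  qed
  moreover have "(\<lambda>x. Re (\<Prod>b\<in>Basis. c b (x \<bullet> b))) differentiable (at x)" for x
    using D' by (auto simp: differentiable_def)
  ultimately show ?case by simp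
qed

lemma Re_prod_test_function:
  fixes c :: "'a::euclidean_space \<Rightarrow> real \<Rightarrow> complex"
  assumes "\<And>b k. b \<in> Basis \<Longrightarrow> Ck_real k (c b)"
    and "\<And>b x. b \<in> Basis \<Longrightarrow> x \<notin> {l \<bullet> b..r \<bullet> b} \<Longrightarrow> c b x = 0"
    and "cbox l r \<subseteq> \<Omega>"
  shows "(\<lambda>x. Re (\<Prod>b\<in>Basis. c b (x \<bullet> b))) \<in> test_functions \<Omega>"
proof -
  have sub: "{x. Re (\<Prod>b\<in>Basis. c b (x \<bullet> b)) \<noteq> 0} \<subseteq> cbox l r"
  proof
    fix x assume "x \<in> {x. Re (\<Prod>b\<in>Basis. c b (x \<bullet> b)) \<noteq> 0}"
    then have "(\<Prod>b\<in>Basis. c b (x \<bullet> b)) \<noteq> 0" by (metis (mono_tags) mem_Collect_eq zero_complex.simps(1))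
    then have "\<forall>b\<in>Basis. c b (x \<bullet> b) \<noteq> 0" by (metis finite_Basis prod_zero)
    then show "x \<in> cbox l r" using assms(2) by (auto simp: mem_box)
  qed
  have *: "closure {x. Re (\<Prod>b\<in>Basis. c b (x \<bullet> b)) \<noteq> 0} \<subseteq> cbox l r"
    by (rule closure_minimal[OF sub closed_cbox])
  have "compact (closure {x. Re (\<Prod>b\<in>Basis. c b (x \<bullet> b)) \<noteq> 0})"
    using bounded_subset[OF bounded_cbox sub] by simp
  then show ?thesis
    using * assms(1,3) by (auto simp: test_functions_def smooth_def intro!: C_k_Re_prod)
qed

section \<open>The unnormalised Fourier transform\<close>

text \<open>No normalising constant, and the sign \<open>+ \<i>\<close>: with this choice
  \<open>cnj (fourier \<phi> \<xi>)\<close>, the factor that occurs in \<open>freq_inner\<close>, is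
  a constant times \<open>ft\<close> at the same point, and the inverse transform is a constant
  multiple of \<open>ft\<close> as well.\<close>

definition ft :: "('a::euclidean_space \<Rightarrow> complex) \<Rightarrow> 'a \<Rightarrow> complex" where
  "ft f \<xi> = (LINT x|lborel. exp (\<i> * complex_of_real (x \<bullet> \<xi>)) * f x)"

lemma integrable_exp_mult:
  fixes f :: "'a::euclidean_space \<Rightarrow> complex"
  assumes "integrable lborel f"
  shows "integrable lborel (\<lambda>x. exp (\<i> * complex_of_real (x \<bullet> \<xi>)) * f x)"
  by (rule Bochner_Integration.integrable_bound[OF assms])
     (use assms in \<open>auto simp: norm_mult intro!: borel_measurable_times borel_measurable_continuous_onI continuous_intros\<close>)

lemma norm_ft_le:
  fixes f :: "'a::euclidean_space \<Rightarrow> complex"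
  assumes "integrable lborel f"
  shows "cmod (ft f \<xi>) \<le> (LINT x|lborel. cmod (f x))"
proof -
  have "cmod (ft f \<xi>) \<le> (LINT x|lborel. cmod (exp (\<i> * complex_of_real (x \<bullet> \<xi>)) * f x))"
    unfolding ft_def by (rule integral_norm_bound)
  then show ?thesis by (simp add: norm_mult)
qed

lemma continuous_on_ft:
  fixes f :: "'a::euclidean_space \<Rightarrow> complex"
  assumes "integrable lborel f"
  shows "continuous_on UNIV (ft f)"
proof -
  note [measurable] = borel_measurable_integrable[OF assms]
  have "(\<lambda>n. ft f (X n)) \<longlonglongrightarrow> ft f a" if "X \<longlonglongrightarrow> a" for X a
    unfolding ft_def
  proof (rule integral_dominated_convergence[where w="\<lambda>x. cmod (f x)"])
    show "AE x in lborel. (\<lambda>n. exp (\<i> * complex_of_real (x \<bullet> X n)) * f x) \<longlonglongrightarrow> exp (\<i> * complex_of_real (x \<bullet> a)) * f x"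
      by (auto intro!: tendsto_intros that)
  qed (use assms in \<open>auto simp: norm_mult intro!: borel_measurable_times borel_measurable_continuous_onI continuous_intros\<close>)
  then show ?thesis
    by (auto simp: continuous_on_eq_continuous_at continuous_at_sequentially o_def)
qed

lemma ft_measurable [measurable]:
  "integrable lborel f \<Longrightarrow> ft f \<in> borel_measurable borel"
  by (intro borel_measurable_continuous_onI continuous_on_ft)

lemma ft_add:
  assumes "integrable lborel f" "integrable lborel g"
  shows "ft (\<lambda>x. f x + g x) \<xi> = ft f \<xi> + ft g \<xi>"
  unfolding ft_def distrib_left
  by (intro Bochner_Integration.integral_add integrable_exp_mult assms)

lemma ft_cmult: "ft (\<lambda>x. c * f x) \<xi> = c * ft f \<xi>"
  unfolding ft_def by (subst integral_mult_right_zero[symmetric]) (simp add: mult_ac)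

lemma ft_diff:
  assumes "integrable lborel f" "integrable lborel g"
  shows "ft (\<lambda>x. f x - g x) \<xi> = ft f \<xi> - ft g \<xi>"
  unfolding ft_def right_diff_distrib
  by (intro Bochner_Integration.integral_diff integrable_exp_mult assms)

lemma lborel_integral_translate:
  fixes f :: "'a::euclidean_space \<Rightarrow> 'b::{banach, second_countable_topology}"
  assumes [measurable]: "f \<in> borel_measurable borel"
  shows "(LINT x|lborel. f (x + a)) = (LINT x|lborel. f x)"
proof -
  have "(LINT x|lborel. f x) = (LINT x|distr lborel borel ((+) a). f x)"
    by (simp only: lborel_distr_plus)
  also have "\<dots> = (LINT x|lborel. f (a + x))"
    by (rule integral_distr) auto
  finally show ?thesis by (simp add: add.commute)
qed

lemma lborel_integrable_translate:
  fixes f :: "'a::euclidean_space \<Rightarrow> 'b::{banach, second_countable_topology}"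
  assumes "integrable lborel f"
  shows "integrable lborel (\<lambda>x. f (x + a))"
proof -
  have [measurable]: "f \<in> borel_measurable borel" using assms by auto
  have "integrable (distr lborel borel ((+) a)) f" using assms by (simp only: lborel_distr_plus)
  then have "integrable lborel (\<lambda>x. f (a + x))" by (subst (asm) integrable_distr_eq) auto
  then show ?thesis by (simp add: add.commute)
qed

lemma ft_translate:
  fixes f :: "'a::euclidean_space \<Rightarrow> complex"
  assumes "integrable lborel f"
  shows "ft (\<lambda>x. f (x + a)) \<xi> = exp (- \<i> * complex_of_real (a \<bullet> \<xi>)) * ft f \<xi>"
proof -
  have [measurable]: "f \<in> borel_measurable borel" using assms by auto
  have [measurable]: "(\<lambda>x. exp (\<i> * complex_of_real ((x - a) \<bullet> \<xi>))) \<in> borel_measurable borel"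
    by (intro borel_measurable_continuous_onI continuous_intros)
  have "ft (\<lambda>x. f (x + a)) \<xi> = (LINT x|lborel. exp (\<i> * complex_of_real ((x + a - a) \<bullet> \<xi>)) * f (x + a))"
    by (simp add: ft_def)
  also have "\<dots> = (LINT x|lborel. exp (\<i> * complex_of_real ((x - a) \<bullet> \<xi>)) * f x)"
    by (rule lborel_integral_translate) measurable
  also have "\<dots> = (LINT x|lborel. exp (- \<i> * complex_of_real (a \<bullet> \<xi>)) * (exp (\<i> * complex_of_real (x \<bullet> \<xi>)) * f x))"
    by (intro Bochner_Integration.integral_cong refl)
       (simp add: inner_diff_left exp_diff exp_minus algebra_simps divide_inverse)
  finally show ?thesis by (simp add: ft_def)
qed

subsection \<open>Test functions\<close>

lemma C_k_lincomb: "C_k k f \<Longrightarrow> C_k k g \<Longrightarrow> C_k k (\<lambda>x. a * f x + g x)"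
proof (induction k arbitrary: f g)
  case 0
  then show ?case by (auto intro!: continuous_intros)
next
  case (Suc k)
  have D: "((\<lambda>x. a * f x + g x) has_derivative
      (\<lambda>h. a * frechet_derivative f (at x) h + frechet_derivative g (at x) h)) (at x)" for x
    using Suc.prems by (auto intro!: has_derivative_add has_derivative_mult_right
        simp: frechet_derivative_works[symmetric])
  have "C_k k (\<lambda>x. a * frechet_derivative f (at x) b + frechet_derivative g (at x) b)"
    if "b \<in> Basis" for b
    using Suc.prems that by (intro Suc.IH) auto
  then show ?case
    using D by (auto simp: frechet_derivative_at[OF D, symmetric] differentiable_def)
qed

lemma test_functions_UNIV: "\<phi> \<in> test_functions \<Omega> \<Longrightarrow> \<phi> \<in> test_functions UNIV"
  by (simp add: test_functions_def)

lemma test_functions_lincomb: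
  assumes "\<phi> \<in> test_functions \<Omega>" "\<psi> \<in> test_functions \<Omega>"
  shows "(\<lambda>x. a * \<phi> x + \<psi> x) \<in> test_functions \<Omega>"
proof -
  have sub: "{x. a * \<phi> x + \<psi> x \<noteq> 0} \<subseteq> {x. \<phi> x \<noteq> 0} \<union> {x. \<psi> x \<noteq> 0}" by auto
  then have *: "closure {x. a * \<phi> x + \<psi> x \<noteq> 0} \<subseteq> closure {x. \<phi> x \<noteq> 0} \<union> closure {x. \<psi> x \<noteq> 0}"
    by (metis closure_Un closure_mono)
  have "bounded ({x. \<phi> x \<noteq> 0} \<union> {x. \<psi> x \<noteq> 0})"
    using assms by (simp add: test_functions_def)
  then have "bounded {x. a * \<phi> x + \<psi> x \<noteq> 0}"
    by (rule bounded_subset[OF _ sub])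
  then show ?thesis using assms *
    by (auto simp: test_functions_def smooth_def intro!: C_k_lincomb)
qed

lemma test_functions_diff:
  assumes "\<phi> \<in> test_functions \<Omega>" "\<psi> \<in> test_functions \<Omega>"
  shows "(\<lambda>x. \<phi> x - \<psi> x) \<in> test_functions \<Omega>"
  using test_functions_lincomb[OF assms(2,1), of "-1"] by simp

lemma test_functions_0: "(\<lambda>x. 0) \<in> test_functions \<Omega>"
proof -
  have "C_k k (\<lambda>x::'a. 0)" for k
  proof (induction k)
    case (Suc k)
    then show ?case by (simp add: frechet_derivative_const)
  qed auto
  then show ?thesis by (auto simp: test_functions_def smooth_def)
qed

lemma test_functions_sum:
  assumes "finite I" "\<And>i. i \<in> I \<Longrightarrow> \<phi> i \<in> test_functions \<Omega>"
  shows "(\<lambda>x. \<Sum>i\<in>I. \<phi> i x) \<in> test_functions \<Omega>"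
  using assms
proof (induction I)
  case empty
  then show ?case by (simp add: test_functions_0)
next
  case (insert i I)
  then show ?case
    using test_functions_lincomb[of "\<phi> i" \<Omega> "\<lambda>x. \<Sum>i\<in>I. \<phi> i x" 1] by simp
qed

lemma test_function_has_derivative:
  assumes "\<phi> \<in> test_functions \<Omega>"
  shows "(\<phi> has_derivative frechet_derivative \<phi> (at x)) (at x)"
proof -
  have "C_k 1 \<phi>" using assms by (auto simp: test_functions_def smooth_def)
  then show ?thesis by (simp add: frechet_derivative_works)
qed

lemma test_functions_deriv:
  assumes "\<phi> \<in> test_functions \<Omega>" "b \<in> Basis"
  shows "(\<lambda>x. frechet_derivative \<phi> (at x) b) \<in> test_functions \<Omega>"
proof -
  define S where "S = closure {x. \<phi> x \<noteq> 0}"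
  have "frechet_derivative \<phi> (at x) b = 0" if "x \<notin> S" for x
  proof -
    have "(\<phi> has_derivative (\<lambda>h. 0)) (at x)"
    proof (rule has_derivative_transform_within_open[of "\<lambda>_. 0" _ _ _ "- S"])
      show "open (- S)" by (auto simp: S_def)
      show "0 = \<phi> x" if "x \<in> - S" for x
        using that closure_subset[of "{x. \<phi> x \<noteq> 0}"] by (auto simp: S_def)
    qed (use that in auto)
    then show ?thesis by (metis frechet_derivative_at)
  qed
  then have "{x. frechet_derivative \<phi> (at x) b \<noteq> 0} \<subseteq> S" by auto
  then have *: "closure {x. frechet_derivative \<phi> (at x) b \<noteq> 0} \<subseteq> S"
    by (simp add: S_def closure_minimal)
  moreover have "bounded S" using assms by (simp add: S_def test_functions_def compact_imp_bounded)
  ultimately have "bounded {x. frechet_derivative \<phi> (at x) b \<noteq> 0}"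
    by (meson bounded_subset closure_subset order_trans)
  moreover have "C_k k (\<lambda>x. frechet_derivative \<phi> (at x) b)" for k
  proof -
    have "C_k (Suc k) \<phi>" using assms by (auto simp: test_functions_def smooth_def)
    then show ?thesis using assms(2) by simp
  qed
  ultimately show ?thesis using assms * by (auto simp: test_functions_def smooth_def S_def)
qed

lemma test_function_continuous:
  assumes "\<phi> \<in> test_functions \<Omega>" shows "continuous_on UNIV \<phi>"
proof -
  have "C_k 0 \<phi>" using assms unfolding test_functions_def smooth_def by blast
  then show ?thesis by simp
qed

lemma test_function_measurable [measurable_dest]:
  "\<phi> \<in> test_functions \<Omega> \<Longrightarrow> \<phi> \<in> borel_measurable borel"
  by (intro borel_measurable_continuous_onI test_function_continuous)

lemma test_function_bounded:
  assumes "\<phi> \<in> test_functions \<Omega>"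
  obtains B R where "B > 0" "R > 0" "\<And>x. \<bar>\<phi> x\<bar> \<le> B" "\<And>x. norm x > R \<Longrightarrow> \<phi> x = 0"
proof -
  define S where "S = closure {x. \<phi> x \<noteq> 0}"
  have S: "compact S" using assms by (auto simp: S_def test_functions_def)
  obtain R where R: "R > 0" "\<And>x. x \<in> S \<Longrightarrow> norm x \<le> R"
    using compact_imp_bounded[OF S] by (auto simp: bounded_pos)
  have "compact (\<phi> ` S)"
    using S continuous_on_subset[OF test_function_continuous[OF assms]] by (intro compact_continuous_image) auto
  then obtain B where B: "B > 0" "\<And>x. x \<in> S \<Longrightarrow> \<bar>\<phi> x\<bar> \<le> B"
    using compact_imp_bounded[of "\<phi> ` S"] by (auto simp: bounded_pos)
  have 0: "\<phi> x = 0" if "x \<notin> S" for x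
    using that closure_subset[of "{x. \<phi> x \<noteq> 0}"] by (auto simp: S_def)
  show ?thesis
  proof (rule that[OF B(1) R(1)])
    show "\<bar>\<phi> x\<bar> \<le> B" for x using B 0[of x] by (cases "x \<in> S") auto
    show "norm x > R \<Longrightarrow> \<phi> x = 0" for x using R 0[of x] by force
  qed
qed

lemma integrable_indicator_cball: "integrable lborel (\<lambda>x. B * indicator (cball (a::'a::euclidean_space) R) x :: real)"
  by (intro integrable_mult_right integrable_real_indicator)
     (use emeasure_lborel_cball_finite[of a R] in \<open>auto simp: infinity_ennreal_def\<close>)

lemma test_function_integrable:
  assumes "\<phi> \<in> test_functions \<Omega>"
  shows "integrable lborel \<phi>"
proof -
  note [measurable] = test_function_measurable[OF assms]
  obtain B R where "B > 0" "\<And>x. \<bar>\<phi> x\<bar> \<le> B" "\<And>x. norm x > R \<Longrightarrow> \<phi> x = 0"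
    using test_function_bounded[OF assms] by metis
  then show ?thesis
    by (intro Bochner_Integration.integrable_bound[OF integrable_indicator_cball[of B 0 R]])
       (auto simp: indicator_def dist_norm not_le)
qed

section \<open>Fourier transforms of test functions: derivatives and rapid decay\<close>

lemma fourier_eq_ft:
  fixes \<phi> :: "'a::euclidean_space \<Rightarrow> real"
  assumes "\<phi> \<in> borel_measurable borel"
  shows "fourier \<phi> \<xi> = of_real ((2 * pi) powr (- real DIM('a) / 2)) * ft (\<lambda>x. of_real (\<phi> x)) (- \<xi>)"
    and "cnj (fourier \<phi> \<xi>) = of_real ((2 * pi) powr (- real DIM('a) / 2)) * ft (\<lambda>x. of_real (\<phi> x)) \<xi>"
proof -
  note [measurable] = assms
  have [measurable]: "(\<lambda>x. exp (- \<i> * complex_of_real (x \<bullet> \<xi>))) \<in> borel_measurable borel"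
    by (intro borel_measurable_continuous_onI continuous_intros)
  have "(LINT x|lebesgue. exp (- \<i> * complex_of_real (x \<bullet> \<xi>)) * complex_of_real (\<phi> x))
     = (LINT x|lborel. exp (- \<i> * complex_of_real (x \<bullet> \<xi>)) * complex_of_real (\<phi> x))"
    by (rule integral_completion) measurable
  also have "\<dots> = ft (\<lambda>x. of_real (\<phi> x)) (- \<xi>)" by (simp add: ft_def)
  finally show 1: "fourier \<phi> \<xi> = of_real ((2 * pi) powr (- real DIM('a) / 2)) * ft (\<lambda>x. of_real (\<phi> x)) (- \<xi>)"
    by (simp add: fourier_def)
  have "cnj (ft (\<lambda>x. of_real (\<phi> x)) (- \<xi>)) = ft (\<lambda>x. of_real (\<phi> x)) \<xi>"
    unfolding ft_def 
    by (subst Bochner_Integration.integral_cnj[symmetric])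
       (rule Bochner_Integration.integral_cong, auto simp: exp_cnj)
  then show "cnj (fourier \<phi> \<xi>) = of_real ((2 * pi) powr (- real DIM('a) / 2)) * ft (\<lambda>x. of_real (\<phi> x)) \<xi>"
    by (simp add: 1)
qed

text \<open>Difference quotients replace integration by parts: translation by h b multiplies the
  transform by an exponential, so the quotient has the multiplier (exp (-i h (b . xi)) - 1) / h, and
  both sides converge as h tends to 0.\<close>

lemma ft_test_deriv:
  fixes \<phi> :: "'a::euclidean_space \<Rightarrow> real"
  assumes \<phi>: "\<phi> \<in> test_functions \<Omega>" and b: "b \<in> Basis"
  shows "ft (\<lambda>x. of_real (frechet_derivative \<phi> (at x) b)) \<xi> = - \<i> * of_real (b \<bullet> \<xi>) * ft (\<lambda>x. of_real (\<phi> x)) \<xi>"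
proof -
  define D where "D x = frechet_derivative \<phi> (at x) b" for x
  have D: "D \<in> test_functions \<Omega>" unfolding D_def[abs_def] by (rule test_functions_deriv[OF \<phi> b])
  note [measurable] = test_function_measurable[OF \<phi>] test_function_measurable[OF D]
  define h where "h n = inverse (real (Suc n))" for n
  have h: "h n > 0" "h n \<le> 1" for n by (auto simp: h_def inverse_le_1_iff)
  have h0: "h \<longlonglongrightarrow> 0" unfolding h_def[abs_def] by (rule LIMSEQ_inverse_real_of_nat)
  have h0': "filterlim h (at 0) sequentially"
    using h0 h by (auto simp: filterlim_at intro!: always_eventually) (metis less_irrefl)
  obtain B R where B: "B > 0" "\<And>x. \<bar>D x\<bar> \<le> B" and R: "R > 0" "\<And>x. norm x > R \<Longrightarrow> \<phi> x = 0"
    using test_function_bounded[OF \<phi>] test_function_bounded[OF D] by metis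
  have line: "((\<lambda>t. \<phi> (x + t *\<^sub>R b)) has_real_derivative D (x + t *\<^sub>R b)) (at t)" for x t
  proof -
    have "((\<lambda>t. x + t *\<^sub>R b) has_derivative (\<lambda>h. h *\<^sub>R b)) (at t)"
      by (auto intro!: derivative_eq_intros)
    from diff_chain_at[OF this test_function_has_derivative[OF \<phi>]]
    have "((\<lambda>t. \<phi> (x + t *\<^sub>R b)) has_derivative (\<lambda>h. frechet_derivative \<phi> (at (x + t *\<^sub>R b)) (h *\<^sub>R b))) (at t)"
      by (simp add: o_def)
    moreover have "frechet_derivative \<phi> (at y) (h *\<^sub>R b) = D y * h" for h y
      using linear_cmul[OF linear_frechet_derivative[OF differentiableI[OF test_function_has_derivative[OF \<phi>]]]]
      by (simp add: D_def mult.commute)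
    ultimately show ?thesis by (simp add: has_field_derivative_def)
  qed
  define q where "q n x = (\<phi> (x + h n *\<^sub>R b) - \<phi> x) / h n" for n x
  have q_lim: "(\<lambda>n. q n x) \<longlonglongrightarrow> D x" for x
  proof -
    have "((\<lambda>t. (\<phi> (x + t *\<^sub>R b) - \<phi> x) / t) \<longlongrightarrow> D x) (at 0)"
      using line[of x 0] by (simp add: has_field_derivative_iff)
    from filterlim_compose[OF this h0'] show ?thesis by (simp add: q_def)
  qed
  \<comment> \<open>The mean value theorem gives the bound B; steps of length at most 1 keep the
    supports of all quotients in the ball of radius R + 1, which makes the bound integrable.\<close>
  have q_bound: "\<bar>q n x\<bar> \<le> B * indicator (cball 0 (R + 1)) x" for n x
  proof (cases "norm x \<le> R + 1")
    case True
    from MVT2[of 0 "h n" "\<lambda>t. \<phi> (x + t *\<^sub>R b)" "\<lambda>t. D (x + t *\<^sub>R b)"] line h(1)[of n]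
    obtain z where "\<phi> (x + h n *\<^sub>R b) - \<phi> x = h n * D (x + z *\<^sub>R b)" by auto
    then have "q n x = D (x + z *\<^sub>R b)" using h(1)[of n] by (simp add: q_def)
    then show ?thesis using B True by simp
  next
    case False
    have "norm (h n *\<^sub>R b) \<le> 1" using b h[of n] by simp
    then have "norm (x + h n *\<^sub>R b) > R" using norm_triangle_ineq4[of "x + h n *\<^sub>R b" "h n *\<^sub>R b"] False by simp
    then show ?thesis using False R by (simp add: q_def)
  qed
  have i\<phi>: "integrable lborel (\<lambda>x. complex_of_real (\<phi> x))"
    using test_function_integrable[OF \<phi>] by simp
  have "(\<lambda>n. ft (\<lambda>x. of_real (q n x)) \<xi>) \<longlonglongrightarrow> ft (\<lambda>x. of_real (D x)) \<xi>"
    unfolding ft_def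
  proof (rule integral_dominated_convergence[where w="\<lambda>x. B * indicator (cball 0 (R + 1)) x"])
    show "AE x in lborel. (\<lambda>n. exp (\<i> * complex_of_real (x \<bullet> \<xi>)) * complex_of_real (q n x)) \<longlonglongrightarrow> exp (\<i> * complex_of_real (x \<bullet> \<xi>)) * complex_of_real (D x)"
      by (intro AE_I2 tendsto_intros q_lim)
    show "AE x in lborel. cmod (exp (\<i> * complex_of_real (x \<bullet> \<xi>)) * complex_of_real (q n x)) \<le> B * indicator (cball 0 (R + 1)) x" for n
      using q_bound by (intro AE_I2) (simp add: norm_mult)
    have [measurable]: "(\<lambda>x. exp (\<i> * complex_of_real (x \<bullet> \<xi>))) \<in> borel_measurable borel"
      by (intro borel_measurable_continuous_onI continuous_intros)
    show "(\<lambda>x. exp (\<i> * complex_of_real (x \<bullet> \<xi>)) * complex_of_real (D x)) \<in> borel_measurable lborel" by measurable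
    show "(\<lambda>x. exp (\<i> * complex_of_real (x \<bullet> \<xi>)) * complex_of_real (q n x)) \<in> borel_measurable lborel" for n
      unfolding q_def by measurable
    show "integrable lborel (\<lambda>x::'a. B * indicator (cball 0 (R + 1)) x)"
      by (rule integrable_indicator_cball)
  qed
  moreover have "ft (\<lambda>x. of_real (q n x)) \<xi> = (exp (- \<i> * of_real (h n * (b \<bullet> \<xi>))) - 1) / of_real (h n) * ft (\<lambda>x. of_real (\<phi> x)) \<xi>" for n
  proof -
    have "ft (\<lambda>x. of_real (q n x)) \<xi> = ft (\<lambda>x. (1 / of_real (h n)) * (of_real (\<phi> (x + h n *\<^sub>R b)) - of_real (\<phi> x))) \<xi>"
      by (simp add: q_def)
    also have "\<dots> = (1 / of_real (h n)) * (ft (\<lambda>x. of_real (\<phi> (x + h n *\<^sub>R b))) \<xi> - ft (\<lambda>x. of_real (\<phi> x)) \<xi>)"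
      unfolding ft_cmult
      by (subst ft_diff) (use i\<phi> lborel_integrable_translate[OF i\<phi>] in auto)
    also have "ft (\<lambda>x. of_real (\<phi> (x + h n *\<^sub>R b))) \<xi> = exp (- \<i> * of_real (h n * (b \<bullet> \<xi>))) * ft (\<lambda>x. of_real (\<phi> x)) \<xi>"
      using ft_translate[OF i\<phi>, of "h n *\<^sub>R b" \<xi>] by simp
    finally show ?thesis by (simp add: field_simps)
  qed
  moreover have "(\<lambda>n. (exp (- \<i> * of_real (h n * (b \<bullet> \<xi>))) - 1) / of_real (h n) * ft (\<lambda>x. of_real (\<phi> x)) \<xi>)
     \<longlonglongrightarrow> (- \<i> * of_real (b \<bullet> \<xi>)) * ft (\<lambda>x. of_real (\<phi> x)) \<xi>"
  proof (intro tendsto_mult tendsto_const)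
    have "((\<lambda>z. exp (- \<i> * (z * of_real (b \<bullet> \<xi>)))) has_field_derivative - \<i> * of_real (b \<bullet> \<xi>)) (at 0)"
      by (auto intro!: derivative_eq_intros)
    then have 1: "((\<lambda>z. (exp (- \<i> * (z * of_real (b \<bullet> \<xi>))) - 1) / z) \<longlongrightarrow> - \<i> * of_real (b \<bullet> \<xi>)) (at 0)"
      by (simp add: has_field_derivative_iff)
    have 2: "filterlim (\<lambda>n. complex_of_real (h n)) (at 0) sequentially"
      using tendsto_of_real[OF h0, where 'a=complex] h by (auto simp: filterlim_at intro!: always_eventually) (metis less_irrefl)
    from filterlim_compose[OF 1 2]
    show "(\<lambda>n. (exp (- \<i> * of_real (h n * (b \<bullet> \<xi>))) - 1) / of_real (h n)) \<longlonglongrightarrow> - \<i> * of_real (b \<bullet> \<xi>)"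
      by simp
  qed
  ultimately have "ft (\<lambda>x. of_real (D x)) \<xi> = (- \<i> * of_real (b \<bullet> \<xi>)) * ft (\<lambda>x. of_real (\<phi> x)) \<xi>"
    using LIMSEQ_unique by fastforce
  then show ?thesis by (simp add: D_def)
qed

text \<open>The transform of \<phi> minus its Laplacian is (1 + |xi|^2) times that of \<phi>, so the
  bound of order M for this test function is the bound of order M + 1 for \<phi>; hence \<phi> is
  arbitrary in the induction.\<close>

lemma ft_test_decay:
  fixes \<phi> :: "'a::euclidean_space \<Rightarrow> real"
  assumes "\<phi> \<in> test_functions \<Omega>"
  shows "\<exists>C. \<forall>\<xi>. (1 + (norm \<xi>)\<^sup>2) ^ M * cmod (ft (\<lambda>x. of_real (\<phi> x)) \<xi>) \<le> C"
  using assms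
proof (induction M arbitrary: \<phi>)
  case 0
  then show ?case
    using norm_ft_le[of "\<lambda>x. of_real (\<phi> x)"] test_function_integrable[OF 0] by (auto intro!: exI)
next
  case (Suc M)
  define D where "D b f x = frechet_derivative f (at x) b" for b :: 'a and f :: "'a \<Rightarrow> real" and x
  have D: "D b f \<in> test_functions \<Omega>" if "b \<in> Basis" "f \<in> test_functions \<Omega>" for b f
    unfolding D_def[abs_def] by (rule test_functions_deriv) fact+
  define L where "L = (\<lambda>x. (\<Sum>b\<in>Basis. D b (D b \<phi>) x))"
  have L: "L \<in> test_functions \<Omega>"
    unfolding L_def by (intro test_functions_sum D Suc.prems) auto
  define \<psi> where "\<psi> = (\<lambda>x. \<phi> x - L x)"
  have \<psi>: "\<psi> \<in> test_functions \<Omega>" unfolding \<psi>_def by (intro test_functions_diff L Suc.prems)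
  have "ft (\<lambda>x. of_real (\<psi> x)) \<xi> = (1 + (norm \<xi>)\<^sup>2) * ft (\<lambda>x. of_real (\<phi> x)) \<xi>" for \<xi>
  proof -
    have i: "integrable lborel (\<lambda>x. complex_of_real (D b (D b \<phi>) x))" if "b \<in> Basis" for b
      using test_function_integrable[OF D[OF that D[OF that Suc.prems]]] by simp
    have "ft (\<lambda>x. of_real (L x)) \<xi> = (\<Sum>b\<in>Basis. ft (\<lambda>x. of_real (D b (D b \<phi>) x)) \<xi>)"
      unfolding L_def ft_def of_real_sum sum_distrib_left
      by (intro Bochner_Integration.integral_sum integrable_exp_mult i)
    also have "\<dots> = (\<Sum>b\<in>Basis. - (of_real (b \<bullet> \<xi>))\<^sup>2 * ft (\<lambda>x. of_real (\<phi> x)) \<xi>)"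
    proof (intro sum.cong refl)
      fix b :: 'a assume b: "b \<in> Basis"
      have "ft (\<lambda>x. of_real (D b (D b \<phi>) x)) \<xi> = - \<i> * of_real (b \<bullet> \<xi>) * ft (\<lambda>x. of_real (D b \<phi> x)) \<xi>"
        using ft_test_deriv[OF D[OF b Suc.prems] b, of \<xi>] by (simp add: D_def[of b "D b \<phi>"])
      also have "ft (\<lambda>x. of_real (D b \<phi> x)) \<xi> = - \<i> * of_real (b \<bullet> \<xi>) * ft (\<lambda>x. of_real (\<phi> x)) \<xi>"
        using ft_test_deriv[OF Suc.prems b, of \<xi>] by (simp add: D_def[of b \<phi>])
      finally show "ft (\<lambda>x. of_real (D b (D b \<phi>) x)) \<xi> = - (of_real (b \<bullet> \<xi>))\<^sup>2 * ft (\<lambda>x. of_real (\<phi> x)) \<xi>"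
        by (simp add: power2_eq_square algebra_simps)
    qed
    also have "\<dots> = - of_real (\<Sum>b\<in>Basis. (\<xi> \<bullet> b)\<^sup>2) * ft (\<lambda>x. of_real (\<phi> x)) \<xi>"
      by (simp add: sum_distrib_right sum_negf inner_commute)
    also have "(\<Sum>b\<in>Basis. (\<xi> \<bullet> b)\<^sup>2) = (norm \<xi>)\<^sup>2"
      by (simp add: norm_eq_sqrt_inner euclidean_inner[of \<xi> \<xi>] power2_eq_square sum_nonneg)
    finally have "ft (\<lambda>x. of_real (L x)) \<xi> = - of_real ((norm \<xi>)\<^sup>2) * ft (\<lambda>x. of_real (\<phi> x)) \<xi>" .
    moreover have "ft (\<lambda>x. of_real (\<psi> x)) \<xi> = ft (\<lambda>x. of_real (\<phi> x)) \<xi> - ft (\<lambda>x. of_real (L x)) \<xi>"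
      unfolding \<psi>_def of_real_diff
      using test_function_integrable[OF L] test_function_integrable[OF Suc.prems]
      by (intro ft_diff) auto
    ultimately show ?thesis by (simp add: algebra_simps)
  qed
  then have *: "cmod (ft (\<lambda>x. of_real (\<psi> x)) \<xi>) = (1 + (norm \<xi>)\<^sup>2) * cmod (ft (\<lambda>x. of_real (\<phi> x)) \<xi>)" for \<xi>
    by (simp add: norm_mult) (metis norm_of_real abs_of_nonneg of_real_1 of_real_add of_real_power add_nonneg_nonneg zero_le_one zero_le_power2)
  from Suc.IH[OF \<psi>] obtain C where "\<And>\<xi>. (1 + (norm \<xi>)\<^sup>2) ^ M * cmod (ft (\<lambda>x. of_real (\<psi> x)) \<xi>) \<le> C" by auto
  then show ?case unfolding * by (auto simp: mult_ac)
qed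

subsection \<open>Integrals of product functions and Gaussians\<close>

lemma
  fixes f :: "'a::euclidean_space \<Rightarrow> real \<Rightarrow> 'b::{real_normed_field, banach, second_countable_topology}"
  assumes "\<And>b. b \<in> Basis \<Longrightarrow> integrable lborel (f b)"
  shows integrable_lborel_prod: "integrable lborel (\<lambda>x::'a. \<Prod>b\<in>Basis. f b (x \<bullet> b))"
    and integral_lborel_prod: "(LINT x|lborel. (\<Prod>b\<in>Basis. f b (x \<bullet> b))) = (\<Prod>b\<in>Basis. integral\<^sup>L lborel (f b))"
proof -
  interpret product_sigma_finite "\<lambda>_::'a. lborel :: real measure" by standard
  have [measurable]: "(\<lambda>f. \<Sum>b\<in>Basis. f b *\<^sub>R b) \<in> Pi\<^sub>M Basis (\<lambda>_::'a. lborel) \<rightarrow>\<^sub>M borel"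
    by measurable
  have [measurable]: "f b \<in> borel_measurable borel" if "b \<in> Basis" for b
    using assms[OF that] by auto
  have *: "(\<lambda>g. \<Prod>b\<in>Basis. f b ((\<Sum>c\<in>Basis. g c *\<^sub>R c) \<bullet> b)) = (\<lambda>g. \<Prod>b\<in>Basis. f b (g b))"
    by (auto intro!: ext prod.cong)
  show "integrable lborel (\<lambda>x::'a. \<Prod>b\<in>Basis. f b (x \<bullet> b))"
    by (subst lborel_eq, subst integrable_distr_eq)
       (auto simp: * intro!: product_integrable_prod assms)
  show "(LINT x|lborel. (\<Prod>b\<in>Basis. f b (x \<bullet> b))) = (\<Prod>b\<in>Basis. integral\<^sup>L lborel (f b))"
    by (subst lborel_eq, subst integral_distr)
       (auto simp: * intro!: product_integral_prod assms)
qed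

lemma ft_prod:
  fixes f :: "'a::euclidean_space \<Rightarrow> real \<Rightarrow> complex"
  assumes "\<And>b. b \<in> Basis \<Longrightarrow> integrable lborel (f b)"
  shows "ft (\<lambda>x::'a. \<Prod>b\<in>Basis. f b (x \<bullet> b)) \<xi> = (\<Prod>b\<in>Basis. ft (f b) (\<xi> \<bullet> b))"
proof -
  have "exp (\<i> * complex_of_real (x \<bullet> \<xi>)) = (\<Prod>b\<in>Basis. exp (\<i> * complex_of_real ((x \<bullet> b) * (\<xi> \<bullet> b))))" for x
    by (subst euclidean_inner) (simp add: exp_sum sum_distrib_left)
  then have "ft (\<lambda>x::'a. \<Prod>b\<in>Basis. f b (x \<bullet> b)) \<xi> =
     (LINT x|lborel. (\<Prod>b\<in>Basis. exp (\<i> * complex_of_real ((x \<bullet> b) * (\<xi> \<bullet> b))) * f b (x \<bullet> b)))"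
    by (simp add: ft_def prod.distrib)
  also have "\<dots> = (\<Prod>b\<in>Basis. LINT x|lborel. exp (\<i> * complex_of_real (x * (\<xi> \<bullet> b))) * f b x)"
    using integrable_exp_mult[OF assms] by (intro integral_lborel_prod) simp
  finally show ?thesis by (simp add: ft_def)
qed

lemma integrable_inverse_1_plus_sq: "integrable lborel (\<lambda>x::real. inverse (1 + x\<^sup>2))"
  using integrable_inverse_1_plus_square by (simp add: set_integrable_def)

lemma prod_1_plus_sq_le: "(\<Prod>b\<in>Basis. 1 + ((x::'a::euclidean_space) \<bullet> b)\<^sup>2) \<le> (1 + (norm x)\<^sup>2) ^ DIM('a)"
proof -
  have "(\<Prod>b\<in>Basis. 1 + (x \<bullet> b)\<^sup>2) \<le> (\<Prod>b\<in>(Basis::'a set). 1 + (norm x)\<^sup>2)"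
    by (intro prod_mono) (auto intro!: power_mono simp: Basis_le_norm abs_le_square_iff[symmetric])
  then show ?thesis by simp
qed

lemma prod_ge_1_plus_sum:
  fixes f :: "'a \<Rightarrow> real"
  assumes "finite A" "\<And>a. a \<in> A \<Longrightarrow> f a \<ge> 0"
  shows "1 + (\<Sum>a\<in>A. f a) \<le> (\<Prod>a\<in>A. 1 + f a)"
  using assms
proof (induction A)
  case (insert a A)
  have "1 + (f a + sum f A) \<le> (1 + f a) * (1 + sum f A)"
    using insert by (simp add: algebra_simps sum_nonneg)
  also have "\<dots> \<le> (1 + f a) * (\<Prod>a\<in>A. 1 + f a)"
    using insert by (intro mult_left_mono) auto
  finally show ?case using insert by simp
qed auto

lemma norm_sq_eq_sum: "(norm (x::'a::euclidean_space))\<^sup>2 = (\<Sum>b\<in>Basis. (x \<bullet> b)\<^sup>2)"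
  by (simp add: norm_eq_sqrt_inner euclidean_inner[of x x] power2_eq_square sum_nonneg)

lemma one_plus_norm_sq_le_prod: "1 + (norm (x::'a::euclidean_space))\<^sup>2 \<le> (\<Prod>b\<in>Basis. 1 + (x \<bullet> b)\<^sup>2)"
  unfolding norm_sq_eq_sum by (rule prod_ge_1_plus_sum) auto

text \<open>Comparison with a product of one-dimensional functions 1 / (1 + x^2) avoids polar
  coordinates; the exponent is the number of factors.\<close>

lemma integrable_inverse_norm_power:
  "integrable lborel (\<lambda>x::'a::euclidean_space. inverse ((1 + (norm x)\<^sup>2) ^ DIM('a)))"
proof (rule Bochner_Integration.integrable_bound)
  show "integrable lborel (\<lambda>x::'a. \<Prod>b\<in>Basis. inverse (1 + (x \<bullet> b)\<^sup>2))"
    by (intro integrable_lborel_prod integrable_inverse_1_plus_sq)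
  have "inverse ((1 + (norm x)\<^sup>2) ^ DIM('a)) \<le> (\<Prod>b\<in>Basis. inverse (1 + (x \<bullet> b)\<^sup>2))" for x :: 'a
    unfolding prod_inversef[unfolded o_def]
    by (intro le_imp_inverse_le prod_1_plus_sq_le prod_pos) (auto intro: add_pos_nonneg)
  then show "AE x in lborel. norm (inverse ((1 + (norm x)\<^sup>2) ^ DIM('a))) \<le> norm (\<Prod>b\<in>Basis. inverse (1 + ((x::'a) \<bullet> b)\<^sup>2))"
    by (intro AE_I2) (auto simp: prod_nonneg)
qed auto

text \<open>Completing the square gives a multiple of the normal density with mean \<alpha> / (2 k)
  and variance 1 / (2 k).\<close>

lemma integrable_gaussian:
  assumes "k > 0" shows "integrable lborel (\<lambda>x::real. exp (\<alpha> * x - k * x\<^sup>2))"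
proof -
  have "exp (\<alpha> * x - k * x\<^sup>2) = exp (\<alpha>\<^sup>2 / (4 * k)) * sqrt (pi / k) * normal_density (\<alpha> / (2 * k)) (sqrt (1 / (2 * k))) x" for x
  proof -
    have "- (x - \<alpha> / (2 * k))\<^sup>2 / (2 * (sqrt (1 / (2 * k)))\<^sup>2) = - k * (x - \<alpha> / (2 * k))\<^sup>2"
      using assms by simp
    also have "\<dots> = (\<alpha> * x - k * x\<^sup>2) - \<alpha>\<^sup>2 / (4 * k)"
      using assms by (simp add: field_simps power2_eq_square)
    finally have "normal_density (\<alpha> / (2 * k)) (sqrt (1 / (2 * k))) x = 1 / sqrt (pi / k) * exp ((\<alpha> * x - k * x\<^sup>2) - \<alpha>\<^sup>2 / (4 * k))"
      using assms by (simp add: normal_density_def)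
    then show ?thesis using assms by (simp add: exp_diff)
  qed
  then show ?thesis using assms by (simp add: integrable_normal_density)
qed

lemma ft_std_gaussian: "(LINT x|lborel. exp (\<i> * complex_of_real (t * x)) * complex_of_real (exp (- x\<^sup>2 / 2)))
   = of_real (sqrt (2 * pi) * exp (- t\<^sup>2 / 2))"
proof -
  have [measurable]: "(\<lambda>x. exp (\<i> * complex_of_real (t * x))) \<in> borel_measurable borel"
    by (intro borel_measurable_continuous_onI continuous_intros)
  have "complex_of_real (exp (- t\<^sup>2 / 2)) = (LINT x|density lborel std_normal_density. exp (\<i> * complex_of_real (t * x)))"
    using fun_cong[OF char_std_normal_distribution, of t] by (simp add: char_def)
  also have "\<dots> = (LINT x|lborel. std_normal_density x *\<^sub>R exp (\<i> * complex_of_real (t * x)))"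
    by (rule integral_density) auto
  also have "\<dots> = (LINT x|lborel. of_real (1 / sqrt (2 * pi)) * (exp (\<i> * complex_of_real (t * x)) * complex_of_real (exp (- x\<^sup>2 / 2))))"
    by (intro Bochner_Integration.integral_cong refl)
       (simp add: std_normal_density_def scaleR_conv_of_real mult_ac)
  also have "\<dots> = of_real (1 / sqrt (2 * pi)) * (LINT x|lborel. exp (\<i> * complex_of_real (t * x)) * complex_of_real (exp (- x\<^sup>2 / 2)))"
    by (rule integral_mult_right_zero)
  finally show ?thesis by (simp add: field_simps)
qed

text \<open>No contour shift is involved: the real part of \<open>a\<close> moves the centre of the
  Gaussian and its imaginary part is a frequency, so an affine substitution reduces the integral to
  the characteristic function of the standard normal distribution.\<close>

lemma gaussian_integral_complex:
  assumes k: "k > 0"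
  shows "(LINT x|lborel. exp (a * complex_of_real x - of_real (k * x\<^sup>2))) = of_real (sqrt (pi / k)) * exp (a\<^sup>2 / of_real (4 * k))"
proof -
  define \<alpha> \<beta> where "\<alpha> = Re a" and "\<beta> = Im a"
  have a: "a = of_real \<alpha> + \<i> * of_real \<beta>" by (simp add: \<alpha>_def \<beta>_def complex_eq)
  \<comment> \<open>\<open>c\<close> is the standard deviation and \<open>m\<close> the mean of the
    normal density proportional to the modulus of the integrand.\<close>
  define c where "c = 1 / sqrt (2 * k)"
  define m where "m = \<alpha> / (2 * k)"
  have c: "c > 0" "c\<^sup>2 = 1 / (2 * k)" using k by (auto simp: c_def power_divide)
  have "(LINT x|lborel. exp (a * complex_of_real x - of_real (k * x\<^sup>2)))
     = \<bar>c\<bar> *\<^sub>R (LINT x|lborel. exp (a * complex_of_real (m + c * x) - of_real (k * (m + c * x)\<^sup>2)))"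
    using c by (intro lborel_integral_real_affine) auto
  also have "(LINT x|lborel. exp (a * complex_of_real (m + c * x) - of_real (k * (m + c * x)\<^sup>2)))
     = (LINT x|lborel. exp (of_real (\<alpha>\<^sup>2 / (4 * k)) + \<i> * of_real (\<beta> * m)) * (exp (\<i> * complex_of_real ((\<beta> * c) * x)) * complex_of_real (exp (- x\<^sup>2 / 2))))"
  proof (intro Bochner_Integration.integral_cong refl)
    fix x
    have 1: "\<alpha> * (m + c * x) - k * (m + c * x)\<^sup>2 = \<alpha>\<^sup>2 / (4 * k) - x\<^sup>2 / 2"
    proof -
      have "\<alpha> * (m + c * x) - k * (m + c * x)\<^sup>2 = \<alpha> * m - k * m\<^sup>2 + (\<alpha> - 2 * k * m) * c * x - k * c\<^sup>2 * x\<^sup>2"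
        by (simp add: power2_eq_square algebra_simps)
      also have "\<alpha> - 2 * k * m = 0" using k by (simp add: m_def)
      also have "k * c\<^sup>2 = 1/2" using k c by simp
      also have "\<alpha> * m - k * m\<^sup>2 = \<alpha>\<^sup>2 / (4 * k)" using k by (simp add: m_def power2_eq_square field_simps)
      finally show ?thesis by simp
    qed
    have "a * complex_of_real (m + c * x) - of_real (k * (m + c * x)\<^sup>2)
       = of_real (\<alpha> * (m + c * x) - k * (m + c * x)\<^sup>2) + \<i> * of_real (\<beta> * (m + c * x))"
      by (simp add: a algebra_simps)
    also have "\<dots> = (of_real (\<alpha>\<^sup>2 / (4 * k)) + \<i> * of_real (\<beta> * m)) + \<i> * complex_of_real ((\<beta> * c) * x) + of_real (- x\<^sup>2 / 2)"
      unfolding 1 by (simp add: algebra_simps)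
    finally have *: "a * complex_of_real (m + c * x) - of_real (k * (m + c * x)\<^sup>2) = (of_real (\<alpha>\<^sup>2 / (4 * k)) + \<i> * of_real (\<beta> * m)) + \<i> * complex_of_real ((\<beta> * c) * x) + of_real (- x\<^sup>2 / 2)" .
    show "exp (a * complex_of_real (m + c * x) - of_real (k * (m + c * x)\<^sup>2)) =
       exp (of_real (\<alpha>\<^sup>2 / (4 * k)) + \<i> * of_real (\<beta> * m)) * (exp (\<i> * complex_of_real ((\<beta> * c) * x)) * complex_of_real (exp (- x\<^sup>2 / 2)))"
      unfolding * exp_add exp_of_real[symmetric] by (simp add: mult_ac)
  qed
  also have "\<dots> = exp (of_real (\<alpha>\<^sup>2 / (4 * k)) + \<i> * of_real (\<beta> * m)) * of_real (sqrt (2 * pi) * exp (- (\<beta> * c)\<^sup>2 / 2))"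
    by (simp only: integral_mult_right_zero ft_std_gaussian)
  also have "\<bar>c\<bar> *\<^sub>R \<dots> = of_real (c * sqrt (2 * pi)) * exp (of_real (\<alpha>\<^sup>2 / (4 * k)) + \<i> * of_real (\<beta> * m) + of_real (- (\<beta> * c)\<^sup>2 / 2))"
    by (simp only: abs_of_pos[OF c(1)] scaleR_conv_of_real exp_add exp_of_real of_real_mult mult_ac)
  also have "c * sqrt (2 * pi) = sqrt (pi / k)"
    using k by (simp add: c_def real_sqrt_divide real_sqrt_mult)
  also have "of_real (\<alpha>\<^sup>2 / (4 * k)) + \<i> * of_real (\<beta> * m) + of_real (- (\<beta> * c)\<^sup>2 / 2) = a\<^sup>2 / of_real (4 * k)"
  proof -
    have "- (\<beta> * c)\<^sup>2 / 2 = - \<beta>\<^sup>2 / (4 * k)" by (simp add: power_mult_distrib c)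
    then show ?thesis using k by (simp only:) (simp add: a m_def power2_eq_square field_simps)
  qed
  finally show ?thesis .
qed

lemma integrable_gaussian_complex:
  assumes k: "k > 0"
  shows "integrable lborel (\<lambda>x. exp (a * complex_of_real x - of_real (k * x\<^sup>2)))"
  by (rule Bochner_Integration.integrable_bound[OF integrable_gaussian[OF k, of "Re a"]]) auto

lemma nn_integral_even:
  assumes [measurable]: "f \<in> borel_measurable borel"
  shows "(\<integral>\<^sup>+x. f (- x :: real) \<partial>lborel) = (\<integral>\<^sup>+x. f x \<partial>lborel)"
proof -
  have "(\<integral>\<^sup>+x. f x \<partial>lborel) = (\<integral>\<^sup>+x. f x \<partial>distr lborel borel uminus)" by (simp only: lborel_distr_uminus)
  also have "\<dots> = (\<integral>\<^sup>+x. f (- x) \<partial>lborel)" by (rule nn_integral_distr) auto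
  finally show ?thesis by simp
qed

text \<open>\<open>p x\<close> and \<open>p (- x)\<close> dominate the singularity on the two sides
  of 0, and the Gaussian alone dominates the rest.\<close>

lemma nn_integral_abs_powr_gaussian_finite:
  fixes a k :: real
  assumes a: "0 \<le> a" "a < 1" and k: "k > 0"
  shows "(\<integral>\<^sup>+x. ennreal (\<bar>x\<bar> powr (- a) * exp (- k * x\<^sup>2)) \<partial>lborel) < \<infinity>" (is "?I < _")
proof -
  define p where "p x = indicator {0<..1} x * x powr (- a)" for x :: real
  have [measurable]: "p \<in> borel_measurable borel" unfolding p_def[abs_def] by measurable
  have "(\<lambda>x. x powr (- a)) integrable_on {0<..1}"
    using integrable_on_powr_from_0'[of "- a" 1] a by simp
  then have "(\<lambda>x. x powr (- a)) absolutely_integrable_on {0<..1}"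
    by (intro nonnegative_absolutely_integrable_1) auto
  then have "integrable lebesgue p"
    by (simp add: set_integrable_def p_def[abs_def])
  then have "integrable lborel p" by (subst (asm) integrable_completion) auto
  then have p: "(\<integral>\<^sup>+x. ennreal (p x) \<partial>lborel) < \<infinity>"
    by (subst nn_integral_eq_integral) (auto simp: p_def)
  have g: "(\<integral>\<^sup>+x. ennreal (exp (- k * (x::real)\<^sup>2)) \<partial>lborel) < \<infinity>"
    using integrable_gaussian[OF k, of 0] by (subst nn_integral_eq_integral) auto
  have "?I \<le> (\<integral>\<^sup>+x. ennreal (p x) + ennreal (p (- x)) + ennreal (exp (- k * x\<^sup>2)) \<partial>lborel)"
  proof (rule nn_integral_mono)
    fix x :: real
    have "\<bar>x\<bar> powr (- a) * exp (- k * x\<^sup>2) \<le> p x + p (- x) + exp (- k * x\<^sup>2)"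
    proof -
      have e: "exp (- k * x\<^sup>2) \<le> 1" using k by simp
      consider "x = 0" | "0 < x" "x \<le> 1" | "-1 \<le> x" "x < 0" | "\<bar>x\<bar> > 1" by linarith
      then show ?thesis
      proof cases
        case 2
        then have "\<bar>x\<bar> powr (- a) * exp (- k * x\<^sup>2) \<le> x powr (- a) * 1" using e by (intro mult_mono) auto
        then show ?thesis using 2 by (simp add: p_def add_increasing2)
      next
        case 3
        then have "\<bar>x\<bar> powr (- a) * exp (- k * x\<^sup>2) \<le> (- x) powr (- a) * 1" using e by (intro mult_mono) auto
        then show ?thesis using 3 by (simp add: p_def add_increasing2)
      next
        case 4
        then have "\<bar>x\<bar> powr (- a) \<le> 1" using a powr_mono[of "- a" 0 "\<bar>x\<bar>"] by (auto split: if_splits)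
        then have "\<bar>x\<bar> powr (- a) * exp (- k * x\<^sup>2) \<le> 1 * exp (- k * x\<^sup>2)" by (intro mult_right_mono) auto
        moreover have "0 \<le> p x" "0 \<le> p (- x)" by (auto simp: p_def)
        ultimately show ?thesis by linarith
      qed (auto simp: p_def)
    qed
    moreover have "0 \<le> p x" "0 \<le> p (- x)" by (auto simp: p_def)
    ultimately show "ennreal (\<bar>x\<bar> powr (- a) * exp (- k * x\<^sup>2)) \<le> ennreal (p x) + ennreal (p (- x)) + ennreal (exp (- k * x\<^sup>2))"
      by (simp add: ennreal_plus[symmetric] ennreal_leI del: ennreal_plus)
  qed
  also have "\<dots> = (\<integral>\<^sup>+x. ennreal (p x) \<partial>lborel) + (\<integral>\<^sup>+x. ennreal (p (- x)) \<partial>lborel) + (\<integral>\<^sup>+x. ennreal (exp (- k * (x::real)\<^sup>2)) \<partial>lborel)"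
    by (simp add: nn_integral_add)
  also have "(\<integral>\<^sup>+x. ennreal (p (- x)) \<partial>lborel) = (\<integral>\<^sup>+x. ennreal (p x) \<partial>lborel)"
    by (rule nn_integral_even) auto
  also have "(\<integral>\<^sup>+x. ennreal (p x) \<partial>lborel) + (\<integral>\<^sup>+x. ennreal (p x) \<partial>lborel) + (\<integral>\<^sup>+x. ennreal (exp (- k * (x::real)\<^sup>2)) \<partial>lborel) < \<infinity>"
    using p g by (simp add: less_top)
  finally show ?thesis .
qed

text \<open>The exponent is shared equally among the coordinates, none of which exceeds the norm.
  For \<gamma> < N, as in the next lemma, a singularity of order \<gamma> thus becomes a product of
  one-dimensional singularities of order \<gamma> / N < 1, each of them integrable.\<close>

lemma norm_powr_le_prod:
  fixes x :: "'a::euclidean_space"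
  assumes "\<gamma> \<ge> 0" "\<And>b. b \<in> Basis \<Longrightarrow> x \<bullet> b \<noteq> 0"
  shows "norm x powr (- \<gamma>) \<le> (\<Prod>b\<in>Basis. \<bar>x \<bullet> b\<bar> powr (- (\<gamma> / DIM('a))))"
proof -
  obtain b :: 'a where "b \<in> Basis" using nonempty_Basis by blast
  then have x: "norm x > 0" using assms(2)[of b] by auto
  have "norm x powr (- \<gamma>) = (norm x powr (- (\<gamma> / DIM('a)))) ^ DIM('a)"
    using x by (simp add: powr_powr[symmetric] powr_realpow[symmetric] powr_powr)
  also have "\<dots> = (\<Prod>b\<in>(Basis::'a set). norm x powr (- (\<gamma> / DIM('a))))" by simp
  also have "\<dots> \<le> (\<Prod>b\<in>Basis. \<bar>x \<bullet> b\<bar> powr (- (\<gamma> / DIM('a))))"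
    using assms by (intro prod_mono) (auto intro!: powr_mono2' Basis_le_norm)
  finally show ?thesis .
qed

lemma nn_integral_norm_powr_gaussian_finite:
  fixes \<gamma> k :: real
  assumes \<gamma>: "0 \<le> \<gamma>" "\<gamma> < DIM('a)" and k: "k > 0"
  shows "(\<integral>\<^sup>+x. ennreal (norm (x::'a::euclidean_space) powr (- \<gamma>) * exp (- k * (norm x)\<^sup>2)) \<partial>lborel) < \<infinity>"
proof -
  define a where "a = \<gamma> / DIM('a)"
  have a: "0 \<le> a" "a < 1" using \<gamma> by (auto simp: a_def)
  have "AE x in lborel. \<forall>b\<in>Basis. (x::'a) \<bullet> b \<noteq> 0"
    by (intro AE_finite_allI AE_lborel_inner_neq) auto
  then have "(\<integral>\<^sup>+x. ennreal (norm (x::'a) powr (- \<gamma>) * exp (- k * (norm x)\<^sup>2)) \<partial>lborel)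
     \<le> (\<integral>\<^sup>+x. (\<Prod>b\<in>Basis. ennreal (\<bar>(x::'a) \<bullet> b\<bar> powr (- a) * exp (- k * (x \<bullet> b)\<^sup>2))) \<partial>lborel)"
  proof (intro nn_integral_mono_AE, eventually_elim)
    case (elim x)
    have e: "exp (- k * (norm x)\<^sup>2) = (\<Prod>b\<in>Basis. exp (- k * (x \<bullet> b)\<^sup>2))"
      by (simp add: norm_sq_eq_sum sum_distrib_left exp_sum[symmetric] sum_negf)
    have "norm x powr (- \<gamma>) * exp (- k * (norm x)\<^sup>2) \<le> (\<Prod>b\<in>Basis. \<bar>x \<bullet> b\<bar> powr (- a)) * exp (- k * (norm x)\<^sup>2)"
      using norm_powr_le_prod[OF \<gamma>(1), of x] elim by (intro mult_right_mono) (auto simp: a_def)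
    also have "\<dots> = (\<Prod>b\<in>Basis. \<bar>x \<bullet> b\<bar> powr (- a) * exp (- k * (x \<bullet> b)\<^sup>2))"
      by (simp only: e prod.distrib)
    finally show ?case by (subst prod_ennreal) (auto intro: ennreal_leI)
  qed
  also have "\<dots> = (\<Prod>b\<in>(Basis::'a set). \<integral>\<^sup>+x. ennreal (\<bar>x\<bar> powr (- a) * exp (- k * x\<^sup>2)) \<partial>lborel)"
    by (intro nn_integral_lborel_prod) auto
  also have "\<dots> < \<infinity>"
    using nn_integral_abs_powr_gaussian_finite[OF a k] by (simp add: power_less_top_ennreal)
  finally show ?thesis .
qed

subsection \<open>Weighted square-integrable functions\<close>

text \<open>The Riesz-Fischer argument for functions instead of classes, with only the differences
  of the members square integrable. The measure is general because the lemma is applied with the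
  weight as a density.\<close>

lemma L2_complete:
  fixes F :: "nat \<Rightarrow> 'a \<Rightarrow> complex"
  assumes [measurable]: "\<And>n. F n \<in> borel_measurable M"
    and cauchy: "\<And>e. e > 0 \<Longrightarrow> \<exists>K. \<forall>m\<ge>K. \<forall>n\<ge>K. (\<integral>\<^sup>+x. ennreal ((cmod (F m x - F n x))\<^sup>2) \<partial>M) < ennreal e"
  obtains g where "g \<in> borel_measurable M" "(\<lambda>n. \<integral>\<^sup>+x. ennreal ((cmod (F n x - g x))\<^sup>2) \<partial>M) \<longlonglongrightarrow> 0"
proof -
  \<comment> \<open>The rate 1/8 leaves a geometric series after multiplication by 4 ^ j: at almost
    every x the numbers \<open>2 ^ j * d j x\<close> are then bounded, so that the telescoping
    series converges geometrically.\<close>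
  define K where "K j = (SOME K. \<forall>m\<ge>K. \<forall>n\<ge>K. (\<integral>\<^sup>+x. ennreal ((cmod (F m x - F n x))\<^sup>2) \<partial>M) < ennreal ((1/8) ^ j))" for j :: nat
  have K: "(\<integral>\<^sup>+x. ennreal ((cmod (F m x - F n x))\<^sup>2) \<partial>M) < ennreal ((1/8) ^ j)" if "m \<ge> K j" "n \<ge> K j" for m n j
    using someI_ex[OF cauchy[of "(1/8) ^ j"]] that unfolding K_def[symmetric] by auto
  \<comment> \<open>The partial sums make the indices increasing and at least \<open>K j\<close>;
    the summand j makes them tend to infinity.\<close>
  define r where "r j = (\<Sum>i\<le>j. K i) + j" for j
  have rK: "r j \<ge> K j" for j by (simp add: r_def trans_le_add1 member_le_sum)
  have r_mono: "r j \<le> r (Suc j)" for j by (simp add: r_def)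
  have r_ge: "r j \<ge> j" for j by (simp add: r_def)
  define d where "d j x = cmod (F (r (Suc j)) x - F (r j) x)" for j x
  have [measurable]: "d j \<in> borel_measurable M" for j unfolding d_def[abs_def] by measurable
  have dint: "(\<integral>\<^sup>+x. ennreal (4 ^ j * (d j x)\<^sup>2) \<partial>M) \<le> ennreal ((1/2) ^ j)" for j
  proof -
    have "(\<integral>\<^sup>+x. ennreal (4 ^ j * (d j x)\<^sup>2) \<partial>M) = ennreal (4 ^ j) * (\<integral>\<^sup>+x. ennreal ((d j x)\<^sup>2) \<partial>M)"
      by (subst nn_integral_cmult[symmetric]) (auto simp: ennreal_mult)
    also have "\<dots> \<le> ennreal (4 ^ j) * ennreal ((1/8) ^ j)"
      unfolding d_def using K[of j "r (Suc j)" "r j"] rK[of j] r_mono[of j] by (intro mult_left_mono) auto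
    also have "\<dots> = ennreal ((1/2) ^ j)"
      by (simp add: ennreal_mult[symmetric] power_mult_distrib[symmetric])
    finally show ?thesis .
  qed
  have "(\<integral>\<^sup>+x. (\<Sum>j. ennreal (4 ^ j * (d j x)\<^sup>2)) \<partial>M) = (\<Sum>j. \<integral>\<^sup>+x. ennreal (4 ^ j * (d j x)\<^sup>2) \<partial>M)"
    by (rule nn_integral_suminf) auto
  also have "\<dots> \<le> (\<Sum>j. ennreal ((1/2) ^ j))"
    by (intro suminf_le dint) auto
  also have "\<dots> < \<infinity>"
    by (subst suminf_ennreal2) (auto intro!: summable_geometric)
  finally have "AE x in M. (\<Sum>j. ennreal (4 ^ j * (d j x)\<^sup>2)) \<noteq> \<infinity>"
    by (intro nn_integral_PInf_AE) auto
  then have conv: "AE x in M. convergent (\<lambda>j. F (r j) x)"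
  proof eventually_elim
    case (elim x)
    define C where "C = enn2real (\<Sum>j. ennreal (4 ^ j * (d j x)\<^sup>2))"
    have "ennreal (4 ^ j * (d j x)\<^sup>2) \<le> ennreal C" for j
      using elim sum_le_suminf[of "\<lambda>j. ennreal (4 ^ j * (d j x)\<^sup>2)" "{j}"] by (simp add: C_def less_top)
    then have "4 ^ j * (d j x)\<^sup>2 \<le> C" for j
      by (subst (asm) ennreal_le_iff) (auto simp: C_def)
    then have "sqrt (4 ^ j * (d j x)\<^sup>2) \<le> sqrt C" for j by simp
    then have "2 ^ j * d j x \<le> sqrt C" for j
      by (simp add: real_sqrt_mult d_def real_sqrt_power)
    then have "d j x \<le> sqrt C * (1/2) ^ j" for j by (simp add: field_simps)
    then have "summable (\<lambda>j. F (r (Suc j)) x - F (r j) x)"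
      using summable_comparison_test'[of "\<lambda>j. sqrt C * (1/2) ^ j" 0 "\<lambda>j. F (r (Suc j)) x - F (r j) x"]
      by (simp add: d_def summable_mult summable_geometric)
    then have "convergent (\<lambda>n. \<Sum>j<n. F (r (Suc j)) x - F (r j) x)" by (simp add: summable_iff_convergent)
    then have "convergent (\<lambda>n. F (r n) x - F (r 0) x)"
      by (subst (asm) sum_lessThan_telescope)
    then have "convergent (\<lambda>n. (F (r n) x - F (r 0) x) + F (r 0) x)"
      by (intro convergent_add convergent_const)
    then show ?case by simp
  qed
  define g where "g x = lim (\<lambda>j. F (r j) x)" for x
  have [measurable]: "g \<in> borel_measurable M" unfolding g_def[abs_def] by measurable
  have lim: "AE x in M. (\<lambda>j. F (r j) x) \<longlonglongrightarrow> g x"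
    using conv by eventually_elim (simp add: g_def convergent_LIMSEQ_iff)
  have bound: "\<exists>K. \<forall>n\<ge>K. (\<integral>\<^sup>+x. ennreal ((cmod (F n x - g x))\<^sup>2) \<partial>M) \<le> ennreal e" if "e > 0" for e
  proof -
    obtain K where K: "\<And>m n. m \<ge> K \<Longrightarrow> n \<ge> K \<Longrightarrow> (\<integral>\<^sup>+x. ennreal ((cmod (F m x - F n x))\<^sup>2) \<partial>M) < ennreal e"
      using cauchy[OF \<open>e > 0\<close>] by blast
    have "(\<integral>\<^sup>+x. ennreal ((cmod (F n x - g x))\<^sup>2) \<partial>M) \<le> ennreal e" if "n \<ge> K" for n
    proof -
      have "(\<integral>\<^sup>+x. ennreal ((cmod (F n x - g x))\<^sup>2) \<partial>M) = (\<integral>\<^sup>+x. liminf (\<lambda>j. ennreal ((cmod (F n x - F (r j) x))\<^sup>2)) \<partial>M)"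
        using lim
      proof (intro nn_integral_cong_AE, eventually_elim)
        case (elim x)
        have "(\<lambda>j. ennreal ((cmod (F n x - F (r j) x))\<^sup>2)) \<longlonglongrightarrow> ennreal ((cmod (F n x - g x))\<^sup>2)"
          by (intro tendsto_intros elim)
        then show ?case by (rule lim_imp_Liminf[symmetric, rotated]) simp
      qed
      \<comment> \<open>Fatou's lemma along the subsequence: the Cauchy bound passes to the limit in
        one of its two indices.\<close>
      also have "\<dots> \<le> liminf (\<lambda>j. \<integral>\<^sup>+x. ennreal ((cmod (F n x - F (r j) x))\<^sup>2) \<partial>M)"
        by (rule nn_integral_liminf) auto
      also have "\<dots> \<le> ennreal e"
      proof (rule Liminf_le)
        show "\<forall>\<^sub>F j in sequentially. (\<integral>\<^sup>+x. ennreal ((cmod (F n x - F (r j) x))\<^sup>2) \<partial>M) \<le> ennreal e"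
          using eventually_ge_at_top[of K]
        proof eventually_elim
          case (elim j)
          then show ?case using K[OF \<open>n \<ge> K\<close>, of "r j"] r_ge[of j] by (auto intro: less_imp_le)
        qed
      qed simp
      finally show ?thesis .
    qed
    then show ?thesis by blast
  qed
  have "(\<lambda>n. \<integral>\<^sup>+x. ennreal ((cmod (F n x - g x))\<^sup>2) \<partial>M) \<longlonglongrightarrow> 0"
  proof (rule tendsto_zero_ennreal)
    fix e :: real assume "e > 0"
    then obtain K where "\<forall>n\<ge>K. (\<integral>\<^sup>+x. ennreal ((cmod (F n x - g x))\<^sup>2) \<partial>M) \<le> ennreal (e / 2)"
      using bound[of "e / 2"] by auto
    moreover have "ennreal (e / 2) < ennreal e" using \<open>e > 0\<close> by (simp add: ennreal_less_iff)
    ultimately show "\<forall>\<^sub>F n in sequentially. (\<integral>\<^sup>+x. ennreal ((cmod (F n x - g x))\<^sup>2) \<partial>M) < ennreal e"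
      by (auto simp: eventually_sequentially intro: order.strict_trans1)
  qed
  then show ?thesis by (rule that[rotated]) simp
qed

text \<open>For positive \<gamma> this is the squared norm of the completion in frequency space, for
  negative \<gamma> that of its dual. Values in \<open>ennreal\<close> let finiteness be proved
  rather than presupposed.\<close>

definition weighted_sq :: "real \<Rightarrow> ('a::euclidean_space \<Rightarrow> complex) \<Rightarrow> ennreal" where
  "weighted_sq \<gamma> w = (\<integral>\<^sup>+\<xi>. ennreal (norm \<xi> powr (2 * \<gamma>) * (cmod (w \<xi>))\<^sup>2) \<partial>lborel)"

lemma powr_square: "(x powr \<gamma>)\<^sup>2 = x powr (2 * \<gamma>)" for x :: real
  by (simp add: power2_eq_square powr_add[symmetric])

lemma weighted_Cauchy_Schwarz:
  fixes w r :: "'a::euclidean_space \<Rightarrow> complex"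
  assumes [measurable]: "w \<in> borel_measurable borel" "r \<in> borel_measurable borel"
  shows "(\<integral>\<^sup>+\<xi>. ennreal (cmod (w \<xi>) * cmod (r \<xi>)) \<partial>lborel)\<^sup>2 \<le> weighted_sq \<gamma> w * weighted_sq (- \<gamma>) r"
proof -
  \<comment> \<open>Since \<open>0 powr x = 0\<close>, the two weights multiply to 1 only off the
    origin.\<close>
  have "AE \<xi> in lborel. \<xi> \<noteq> (0::'a)" by (rule AE_lborel_singleton)
  then have "(\<integral>\<^sup>+\<xi>. ennreal (cmod (w \<xi>) * cmod (r \<xi>)) \<partial>lborel)
    = (\<integral>\<^sup>+\<xi>. ennreal (norm \<xi> powr \<gamma> * cmod (w \<xi>)) * ennreal (norm \<xi> powr (- \<gamma>) * cmod (r \<xi>)) \<partial>lborel)"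
  proof (intro nn_integral_cong_AE, eventually_elim)
    case (elim \<xi>)
    then have "norm \<xi> powr \<gamma> * norm \<xi> powr (- \<gamma>) = 1" by (simp add: powr_add[symmetric])
    then have "norm \<xi> powr \<gamma> * cmod (w \<xi>) * (norm \<xi> powr (- \<gamma>) * cmod (r \<xi>)) = cmod (w \<xi>) * cmod (r \<xi>)"
      by (metis (no_types, opaque_lifting) mult.assoc mult.commute mult.right_neutral)
    then show ?case by (simp add: ennreal_mult[symmetric])
  qed
  also have "\<dots>\<^sup>2 \<le> (\<integral>\<^sup>+\<xi>. (ennreal (norm \<xi> powr \<gamma> * cmod (w \<xi>)))\<^sup>2 \<partial>lborel) * (\<integral>\<^sup>+\<xi>. (ennreal (norm \<xi> powr (- \<gamma>) * cmod (r \<xi>)))\<^sup>2 \<partial>lborel)"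
    by (rule Cauchy_Schwarz_nn_integral) auto
  also have "\<dots> = weighted_sq \<gamma> w * weighted_sq (- \<gamma>) r"
    unfolding weighted_sq_def
    by (simp add: ennreal_power power_mult_distrib powr_square)
  finally show ?thesis .
qed

lemma weighted_L1_finite:
  fixes w r :: "'a::euclidean_space \<Rightarrow> complex"
  assumes "w \<in> borel_measurable borel" "r \<in> borel_measurable borel"
    and "weighted_sq \<gamma> w < \<infinity>" "weighted_sq (- \<gamma>) r < \<infinity>"
  shows "(\<integral>\<^sup>+\<xi>. ennreal (cmod (w \<xi>) * cmod (r \<xi>)) \<partial>lborel) < \<infinity>"
proof -
  have "(\<integral>\<^sup>+\<xi>. ennreal (cmod (w \<xi>) * cmod (r \<xi>)) \<partial>lborel)\<^sup>2 < \<infinity>"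
    using weighted_Cauchy_Schwarz[OF assms(1,2), of \<gamma>] assms(3,4)
    by (auto intro: order.strict_trans1 simp: ennreal_mult_less_top)
  then show ?thesis by (simp add: power_less_top_ennreal)
qed

lemma weighted_L1_tendsto_0:
  fixes w :: "nat \<Rightarrow> 'a::euclidean_space \<Rightarrow> complex"
  assumes "\<And>n. w n \<in> borel_measurable borel" "r \<in> borel_measurable borel"
    and lim: "(\<lambda>n. weighted_sq \<gamma> (w n)) \<longlonglongrightarrow> 0" and fin: "weighted_sq (- \<gamma>) r < \<infinity>"
  shows "(\<lambda>n. \<integral>\<^sup>+\<xi>. ennreal (cmod (w n \<xi>) * cmod (r \<xi>)) \<partial>lborel) \<longlonglongrightarrow> 0"
proof -
  define X where "X n = (\<integral>\<^sup>+\<xi>. ennreal (cmod (w n \<xi>) * cmod (r \<xi>)) \<partial>lborel)" for n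
  have le: "(X n)\<^sup>2 \<le> weighted_sq \<gamma> (w n) * weighted_sq (- \<gamma>) r" for n
    unfolding X_def by (rule weighted_Cauchy_Schwarz) fact+
  have "(\<lambda>n. weighted_sq \<gamma> (w n) * weighted_sq (- \<gamma>) r) \<longlonglongrightarrow> 0 * weighted_sq (- \<gamma>) r"
    using fin by (intro tendsto_mult_ennreal lim tendsto_const) auto
  then have "(\<lambda>n. (X n)\<^sup>2) \<longlonglongrightarrow> 0"
    using tendsto_sandwich[of "\<lambda>_. 0" "\<lambda>n. (X n)\<^sup>2" sequentially "\<lambda>n. weighted_sq \<gamma> (w n) * weighted_sq (- \<gamma>) r" 0] le
    by simp
  have "X \<longlonglongrightarrow> 0"
  proof (rule tendsto_zero_ennreal)
    fix e :: real assume "e > 0"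
    then have "\<forall>\<^sub>F n in sequentially. (X n)\<^sup>2 < ennreal (e\<^sup>2)"
      using order_tendstoD(2)[OF \<open>(\<lambda>n. (X n)\<^sup>2) \<longlonglongrightarrow> 0\<close>, of "ennreal (e\<^sup>2)"] by simp
    then show "\<forall>\<^sub>F n in sequentially. X n < ennreal e"
    proof eventually_elim
      case (elim n)
      show ?case
      proof (rule ccontr)
        assume "\<not> X n < ennreal e"
        then have "(ennreal e)\<^sup>2 \<le> (X n)\<^sup>2" by (intro power_mono) auto
        then show False using elim \<open>e > 0\<close> by (simp add: ennreal_power)
      qed
    qed
  qed
  then show ?thesis by (simp add: X_def[abs_def])
qed

lemma weighted_sq_triangle:
  assumes [measurable]: "f \<in> borel_measurable borel" "g \<in> borel_measurable borel"
  shows "weighted_sq \<gamma> (\<lambda>\<xi>. f \<xi> - g \<xi>) \<le> 2 * weighted_sq \<gamma> f + 2 * weighted_sq \<gamma> g"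
proof -
  have "weighted_sq \<gamma> (\<lambda>\<xi>. f \<xi> - g \<xi>) \<le>
    (\<integral>\<^sup>+\<xi>. 2 * ennreal (norm \<xi> powr (2 * \<gamma>) * (cmod (f \<xi>))\<^sup>2) + 2 * ennreal (norm \<xi> powr (2 * \<gamma>) * (cmod (g \<xi>))\<^sup>2) \<partial>lborel)"
    unfolding weighted_sq_def
  proof (rule nn_integral_mono)
    fix \<xi> :: 'a
    have "(cmod (f \<xi> - g \<xi>))\<^sup>2 \<le> (cmod (f \<xi>) + cmod (g \<xi>))\<^sup>2"
      by (intro power_mono norm_triangle_ineq4) auto
    also have "\<dots> \<le> 2 * (cmod (f \<xi>))\<^sup>2 + 2 * (cmod (g \<xi>))\<^sup>2"
      using sum_squares_bound[of "cmod (f \<xi>)" "cmod (g \<xi>)"] by (simp add: power2_sum)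
    finally have "norm \<xi> powr (2 * \<gamma>) * (cmod (f \<xi> - g \<xi>))\<^sup>2 \<le>
      2 * (norm \<xi> powr (2 * \<gamma>) * (cmod (f \<xi>))\<^sup>2) + 2 * (norm \<xi> powr (2 * \<gamma>) * (cmod (g \<xi>))\<^sup>2)"
      using mult_left_mono[of "(cmod (f \<xi> - g \<xi>))\<^sup>2" "2 * (cmod (f \<xi>))\<^sup>2 + 2 * (cmod (g \<xi>))\<^sup>2" "norm \<xi> powr (2 * \<gamma>)"]
      by (simp add: algebra_simps)
    then have "ennreal (norm \<xi> powr (2 * \<gamma>) * (cmod (f \<xi> - g \<xi>))\<^sup>2) \<le>
      ennreal (2 * (norm \<xi> powr (2 * \<gamma>) * (cmod (f \<xi>))\<^sup>2) + 2 * (norm \<xi> powr (2 * \<gamma>) * (cmod (g \<xi>))\<^sup>2))"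
      by (rule ennreal_leI)
    also have "\<dots> = 2 * ennreal (norm \<xi> powr (2 * \<gamma>) * (cmod (f \<xi>))\<^sup>2) + 2 * ennreal (norm \<xi> powr (2 * \<gamma>) * (cmod (g \<xi>))\<^sup>2)"
      by (subst ennreal_plus) (auto simp: ennreal_mult)
    finally show "ennreal (norm \<xi> powr (2 * \<gamma>) * (cmod (f \<xi> - g \<xi>))\<^sup>2) \<le> \<dots>" .
  qed
  also have "\<dots> = 2 * weighted_sq \<gamma> f + 2 * weighted_sq \<gamma> g"
    unfolding weighted_sq_def by (simp add: nn_integral_add nn_integral_cmult)
  finally show ?thesis .
qed

lemma weighted_sq_limit_finite:
  assumes "\<And>n. F n \<in> borel_measurable borel" "g \<in> borel_measurable borel"
    and "\<And>n. weighted_sq \<gamma> (F n) < \<infinity>" and "(\<lambda>n::nat. weighted_sq \<gamma> (\<lambda>\<xi>. F n \<xi> - g \<xi>)) \<longlonglongrightarrow> 0"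
  shows "weighted_sq \<gamma> g < \<infinity>"
proof -
  have "\<forall>\<^sub>F n in sequentially. weighted_sq \<gamma> (\<lambda>\<xi>. F n \<xi> - g \<xi>) < 1"
    using assms(4) by (rule order_tendstoD) simp
  then obtain n where n: "weighted_sq \<gamma> (\<lambda>\<xi>. F n \<xi> - g \<xi>) < 1"
    by (auto simp: eventually_sequentially)
  have "weighted_sq \<gamma> g = weighted_sq \<gamma> (\<lambda>\<xi>. F n \<xi> - (F n \<xi> - g \<xi>))" by simp
  also have "\<dots> \<le> 2 * weighted_sq \<gamma> (F n) + 2 * weighted_sq \<gamma> (\<lambda>\<xi>. F n \<xi> - g \<xi>)"
    using assms(1,2) by (intro weighted_sq_triangle) auto
  also have "\<dots> < \<infinity>"
    using assms(3)[of n] n by (auto simp: ennreal_mult_less_top intro: less_trans)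
  finally show ?thesis .
qed

text \<open>The splitting \<open>\<bar>w\<bar> \<le> \<delta> + \<delta> powr (1 - p) * \<bar>w\<bar> powr p\<close> replaces Hoelder's inequality here.\<close>

lemma abs_le_powr_split:
  fixes w :: real
  assumes "p > 1" "\<delta> > 0"
  shows "\<bar>w\<bar> \<le> \<delta> + \<delta> powr (1 - p) * \<bar>w\<bar> powr p"
proof (cases "\<bar>w\<bar> \<le> \<delta>")
  case False
  then have w: "\<bar>w\<bar> > 0" using assms by linarith
  have "\<bar>w\<bar> powr (1 - p) \<le> \<delta> powr (1 - p)"
    using assms False by (intro powr_mono2') auto
  then have "\<bar>w\<bar> powr (1 - p) * \<bar>w\<bar> powr p \<le> \<delta> powr (1 - p) * \<bar>w\<bar> powr p"
    by (intro mult_right_mono) auto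
  then show ?thesis using w assms by (simp add: powr_add[symmetric])
qed (auto intro: add_increasing2)

lemma nn_integral_powr_split:
  fixes w r :: "'a::euclidean_space \<Rightarrow> real"
  assumes [measurable]: "w \<in> borel_measurable borel" "r \<in> borel_measurable borel"
    and r: "\<And>x. 0 \<le> r x" "\<And>x. r x \<le> B" and p: "p > 1" and d: "\<delta> > 0"
  shows "(\<integral>\<^sup>+x. ennreal (\<bar>w x\<bar> * r x) \<partial>lborel) \<le> ennreal \<delta> * (\<integral>\<^sup>+x. ennreal (r x) \<partial>lborel)
     + ennreal (\<delta> powr (1 - p) * B) * (\<integral>\<^sup>+x. ennreal (\<bar>w x\<bar> powr p) \<partial>lborel)"
proof -
  have B: "B \<ge> 0" using r[of 0] by linarith
  have "(\<integral>\<^sup>+x. ennreal (\<bar>w x\<bar> * r x) \<partial>lborel) \<le> (\<integral>\<^sup>+x. ennreal \<delta> * ennreal (r x) + ennreal (\<delta> powr (1 - p) * B) * ennreal (\<bar>w x\<bar> powr p) \<partial>lborel)"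
  proof (rule nn_integral_mono)
    fix x :: 'a
    have "\<bar>w x\<bar> * r x \<le> (\<delta> + \<delta> powr (1 - p) * \<bar>w x\<bar> powr p) * r x"
      using abs_le_powr_split[OF p d] r by (intro mult_right_mono) auto
    also have "\<dots> \<le> \<delta> * r x + \<delta> powr (1 - p) * \<bar>w x\<bar> powr p * B"
      using r by (simp add: distrib_right mult_left_mono)
    finally have "ennreal (\<bar>w x\<bar> * r x) \<le> ennreal (\<delta> * r x + \<delta> powr (1 - p) * B * \<bar>w x\<bar> powr p)"
      by (intro ennreal_leI) (simp add: mult_ac)
    also have "\<dots> = ennreal \<delta> * ennreal (r x) + ennreal (\<delta> powr (1 - p) * B) * ennreal (\<bar>w x\<bar> powr p)"
      using r d B by (simp add: ennreal_mult)
    finally show "ennreal (\<bar>w x\<bar> * r x) \<le> \<dots>" .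
  qed
  also have "\<dots> = ennreal \<delta> * (\<integral>\<^sup>+x. ennreal (r x) \<partial>lborel)
     + ennreal (\<delta> powr (1 - p) * B) * (\<integral>\<^sup>+x. ennreal (\<bar>w x\<bar> powr p) \<partial>lborel)"
    by (simp add: nn_integral_add nn_integral_cmult)
  finally show ?thesis .
qed

lemma Lp_L1_tendsto_0:
  fixes w :: "nat \<Rightarrow> 'a::euclidean_space \<Rightarrow> real"
  assumes w: "\<And>n. w n \<in> borel_measurable borel" and rm: "r \<in> borel_measurable borel"
    and r: "\<And>x. 0 \<le> r x" "\<And>x. r x \<le> B" and p: "p > 1"
    and rfin: "(\<integral>\<^sup>+x. ennreal (r x) \<partial>lborel) < \<infinity>"
    and lim: "(\<lambda>n. \<integral>\<^sup>+x. ennreal (\<bar>w n x\<bar> powr p) \<partial>lborel) \<longlonglongrightarrow> 0"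
  shows "(\<lambda>n. \<integral>\<^sup>+x. ennreal (\<bar>w n x\<bar> * r x) \<partial>lborel) \<longlonglongrightarrow> 0"
proof (rule tendsto_zero_ennreal)
  fix e :: real assume e: "e > 0"
  define I where "I = enn2real (\<integral>\<^sup>+x. ennreal (r x) \<partial>lborel)"
  have I: "(\<integral>\<^sup>+x. ennreal (r x) \<partial>lborel) = ennreal I" "I \<ge> 0"
    using rfin by (auto simp: I_def less_top)
  \<comment> \<open>The threshold of the splitting is chosen so that its first term stays below e /
    2; the summand 1 covers the case I = 0. With \<delta> fixed, the second term tends to 0.\<close>
  define \<delta> where "\<delta> = e / (2 * (I + 1))"
  have \<delta>: "\<delta> > 0" using e I by (auto simp: \<delta>_def)
  have "\<delta> * I < e / 2"
  proof -
    have "\<delta> * I < \<delta> * (I + 1)" using \<delta> by simp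
    also have "\<dots> = e / 2" using I by (simp add: \<delta>_def field_simps)
    finally show ?thesis .
  qed
  have "(\<lambda>n. ennreal (\<delta> powr (1 - p) * B) * (\<integral>\<^sup>+x. ennreal (\<bar>w n x\<bar> powr p) \<partial>lborel)) \<longlonglongrightarrow> ennreal (\<delta> powr (1 - p) * B) * 0"
    by (intro ennreal_tendsto_cmult lim) auto
  then have "\<forall>\<^sub>F n in sequentially. ennreal (\<delta> powr (1 - p) * B) * (\<integral>\<^sup>+x. ennreal (\<bar>w n x\<bar> powr p) \<partial>lborel) < ennreal (e / 2)"
    using e by (intro order_tendstoD) auto
  then show "\<forall>\<^sub>F n in sequentially. (\<integral>\<^sup>+x. ennreal (\<bar>w n x\<bar> * r x) \<partial>lborel) < ennreal e"
  proof eventually_elim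
    case (elim n)
    have "(\<integral>\<^sup>+x. ennreal (\<bar>w n x\<bar> * r x) \<partial>lborel) \<le> ennreal \<delta> * ennreal I
      + ennreal (\<delta> powr (1 - p) * B) * (\<integral>\<^sup>+x. ennreal (\<bar>w n x\<bar> powr p) \<partial>lborel)"
      unfolding I(1)[symmetric] by (rule nn_integral_powr_split[OF w rm r p \<delta>])
    also have "\<dots> < ennreal (e / 2 + e / 2)"
      using \<open>\<delta> * I < e / 2\<close> \<delta> I elim
      by (intro add_mono_ennreal) (auto simp: ennreal_mult[symmetric] ennreal_less_iff)
    finally show ?case by simp
  qed
qed

subsection \<open>The Fourier transform of elements of the completion\<close>

lemma fourier_test_measurable:
  assumes "\<phi> \<in> test_functions \<Omega>"
  shows "fourier \<phi> \<in> borel_measurable borel"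
proof -
  have "integrable lborel (\<lambda>x. complex_of_real (\<phi> x))"
    using test_function_integrable[OF assms] by simp
  note [measurable] = ft_measurable[OF this]
  show ?thesis
    unfolding fourier_eq_ft(1)[OF test_function_measurable[OF assms], abs_def] by measurable
qed

lemma fourier_test_diff:
  assumes "\<phi> \<in> test_functions \<Omega>" "\<psi> \<in> test_functions \<Omega>"
  shows "fourier (\<lambda>x. \<phi> x - \<psi> x) \<xi> = fourier \<phi> \<xi> - fourier \<psi> \<xi>"
  using test_function_measurable[OF assms(1)] test_function_measurable[OF assms(2)]
  by (simp add: fourier_eq_ft ft_diff test_function_integrable[OF assms(1)] test_function_integrable[OF assms(2)] right_diff_distrib)

lemma fourier_test_decay:
  fixes \<phi> :: "'a::euclidean_space \<Rightarrow> real"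
  assumes "\<phi> \<in> test_functions \<Omega>"
  obtains C where "C \<ge> 0" "\<And>\<xi>. (1 + (norm \<xi>)\<^sup>2) ^ M * cmod (fourier \<phi> \<xi>) \<le> C"
proof -
  obtain C where C: "\<And>\<xi>. (1 + (norm \<xi>)\<^sup>2) ^ M * cmod (ft (\<lambda>x. of_real (\<phi> x)) \<xi>) \<le> C"
    using ft_test_decay[OF assms] by blast
  define c where "c = (2 * pi) powr (- real DIM('a) / 2)"
  have c: "c \<ge> 0" by (simp add: c_def)
  have "(1 + (norm \<xi>)\<^sup>2) ^ M * cmod (fourier \<phi> \<xi>) \<le> c * C" for \<xi>
    using mult_left_mono[OF C[of "- \<xi>"] c]
    by (simp add: fourier_eq_ft[OF test_function_measurable[OF assms]] norm_mult c_def mult_ac)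
  moreover have "0 \<le> c * C"
    using order_trans[OF _ calculation[of 0]] by simp
  ultimately show ?thesis using that by blast
qed

lemma norm_powr_le_power:
  fixes \<xi> :: "'a::real_normed_vector"
  assumes "0 \<le> \<gamma>" "\<gamma> \<le> real m"
  shows "norm \<xi> powr (2 * \<gamma>) \<le> (1 + (norm \<xi>)\<^sup>2) ^ m"
proof -
  have "norm \<xi> powr (2 * \<gamma>) = ((norm \<xi>)\<^sup>2) powr \<gamma>"
    using powr_powr[of "norm \<xi>" 2 \<gamma>] by simp
  also have "\<dots> \<le> (1 + (norm \<xi>)\<^sup>2) powr \<gamma>" using assms by (intro powr_mono2) auto
  also have "\<dots> \<le> (1 + (norm \<xi>)\<^sup>2) powr (real m)" using assms by (intro powr_mono) auto
  also have "\<dots> = (1 + (norm \<xi>)\<^sup>2) ^ m" by (intro powr_realpow) (auto intro: add_pos_nonneg)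
  finally show ?thesis .
qed

lemma integrable_test_weighted:
  fixes \<phi> :: "'a::euclidean_space \<Rightarrow> real"
  assumes \<phi>: "\<phi> \<in> test_functions \<Omega>" and \<gamma>: "\<gamma> \<ge> 0"
  shows "integrable lborel (\<lambda>\<xi>. norm \<xi> powr (2 * \<gamma>) * (cmod (fourier \<phi> \<xi>))\<^sup>2)"
proof -
  note [measurable] = fourier_test_measurable[OF \<phi>]
  obtain m :: nat where m: "\<gamma> \<le> real m" using real_arch_simple by blast
  obtain C where C: "C \<ge> 0" "\<And>\<xi>. (1 + (norm \<xi>)\<^sup>2) ^ (m + DIM('a)) * cmod (fourier \<phi> \<xi>) \<le> C"
    using fourier_test_decay[OF \<phi>] by blast
  show ?thesis
  proof (rule Bochner_Integration.integrable_bound)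
    show "integrable lborel (\<lambda>\<xi>::'a. C\<^sup>2 * inverse ((1 + (norm \<xi>)\<^sup>2) ^ DIM('a)))"
      by (intro integrable_mult_right integrable_inverse_norm_power)
    show "AE \<xi> in lborel. norm (norm \<xi> powr (2 * \<gamma>) * (cmod (fourier \<phi> \<xi>))\<^sup>2) \<le> norm (C\<^sup>2 * inverse ((1 + (norm \<xi>)\<^sup>2) ^ DIM('a)))"
    proof (rule AE_I2)
      fix \<xi> :: 'a
      define A where "A = 1 + (norm \<xi>)\<^sup>2"
      have A: "A \<ge> 1" by (simp add: A_def)
      define f where "f = cmod (fourier \<phi> \<xi>)"
      have f: "f \<ge> 0" "A ^ (m + DIM('a)) * f \<le> C" using C(2)[of \<xi>] by (auto simp: f_def A_def)
      have "f \<le> A ^ (m + DIM('a)) * f" using f A by (simp add: mult_le_cancel_right1)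
      then have fC: "f \<le> C" using f by linarith
      have "norm \<xi> powr (2 * \<gamma>) * f\<^sup>2 \<le> A ^ m * f\<^sup>2"
        using norm_powr_le_power[OF \<gamma> m] by (intro mult_right_mono) (auto simp: A_def)
      \<comment> \<open>One factor of the squared transform absorbs the weight and the integrable
        power; the other is merely bounded by C.\<close>
      also have "\<dots> = inverse (A ^ DIM('a)) * ((A ^ (m + DIM('a)) * f) * f)"
        using A by (simp add: power_add power2_eq_square field_simps)
      also have "\<dots> \<le> inverse (A ^ DIM('a)) * (C * C)"
        using A f fC C by (intro mult_left_mono mult_mono) auto
      finally show "norm (norm \<xi> powr (2 * \<gamma>) * (cmod (fourier \<phi> \<xi>))\<^sup>2) \<le> norm (C\<^sup>2 * inverse ((1 + (norm \<xi>)\<^sup>2) ^ DIM('a)))"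
        using A by (simp add: A_def f_def power2_eq_square mult_ac)
    qed
  qed measurable
qed

lemma freq_inner_lborel:
  assumes [measurable]: "g \<in> borel_measurable borel" "h \<in> borel_measurable borel"
  shows "freq_inner \<gamma> g h = (LINT \<xi>|lborel. complex_of_real (norm \<xi> powr (2 * \<gamma>)) * g \<xi> * cnj (h \<xi>))"
proof -
  have [measurable]: "cnj \<in> borel_measurable borel"
    by (intro borel_measurable_continuous_onI continuous_intros)
  show ?thesis unfolding freq_inner_def by (rule integral_completion) measurable
qed

lemma test_norm_eq:
  assumes \<phi>: "\<phi> \<in> test_functions \<Omega>"
  shows "test_norm \<gamma> \<phi> = sqrt (LINT \<xi>|lborel. norm \<xi> powr (2 * \<gamma>) * (cmod (fourier \<phi> \<xi>))\<^sup>2)"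
proof -
  note [measurable] = fourier_test_measurable[OF \<phi>]
  have "freq_inner \<gamma> (fourier \<phi>) (fourier \<phi>) = (LINT \<xi>|lborel. complex_of_real (norm \<xi> powr (2 * \<gamma>) * (cmod (fourier \<phi> \<xi>))\<^sup>2))"
    by (subst freq_inner_lborel) (auto simp: mult.assoc complex_norm_square[symmetric])
  also have "\<dots> = complex_of_real (LINT \<xi>|lborel. norm \<xi> powr (2 * \<gamma>) * (cmod (fourier \<phi> \<xi>))\<^sup>2)"
    by (rule integral_complex_of_real)
  finally show ?thesis by (simp add: test_norm_def)
qed

lemma weighted_sq_test:
  assumes \<phi>: "\<phi> \<in> test_functions \<Omega>" and \<gamma>: "\<gamma> \<ge> 0"
  shows "weighted_sq \<gamma> (fourier \<phi>) = ennreal ((test_norm \<gamma> \<phi>)\<^sup>2)"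
  unfolding weighted_sq_def test_norm_eq[OF \<phi>]
  by (simp add: nn_integral_eq_integral[OF integrable_test_weighted[OF \<phi> \<gamma>]])

text \<open>\<open>test_norm\<close> of a difference is the weighted L2 distance of the transforms,
  so completeness yields a limit. Its existence is what gives meaning to the \<open>SOME\<close> in
  \<open>D_fourier\<close>.\<close>

lemma D_approx_fourier_limit:
  assumes D: "D_approx \<gamma> \<phi> u" and \<gamma>: "\<gamma> \<ge> 0"
  obtains g where "g \<in> borel_measurable borel" "(\<lambda>n. weighted_sq \<gamma> (\<lambda>\<xi>. fourier (\<phi> n) \<xi> - g \<xi>)) \<longlonglongrightarrow> 0"
proof -
  have \<phi>: "\<phi> n \<in> test_functions UNIV" for n using D by (simp add: D_approx_def)
  have [measurable]: "fourier (\<phi> n) \<in> borel_measurable borel" for n by (rule fourier_test_measurable[OF \<phi>])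
  \<comment> \<open>With the weight as a density, the weighted distance becomes a plain L2
    distance.\<close>
  define M where "M = density (lborel :: 'a measure) (\<lambda>\<xi>. ennreal (norm \<xi> powr (2 * \<gamma>)))"
  have M: "(\<integral>\<^sup>+\<xi>. ennreal ((cmod (w \<xi>))\<^sup>2) \<partial>M) = weighted_sq \<gamma> w" if [measurable]: "w \<in> borel_measurable borel" for w
    unfolding M_def weighted_sq_def by (subst nn_integral_density) (auto simp: ennreal_mult)
  have "\<exists>K. \<forall>m\<ge>K. \<forall>n\<ge>K. (\<integral>\<^sup>+\<xi>. ennreal ((cmod (fourier (\<phi> m) \<xi> - fourier (\<phi> n) \<xi>))\<^sup>2) \<partial>M) < ennreal e"
    if e: "e > 0" for e
  proof -
    obtain K where K: "\<And>m n. m \<ge> K \<Longrightarrow> n \<ge> K \<Longrightarrow> test_norm \<gamma> (\<lambda>x. \<phi> m x - \<phi> n x) < sqrt e"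
      using D e unfolding D_approx_def by (meson real_sqrt_gt_zero)
    have "(\<integral>\<^sup>+\<xi>. ennreal ((cmod (fourier (\<phi> m) \<xi> - fourier (\<phi> n) \<xi>))\<^sup>2) \<partial>M) < ennreal e"
      if "m \<ge> K" "n \<ge> K" for m n
    proof -
      have "(\<integral>\<^sup>+\<xi>. ennreal ((cmod (fourier (\<phi> m) \<xi> - fourier (\<phi> n) \<xi>))\<^sup>2) \<partial>M) = weighted_sq \<gamma> (fourier (\<lambda>x. \<phi> m x - \<phi> n x))"
      proof (subst M)
        have "fourier (\<lambda>x. \<phi> m x - \<phi> n x) = (\<lambda>\<xi>. fourier (\<phi> m) \<xi> - fourier (\<phi> n) \<xi>)"
          by (rule ext) (rule fourier_test_diff[OF \<phi> \<phi>])
        then show "weighted_sq \<gamma> (\<lambda>\<xi>. fourier (\<phi> m) \<xi> - fourier (\<phi> n) \<xi>) = weighted_sq \<gamma> (fourier (\<lambda>x. \<phi> m x - \<phi> n x))"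
          by simp
      qed measurable
      also have "\<dots> = ennreal ((test_norm \<gamma> (\<lambda>x. \<phi> m x - \<phi> n x))\<^sup>2)"
        by (rule weighted_sq_test[OF test_functions_diff[OF \<phi> \<phi>] \<gamma>])
      also have "\<dots> < ennreal e"
      proof (rule ennreal_lessI[OF e])
        have "(test_norm \<gamma> (\<lambda>x. \<phi> m x - \<phi> n x))\<^sup>2 < (sqrt e)\<^sup>2"
          using K[OF that] by (intro power_strict_mono) (simp_all add: test_norm_eq[OF test_functions_diff[OF \<phi> \<phi>]])
        then show "(test_norm \<gamma> (\<lambda>x. \<phi> m x - \<phi> n x))\<^sup>2 < e" using e by simp
      qed
      finally show ?thesis .
    qed
    then show ?thesis by blast
  qed
  moreover have "fourier (\<phi> n) \<in> borel_measurable M" for n by (simp add: M_def)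
  ultimately obtain g where g: "g \<in> borel_measurable M"
    "(\<lambda>n. \<integral>\<^sup>+\<xi>. ennreal ((cmod (fourier (\<phi> n) \<xi> - g \<xi>))\<^sup>2) \<partial>M) \<longlonglongrightarrow> 0"
    using L2_complete[of "\<lambda>n. fourier (\<phi> n)" M] by blast
  have [measurable]: "g \<in> borel_measurable borel" using g(1) by (simp add: M_def)
  show ?thesis using that[of g] g(2) by (subst (asm) M) auto
qed

text \<open>\<open>D_fourier\<close> is only known to be Lebesgue measurable; Fubini arguments on
  product measures are carried out with Borel functions, and a null set is harmless in every
  integral.\<close>

lemma borel_version_complex:
  fixes g :: "'a::euclidean_space \<Rightarrow> complex"
  assumes [measurable]: "g \<in> borel_measurable lebesgue"
  obtains g' where "g' \<in> borel_measurable borel" "AE x in lborel. g x = g' x"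
proof -
  have "(\<lambda>x. Re (g x)) \<in> borel_measurable lebesgue" "(\<lambda>x. Im (g x)) \<in> borel_measurable lebesgue"
    by measurable
  from this[THEN completion_ex_borel_measurable_real]
  obtain r i where [measurable]: "r \<in> borel_measurable borel" "i \<in> borel_measurable borel"
    and "AE x in lborel. Re (g x) = r x" "AE x in lborel. Im (g x) = i x" by auto
  from this(3,4) have "AE x in lborel. g x = complex_of_real (r x) + \<i> * complex_of_real (i x)"
    by eventually_elim (simp add: complex_eq_iff)
  moreover have "(\<lambda>x. complex_of_real (r x) + \<i> * complex_of_real (i x)) \<in> borel_measurable borel"
    by measurable
  ultimately show ?thesis using that by blast
qed

lemma test_function_in_D_space:
  assumes "\<phi> \<in> test_functions \<Omega>"
  shows "\<phi> \<in> D_space \<gamma>"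
proof -
  have "test_norm \<gamma> (\<lambda>x. \<phi> x - \<phi> x) = 0"
    by (simp add: test_norm_def freq_inner_def fourier_def)
  then have "D_approx \<gamma> (\<lambda>n. \<phi>) \<phi>"
    using test_functions_UNIV[OF assms] by (simp add: D_approx_def)
  then show ?thesis
    using test_function_measurable[OF assms] by (auto simp: D_space_def intro!: measurable_completion)
qed

lemma is_D_fourier_D_fourier:
  assumes "u \<in> D_space \<gamma>" "\<gamma> \<ge> 0"
  shows "is_D_fourier \<gamma> u (D_fourier \<gamma> u)"
proof -
  obtain \<phi> where "D_approx \<gamma> \<phi> u" using assms(1) by (auto simp: D_space_def)
  moreover from D_approx_fourier_limit[OF this assms(2)] obtain g where
    "g \<in> borel_measurable borel" "(\<lambda>n. weighted_sq \<gamma> (\<lambda>\<xi>. fourier (\<phi> n) \<xi> - g \<xi>)) \<longlonglongrightarrow> 0" by blast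
  ultimately have "is_D_fourier \<gamma> u g"
    unfolding is_D_fourier_def weighted_sq_def nn_integral_completion
    by (auto intro!: measurable_completion)
  then show ?thesis unfolding D_fourier_def using someI[of "is_D_fourier \<gamma> u" g] by simp
qed

lemma D_fourier_measurable:
  "u \<in> D_space \<gamma> \<Longrightarrow> \<gamma> \<ge> 0 \<Longrightarrow> D_fourier \<gamma> u \<in> borel_measurable lebesgue"
  using is_D_fourier_D_fourier[of u \<gamma>] by (simp add: is_D_fourier_def)

text \<open>One and the same sequence converges to u in the Sobolev exponent and has transforms
  converging to g: this is the link between u and its transform.\<close>

lemma D_fourier_approx:
  assumes u: "u \<in> D_space \<gamma>" and \<gamma>: "\<gamma> \<ge> 0"
  obtains \<phi> g where "D_approx \<gamma> \<phi> u" "g \<in> borel_measurable borel" "AE \<xi> in lborel. D_fourier \<gamma> u \<xi> = g \<xi>"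
    "(\<lambda>n. weighted_sq \<gamma> (\<lambda>\<xi>. fourier (\<phi> n) \<xi> - g \<xi>)) \<longlonglongrightarrow> 0"
proof -
  from is_D_fourier_D_fourier[OF u \<gamma>] obtain \<psi> where \<psi>: "D_fourier \<gamma> u \<in> borel_measurable lebesgue" "D_approx \<gamma> \<psi> u"
    "(\<lambda>n. weighted_sq \<gamma> (\<lambda>\<xi>. fourier (\<psi> n) \<xi> - D_fourier \<gamma> u \<xi>)) \<longlonglongrightarrow> 0"
    unfolding is_D_fourier_def weighted_sq_def nn_integral_completion by auto
  obtain g' where g': "g' \<in> borel_measurable borel" "AE \<xi> in lborel. D_fourier \<gamma> u \<xi> = g' \<xi>"
    using borel_version_complex[OF \<psi>(1)] by blast
  have "weighted_sq \<gamma> (\<lambda>\<xi>. fourier (\<psi> n) \<xi> - D_fourier \<gamma> u \<xi>) = weighted_sq \<gamma> (\<lambda>\<xi>. fourier (\<psi> n) \<xi> - g' \<xi>)" for n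
    unfolding weighted_sq_def using g'(2) by (intro nn_integral_cong_AE) auto
  then show ?thesis using that[OF \<psi>(2) g'] \<psi>(3) by simp
qed

section \<open>Exchange of integrals and the multiplication formula\<close>

lemma borel_measurable_pair_continuous:
  fixes k :: "'a::euclidean_space \<times> 'b::euclidean_space \<Rightarrow> 'c::topological_space"
  assumes "continuous_on UNIV k"
  shows "k \<in> borel_measurable (lborel \<Otimes>\<^sub>M lborel)"
  unfolding lborel_prod using borel_measurable_continuous_onI[OF assms] by simp

lemma integrable_pair_mult:
  fixes f :: "'a::euclidean_space \<Rightarrow> complex" and g :: "'b::euclidean_space \<Rightarrow> complex"
  assumes f: "integrable lborel f" and g: "integrable lborel g"
  shows "integrable (lborel \<Otimes>\<^sub>M lborel) (\<lambda>p. f (fst p) * g (snd p))"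
proof -
  note [measurable] = borel_measurable_integrable[OF f] borel_measurable_integrable[OF g]
  show ?thesis
  proof (rule lborel_pair.Fubini_integrable)
    show "integrable lborel (\<lambda>x. LINT y|lborel. norm (f (fst (x, y)) * g (snd (x, y))))"
      using f by (simp add: norm_mult)
    show "AE x in lborel. integrable lborel (\<lambda>y. f (fst (x, y)) * g (snd (x, y)))"
      using g by simp
  qed measurable
qed

lemma Fubini_kernel:
  fixes f :: "'a::euclidean_space \<Rightarrow> complex" and g :: "'b::euclidean_space \<Rightarrow> complex"
  assumes f: "integrable lborel f" and g: "integrable lborel g"
    and k: "(\<lambda>p. k (fst p) (snd p)) \<in> borel_measurable (lborel \<Otimes>\<^sub>M lborel)" "\<And>x y. cmod (k x y) \<le> B"
  shows "(LINT y|lborel. (LINT x|lborel. k x y * f x) * g y) = (LINT x|lborel. f x * (LINT y|lborel. k x y * g y))"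
proof -
  note [measurable] = borel_measurable_integrable[OF f] borel_measurable_integrable[OF g] k(1)
  have B: "B \<ge> 0" using k(2) norm_ge_zero order_trans by blast
  have "integrable (lborel \<Otimes>\<^sub>M lborel) (\<lambda>p. k (fst p) (snd p) * f (fst p) * g (snd p))"
  proof (rule Bochner_Integration.integrable_bound)
    show "integrable (lborel \<Otimes>\<^sub>M lborel) (\<lambda>p. of_real B * (f (fst p) * g (snd p)))"
      by (intro integrable_mult_right integrable_pair_mult f g)
    show "AE p in lborel \<Otimes>\<^sub>M lborel. norm (k (fst p) (snd p) * f (fst p) * g (snd p)) \<le> norm (of_real B * (f (fst p) * g (snd p)))"
      using k(2) B by (auto simp: norm_mult mult.assoc intro!: mult_right_mono)
  qed measurable
  then have "integrable (lborel \<Otimes>\<^sub>M lborel) (case_prod (\<lambda>x y. k x y * f x * g y))"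
    by (simp add: case_prod_beta')
  from lborel_pair.Fubini_integral[OF this]
  have "(LINT y|lborel. (LINT x|lborel. k x y * f x * g y)) = (LINT x|lborel. (LINT y|lborel. k x y * f x * g y))" .
  also have "(\<lambda>x. LINT y|lborel. k x y * f x * g y) = (\<lambda>x. f x * (LINT y|lborel. k x y * g y))"
    by (subst integral_mult_right_zero[symmetric]) (simp add: mult_ac)
  finally show ?thesis by simp
qed

text \<open>The multiplication formula: both sides are the double integral of f and g against the
  symmetric kernel exp (-i x . xi).\<close>

lemma ft_swap:
  fixes f g :: "'a::euclidean_space \<Rightarrow> complex"
  assumes f: "integrable lborel f" and g: "integrable lborel g"
  shows "(LINT \<xi>|lborel. ft f (- \<xi>) * g \<xi>) = (LINT x|lborel. f x * ft g (- x))"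
proof -
  have "(LINT \<xi>|lborel. (LINT x|lborel. exp (\<i> * complex_of_real (x \<bullet> - \<xi>)) * f x) * g \<xi>)
    = (LINT x|lborel. f x * (LINT \<xi>|lborel. exp (\<i> * complex_of_real (x \<bullet> - \<xi>)) * g \<xi>))"
    by (rule Fubini_kernel[OF f g, where B=1])
       (auto intro!: borel_measurable_pair_continuous continuous_intros)
  then show ?thesis by (simp add: ft_def inner_commute)
qed

lemma weighted_sq_bounded_support:
  fixes \<gamma> :: real and r :: "'a::euclidean_space \<Rightarrow> complex"
  assumes [measurable]: "r \<in> borel_measurable borel"
    and B: "\<And>x. cmod (r x) \<le> B" and R: "\<And>x. norm x > R \<Longrightarrow> r x = 0"
    and \<gamma>: "0 < \<gamma>" "2 * \<gamma> < DIM('a)"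
  shows "weighted_sq (- \<gamma>) r < \<infinity>"
proof -
  \<comment> \<open>On the ball of radius R the squared function is dominated by a multiple of exp
    (-|x|^2), which reduces the singular weight at 0 to the Gaussian integral already known to be
    finite.\<close>
  define C where "C = B\<^sup>2 * exp (R\<^sup>2)"
  have C: "C \<ge> 0" by (simp add: C_def)
  have "weighted_sq (- \<gamma>) r \<le> (\<integral>\<^sup>+x. ennreal C * ennreal (norm (x::'a) powr (- (2 * \<gamma>)) * exp (- 1 * (norm x)\<^sup>2)) \<partial>lborel)"
    unfolding weighted_sq_def
  proof (rule nn_integral_mono)
    fix x :: 'a
    have "(cmod (r x))\<^sup>2 \<le> C * exp (- (norm x)\<^sup>2)"
    proof (cases "norm x > R")
      case False
      then have "1 \<le> exp (R\<^sup>2) * exp (- (norm x)\<^sup>2)"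
        by (simp add: exp_add[symmetric] power_mono)
      then have "B\<^sup>2 * 1 \<le> B\<^sup>2 * (exp (R\<^sup>2) * exp (- (norm x)\<^sup>2))" by (intro mult_left_mono) auto
      moreover have "(cmod (r x))\<^sup>2 \<le> B\<^sup>2" by (intro power_mono B) auto
      ultimately show ?thesis by (simp add: C_def)
    qed (use R C in auto)
    then have "norm x powr (- (2 * \<gamma>)) * (cmod (r x))\<^sup>2 \<le> norm x powr (- (2 * \<gamma>)) * (C * exp (- (norm x)\<^sup>2))"
      by (intro mult_left_mono) auto
    then show "ennreal (norm x powr (2 * - \<gamma>) * (cmod (r x))\<^sup>2) \<le> ennreal C * ennreal (norm x powr (- (2 * \<gamma>)) * exp (- 1 * (norm x)\<^sup>2))"
      using C by (simp add: ennreal_mult[symmetric] mult_ac ennreal_leI)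
  qed
  also have "\<dots> = ennreal C * (\<integral>\<^sup>+x. ennreal (norm (x::'a) powr (- (2 * \<gamma>)) * exp (- 1 * (norm x)\<^sup>2)) \<partial>lborel)"
    by (rule nn_integral_cmult) auto
  also have "\<dots> < \<infinity>"
    using nn_integral_norm_powr_gaussian_finite[of "2 * \<gamma>" 1, where 'a='a] \<gamma>
    by (simp add: ennreal_mult_less_top)
  finally show ?thesis .
qed

section \<open>Functions annihilated by all test functions\<close>

text \<open>Lebesgue differentiation: off a negligible set, h x is the limit of the averages over
  the cubes \<open>cbox x (x + r *\<^sub>R One)\<close>, all of which are 0.\<close>

lemma box_integrals_0_imp_AE_0:
  fixes h :: "'a::euclidean_space \<Rightarrow> complex"
  assumes h: "\<And>a b. set_integrable lborel (cbox a b) h"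
    and 0: "\<And>a b. (LINT x:cbox a b|lborel. h x) = 0"
  shows "AE x in lborel. h x = 0"
proof -
  have int: "h integrable_on cbox a b" "integral (cbox a b) h = 0" for a b
    using set_borel_integral_eq_integral[OF h[of a b]] 0[of a b] by auto
  obtain N where N: "negligible N" "\<And>x e. \<lbrakk>x \<notin> N; 0 < e\<rbrakk> \<Longrightarrow>
     \<exists>d>0. \<forall>r. 0 < r \<and> r < d \<longrightarrow> norm (integral (cbox x (x + r *\<^sub>R One)) h /\<^sub>R r ^ DIM('a) - h x) < e"
    using integrable_ccontinuous_explicit[OF int(1)] by metis
  have "h x = 0" if xN: "x \<notin> N" for x
  proof (rule ccontr)
    assume "h x \<noteq> 0"
    then have "\<exists>d>0. \<forall>r::real. 0 < r \<longrightarrow> r < d \<longrightarrow> False"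
      using N(2)[OF xN, of "norm (h x)"] by (simp add: int(2))
    then obtain d :: real where "d > 0" "\<forall>r. 0 < r \<longrightarrow> r < d \<longrightarrow> False" by blast
    then show False using dense[of 0 d] by auto
  qed
  then have "AE x in lebesgue. h x = 0"
    using N(1) unfolding negligible_iff_null_sets by (auto intro: AE_I')
  then show ?thesis by (simp add: AE_completion_iff)
qed

text \<open>(x - a) (b - x) is positive exactly inside the interval, so a large factor k pushes the
  argument of \<open>step\<close> below 0 there, while elsewhere it stays at least 1.\<close>

lemma step_box_tendsto:
  assumes "a \<le> b"
  shows "(\<lambda>k. step (1 - real k * ((x - a) * (b - x)))) \<longlonglongrightarrow> indicator {a<..<b} x"
proof (cases "a < x \<and> x < b")
  case True
  define y where "y = (x - a) * (b - x)"
  have y: "y > 0" using True by (simp add: y_def)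
  obtain K :: nat where K: "1 / y \<le> real K" using real_arch_simple by blast
  have "step (1 - real k * y) = 1" if "k \<ge> K" for k
  proof (rule step_eq_1)
    have "1 / y \<le> real k" using K that by linarith
    then show "1 - real k * y \<le> 0" using y by (simp add: field_simps)
  qed
  then have "(\<lambda>k. step (1 - real k * y)) \<longlonglongrightarrow> 1"
    by (intro tendsto_eventually) (auto simp: eventually_sequentially)
  then show ?thesis using True by (simp add: y_def)
next
  case False
  then have "(x - a) * (b - x) \<le> 0" using assms by (auto simp: mult_le_0_iff)
  then have "step (1 - real k * ((x - a) * (b - x))) = 0" for k
    by (intro step_eq_0) (simp add: mult_nonneg_nonpos)
  then show ?thesis using False by simp
qed

lemma box_test_functions:
  fixes a b :: "'a::euclidean_space"
  assumes ab: "\<And>i. i \<in> Basis \<Longrightarrow> a \<bullet> i \<le> b \<bullet> i"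
  obtains \<eta> where "\<And>k::nat. \<eta> k \<in> test_functions UNIV" "\<And>k x. \<bar>\<eta> k x\<bar> \<le> indicator (cbox a b) x"
    "\<And>x. (\<lambda>k. \<eta> k x) \<longlonglongrightarrow> indicator (box a b) x"
proof -
  define s where "s k i x = step (1 - real k * ((x - a \<bullet> i) * (b \<bullet> i - x)))" for k and i :: 'a and x
  define \<eta> where "\<eta> k x = (\<Prod>i\<in>Basis. s k i (x \<bullet> i))" for k and x :: 'a
  have s0: "s k i x = 0" if "i \<in> Basis" "x \<notin> {a \<bullet> i..b \<bullet> i}" for k i x
  proof -
    have "(x - a \<bullet> i) * (b \<bullet> i - x) \<le> 0" using that ab[OF that(1)] by (auto simp: mult_le_0_iff)
    then show ?thesis unfolding s_def by (intro step_eq_0) (simp add: mult_nonneg_nonpos)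
  qed
  have "(\<lambda>x. Re (\<Prod>i\<in>Basis. complex_of_real (s k i (x \<bullet> i)))) \<in> test_functions UNIV" for k
  proof (rule Re_prod_test_function[of _ a b])
    show "Ck_real m (\<lambda>x. complex_of_real (s k i x))" for m i
      unfolding s_def
      by (intro Ck_real_of_real Ck_real_compose[OF Ck_real_step] Ck_real_diff Ck_real_const Ck_real_mult Ck_real_ident)
  qed (use s0 in auto)
  moreover have "(\<lambda>x. Re (\<Prod>i\<in>Basis. complex_of_real (s k i (x \<bullet> i)))) = \<eta> k" for k
    by (simp add: \<eta>_def fun_eq_iff flip: of_real_prod)
  ultimately have 1: "\<eta> k \<in> test_functions UNIV" for k by simp
  have 2: "\<bar>\<eta> k x\<bar> \<le> indicator (cbox a b) x" for k x
  proof (cases "x \<in> cbox a b")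
    case True
    have "\<eta> k x \<le> (\<Prod>i\<in>(Basis::'a set). 1)" "\<eta> k x \<ge> 0"
      unfolding \<eta>_def s_def by (intro prod_mono prod_nonneg conjI step_nonneg step_le_1)+
    then show ?thesis using True by simp
  next
    case False
    then obtain i where "i \<in> Basis" "x \<bullet> i \<notin> {a \<bullet> i..b \<bullet> i}" by (auto simp: mem_box)
    then have "\<exists>i\<in>Basis. s k i (x \<bullet> i) = 0" using s0 by blast
    then have "\<eta> k x = 0" unfolding \<eta>_def by (intro prod_zero) auto
    then show ?thesis by simp
  qed
  have 3: "(\<lambda>k. \<eta> k x) \<longlonglongrightarrow> indicator (box a b) x" for x
  proof -
    have "(\<lambda>k. \<eta> k x) \<longlonglongrightarrow> (\<Prod>i\<in>Basis. indicator {a \<bullet> i<..<b \<bullet> i} (x \<bullet> i))"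
      unfolding \<eta>_def s_def by (intro tendsto_prod step_box_tendsto ab)
    also have "(\<Prod>i\<in>Basis. indicator {a \<bullet> i<..<b \<bullet> i} (x \<bullet> i)) = (indicator (box a b) x :: real)"
    proof (cases "x \<in> box a b")
      case False
      then obtain i where "i \<in> Basis" "x \<bullet> i \<notin> {a \<bullet> i<..<b \<bullet> i}" by (auto simp: mem_box)
      then have "\<exists>i\<in>Basis. indicator {a \<bullet> i<..<b \<bullet> i} (x \<bullet> i) = (0::real)" by force
      then have "(\<Prod>i\<in>Basis. indicator {a \<bullet> i<..<b \<bullet> i} (x \<bullet> i)) = (0::real)" by (intro prod_zero) auto
      then show ?thesis using False by simp
    qed (auto simp: mem_box intro!: prod.neutral)
    finally show ?thesis .
  qed
  show ?thesis using that[of \<eta>, OF 1 2 3] .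
qed

text \<open>The tests are confined to those dominated by the indicator of the box, which later
  permits a local version. The cut-offs converge to the indicator of the open box; the boundary does
  not affect the integral.\<close>

lemma test_integrals_0_imp_cbox_integral_0:
  fixes h :: "'a::euclidean_space \<Rightarrow> complex"
  assumes hm: "h \<in> borel_measurable borel"
    and h: "set_integrable lborel (cbox a b) h"
    and 0: "\<And>\<eta>. \<eta> \<in> test_functions UNIV \<Longrightarrow> (\<And>x. \<bar>\<eta> x\<bar> \<le> indicator (cbox a b) x) \<Longrightarrow> (LINT x|lborel. h x * complex_of_real (\<eta> x)) = 0"
  shows "(LINT x:cbox a b|lborel. h x) = 0"
proof (cases "\<forall>i\<in>Basis. a \<bullet> i \<le> b \<bullet> i")
  note [measurable] = hm
  case True
  obtain \<eta> where \<eta>: "\<And>k::nat. \<eta> k \<in> test_functions UNIV" "\<And>k x. \<bar>\<eta> k x\<bar> \<le> indicator (cbox a b) x"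
    "\<And>x. (\<lambda>k. \<eta> k x) \<longlonglongrightarrow> indicator (box a b) x"
    using box_test_functions[of a b] True by blast
  note [measurable] = test_function_measurable[OF \<eta>(1)]
  have ib: "set_integrable lborel (box a b) h"
    by (rule set_integrable_subset[OF h]) (auto simp: box_subset_cbox)
  have "(\<lambda>k. LINT x|lborel. h x * complex_of_real (\<eta> k x)) \<longlonglongrightarrow> (LINT x|lborel. h x * complex_of_real (indicator (box a b) x))"
  proof (rule integral_dominated_convergence[where w="\<lambda>x. cmod (indicator (cbox a b) x *\<^sub>R h x)"])
    show "integrable lborel (\<lambda>x. cmod (indicator (cbox a b) x *\<^sub>R h x))"
      by (rule integrable_norm[OF h[unfolded set_integrable_def]])
    show "AE x in lborel. (\<lambda>k. h x * complex_of_real (\<eta> k x)) \<longlonglongrightarrow> h x * complex_of_real (indicator (box a b) x)"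
      by (intro AE_I2 tendsto_intros \<eta>)
    show "AE x in lborel. norm (h x * complex_of_real (\<eta> k x)) \<le> cmod (indicator (cbox a b) x *\<^sub>R h x)" for k
      using mult_left_mono[OF \<eta>(2)] by (intro AE_I2) (simp add: norm_mult mult.commute)
  qed measurable
  then have "(LINT x|lborel. h x * complex_of_real (indicator (box a b) x)) = 0"
    by (simp add: 0[OF \<eta>(1,2)] LIMSEQ_const_iff)
  then have "(LINT x:box a b|lborel. h x) = 0"
    by (simp add: set_lebesgue_integral_def scaleR_conv_of_real mult.commute)
  then have "integral (box a b) h = 0" using set_borel_integral_eq_integral[OF ib] by simp
  then show ?thesis using set_borel_integral_eq_integral[OF h] by (simp add: integral_open_interval)
next
  case False
  then have "cbox a b = {}" by (force simp: box_eq_empty)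
  then show ?thesis by (simp add: set_lebesgue_integral_def)
qed

lemma test_integrals_0_imp_AE_0:
  fixes h :: "'a::euclidean_space \<Rightarrow> complex"
  assumes hm: "h \<in> borel_measurable borel"
    and h: "\<And>a b. set_integrable lborel (cbox a b) h"
    and 0: "\<And>\<eta>. \<eta> \<in> test_functions UNIV \<Longrightarrow> (LINT x|lborel. h x * complex_of_real (\<eta> x)) = 0"
  shows "AE x in lborel. h x = 0"
  by (rule box_integrals_0_imp_AE_0[OF h test_integrals_0_imp_cbox_integral_0[OF hm h 0]])

section \<open>The two transforms of a test function agree\<close>

lemma D_approx_Lp:
  fixes u :: "'a::euclidean_space \<Rightarrow> real"
  assumes "D_approx \<gamma> \<phi> u" "AE x in lborel. u x = v x"
  shows "(\<lambda>n. \<integral>\<^sup>+x. ennreal (\<bar>\<phi> n x - v x\<bar> powr (2 * real DIM('a) / (real DIM('a) - 2 * \<gamma>))) \<partial>lborel) \<longlonglongrightarrow> 0"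
proof -
  have "(\<integral>\<^sup>+x. ennreal (\<bar>\<phi> n x - v x\<bar> powr (2 * real DIM('a) / (real DIM('a) - 2 * \<gamma>))) \<partial>lborel)
    = (\<integral>\<^sup>+x. ennreal (\<bar>\<phi> n x - u x\<bar> powr (2 * real DIM('a) / (real DIM('a) - 2 * \<gamma>))) \<partial>lebesgue)" for n
    unfolding nn_integral_completion using assms(2) by (intro nn_integral_cong_AE) auto
  then show ?thesis using assms(1) by (simp add: D_approx_def)
qed

lemma Sobolev_exponent_gt_1:
  fixes N \<gamma> :: real
  shows "0 < \<gamma> \<Longrightarrow> 2 * \<gamma> < N \<Longrightarrow> 2 * N / (N - 2 * \<gamma>) > 1"
  by (simp add: field_simps)

lemma integrable_fourier_test:
  fixes \<phi> :: "'a::euclidean_space \<Rightarrow> real"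
  assumes "\<phi> \<in> test_functions \<Omega>"
  shows "integrable lborel (fourier \<phi>)"
proof -
  note [measurable] = fourier_test_measurable[OF assms]
  obtain C where C: "C \<ge> 0" "\<And>\<xi>. (1 + (norm \<xi>)\<^sup>2) ^ DIM('a) * cmod (fourier \<phi> \<xi>) \<le> C"
    using fourier_test_decay[OF assms] by blast
  show ?thesis
  proof (rule Bochner_Integration.integrable_bound)
    show "integrable lborel (\<lambda>\<xi>::'a. C * inverse ((1 + (norm \<xi>)\<^sup>2) ^ DIM('a)))"
      by (intro integrable_mult_right integrable_inverse_norm_power)
    have "cmod (fourier \<phi> \<xi>) \<le> C * inverse ((1 + (norm \<xi>)\<^sup>2) ^ DIM('a))" for \<xi>
    proof -
      have "(1 + (norm \<xi>)\<^sup>2) ^ DIM('a) > 0" by (intro zero_less_power add_pos_nonneg) auto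
      then show ?thesis using C(2)[of \<xi>] by (simp add: field_simps)
    qed
    then show "AE \<xi> in lborel. norm (fourier \<phi> \<xi>) \<le> norm (C * inverse ((1 + (norm \<xi>)\<^sup>2) ^ DIM('a)))"
      using C(1) by (intro AE_I2) auto
  qed measurable
qed

text \<open>The sequence behind \<open>D_fourier\<close> need not be the constant one. Its
  differences \<open>\<psi> n\<close> to \<phi> tend to 0 in L^p, while their transforms tend to
  \<open>h\<close> in the weighted L2 space. Against a test function the multiplication formula
  moves the transform to the other side, where convergence in L^p forces the limit 0; hence
  \<open>h\<close> vanishes.\<close>

lemma D_fourier_test:
  fixes \<gamma> :: real and \<phi> :: "'a::euclidean_space \<Rightarrow> real"
  assumes \<phi>: "\<phi> \<in> test_functions \<Omega>" and \<gamma>: "0 < \<gamma>" "2 * \<gamma> < DIM('a)"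
  shows "AE \<xi> in lborel. D_fourier \<gamma> \<phi> \<xi> = fourier \<phi> \<xi>"
proof -
  define p where "p = 2 * real DIM('a) / (real DIM('a) - 2 * \<gamma>)"
  have p: "p > 1" unfolding p_def using \<gamma> by (intro Sobolev_exponent_gt_1) auto
  note \<phi>U = test_functions_UNIV[OF \<phi>]
  have [measurable]: "\<phi> \<in> borel_measurable borel" by (rule test_function_measurable[OF \<phi>])
  have fm[measurable]: "fourier \<phi> \<in> borel_measurable borel" by (rule fourier_test_measurable[OF \<phi>])
  note uD = test_function_in_D_space[OF \<phi>]
  obtain \<phi>n g where D: "D_approx \<gamma> \<phi>n \<phi>" and gm[measurable]: "g \<in> borel_measurable borel"
    and g: "AE \<xi> in lborel. D_fourier \<gamma> \<phi> \<xi> = g \<xi>"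
      "(\<lambda>n. weighted_sq \<gamma> (\<lambda>\<xi>. fourier (\<phi>n n) \<xi> - g \<xi>)) \<longlonglongrightarrow> 0"
    using D_fourier_approx[OF uD less_imp_le[OF \<gamma>(1)]] by blast
  have \<phi>n: "\<phi>n n \<in> test_functions UNIV" for n using D by (simp add: D_approx_def)
  define \<psi> where "\<psi> n x = \<phi>n n x - \<phi> x" for n x
  have \<psi>: "\<psi> n \<in> test_functions UNIV" for n
    unfolding \<psi>_def[abs_def] by (intro test_functions_diff \<phi>n \<phi>U)
  have [measurable]: "\<psi> n \<in> borel_measurable borel" for n by (rule test_function_measurable[OF \<psi>])
  have [measurable]: "fourier (\<psi> n) \<in> borel_measurable borel" for n by (rule fourier_test_measurable[OF \<psi>])
  define h where "h \<xi> = g \<xi> - fourier \<phi> \<xi>" for \<xi>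
  have hm[measurable]: "h \<in> borel_measurable borel" unfolding h_def[abs_def] by measurable
  have "fourier (\<psi> n) \<xi> = fourier (\<phi>n n) \<xi> - fourier \<phi> \<xi>" for n \<xi>
    unfolding \<psi>_def[abs_def] by (rule fourier_test_diff[OF \<phi>n \<phi>U])
  then have lim: "(\<lambda>n. weighted_sq \<gamma> (\<lambda>\<xi>. fourier (\<psi> n) \<xi> - h \<xi>)) \<longlonglongrightarrow> 0"
    using g(2) by (simp add: h_def)
  have hfin: "weighted_sq \<gamma> h < \<infinity>"
  proof (rule weighted_sq_limit_finite[OF _ hm _ lim])
    show "weighted_sq \<gamma> (fourier (\<psi> n)) < \<infinity>" for n
      using weighted_sq_test[OF \<psi>, of \<gamma>] \<gamma> by simp
  qed measurable
  have "AE \<xi> in lborel. h \<xi> = 0"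
  proof (rule test_integrals_0_imp_AE_0[OF hm])
    fix a b :: 'a
    obtain R where R: "\<And>x. x \<in> cbox a b \<Longrightarrow> norm x \<le> R"
      using bounded_cbox[of a b] by (auto simp: bounded_iff)
    have "weighted_sq (- \<gamma>) (\<lambda>x. indicator (cbox a b) x) < \<infinity>"
      by (rule weighted_sq_bounded_support[where B=1 and R=R])
         (use R \<gamma> in \<open>auto simp: indicator_def not_le[symmetric]\<close>)
    from weighted_L1_finite[OF hm _ hfin this]
    have "(\<integral>\<^sup>+\<xi>. ennreal (cmod (indicator (cbox a b) \<xi> *\<^sub>R h \<xi>)) \<partial>lborel) < \<infinity>"
      by (rule order.strict_trans1[rotated]) (auto intro!: nn_integral_mono simp: indicator_def)
    then show "set_integrable lborel (cbox a b) h"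
      unfolding set_integrable_def by (intro integrableI_bounded) measurable
  next
    fix \<eta> :: "'a \<Rightarrow> real" assume \<eta>: "\<eta> \<in> test_functions UNIV"
    note [measurable] = test_function_measurable[OF \<eta>]
    define c where "c = complex_of_real ((2 * pi) powr (- real DIM('a) / 2))"
    define e where "e x = complex_of_real (\<eta> x)" for x
    have e: "integrable lborel e" using test_function_integrable[OF \<eta>] by (simp add: e_def[abs_def])
    have em[measurable]: "e \<in> borel_measurable borel" using e by auto
    obtain B R where B: "\<And>x. \<bar>\<eta> x\<bar> \<le> B" "\<And>x. norm x > R \<Longrightarrow> \<eta> x = 0"
      using test_function_bounded[OF \<eta>] by metis
    have efin: "weighted_sq (- \<gamma>) e < \<infinity>"
      by (rule weighted_sq_bounded_support[where B=B and R=R]) (use B \<gamma> in \<open>auto simp: e_def\<close>)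
    have fe: "integrable lborel (\<lambda>\<xi>. fourier (\<psi> n) \<xi> * e \<xi>)" for n
    proof (rule Bochner_Integration.integrable_bound[OF integrable_mult_right[OF integrable_fourier_test[OF \<psi>], of "of_real B"]])
      show "AE \<xi> in lborel. cmod (fourier (\<psi> n) \<xi> * e \<xi>) \<le> cmod (complex_of_real B * fourier (\<psi> n) \<xi>)"
        using B(1) order_trans[OF abs_ge_zero B(1)]
        by (intro AE_I2) (auto simp: norm_mult e_def mult.commute intro!: mult_right_mono)
    qed measurable
    have he: "integrable lborel (\<lambda>\<xi>. h \<xi> * e \<xi>)"
      using weighted_L1_finite[OF hm em hfin efin] by (intro integrableI_bounded) (auto simp: norm_mult)
    have "(\<lambda>n. LINT \<xi>|lborel. fourier (\<psi> n) \<xi> * e \<xi>) \<longlonglongrightarrow> (LINT \<xi>|lborel. h \<xi> * e \<xi>)"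
    proof (rule tendsto_L1_int[OF fe he])
      have "(\<lambda>n. \<integral>\<^sup>+\<xi>. ennreal (cmod (fourier (\<psi> n) \<xi> - h \<xi>) * cmod (e \<xi>)) \<partial>lborel) \<longlonglongrightarrow> 0"
        by (rule weighted_L1_tendsto_0[OF _ em lim efin]) measurable
      then show "(\<lambda>n. \<integral>\<^sup>+\<xi>. ennreal (cmod (fourier (\<psi> n) \<xi> * e \<xi> - h \<xi> * e \<xi>)) \<partial>lborel) \<longlonglongrightarrow> 0"
        by (simp add: norm_mult left_diff_distrib[symmetric])
    qed
    moreover have "(\<lambda>n. LINT \<xi>|lborel. fourier (\<psi> n) \<xi> * e \<xi>) \<longlonglongrightarrow> 0"
    proof -
      \<comment> \<open>Here \<open>\<eta>\<close> is a function of frequency; its own transform is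
        bounded and integrable, which is what the pairing with a null sequence in L^p
        requires.\<close>
      have swap: "(LINT \<xi>|lborel. fourier (\<psi> n) \<xi> * e \<xi>) = (LINT x|lborel. of_real (\<psi> n x) * fourier \<eta> x)" for n
      proof -
        have i: "integrable lborel (\<lambda>x. complex_of_real (\<psi> n x))" using test_function_integrable[OF \<psi>] by simp
        have "(LINT \<xi>|lborel. fourier (\<psi> n) \<xi> * e \<xi>) = c * (LINT \<xi>|lborel. ft (\<lambda>x. of_real (\<psi> n x)) (- \<xi>) * e \<xi>)"
          by (simp add: fourier_eq_ft c_def mult.assoc)
        also have "\<dots> = c * (LINT x|lborel. of_real (\<psi> n x) * ft e (- x))"
          by (simp add: ft_swap[OF i e])
        also have "\<dots> = (LINT x|lborel. of_real (\<psi> n x) * fourier \<eta> x)"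
          by (subst integral_mult_right_zero[symmetric]) (simp add: fourier_eq_ft c_def e_def[abs_def] mult_ac)
        finally show ?thesis .
      qed
      obtain C where C: "\<And>\<xi>. (1 + (norm \<xi>)\<^sup>2) ^ 0 * cmod (fourier \<eta> \<xi>) \<le> C"
        using fourier_test_decay[OF \<eta>] by metis
      have [measurable]: "fourier \<eta> \<in> borel_measurable borel" by (rule fourier_test_measurable[OF \<eta>])
      have fin: "(\<integral>\<^sup>+x. ennreal (cmod (fourier \<eta> x)) \<partial>lborel) < \<infinity>"
        using integrable_fourier_test[OF \<eta>] by (simp add: integrable_iff_bounded)
      have lp: "(\<lambda>n. \<integral>\<^sup>+x. ennreal (\<bar>\<psi> n x\<bar> powr p) \<partial>lborel) \<longlonglongrightarrow> 0"
        using D_approx_Lp[OF D, of \<phi>] by (simp add: \<psi>_def p_def)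
      have "(\<lambda>n. \<integral>\<^sup>+x. ennreal (\<bar>\<psi> n x\<bar> * cmod (fourier \<eta> x)) \<partial>lborel) \<longlonglongrightarrow> 0"
        by (rule Lp_L1_tendsto_0[OF _ _ _ _ p fin lp, where B=C]) (use C in auto)
      have "(\<lambda>n. LINT x|lborel. of_real (\<psi> n x) * fourier \<eta> x) \<longlonglongrightarrow> (LINT x::'a|lborel. (0::complex))"
      proof (rule tendsto_L1_int)
        show "(\<lambda>n. \<integral>\<^sup>+x. ennreal (cmod (of_real (\<psi> n x) * fourier \<eta> x - 0)) \<partial>lborel) \<longlonglongrightarrow> 0"
          using \<open>(\<lambda>n. \<integral>\<^sup>+x. ennreal (\<bar>\<psi> n x\<bar> * cmod (fourier \<eta> x)) \<partial>lborel) \<longlonglongrightarrow> 0\<close> by (simp add: norm_mult)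
        show "integrable lborel (\<lambda>x. of_real (\<psi> n x) * fourier \<eta> x)" for n
        proof -
          obtain B' where B': "\<And>x. \<bar>\<psi> n x\<bar> \<le> B'" using test_function_bounded[OF \<psi>] by metis
          show ?thesis
            by (rule Bochner_Integration.integrable_bound[OF integrable_mult_right[OF integrable_fourier_test[OF \<eta>], of "of_real B'"]])
               (use B' order_trans[OF abs_ge_zero B'] in \<open>auto simp: norm_mult intro!: mult_right_mono\<close>)
        qed
      qed simp
      then show ?thesis by (simp add: swap)
    qed
    ultimately show "(LINT \<xi>|lborel. h \<xi> * complex_of_real (\<eta> \<xi>)) = 0"
      unfolding e_def by (rule LIMSEQ_unique)
  qed
  with g(1) show ?thesis by eventually_elim (simp add: h_def)
qed

subsection \<open>Fourier transforms of truncated Gaussians\<close>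

text \<open>The derivative of exp (i x xi) v x integrates to 0 over the line because v vanishes at
  both ends.\<close>

lemma ft_vector_derivative:
  fixes v :: "real \<Rightarrow> complex"
  assumes d: "\<And>x. (v has_vector_derivative v' x) (at x)" and c: "continuous_on UNIV v'"
    and i: "integrable lborel v" "integrable lborel v'"
    and l: "(v \<longlongrightarrow> 0) at_top" "(v \<longlongrightarrow> 0) at_bot"
  shows "ft v' \<xi> = - \<i> * of_real \<xi> * ft v \<xi>"
proof -
  define E where "E x = exp (\<i> * complex_of_real (x * \<xi>))" for x
  define f where "f x = E x * v' x + (\<i> * of_real \<xi> * E x) * v x" for x
  have cv: "continuous_on UNIV v"
    using d by (auto intro!: continuous_at_imp_continuous_on intro: has_vector_derivative_continuous)
  have E: "(E has_vector_derivative \<i> * of_real \<xi> * E x) (at x)" for x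
  proof -
    have "((\<lambda>z. exp (\<i> * (z * of_real \<xi>))) has_field_derivative \<i> * of_real \<xi> * exp (\<i> * (of_real x * of_real \<xi>))) (at (of_real x))"
      by (auto intro!: derivative_eq_intros)
    from has_vector_derivative_real_field[OF this] show ?thesis by (simp add: E_def[abs_def])
  qed
  have F: "((\<lambda>x. E x * v x) has_vector_derivative f x) (at x)" for x
    unfolding f_def by (rule has_vector_derivative_mult[OF E d])
  have cE: "continuous_on UNIV E" unfolding E_def by (intro continuous_intros)
  have cf: "isCont f x" for x
  proof -
    have "continuous_on UNIV f" unfolding f_def by (intro continuous_intros cE c cv)
    then show ?thesis by (simp add: continuous_on_eq_continuous_at)
  qed
  have i1: "integrable lborel (\<lambda>x. E x * v x)" "integrable lborel (\<lambda>x. E x * v' x)"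
    using integrable_exp_mult[OF i(1), of \<xi>] integrable_exp_mult[OF i(2), of \<xi>] by (simp_all add: E_def)
  then have fi: "integrable lborel f" unfolding f_def by (simp add: mult.assoc)
  have nE: "cmod (E x) = 1" for x by (simp add: E_def)
  have l': "((\<lambda>x. E x * v x) \<longlongrightarrow> 0) at_top" "((\<lambda>x. E x * v x) \<longlongrightarrow> 0) at_bot"
    using tendsto_norm_zero[OF l(1)] tendsto_norm_zero[OF l(2)]
    by (intro tendsto_norm_zero_cancel[of "\<lambda>x. E x * v x"], simp add: norm_mult nE)+
  have "(LBINT x=-\<infinity>..\<infinity>. f x) = 0 - 0"
  proof (rule interval_integral_FTC_integrable[where F="\<lambda>x. E x * v x"])
    show "(((\<lambda>x. E x * v x) \<circ> real_of_ereal) \<longlongrightarrow> 0) (at_right (-\<infinity>))"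
      using l'(2) by (simp add: ereal_tendsto_simps)
    show "(((\<lambda>x. E x * v x) \<circ> real_of_ereal) \<longlongrightarrow> 0) (at_left \<infinity>)"
      using l'(1) by (simp add: ereal_tendsto_simps)
    show "set_integrable lborel (einterval (-\<infinity>) \<infinity>) f"
      using fi by (simp add: set_integrable_def)
  qed (use F cf in auto)
  then have "(LINT x|lborel. f x) = 0"
    by (simp add: interval_lebesgue_integral_def set_lebesgue_integral_def)
  moreover have "(LINT x|lborel. f x) = ft v' \<xi> + \<i> * of_real \<xi> * ft v \<xi>"
    unfolding f_def using i1 by (simp add: mult.assoc ft_def E_def)
  ultimately show ?thesis by (simp add: add_eq_0_iff)
qed

text \<open>Only even orders occur in (1 + xi^2)^2 F v = F v - 2 F v'' + F v'''', with F for
  \<open>ft\<close>; the moduli 1, 2, 1 of the coefficients add up to the factor 4. Four derivatives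
  are taken because the resulting decay has to outweigh |xi|^(2 s) for s < 2.\<close>

lemma ft_four_derivatives_bound:
  fixes v :: "nat \<Rightarrow> real \<Rightarrow> complex"
  assumes d: "\<And>j x. j < 4 \<Longrightarrow> (v j has_vector_derivative v (Suc j) x) (at x)"
    and c: "continuous_on UNIV (v 4)"
    and K: "\<And>j x. j \<le> 4 \<Longrightarrow> cmod (v j x) \<le> K * exp (- x\<^sup>2 / 16)"
  shows "cmod (ft (v 0) \<xi>) \<le> 4 * K * (LINT x|lborel. exp (- x\<^sup>2 / 16)) / (1 + \<xi>\<^sup>2)\<^sup>2"
proof -
  define G where "G = (LINT x::real|lborel. exp (- x\<^sup>2 / 16))"
  have iG: "integrable lborel (\<lambda>x::real. exp (- x\<^sup>2 / 16))"
    using integrable_gaussian[of "1/16" 0] by simp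
  have cont: "continuous_on UNIV (v j)" if "j \<le> 4" for j
  proof (cases "j = 4")
    case False
    then have "j < 4" using that by simp
    then show ?thesis using d by (auto intro!: continuous_at_imp_continuous_on intro: has_vector_derivative_continuous)
  qed (use c in simp)
  have i: "integrable lborel (v j)" if "j \<le> 4" for j
    by (rule Bochner_Integration.integrable_bound[OF integrable_mult_right[OF iG, of K]])
       (use K[OF that] cont[OF that] order_trans[OF norm_ge_zero K[OF that]] in \<open>auto intro!: borel_measurable_continuous_onI\<close>)
  have n: "cmod (ft (v j) \<xi>) \<le> K * G" if "j \<le> 4" for j
  proof -
    have "cmod (ft (v j) \<xi>) \<le> (LINT x|lborel. cmod (v j x))" by (rule norm_ft_le[OF i[OF that]])
    also have "\<dots> \<le> (LINT x|lborel. K * exp (- x\<^sup>2 / 16))"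
      using K[OF that] i[OF that] iG by (intro integral_mono) auto
    finally show ?thesis by (simp add: G_def)
  qed
  have lim: "((\<lambda>x::real. K * exp (- x\<^sup>2 / 16)) \<longlongrightarrow> 0) at_top" "((\<lambda>x::real. K * exp (- x\<^sup>2 / 16)) \<longlongrightarrow> 0) at_bot"
    by real_asymp+
  have l: "(v j \<longlongrightarrow> 0) at_top" "(v j \<longlongrightarrow> 0) at_bot" if "j \<le> 4" for j
    by (rule Lim_null_comparison[OF _ lim(1)], use K[OF that] in simp)
       (rule Lim_null_comparison[OF _ lim(2)], use K[OF that] in simp)
  have step: "ft (v (Suc j)) \<xi> = - \<i> * of_real \<xi> * ft (v j) \<xi>" if "j < 4" for j
    using that by (intro ft_vector_derivative d cont i l) auto
  have 2: "ft (v 2) \<xi> = - (of_real \<xi>)\<^sup>2 * ft (v 0) \<xi>"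
    using step[of 0] step[of 1] by (simp add: numeral_2_eq_2 power2_eq_square algebra_simps)
  have "ft (v 4) \<xi> = - (of_real \<xi>)\<^sup>2 * ft (v 2) \<xi>"
    using step[of 2] step[of 3] by (simp add: eval_nat_numeral power2_eq_square algebra_simps)
  then have 4: "ft (v 4) \<xi> = (of_real \<xi>)\<^sup>2 * (of_real \<xi>)\<^sup>2 * ft (v 0) \<xi>" by (simp add: 2)
  have "of_real ((1 + \<xi>\<^sup>2)\<^sup>2) * ft (v 0) \<xi> = ft (v 0) \<xi> - 2 * ft (v 2) \<xi> + ft (v 4) \<xi>"
    unfolding 2 4 by (simp add: power2_eq_square algebra_simps)
  also have "cmod \<dots> \<le> cmod (ft (v 0) \<xi> - 2 * ft (v 2) \<xi>) + cmod (ft (v 4) \<xi>)" by (rule norm_triangle_ineq)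
  also have "cmod (ft (v 0) \<xi> - 2 * ft (v 2) \<xi>) \<le> cmod (ft (v 0) \<xi>) + 2 * cmod (ft (v 2) \<xi>)"
    using norm_triangle_ineq4[of "ft (v 0) \<xi>" "2 * ft (v 2) \<xi>"] by (simp add: norm_mult)
  finally have "(1 + \<xi>\<^sup>2)\<^sup>2 * cmod (ft (v 0) \<xi>) \<le> 4 * K * G"
    using n[of 0] n[of 2] n[of 4] by (simp add: norm_mult del: of_real_power of_real_add)
  moreover have "(1 + \<xi>\<^sup>2)\<^sup>2 > 0"
    by (rule zero_less_power[OF add_pos_nonneg[OF zero_less_one zero_le_power2]])
  ultimately show ?thesis by (simp add: G_def pos_le_divide_eq mult.commute)
qed

lemma poly_gaussian_bound: "(2 + \<bar>x\<bar>) ^ 4 * exp (- x\<^sup>2 / 8) \<le> 4096 * exp (- x\<^sup>2 / 16)" for x :: real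
proof -
  define y where "y = x\<^sup>2 / 16"
  have y: "y \<ge> 0" by (simp add: y_def)
  have "(2 + \<bar>x\<bar>)\<^sup>2 \<le> 8 + 2 * x\<^sup>2"
    using sum_squares_bound[of 2 "\<bar>x\<bar>"] by (simp add: power2_sum)
  \<comment> \<open>In terms of y the bound is 8 + 32 y <= 64 (1 + y / 2); squaring 64 gives
    4096.\<close>
  also have "\<dots> \<le> 64 * exp (y / 2)"
  proof -
    have "1 + y / 2 \<le> exp (y / 2)" by (rule exp_ge_add_one_self)
    moreover have "x\<^sup>2 = 16 * y" by (simp add: y_def)
    ultimately show ?thesis using y by linarith
  qed
  finally have "((2 + \<bar>x\<bar>)\<^sup>2)\<^sup>2 \<le> (64 * exp (y / 2))\<^sup>2" by (intro power_mono) auto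
  then have "(2 + \<bar>x\<bar>) ^ 4 \<le> 4096 * exp y"
  proof -
    have "(exp (y / 2))\<^sup>2 = exp y" by (simp flip: exp_double)
    then show ?thesis using \<open>((2 + \<bar>x\<bar>)\<^sup>2)\<^sup>2 \<le> (64 * exp (y / 2))\<^sup>2\<close>
      by (simp only: power_mult_distrib power_mult[symmetric]) simp
  qed
  then have "(2 + \<bar>x\<bar>) ^ 4 * exp (- x\<^sup>2 / 8) \<le> 4096 * exp y * exp (- x\<^sup>2 / 8)" by (intro mult_right_mono) auto
  also have "\<dots> = 4096 * exp (- x\<^sup>2 / 16)" by (simp add: y_def exp_add[symmetric])
  finally show ?thesis .
qed

text \<open>For a = k (w - x) these are the scaled Hermite polynomials by which a Gaussian of
  precision k is multiplied when it is differentiated up to four times. The moduli 1, 6, 3 of the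
  coefficients of the last one add up to 10, and each monomial is at most S^4.\<close>

lemma Hermite_bounds:
  fixes a :: complex and k :: real
  assumes "k \<ge> 0"
  defines "S \<equiv> 1 + cmod a + k"
  shows "cmod a \<le> 10 * S ^ 4" "cmod (a\<^sup>2 - of_real k) \<le> 10 * S ^ 4"
    "cmod (a ^ 3 - 3 * of_real k * a) \<le> 10 * S ^ 4"
    "cmod (a ^ 4 - 6 * of_real k * a\<^sup>2 + 3 * (of_real k)\<^sup>2) \<le> 10 * S ^ 4"
    "1 \<le> 10 * S ^ 4"
proof -
  define r where "r = cmod a"
  have r: "0 \<le> r" "r \<le> S" "k \<le> S" "1 \<le> S" using assms by (auto simp: r_def)
  have m: "S ^ i \<le> S ^ 4" if "i \<le> 4" for i using r that by (intro power_increasing) auto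
  have p: "r ^ i \<le> S ^ 4" if "i \<le> 4" for i
    using order_trans[OF power_mono[OF r(2) r(1)] m[OF that]] .
  have kp: "k * r ^ i \<le> S ^ 4" if "i \<le> 3" for i
    using order_trans[OF mult_mono[OF r(3) power_mono[OF r(2) r(1)], of i] ] m[of "Suc i"] r that by simp
  have kk: "k * k \<le> S ^ 4"
    using order_trans[OF mult_mono[OF r(3) r(3)]] m[of 2] r assms by (simp add: power2_eq_square)
  have S4: "S ^ 4 \<ge> 0" using r by simp
  have pp: "r \<le> S ^ 4" "1 \<le> S ^ 4" "r\<^sup>2 \<le> S ^ 4" "r ^ 3 \<le> S ^ 4" "r ^ 4 \<le> S ^ 4"
    "k \<le> S ^ 4" "k * r \<le> S ^ 4" "k * r\<^sup>2 \<le> S ^ 4"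
    using p[of 1] p[of 0] p[of 2] p[of 3] p[of 4] kp[of 0] kp[of 1] kp[of 2] by simp_all
  show "cmod a \<le> 10 * S ^ 4" using pp(1) S4 unfolding r_def by linarith
  show "1 \<le> 10 * S ^ 4" using pp(2) by linarith
  have "cmod (a\<^sup>2 - of_real k) \<le> r\<^sup>2 + k"
    using norm_triangle_ineq4[of "a\<^sup>2" "of_real k"] assms by (simp add: norm_power r_def)
  also have "\<dots> \<le> 10 * S ^ 4" using pp S4 by linarith
  finally show "cmod (a\<^sup>2 - of_real k) \<le> 10 * S ^ 4" .
  have "cmod (a ^ 3 - 3 * of_real k * a) \<le> r ^ 3 + 3 * (k * r)"
    using norm_triangle_ineq4[of "a ^ 3" "3 * of_real k * a"] assms by (simp add: norm_power norm_mult r_def)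
  also have "\<dots> \<le> 10 * S ^ 4" using pp S4 by linarith
  finally show "cmod (a ^ 3 - 3 * of_real k * a) \<le> 10 * S ^ 4" .
  have "cmod (a ^ 4 - 6 * of_real k * a\<^sup>2 + 3 * (of_real k)\<^sup>2) \<le> cmod (a ^ 4 - 6 * of_real k * a\<^sup>2) + 3 * (k * k)"
    using norm_triangle_ineq[of "a ^ 4 - 6 * of_real k * a\<^sup>2" "3 * (of_real k)\<^sup>2"] assms
    by (simp add: norm_power norm_mult power2_eq_square)
  also have "cmod (a ^ 4 - 6 * of_real k * a\<^sup>2) \<le> r ^ 4 + 6 * (k * r\<^sup>2)"
    using norm_triangle_ineq4[of "a ^ 4" "6 * of_real k * a\<^sup>2"] assms by (simp add: norm_power norm_mult r_def)
  finally show "cmod (a ^ 4 - 6 * of_real k * a\<^sup>2 + 3 * (of_real k)\<^sup>2) \<le> 10 * S ^ 4"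
    using pp kk by linarith
qed

text \<open>A Gaussian of precision k with complex centre w. For k = 1 / (2 t) its transform is a
  multiple of exp (i w xi - t xi^2), which is the kernel of the heat flow at a complex
  point.\<close>

definition gauss_at :: "real \<Rightarrow> complex \<Rightarrow> real \<Rightarrow> complex" where
  "gauss_at k w x = exp (- of_real (k / 2) * (w - of_real x)\<^sup>2)"

lemma gauss_at_derivative:
  "(gauss_at k w has_vector_derivative of_real k * (w - of_real x) * gauss_at k w x) (at x)"
proof -
  have "((\<lambda>z. exp (- of_real (k / 2) * (w - z)\<^sup>2)) has_field_derivative
     of_real k * (w - of_real x) * exp (- of_real (k / 2) * (w - of_real x)\<^sup>2)) (at (of_real x))"
    by (auto intro!: derivative_eq_intros simp: field_simps)
  from has_vector_derivative_real_field[OF this] show ?thesis by (simp add: gauss_at_def[abs_def])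
qed

text \<open>4 comes from \<open>ft_four_derivatives_bound\<close>, 160 = 16 times 10 from the
  binomial sum 2^4 and the Hermite polynomials, 4096 from
  \<open>poly_gaussian_bound\<close>.\<close>

definition cut_const :: real where
  "cut_const = 4 * (160 * 4096) * (LINT x|lborel. exp (- x\<^sup>2 / 16))"

lemma cut_const_nonneg: "cut_const \<ge> 0"
  by (simp add: cut_const_def)

text \<open>Leibniz's rule: the derivatives of the product are polynomials in k (w - x) and in the
  derivatives of the cut-off, times the Gaussian. The Gaussian bound is demanded only where some
  derivative of the cut-off is nonzero, so a cut-off that vanishes near 0 profits from the smallness
  of the Gaussian away from 0.\<close>

lemma ft_cut_gaussian_bound:
  fixes b :: "nat \<Rightarrow> real \<Rightarrow> real"
  assumes d: "\<And>j x. j < 4 \<Longrightarrow> (b j has_vector_derivative b (Suc j) x) (at x)"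
    and c: "continuous_on UNIV (b 4)"
    and B: "\<And>j x. j \<le> 4 \<Longrightarrow> \<bar>b j x\<bar> \<le> B"
    and w: "cmod w \<le> 1" and k: "k \<ge> 0"
    and E: "E \<ge> 0" "\<And>j x. j \<le> 4 \<Longrightarrow> b j x \<noteq> 0 \<Longrightarrow> cmod (gauss_at k w x) \<le> E * exp (- x\<^sup>2 / 8)"
  shows "cmod (ft (\<lambda>x. of_real (b 0 x) * gauss_at k w x) \<xi>) \<le> cut_const * B * E * (1 + k) ^ 4 / (1 + \<xi>\<^sup>2)\<^sup>2"
proof -
  define g where "g = gauss_at k w"
  define a where "a x = of_real k * (w - of_real x)" for x
  define \<kappa> where "\<kappa> = complex_of_real k"
  define q where "q j x = (if j = 0 then 1 else if j = 1 then a x else if j = 2 then (a x)\<^sup>2 - \<kappa>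
     else if j = 3 then a x ^ 3 - 3 * \<kappa> * a x else a x ^ 4 - 6 * \<kappa> * (a x)\<^sup>2 + 3 * \<kappa>\<^sup>2)" for j :: nat and x
  define bc where "bc j x = complex_of_real (b j x)" for j x
  \<comment> \<open>The Leibniz polynomial of order j: the j-th derivative of the product is
    \<open>p j x * g x\<close>.\<close>
  define p where "p j x = (\<Sum>i\<le>j. of_nat (j choose i) * (bc (j - i) x * q i x))" for j :: nat and x
  define v where "v j x = p j x * g x" for j x
  have B0: "B \<ge> 0" using order_trans[OF abs_ge_zero B[of 0 0]] by simp
  have a': "(a has_vector_derivative - \<kappa>) (at x)" for x
  proof -
    have "((\<lambda>z. of_real k * (w - z)) has_field_derivative - \<kappa>) (at (of_real x))"
      by (auto intro!: derivative_eq_intros simp: \<kappa>_def)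
    from has_vector_derivative_real_field[OF this] show ?thesis by (simp add: a_def[abs_def])
  qed
  have g': "(g has_vector_derivative a x * g x) (at x)" for x
    using gauss_at_derivative[of k w x] by (simp add: g_def a_def)
  have b': "(bc j has_vector_derivative bc (Suc j) x) (at x)" if "j < 4" for j x
    unfolding bc_def using d[OF that]
    by (intro has_vector_derivative_of_real) (simp add: has_real_derivative_iff_has_vector_derivative)
  have b0: "(bc 0 has_vector_derivative bc 1 x) (at x)" and b1: "(bc 1 has_vector_derivative bc 2 x) (at x)"
    and b2: "(bc 2 has_vector_derivative bc 3 x) (at x)" and b3: "(bc 3 has_vector_derivative bc 4 x) (at x)" for x
    using b'[of 0 x] b'[of 1 x] b'[of 2 x] b'[of 3 x] by (simp_all add: eval_nat_numeral)
  note cm = has_vector_derivative_mult_right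
  \<comment> \<open>Powers are written out as products so that the product rule matches the terms
    literally.\<close>
  have p0: "p 0 x = bc 0 x" and p1: "p 1 x = bc 1 x + bc 0 x * a x"
    and p2: "p 2 x = bc 2 x + 2 * (bc 1 x * a x) + bc 0 x * (a x * a x - \<kappa>)"
    and p3: "p 3 x = bc 3 x + 3 * (bc 2 x * a x) + 3 * (bc 1 x * (a x * a x - \<kappa>)) + bc 0 x * (a x * (a x * a x) - 3 * \<kappa> * a x)"
    and p4: "p 4 x = bc 4 x + 4 * (bc 3 x * a x) + 6 * (bc 2 x * (a x * a x - \<kappa>)) + 4 * (bc 1 x * (a x * (a x * a x) - 3 * \<kappa> * a x))
      + bc 0 x * (a x * (a x * (a x * a x)) - 6 * \<kappa> * (a x * a x) + 3 * \<kappa>\<^sup>2)" for x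
  proof -
    have S: "(\<Sum>i\<le>1. f i) = f 0 + f 1" "(\<Sum>i\<le>2. f i) = f 0 + f 1 + f 2" "(\<Sum>i\<le>3. f i) = f 0 + f 1 + f 2 + f 3"
      "(\<Sum>i\<le>4. f i) = f 0 + f 1 + f 2 + f 3 + f 4" for f :: "nat \<Rightarrow> complex"
      by (simp_all add: eval_nat_numeral)
    have C: "2 choose 2 = (1::nat)" "3 choose 2 = (3::nat)" "3 choose 3 = (1::nat)"
      "4 choose 2 = (6::nat)" "4 choose 3 = (4::nat)" "4 choose 4 = (1::nat)"
      by (simp_all add: eval_nat_numeral)
    have pw: "z ^ 3 = z * (z * z)" "z ^ 4 = z * (z * (z * z))" for z :: complex
      by (simp_all add: eval_nat_numeral)
    show "p 0 x = bc 0 x" "p 1 x = bc 1 x + bc 0 x * a x"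
      "p 2 x = bc 2 x + 2 * (bc 1 x * a x) + bc 0 x * (a x * a x - \<kappa>)"
      "p 3 x = bc 3 x + 3 * (bc 2 x * a x) + 3 * (bc 1 x * (a x * a x - \<kappa>)) + bc 0 x * (a x * (a x * a x) - 3 * \<kappa> * a x)"
      "p 4 x = bc 4 x + 4 * (bc 3 x * a x) + 6 * (bc 2 x * (a x * a x - \<kappa>)) + 4 * (bc 1 x * (a x * (a x * a x) - 3 * \<kappa> * a x))
      + bc 0 x * (a x * (a x * (a x * a x)) - 6 * \<kappa> * (a x * a x) + 3 * \<kappa>\<^sup>2)"
      unfolding p_def S by (simp_all add: q_def C pw power2_eq_square[of "a x"])
  qed
  have v': "(v j has_vector_derivative v (Suc j) x) (at x)" if "j < 4" for j x
  proof -
    have "(v 0 has_vector_derivative v 1 x) (at x)"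
      unfolding v_def[abs_def] p0 p1
      by (rule has_vector_derivative_eq_rhs, (rule has_vector_derivative_mult b0 g')+) (simp add: algebra_simps)
    moreover have "(v 1 has_vector_derivative v 2 x) (at x)"
      unfolding v_def[abs_def] p1 p2
      by (rule has_vector_derivative_eq_rhs, (rule has_vector_derivative_add has_vector_derivative_mult b0 b1 a' g')+)
         (simp add: algebra_simps)
    moreover have "(v 2 has_vector_derivative v 3 x) (at x)"
      unfolding v_def[abs_def] p2 p3
      by (rule has_vector_derivative_eq_rhs, (rule has_vector_derivative_add has_vector_derivative_diff has_vector_derivative_const cm has_vector_derivative_mult b0 b1 b2 a' g')+)
         (simp add: algebra_simps)
    moreover have "(v 3 has_vector_derivative v 4 x) (at x)"
      unfolding v_def[abs_def] p3 p4
      by (rule has_vector_derivative_eq_rhs, (rule has_vector_derivative_add has_vector_derivative_diff has_vector_derivative_const cm has_vector_derivative_mult b0 b1 b2 b3 a' g')+)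
         (simp add: algebra_simps power2_eq_square)
    moreover have "j = 0 \<or> j = 1 \<or> j = 2 \<or> j = 3" using that by linarith
    ultimately show ?thesis by (auto simp: eval_nat_numeral)
  qed
  have cont_b: "continuous_on UNIV (b j)" if "j \<le> 4" for j
  proof (cases "j = 4")
    case False
    then have "j < 4" using that by simp
    then show ?thesis using d by (auto intro!: continuous_at_imp_continuous_on intro: has_vector_derivative_continuous)
  qed (use c in simp)
  have cont_g: "continuous_on UNIV g" unfolding g_def gauss_at_def by (intro continuous_intros)
  have cont_q: "continuous_on UNIV (q j)" for j
    unfolding q_def a_def by (cases "j = 0"; cases "j = 1"; cases "j = 2"; cases "j = 3") (auto intro!: continuous_intros)
  have cont_v: "continuous_on UNIV (v 4)"
    unfolding v_def p_def bc_def by (intro continuous_intros cont_q cont_g cont_b) auto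
  define K where "K = 160 * 4096 * B * E * (1 + k) ^ 4"
  have K: "cmod (v j x) \<le> K * exp (- x\<^sup>2 / 16)" if j: "j \<le> 4" for j x
  \<comment> \<open>Where all derivatives of the cut-off vanish, the hypothesis on the Gaussian says
    nothing, but there the product is 0.\<close>
  proof (cases "\<forall>i\<le>4. b i x = 0")
    case True
    then have "p j x = 0" using j unfolding p_def bc_def by (intro sum.neutral) auto
    moreover have "K \<ge> 0" using B0 E k by (simp add: K_def)
    ultimately show ?thesis by (simp add: v_def)
  next
    case False
    then have gE: "cmod (g x) \<le> E * exp (- x\<^sup>2 / 8)" using E(2) by (auto simp: g_def)
    define Q where "Q = 10 * (1 + cmod (a x) + k) ^ 4"
    have Q: "cmod (q i x) \<le> Q" for i
      using Hermite_bounds[OF k, of "a x"] unfolding q_def Q_def \<kappa>_def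
      by (cases "i = 0"; cases "i = 1"; cases "i = 2"; cases "i = 3") auto
    have Q0: "Q \<ge> 0" using order_trans[OF norm_ge_zero Q] .
    have "cmod (p j x) \<le> (\<Sum>i\<le>j. cmod (of_nat (j choose i) * (bc (j - i) x * q i x)))"
      unfolding p_def by (rule norm_sum)
    also have "\<dots> \<le> (\<Sum>i\<le>j. real (j choose i) * (B * Q))"
      using B j B0 Q by (intro sum_mono) (auto simp: norm_mult bc_def intro!: mult_left_mono mult_mono)
    also have "\<dots> = 2 ^ j * (B * Q)"
      by (simp add: sum_distrib_right[symmetric] choose_row_sum flip: of_nat_sum)
    also have "\<dots> \<le> 2 ^ 4 * (B * Q)"
      using j B0 Q0 by (intro mult_right_mono power_increasing) auto
    finally have pj: "cmod (p j x) \<le> 16 * (B * Q)" by simp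
    \<comment> \<open>This separates k from x: the power of 1 + k goes into the constant, the power
      of 2 + |x| is absorbed by half of the Gaussian exponent.\<close>
    have "1 + cmod (a x) + k \<le> (1 + k) * (2 + \<bar>x\<bar>)"
    proof -
      have "cmod (w - of_real x) \<le> 1 + \<bar>x\<bar>" using norm_triangle_ineq4[of w "of_real x"] w by simp
      then have "k * cmod (w - of_real x) \<le> k * (1 + \<bar>x\<bar>)" using k by (rule mult_left_mono)
      moreover have "cmod (a x) = k * cmod (w - of_real x)" using k by (simp add: a_def norm_mult)
      ultimately show ?thesis using k by (simp add: algebra_simps)
    qed
    then have "Q \<le> 10 * ((1 + k) * (2 + \<bar>x\<bar>)) ^ 4"
      unfolding Q_def using k by (intro mult_left_mono power_mono) auto
    then have Q2: "Q \<le> 10 * (1 + k) ^ 4 * (2 + \<bar>x\<bar>) ^ 4" by (simp add: power_mult_distrib)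
    have "cmod (v j x) \<le> (16 * (B * Q)) * (E * exp (- x\<^sup>2 / 8))"
      unfolding v_def norm_mult using pj gE B0 Q0 by (intro mult_mono) auto
    also have "\<dots> \<le> (16 * (B * (10 * (1 + k) ^ 4 * (2 + \<bar>x\<bar>) ^ 4))) * (E * exp (- x\<^sup>2 / 8))"
      using Q2 B0 E by (intro mult_right_mono mult_left_mono) auto
    also have "\<dots> = 160 * B * E * (1 + k) ^ 4 * ((2 + \<bar>x\<bar>) ^ 4 * exp (- x\<^sup>2 / 8))" by simp
    also have "\<dots> \<le> 160 * B * E * (1 + k) ^ 4 * (4096 * exp (- x\<^sup>2 / 16))"
      using B0 E k by (intro mult_left_mono poly_gaussian_bound) auto
    finally show ?thesis by (simp add: K_def mult_ac)
  qed
  have "cmod (ft (v 0) \<xi>) \<le> 4 * K * (LINT x|lborel. exp (- x\<^sup>2 / 16)) / (1 + \<xi>\<^sup>2)\<^sup>2"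
    by (rule ft_four_derivatives_bound[OF v' cont_v K])
  also have "4 * K * (LINT x|lborel. exp (- x\<^sup>2 / 16)) = cut_const * B * E * (1 + k) ^ 4"
    by (simp add: K_def cut_const_def)
  also have "v 0 = (\<lambda>x. of_real (b 0 x) * gauss_at k w x)"
    by (simp add: v_def fun_eq_iff p0 bc_def g_def)
  finally show ?thesis .
qed

section \<open>Cut-off functions and their derivatives\<close>

text \<open>\<open>Ck_real\<close> hides the derivatives behind existential quantifiers; the Leibniz
  estimate needs them as one sequence.\<close>

lemma Ck_real_chain:
  fixes f :: "real \<Rightarrow> 'b::real_normed_vector"
  assumes "Ck_real n f"
  obtains b where "b 0 = f" "\<And>j x. j < n \<Longrightarrow> (b j has_vector_derivative b (Suc j) x) (at x)" "continuous_on UNIV (b n)"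
  using assms
proof (induction n arbitrary: f thesis)
  case 0
  show ?case by (rule "0.prems"(1)[of "\<lambda>_. f"]) (use "0.prems"(2) in auto)
next
  case (Suc n)
  then obtain f' where f': "\<And>x. (f has_vector_derivative f' x) (at x)" "Ck_real n f'" by auto
  obtain b where b: "b 0 = f'" "\<And>j x. j < n \<Longrightarrow> (b j has_vector_derivative b (Suc j) x) (at x)" "continuous_on UNIV (b n)"
    using Suc.IH[OF _ f'(2)] by blast
  show ?case
  proof (rule Suc.prems(1)[of "\<lambda>j. case j of 0 \<Rightarrow> f | Suc i \<Rightarrow> b i"])
    fix j x assume "j < Suc n"
    then show "((case j of 0 \<Rightarrow> f | Suc i \<Rightarrow> b i) has_vector_derivative (case Suc j of 0 \<Rightarrow> f | Suc i \<Rightarrow> b i) x) (at x)"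
      using b f' by (cases j) auto
  qed (use b in auto)
qed

lemma derivative_chain_eq_0:
  fixes b :: "nat \<Rightarrow> real \<Rightarrow> 'b::real_normed_vector"
  assumes d: "\<And>j x. j < n \<Longrightarrow> (b j has_vector_derivative b (Suc j) x) (at x)"
    and U: "open U" "\<And>x. x \<in> U \<Longrightarrow> b 0 x = c" and j: "j < n" and x: "x \<in> U"
  shows "b (Suc j) x = 0"
  using j x
proof (induction j arbitrary: x)
  case 0
  have "(b 0 has_vector_derivative 0) (at x)"
    by (rule has_vector_derivative_transform_within_open[of "\<lambda>_. c" 0 x U]) (use U 0 in auto)
  then show ?case using d[OF 0(1)] vector_derivative_unique_at by blast
next
  case (Suc j)
  have "(b (Suc j) has_vector_derivative 0) (at x)"
    by (rule has_vector_derivative_transform_within_open[of "\<lambda>_. 0" 0 x U]) (use U Suc in auto)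
  then show ?case using d[OF Suc.prems(1)] vector_derivative_unique_at by blast
qed

text \<open>Squaring gives an even function that is smooth at 0 without an absolute value. For
  \<delta> > 0 its value is 1 up to \<delta> and 0 from sqrt 2 times \<delta> on.\<close>

definition bump :: "real \<Rightarrow> real \<Rightarrow> real" where
  "bump \<delta> x = step ((x / \<delta>)\<^sup>2 - 1)"

lemma Ck_real_bump: "Ck_real k (bump \<delta>)"
proof -
  have "Ck_real k (\<lambda>x. step ((x * inverse \<delta>)\<^sup>2 - 1))"
    by (intro Ck_real_compose[OF Ck_real_step] Ck_real_diff Ck_real_const Ck_real_power Ck_real_mult Ck_real_ident)
  then show ?thesis by (simp add: bump_def[abs_def] divide_inverse)
qed

lemma bump_eq_1: assumes "\<delta> > 0" "\<bar>x\<bar> \<le> \<delta>" shows "bump \<delta> x = 1"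
proof -
  have "\<bar>x / \<delta>\<bar> \<le> 1" using assms by simp
  then have "(x / \<delta>)\<^sup>2 \<le> 1" by (simp add: abs_square_le_1)
  then show ?thesis unfolding bump_def by (intro step_eq_1) simp
qed

lemma bump_eq_0: assumes "\<delta> > 0" "\<bar>x\<bar> \<ge> 2 * \<delta>" shows "bump \<delta> x = 0"
proof -
  have "2 \<le> \<bar>x / \<delta>\<bar>" using assms by (simp add: field_simps)
  then have "2\<^sup>2 \<le> \<bar>x / \<delta>\<bar>\<^sup>2" by (intro power_mono) auto
  then have "4 \<le> (x / \<delta>)\<^sup>2" unfolding power2_abs by simp
  then show ?thesis unfolding bump_def by (intro step_eq_0) simp
qed

lemma bump_bounds: "0 \<le> bump \<delta> x" "bump \<delta> x \<le> 1"
  by (simp_all add: bump_def step_nonneg step_le_1)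

text \<open>The derivatives are continuous and vanish beyond 2 \<delta>, hence are bounded by
  compactness. Their vanishing inside \<delta> allows \<open>1 - bump \<delta>\<close> to be treated
  as a cut-off supported away from 0.\<close>

lemma bump_chain:
  assumes \<delta>: "\<delta> > 0"
  obtains b :: "nat \<Rightarrow> real \<Rightarrow> real" and B where "b 0 = bump \<delta>"
    "\<And>j x. j < 4 \<Longrightarrow> (b j has_vector_derivative b (Suc j) x) (at x)"
    "continuous_on UNIV (b 4)" "B \<ge> 1" "\<And>j x. j \<le> 4 \<Longrightarrow> \<bar>b j x\<bar> \<le> B"
    "\<And>j x. j < 4 \<Longrightarrow> \<bar>x\<bar> < \<delta> \<Longrightarrow> b (Suc j) x = 0"
proof -
  obtain b where b: "b 0 = bump \<delta>" "\<And>j x. j < 4 \<Longrightarrow> (b j has_vector_derivative b (Suc j) x) (at x)"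
    "continuous_on UNIV (b 4)"
    using Ck_real_chain[OF Ck_real_bump[of 4 \<delta>]] by blast
  have cont: "continuous_on UNIV (b j)" if "j \<le> 4" for j
  proof (cases "j = 4")
    case False
    then have "j < 4" using that by simp
    then show ?thesis using b(2) by (auto intro!: continuous_at_imp_continuous_on intro: has_vector_derivative_continuous)
  qed (use b(3) in simp)
  have flat: "b (Suc j) x = 0" if "j < 4" "\<bar>x\<bar> < \<delta>" for j x
  proof (rule derivative_chain_eq_0[of 4 b "{-\<delta><..<\<delta>}" 1 j x, OF b(2)])
    show "open {-\<delta><..<\<delta>}" by simp
    show "x \<in> {-\<delta><..<\<delta>}" using that by auto
    show "b 0 y = 1" if "y \<in> {-\<delta><..<\<delta>}" for y using that \<delta> by (auto simp: b(1) intro!: bump_eq_1)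
  qed (use that in auto)
  have out: "b j x = 0" if "j \<le> 4" "\<bar>x\<bar> > 2 * \<delta>" for j x
  proof (cases j)
    case 0
    then show ?thesis using that \<delta> by (simp add: b(1) bump_eq_0)
  next
    case (Suc i)
    have "b (Suc i) x = 0"
    proof (rule derivative_chain_eq_0[of 4 b "{y. \<bar>y\<bar> > 2 * \<delta>}" 0 i x, OF b(2)])
      show "open {y. \<bar>y\<bar> > 2 * \<delta>}" by (intro open_Collect_less continuous_intros)
      show "b 0 y = 0" if "y \<in> {y. \<bar>y\<bar> > 2 * \<delta>}" for y using that \<delta> by (simp add: b(1) bump_eq_0)
    qed (use that Suc in auto)
    then show ?thesis using Suc by simp
  qed
  have "\<exists>B. \<forall>x. \<bar>b j x\<bar> \<le> B" if j: "j \<le> 4" for j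
  proof -
    have "compact (b j ` {-2*\<delta>..2*\<delta>})"
      by (intro compact_continuous_image continuous_on_subset[OF cont[OF j]]) auto
    then have "bounded (b j ` {-2*\<delta>..2*\<delta>})" by (rule compact_imp_bounded)
    then obtain B where "\<forall>y\<in>b j ` {-2*\<delta>..2*\<delta>}. norm y \<le> B" unfolding bounded_iff by blast
    then have B: "\<bar>b j x\<bar> \<le> B" if "x \<in> {-2*\<delta>..2*\<delta>}" for x using that by simp
    have "\<bar>b j x\<bar> \<le> max B 0" for x
    proof (cases "\<bar>x\<bar> > 2 * \<delta>")
      case False
      then have "x \<in> {-2*\<delta>..2*\<delta>}" by auto
      from B[OF this] show ?thesis by simp
    qed (simp add: out[OF j])
    then show ?thesis by blast
  qed
  then obtain Bf where Bf: "\<And>j x. j \<le> 4 \<Longrightarrow> \<bar>b j x\<bar> \<le> Bf j" by metis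
  define B where "B = 1 + (\<Sum>j\<le>4::nat. \<bar>Bf j\<bar>)"
  have "\<bar>b j x\<bar> \<le> B" if "j \<le> 4" for j x
  proof -
    have "\<bar>Bf j\<bar> \<le> (\<Sum>j\<le>4::nat. \<bar>Bf j\<bar>)" using that by (intro member_le_sum) auto
    then show ?thesis using Bf[OF that, of x] by (simp add: B_def)
  qed
  moreover have "B \<ge> 1" by (simp add: B_def sum_nonneg)
  ultimately show ?thesis using that[of b B] b flat by blast
qed

section \<open>Gaussians with complex centres and the error of truncation\<close>

text \<open>The real part of the exponent is at most k \<rho>^2 / 2 - k x^2 / 4, of which x^2 / 8 is
  kept as a fixed integrable Gaussian; here k >= 1/2, that is t <= 1, enters. The rest, (k - 1/2)
  x^2 / 4, is dropped in the first bound and yields the decay in k at distance \<delta> in the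
  second.\<close>

lemma norm_gauss_at_le:
  assumes k: "k \<ge> 1 / 2" and w: "cmod w \<le> \<rho>"
  shows "cmod (gauss_at k w x) \<le> exp (k * \<rho>\<^sup>2 / 2) * exp (- x\<^sup>2 / 8)"
    and "0 \<le> \<delta> \<Longrightarrow> \<bar>x\<bar> \<ge> \<delta> \<Longrightarrow> cmod (gauss_at k w x) \<le> exp (\<delta>\<^sup>2 / 8 - k * \<delta>\<^sup>2 / 4 + k * \<rho>\<^sup>2 / 2) * exp (- x\<^sup>2 / 8)"
proof -
  have w2: "(Re w)\<^sup>2 + (Im w)\<^sup>2 \<le> \<rho>\<^sup>2"
    using power_mono[OF w, of 2] by (simp add: cmod_power2)
  have "(x - 2 * Re w)\<^sup>2 \<ge> 0" by simp
  then have "(Re w - x)\<^sup>2 - (Im w)\<^sup>2 \<ge> x\<^sup>2 / 2 - ((Re w)\<^sup>2 + (Im w)\<^sup>2)"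
    by (simp add: power2_eq_square algebra_simps)
  then have "(Re w - x)\<^sup>2 - (Im w)\<^sup>2 \<ge> x\<^sup>2 / 2 - \<rho>\<^sup>2" using w2 by linarith
  then have "k / 2 * ((Re w - x)\<^sup>2 - (Im w)\<^sup>2) \<ge> k / 2 * (x\<^sup>2 / 2 - \<rho>\<^sup>2)" using k by (intro mult_left_mono) auto
  moreover have "cmod (gauss_at k w x) = exp (- (k / 2 * ((Re w - x)\<^sup>2 - (Im w)\<^sup>2)))"
    by (simp add: gauss_at_def power2_eq_square field_simps)
  ultimately have g: "cmod (gauss_at k w x) \<le> exp (- (k / 2 * (x\<^sup>2 / 2 - \<rho>\<^sup>2)))" by simp
  have h: "- (k / 2 * (x\<^sup>2 / 2 - \<rho>\<^sup>2)) = k * \<rho>\<^sup>2 / 2 - x\<^sup>2 / 8 - (k - 1/2) * (x\<^sup>2 / 4)" by (simp add: field_simps)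
  have "0 \<le> (k - 1/2) * (x\<^sup>2 / 4)" using k by simp
  then have "- (k / 2 * (x\<^sup>2 / 2 - \<rho>\<^sup>2)) \<le> k * \<rho>\<^sup>2 / 2 + - x\<^sup>2 / 8" unfolding h by simp
  then show "cmod (gauss_at k w x) \<le> exp (k * \<rho>\<^sup>2 / 2) * exp (- x\<^sup>2 / 8)"
    using g unfolding exp_add[symmetric] by (meson exp_le_cancel_iff order_trans)
  assume "0 \<le> \<delta>" "\<bar>x\<bar> \<ge> \<delta>"
  then have "\<delta>\<^sup>2 \<le> x\<^sup>2" using power_mono[of \<delta> "\<bar>x\<bar>" 2] by simp
  then have "(k - 1/2) * (\<delta>\<^sup>2 / 4) \<le> (k - 1/2) * (x\<^sup>2 / 4)" using k by (intro mult_left_mono) auto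
  then have "- (k / 2 * (x\<^sup>2 / 2 - \<rho>\<^sup>2)) \<le> (\<delta>\<^sup>2 / 8 - k * \<delta>\<^sup>2 / 4 + k * \<rho>\<^sup>2 / 2) + - x\<^sup>2 / 8" unfolding h
  proof -
    have "(k - 1/2) * (\<delta>\<^sup>2 / 4) = k * \<delta>\<^sup>2 / 4 - \<delta>\<^sup>2 / 8" by (simp add: field_simps)
    then show "k * \<rho>\<^sup>2 / 2 - x\<^sup>2 / 8 - (k - 1/2) * (x\<^sup>2 / 4) \<le> (\<delta>\<^sup>2 / 8 - k * \<delta>\<^sup>2 / 4 + k * \<rho>\<^sup>2 / 2) + - x\<^sup>2 / 8"
      using \<open>(k - 1/2) * (\<delta>\<^sup>2 / 4) \<le> (k - 1/2) * (x\<^sup>2 / 4)\<close> by linarith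
  qed
  then show "cmod (gauss_at k w x) \<le> exp (\<delta>\<^sup>2 / 8 - k * \<delta>\<^sup>2 / 4 + k * \<rho>\<^sup>2 / 2) * exp (- x\<^sup>2 / 8)"
    using g unfolding exp_add[symmetric] by (meson exp_le_cancel_iff order_trans)
qed

lemma power_exp_bounded:
  fixes c :: real
  assumes "c > 0"
  obtains M where "M \<ge> 0" "\<And>k. k \<ge> 0 \<Longrightarrow> (1 + k) ^ n * exp (- c * k) \<le> M"
proof (cases "n = 0")
  case True
  show ?thesis by (rule that[of 1]) (use True assms in auto)
next
  case False
  \<comment> \<open>This m gives 1 + k <= m (1 + c k / n) <= m exp (c k / n), whose n-th power has
    exactly the exponent c k.\<close>
  define m where "m = max 1 (real n / c)"
  have m: "m \<ge> 1" "m * c / n \<ge> 1"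
  proof -
    show "m \<ge> 1" by (simp add: m_def)
    have "real n / c \<le> m" by (simp add: m_def)
    then show "m * c / n \<ge> 1" using assms False by (simp add: field_simps)
  qed
  show ?thesis
  proof (rule that[of "m ^ n"])
    fix k :: real assume k: "k \<ge> 0"
    have "1 + k \<le> m + (m * c / n) * k" using m mult_right_mono[OF m(2) k] by simp
    also have "\<dots> = m * (1 + c * k / n)" by (simp add: algebra_simps)
    also have "\<dots> \<le> m * exp (c * k / n)" using m by (intro mult_left_mono exp_ge_add_one_self) auto
    finally have "(1 + k) ^ n \<le> (m * exp (c * k / n)) ^ n" using k by (intro power_mono) auto
    also have "\<dots> = m ^ n * exp (c * k)"
      using False by (simp add: power_mult_distrib exp_of_nat_mult[symmetric])
    finally have "(1 + k) ^ n * exp (- c * k) \<le> m ^ n * exp (c * k) * exp (- c * k)" by (intro mult_right_mono) auto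
    also have "\<dots> = m ^ n" by (simp add: mult.assoc exp_add[symmetric])
    finally show "(1 + k) ^ n * exp (- c * k) \<le> m ^ n" .
  qed (use m in auto)
qed

lemma gauss_at_expand:
  "gauss_at k w x = exp (- of_real (k / 2) * w\<^sup>2) * exp (of_real k * w * of_real x - of_real ((k / 2) * x\<^sup>2))"
  by (simp add: gauss_at_def exp_add[symmetric] power2_eq_square algebra_simps)

lemma integrable_gauss_at:
  assumes "k > 0" shows "integrable lborel (gauss_at k w)"
  unfolding gauss_at_expand[abs_def]
  using assms by (intro integrable_mult_right integrable_gaussian_complex) auto

lemma ft_gauss_at:
  assumes k: "k > 0"
  shows "ft (gauss_at k w) \<xi> = of_real (sqrt (2 * pi / k)) * exp (\<i> * w * of_real \<xi> - of_real (\<xi>\<^sup>2 / (2 * k)))"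
proof -
  have "ft (gauss_at k w) \<xi> = (LINT x|lborel. exp (- of_real (k / 2) * w\<^sup>2) *
     exp ((of_real k * w + \<i> * of_real \<xi>) * of_real x - of_real ((k / 2) * x\<^sup>2)))"
    unfolding ft_def gauss_at_expand
    by (intro Bochner_Integration.integral_cong refl) (simp add: exp_add[symmetric] algebra_simps)
  also have "\<dots> = exp (- of_real (k / 2) * w\<^sup>2) * (of_real (sqrt (pi / (k / 2))) * exp ((of_real k * w + \<i> * of_real \<xi>)\<^sup>2 / of_real (4 * (k / 2))))"
    using k by (subst integral_mult_right_zero, subst gaussian_integral_complex) auto
  also have "\<dots> = of_real (sqrt (2 * pi / k)) * (exp (- of_real (k / 2) * w\<^sup>2 + (of_real k * w + \<i> * of_real \<xi>)\<^sup>2 / of_real (4 * (k / 2))))"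
  proof -
    have "pi / (k / 2) = 2 * pi / k" by simp
    then show ?thesis by (simp only: exp_add mult_ac)
  qed
  also have "- of_real (k / 2) * w\<^sup>2 + (of_real k * w + \<i> * of_real \<xi>)\<^sup>2 / of_real (4 * (k / 2)) = \<i> * w * of_real \<xi> - of_real (\<xi>\<^sup>2 / (2 * k))"
    using k by (simp add: field_simps power2_eq_square)
  finally show ?thesis .
qed

lemma integrable_bump_gauss:
  assumes "k > 0"
  shows "integrable lborel (\<lambda>x. of_real (bump \<delta> x) * gauss_at k w x)"
proof (rule Bochner_Integration.integrable_bound[OF integrable_gauss_at[OF assms, of w]])
  have [measurable]: "bump \<delta> \<in> borel_measurable borel"
    using Ck_real_bump[of 0 \<delta>] by (intro borel_measurable_continuous_onI) simp
  have [measurable]: "gauss_at k w \<in> borel_measurable borel"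
    using integrable_gauss_at[OF assms, of w] by auto
  show "(\<lambda>x. of_real (bump \<delta> x) * gauss_at k w x) \<in> borel_measurable lborel" by measurable
  show "AE x in lborel. cmod (of_real (bump \<delta> x) * gauss_at k w x) \<le> cmod (gauss_at k w x)"
    using bump_bounds[of \<delta>] by (intro AE_I2) (simp add: norm_mult mult_left_le_one_le)
qed

text \<open>One estimate with three cut-offs: the constant 1, the bump, and their difference. The
  last one and all its derivatives live on |x| >= \<delta>, where the Gaussian carries the extra
  factor exp (\<delta>^2 / 8 - k \<delta>^2 / 4).\<close>

lemma truncated_gauss_bounds:
  assumes \<delta>: "\<delta> > 0" and \<rho>: "0 \<le> \<rho>" "\<rho> \<le> 1"
  obtains C where "C > 0"
    "\<And>(k::real) w \<xi>. k \<ge> 1/2 \<Longrightarrow> cmod w \<le> \<rho> \<Longrightarrow> cmod (ft (gauss_at k w) \<xi>) \<le> C * (1 + k) ^ 4 * exp (k * \<rho>\<^sup>2 / 2) / (1 + \<xi>\<^sup>2)\<^sup>2"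
    "\<And>(k::real) w \<xi>. k \<ge> 1/2 \<Longrightarrow> cmod w \<le> \<rho> \<Longrightarrow> cmod (ft (\<lambda>x. of_real (bump \<delta> x) * gauss_at k w x) \<xi>) \<le> C * (1 + k) ^ 4 * exp (k * \<rho>\<^sup>2 / 2) / (1 + \<xi>\<^sup>2)\<^sup>2"
    "\<And>(k::real) w \<xi>. k \<ge> 1/2 \<Longrightarrow> cmod w \<le> \<rho> \<Longrightarrow> cmod (ft (gauss_at k w) \<xi> - ft (\<lambda>x. of_real (bump \<delta> x) * gauss_at k w x) \<xi>)
      \<le> C * (1 + k) ^ 4 * exp (\<delta>\<^sup>2 / 8 - k * \<delta>\<^sup>2 / 4 + k * \<rho>\<^sup>2 / 2) / (1 + \<xi>\<^sup>2)\<^sup>2"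
proof -
  obtain b :: "nat \<Rightarrow> real \<Rightarrow> real" and B where b: "b 0 = bump \<delta>"
    "\<And>j x. j < 4 \<Longrightarrow> (b j has_vector_derivative b (Suc j) x) (at x)"
    "continuous_on UNIV (b 4)" and B: "B \<ge> 1" "\<And>j x. j \<le> 4 \<Longrightarrow> \<bar>b j x\<bar> \<le> B"
    and flat: "\<And>j x. j < 4 \<Longrightarrow> \<bar>x\<bar> < \<delta> \<Longrightarrow> b (Suc j) x = 0"
    using bump_chain[OF \<delta>] by blast
  \<comment> \<open>The summand 1 makes C positive when \<open>cut_const\<close> is only known to be
    nonnegative.\<close>
  define C where "C = cut_const * B + 1"
  have C: "C > 0" "cut_const * B \<le> C" using cut_const_nonneg B(1) by (auto simp: C_def intro!: add_nonneg_pos)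
  have mono: "X \<le> C * (1 + k) ^ 4 * E / (1 + \<xi>\<^sup>2)\<^sup>2"
    if "X \<le> cut_const * B * E * (1 + k) ^ 4 / (1 + \<xi>\<^sup>2)\<^sup>2" "E \<ge> 0" "k \<ge> 1/2" for X E k \<xi> :: real
  proof -
    have "cut_const * B * (E * (1 + k) ^ 4) \<le> C * (E * (1 + k) ^ 4)" using C that by (intro mult_right_mono) auto
    then have "cut_const * B * E * (1 + k) ^ 4 / (1 + \<xi>\<^sup>2)\<^sup>2 \<le> C * (1 + k) ^ 4 * E / (1 + \<xi>\<^sup>2)\<^sup>2"
      by (intro divide_right_mono) (auto simp: mult_ac)
    then show ?thesis using that(1) by linarith
  qed
  show ?thesis
  proof (rule that[OF C(1)])
    fix k \<xi> :: real and w :: complex assume k: "k \<ge> 1/2" and w: "cmod w \<le> \<rho>"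
    then have k0: "k \<ge> 0" "k > 0" and w1: "cmod w \<le> 1" using \<rho> by auto
    \<comment> \<open>The constant 1 followed by zero derivatives: the uncut Gaussian as a special
      case.\<close>
    define c :: "nat \<Rightarrow> real \<Rightarrow> real" where "c j x = (if j = 0 then 1 else 0)" for j x
    have "cmod (ft (\<lambda>x. of_real (c 0 x) * gauss_at k w x) \<xi>) \<le> cut_const * B * exp (k * \<rho>\<^sup>2 / 2) * (1 + k) ^ 4 / (1 + \<xi>\<^sup>2)\<^sup>2"
      by (rule ft_cut_gaussian_bound[OF _ _ _ w1 k0(1)])
         (use norm_gauss_at_le(1)[OF k w] B(1) in \<open>auto simp: c_def[abs_def]\<close>)
    then show "cmod (ft (gauss_at k w) \<xi>) \<le> C * (1 + k) ^ 4 * exp (k * \<rho>\<^sup>2 / 2) / (1 + \<xi>\<^sup>2)\<^sup>2"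
      using mono[OF _ _ k] by (simp add: c_def)
    have "cmod (ft (\<lambda>x. of_real (b 0 x) * gauss_at k w x) \<xi>) \<le> cut_const * B * exp (k * \<rho>\<^sup>2 / 2) * (1 + k) ^ 4 / (1 + \<xi>\<^sup>2)\<^sup>2"
      by (rule ft_cut_gaussian_bound[OF b(2,3) B(2) w1 k0(1) exp_ge_zero norm_gauss_at_le(1)[OF k w]])
    then show "cmod (ft (\<lambda>x. of_real (bump \<delta> x) * gauss_at k w x) \<xi>) \<le> C * (1 + k) ^ 4 * exp (k * \<rho>\<^sup>2 / 2) / (1 + \<xi>\<^sup>2)\<^sup>2"
      using mono[OF _ _ k] by (simp add: b(1))
    \<comment> \<open>The derivatives of 1 - bump; from order 1 on they are those of the bump up to
      sign.\<close>
    define d where "d j x = (if j = 0 then 1 - b 0 x else - b j x)" for j x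
    have "cmod (ft (\<lambda>x. of_real (d 0 x) * gauss_at k w x) \<xi>) \<le> cut_const * B * exp (\<delta>\<^sup>2 / 8 - k * \<delta>\<^sup>2 / 4 + k * \<rho>\<^sup>2 / 2) * (1 + k) ^ 4 / (1 + \<xi>\<^sup>2)\<^sup>2"
    proof (rule ft_cut_gaussian_bound[OF _ _ _ w1 k0(1) exp_ge_zero])
      fix j x assume "j < (4::nat)"
      then have "((\<lambda>x. - b j x) has_vector_derivative - b (Suc j) x) (at x)"
        by (intro has_vector_derivative_minus b(2))
      moreover have "((\<lambda>x. 1 - b 0 x) has_vector_derivative 0 - b 1 x) (at x)"
        using b(2)[of 0 x] by (intro has_vector_derivative_diff has_vector_derivative_const) simp
      ultimately show "(d j has_vector_derivative d (Suc j) x) (at x)"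
        by (cases "j = 0") (auto simp: d_def[abs_def])
    next
      show "continuous_on UNIV (d 4)" using b(3) by (auto simp: d_def[abs_def] intro!: continuous_intros)
      show "\<bar>d j x\<bar> \<le> B" if "j \<le> 4" for j x
        using B(2)[OF that, of x] B(1) bump_bounds[of \<delta> x] by (auto simp: d_def b(1))
      fix j x assume "j \<le> (4::nat)" "d j x \<noteq> 0"
      have "\<bar>x\<bar> \<ge> \<delta>"
      proof (rule ccontr)
        assume "\<not> \<bar>x\<bar> \<ge> \<delta>"
        then have "d j x = 0"
          using bump_eq_1[OF \<delta>, of x] flat[of "j - 1" x] \<open>j \<le> 4\<close> by (cases j) (auto simp: d_def b(1))
        then show False using \<open>d j x \<noteq> 0\<close> by simp
      qed
      then show "cmod (gauss_at k w x) \<le> exp (\<delta>\<^sup>2 / 8 - k * \<delta>\<^sup>2 / 4 + k * \<rho>\<^sup>2 / 2) * exp (- x\<^sup>2 / 8)"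
        using norm_gauss_at_le(2)[OF k w] \<delta> by simp
    qed
    moreover have "ft (\<lambda>x. of_real (d 0 x) * gauss_at k w x) \<xi> = ft (gauss_at k w) \<xi> - ft (\<lambda>x. of_real (bump \<delta> x) * gauss_at k w x) \<xi>"
      using ft_diff[OF integrable_gauss_at[OF k0(2), of w] integrable_bump_gauss[OF k0(2), of \<delta> w], of \<xi>]
      by (simp add: d_def b(1) algebra_simps)
    ultimately show "cmod (ft (gauss_at k w) \<xi> - ft (\<lambda>x. of_real (bump \<delta> x) * gauss_at k w x) \<xi>)
      \<le> C * (1 + k) ^ 4 * exp (\<delta>\<^sup>2 / 8 - k * \<delta>\<^sup>2 / 4 + k * \<rho>\<^sup>2 / 2) / (1 + \<xi>\<^sup>2)\<^sup>2"
      using mono[OF _ _ k] by simp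
  qed
qed

text \<open>After division by \<open>A * q i\<close> all factors lie in the unit disc, where
  \<open>norm_prod_diff\<close> bounds the difference of the products by the sum of the
  differences.\<close>

lemma norm_prod_diff_scaled:
  fixes a a' :: "'i \<Rightarrow> complex" and q :: "'i \<Rightarrow> real" and A E :: real
  assumes "finite I" and q: "\<And>i. i \<in> I \<Longrightarrow> q i > 0" and A: "A > 0"
    and a: "\<And>i. i \<in> I \<Longrightarrow> cmod (a i) \<le> A * q i" "\<And>i. i \<in> I \<Longrightarrow> cmod (a' i) \<le> A * q i"
    and D: "\<And>i. i \<in> I \<Longrightarrow> cmod (a i - a' i) \<le> A * E * q i"
  shows "cmod ((\<Prod>i\<in>I. a i) - (\<Prod>i\<in>I. a' i)) \<le> A ^ card I * (card I * E) * (\<Prod>i\<in>I. q i)"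
proof -
  define z where "z i = a i / of_real (A * q i)" for i
  define z' where "z' i = a' i / of_real (A * q i)" for i
  have Aq: "A * q i > 0" if "i \<in> I" for i using A q[OF that] by simp
  have az: "a i = of_real (A * q i) * z i" "a' i = of_real (A * q i) * z' i" if "i \<in> I" for i
    using Aq[OF that] by (auto simp: z_def z'_def)
  have 1: "cmod (z i) \<le> 1" "cmod (z' i) \<le> 1" if "i \<in> I" for i
    using Aq[OF that] a[OF that] by (auto simp: z_def z'_def norm_divide abs_of_pos simp del: of_real_mult)
  have 2: "cmod (z i - z' i) \<le> E" if "i \<in> I" for i
  proof -
    have "cmod (z i - z' i) = cmod (a i - a' i) / (A * q i)"
      using Aq[OF that] by (simp add: z_def z'_def norm_divide abs_of_pos diff_divide_distrib[symmetric] del: of_real_mult)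
    also have "\<dots> \<le> (A * E * q i) / (A * q i)"
      using Aq[OF that] D[OF that] by (intro divide_right_mono) auto
    also have "\<dots> = E" using A q[OF that] by simp
    finally show ?thesis .
  qed
  have p: "(\<Prod>i\<in>I. a i) = of_real (\<Prod>i\<in>I. A * q i) * (\<Prod>i\<in>I. z i)" "(\<Prod>i\<in>I. a' i) = of_real (\<Prod>i\<in>I. A * q i) * (\<Prod>i\<in>I. z' i)"
  proof -
    have "(\<Prod>i\<in>I. a i) = (\<Prod>i\<in>I. of_real (A * q i) * z i)" "(\<Prod>i\<in>I. a' i) = (\<Prod>i\<in>I. of_real (A * q i) * z' i)"
      by (intro prod.cong refl az; assumption)+
    then show "(\<Prod>i\<in>I. a i) = of_real (\<Prod>i\<in>I. A * q i) * (\<Prod>i\<in>I. z i)" "(\<Prod>i\<in>I. a' i) = of_real (\<Prod>i\<in>I. A * q i) * (\<Prod>i\<in>I. z' i)"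
      unfolding of_real_prod by (simp_all only: prod.distrib)
  qed
  have P: "(\<Prod>i\<in>I. A * q i) \<ge> 0" using Aq by (intro prod_nonneg) (auto intro: less_imp_le)
  have "cmod ((\<Prod>i\<in>I. a i) - (\<Prod>i\<in>I. a' i)) = (\<Prod>i\<in>I. A * q i) * cmod ((\<Prod>i\<in>I. z i) - (\<Prod>i\<in>I. z' i))"
    unfolding p right_diff_distrib[symmetric] norm_mult norm_of_real using P by simp
  also have "\<dots> \<le> (\<Prod>i\<in>I. A * q i) * (\<Sum>i\<in>I. cmod (z i - z' i))"
    by (intro mult_left_mono norm_prod_diff 1 P)
  also have "\<dots> \<le> (\<Prod>i\<in>I. A * q i) * (\<Sum>i\<in>I. E)"
    by (intro mult_left_mono sum_mono 2 P)
  also have "\<dots> = A ^ card I * (card I * E) * (\<Prod>i\<in>I. q i)"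
    by (simp add: prod.distrib mult_ac)
  finally show ?thesis .
qed

text \<open>The factor \<open>exp (- k * \<delta>\<^sup>2 / 4)\<close> gained from the truncation in one coordinate beats the
  growth \<open>exp (k * \<rho>\<^sup>2 / 2)\<close> in each of the \<open>DIM('a)\<close> coordinates, because of the choice of \<open>\<rho>\<close>.\<close>

lemma product_truncation_bound:
  fixes \<delta> :: real
  defines "\<rho> \<equiv> \<delta> / (2 * real DIM('a::euclidean_space))"
  assumes \<delta>: "0 < \<delta>" "\<delta> \<le> 1"
  obtains M where "M \<ge> 0"
    "\<And>(k::real) w (\<xi>::'a). k \<ge> 1/2 \<Longrightarrow> (\<And>b. b \<in> Basis \<Longrightarrow> cmod (w b) \<le> \<rho>) \<Longrightarrow>
      sqrt (k / (2 * pi)) ^ DIM('a) * cmod ((\<Prod>b\<in>Basis. ft (gauss_at k (w b)) (\<xi> \<bullet> b))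
        - (\<Prod>b\<in>Basis. ft (\<lambda>x. of_real (bump \<delta> x) * gauss_at k (w b) x) (\<xi> \<bullet> b)))
      \<le> M * (\<Prod>b\<in>Basis. inverse ((1 + (\<xi> \<bullet> b)\<^sup>2)\<^sup>2))"
proof -
  define N where "N = DIM('a)"
  have N: "N \<ge> 1" by (simp add: N_def Suc_leI)
  have "\<delta> \<le> 2 * real N" using \<delta> N by linarith
  then have \<rho>: "0 \<le> \<rho>" "\<rho> \<le> 1" using \<delta> N by (auto simp: \<rho>_def N_def)
  obtain C where C: "C > 0"
    "\<And>(k::real) w \<xi>. k \<ge> 1/2 \<Longrightarrow> cmod w \<le> \<rho> \<Longrightarrow> cmod (ft (gauss_at k w) \<xi>) \<le> C * (1 + k) ^ 4 * exp (k * \<rho>\<^sup>2 / 2) / (1 + \<xi>\<^sup>2)\<^sup>2"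
    "\<And>(k::real) w \<xi>. k \<ge> 1/2 \<Longrightarrow> cmod w \<le> \<rho> \<Longrightarrow> cmod (ft (\<lambda>x. of_real (bump \<delta> x) * gauss_at k w x) \<xi>) \<le> C * (1 + k) ^ 4 * exp (k * \<rho>\<^sup>2 / 2) / (1 + \<xi>\<^sup>2)\<^sup>2"
    "\<And>(k::real) w \<xi>. k \<ge> 1/2 \<Longrightarrow> cmod w \<le> \<rho> \<Longrightarrow> cmod (ft (gauss_at k w) \<xi> - ft (\<lambda>x. of_real (bump \<delta> x) * gauss_at k w x) \<xi>)
      \<le> C * (1 + k) ^ 4 * exp (\<delta>\<^sup>2 / 8 - k * \<delta>\<^sup>2 / 4 + k * \<rho>\<^sup>2 / 2) / (1 + \<xi>\<^sup>2)\<^sup>2"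
    using truncated_gauss_bounds[OF \<delta>(1) \<rho>] by blast
  \<comment> \<open>Each of the N factors contributes (1 + k)^4, and the normalising square roots
    contribute at most (1 + k)^N together, hence the exponent 5 N.\<close>
  obtain M0 where M0: "M0 \<ge> 0" "\<And>k. k \<ge> 0 \<Longrightarrow> (1 + k) ^ (5 * N) * exp (- (\<delta>\<^sup>2 / 8) * k) \<le> M0"
    using power_exp_bounded[of "\<delta>\<^sup>2 / 8" "5 * N"] \<delta> by auto
  define M where "M = C ^ N * real N * exp (\<delta>\<^sup>2 / 8) * M0"
  show ?thesis
  proof (rule that[of M])
    show "M \<ge> 0" using C M0 by (simp add: M_def)
    fix k :: real and w :: "'a \<Rightarrow> complex" and \<xi> :: 'a
    assume k: "k \<ge> 1/2" and w: "\<And>b. b \<in> Basis \<Longrightarrow> cmod (w b) \<le> \<rho>"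
    define A where "A = C * (1 + k) ^ 4 * exp (k * \<rho>\<^sup>2 / 2)"
    define E where "E = exp (\<delta>\<^sup>2 / 8 - k * \<delta>\<^sup>2 / 4)"
    define P where "P = (\<Prod>b\<in>Basis. inverse ((1 + (\<xi> \<bullet> b)\<^sup>2)\<^sup>2))"
    have P: "P \<ge> 0" unfolding P_def by (intro prod_nonneg) auto
    have A: "A > 0" using C k by (simp add: A_def)
    have q: "inverse ((1 + x\<^sup>2)\<^sup>2) > 0" for x :: real
      by (intro positive_imp_inverse_positive zero_less_power add_pos_nonneg) auto
    have "cmod ((\<Prod>b\<in>Basis. ft (gauss_at k (w b)) (\<xi> \<bullet> b))
        - (\<Prod>b\<in>Basis. ft (\<lambda>x. of_real (bump \<delta> x) * gauss_at k (w b) x) (\<xi> \<bullet> b)))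
      \<le> A ^ card (Basis::'a set) * (card (Basis::'a set) * E) * (\<Prod>b\<in>Basis. inverse ((1 + (\<xi> \<bullet> b)\<^sup>2)\<^sup>2))"
    proof (rule norm_prod_diff_scaled)
      show "A > 0" by (rule A)
      show "inverse ((1 + (\<xi> \<bullet> b)\<^sup>2)\<^sup>2) > 0" for b by (rule q)
      fix b :: 'a assume b: "b \<in> Basis"
      show "cmod (ft (gauss_at k (w b)) (\<xi> \<bullet> b)) \<le> A * inverse ((1 + (\<xi> \<bullet> b)\<^sup>2)\<^sup>2)"
        using C(2)[OF k w[OF b]] by (simp only: A_def divide_inverse)
      show "cmod (ft (\<lambda>x. of_real (bump \<delta> x) * gauss_at k (w b) x) (\<xi> \<bullet> b)) \<le> A * inverse ((1 + (\<xi> \<bullet> b)\<^sup>2)\<^sup>2)"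
        using C(3)[OF k w[OF b]] by (simp only: A_def divide_inverse)
      have "A * E = C * (1 + k) ^ 4 * exp (\<delta>\<^sup>2 / 8 - k * \<delta>\<^sup>2 / 4 + k * \<rho>\<^sup>2 / 2)"
        by (simp add: A_def E_def exp_add)
      then show "cmod (ft (gauss_at k (w b)) (\<xi> \<bullet> b) - ft (\<lambda>x. of_real (bump \<delta> x) * gauss_at k (w b) x) (\<xi> \<bullet> b)) \<le> A * E * inverse ((1 + (\<xi> \<bullet> b)\<^sup>2)\<^sup>2)"
        using C(4)[OF k w[OF b]] by (simp only: divide_inverse)
    qed simp
    then have "sqrt (k / (2 * pi)) ^ N * cmod ((\<Prod>b\<in>Basis. ft (gauss_at k (w b)) (\<xi> \<bullet> b))
        - (\<Prod>b\<in>Basis. ft (\<lambda>x. of_real (bump \<delta> x) * gauss_at k (w b) x) (\<xi> \<bullet> b)))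
      \<le> sqrt (k / (2 * pi)) ^ N * (A ^ N * (N * E) * P)"
      unfolding N_def P_def using k by (intro mult_left_mono) auto
    also have "\<dots> \<le> (1 + k) ^ N * (A ^ N * (N * E) * P)"
    proof (intro mult_right_mono power_mono)
      have "k / (2 * pi) \<le> k" using k pi_ge_two by (simp add: field_simps mult_le_cancel_left1)
      also have "k \<le> (1 + k)\<^sup>2" using k by (simp add: power2_eq_square algebra_simps)
      finally show "sqrt (k / (2 * pi)) \<le> 1 + k" using k by (intro real_le_lsqrt) auto
    qed (use k A P in \<open>auto simp: E_def\<close>)
    also have "\<dots> = C ^ N * N * ((1 + k) ^ (5 * N)) * (exp (real N * (k * \<rho>\<^sup>2 / 2)) * E) * P"
    proof -
      have "A ^ N = C ^ N * (1 + k) ^ (4 * N) * exp (real N * (k * \<rho>\<^sup>2 / 2))"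
        unfolding A_def power_mult_distrib power_mult exp_of_nat_mult ..
      moreover have "(1 + k) ^ (5 * N) = (1 + k) ^ N * (1 + k) ^ (4 * N)"
        by (simp add: power_add[symmetric])
      ultimately show ?thesis by (simp add: mult_ac)
    qed
    also have "\<dots> \<le> C ^ N * N * ((1 + k) ^ (5 * N)) * (exp (\<delta>\<^sup>2 / 8) * exp (- (\<delta>\<^sup>2 / 8) * k)) * P"
    proof (intro mult_right_mono mult_left_mono)
      \<comment> \<open>With \<rho> = \<delta> / (2 N) the total growth is k \<delta>^2 / (8 N), at
        most half of the gain k \<delta>^2 / 4; the other half beats the powers of 1 + k.\<close>
      have "real N * (k * \<rho>\<^sup>2 / 2) = k * \<delta>\<^sup>2 / 8 / N"
        using N by (simp add: \<rho>_def N_def power2_eq_square field_simps)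
      also have "\<dots> \<le> k * \<delta>\<^sup>2 / 8 / 1"
        using N k by (intro divide_left_mono) auto
      finally have "real N * (k * \<rho>\<^sup>2 / 2) + (\<delta>\<^sup>2 / 8 - k * \<delta>\<^sup>2 / 4) \<le> \<delta>\<^sup>2 / 8 + - (\<delta>\<^sup>2 / 8) * k"
        by (simp add: algebra_simps)
      then show "exp (real N * (k * \<rho>\<^sup>2 / 2)) * E \<le> exp (\<delta>\<^sup>2 / 8) * exp (- (\<delta>\<^sup>2 / 8) * k)"
        unfolding E_def exp_add[symmetric] by simp
    qed (use C k P in auto)
    also have "\<dots> = C ^ N * N * exp (\<delta>\<^sup>2 / 8) * ((1 + k) ^ (5 * N) * exp (- (\<delta>\<^sup>2 / 8) * k)) * P" by (simp add: mult_ac)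
    also have "\<dots> \<le> C ^ N * N * exp (\<delta>\<^sup>2 / 8) * M0 * P"
      using M0(2)[of k] C k P by (intro mult_right_mono mult_left_mono) auto
    finally show "sqrt (k / (2 * pi)) ^ DIM('a) * cmod ((\<Prod>b\<in>Basis. ft (gauss_at k (w b)) (\<xi> \<bullet> b))
        - (\<Prod>b\<in>Basis. ft (\<lambda>x. of_real (bump \<delta> x) * gauss_at k (w b) x) (\<xi> \<bullet> b)))
      \<le> M * (\<Prod>b\<in>Basis. inverse ((1 + (\<xi> \<bullet> b)\<^sup>2)\<^sup>2))"
      by (simp add: M_def P_def N_def)
  qed
qed

subsection \<open>The heat flow of the frequency function\<close>

text \<open>Euler's integral for Gamma, rescaled by r. With r a multiple of |xi|^2 it represents the
  power that cancels the weight.\<close>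

lemma powr_exp_integral:
  fixes s r :: real
  assumes s: "s > 0" and r: "r > 0"
  shows "integrable lborel (\<lambda>t. indicator {0<..} t * (t powr (s - 1) * exp (- r * t)))"
    and "(LINT t|lborel. indicator {0<..} t * (t powr (s - 1) * exp (- r * t))) = Gamma s * r powr (- s)"
proof -
  define f where "f t = indicator {0<..} t * (t powr (s - 1) * exp (- t))" for t :: real
  have [measurable]: "f \<in> borel_measurable borel" unfolding f_def[abs_def] by measurable
  have hi: "((\<lambda>t. t powr (s - 1) / exp t) has_integral Gamma s) {0..}"
    by (rule Gamma_integral_real[OF s])
  have "((\<lambda>t. if t \<in> {0..} then t powr (s - 1) / exp t else 0) has_integral Gamma s) UNIV"
    using hi by (simp only: has_integral_restrict_UNIV)
  moreover have "(\<lambda>t. if t \<in> {0..} then t powr (s - 1) / exp t else 0) = f"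
    by (auto simp: f_def fun_eq_iff exp_minus divide_inverse indicator_def)
  ultimately have hf: "(f has_integral Gamma s) UNIV" by simp
  have "f absolutely_integrable_on UNIV"
    using hf by (intro nonnegative_absolutely_integrable_1) (auto simp: f_def has_integral_integrable)
  then have fi: "integrable lborel f"
    by (simp add: set_integrable_def integrable_completion)
  have fI: "(LINT t|lborel. f t) = Gamma s"
    using has_integral_integral_lborel[OF fi] hf by (rule has_integral_unique)
  have eq: "f (0 + r * t) = r powr (s - 1) * (indicator {0<..} t * (t powr (s - 1) * exp (- r * t)))" for t
    using r by (auto simp: f_def powr_mult zero_less_mult_iff split: split_indicator)
  have "integrable lborel (\<lambda>t. f (0 + r * t))"
    using lborel_integrable_real_affine[OF fi, of r 0] r by simp
  then have "integrable lborel (\<lambda>t. r powr (- (s - 1)) * f (0 + r * t))" by (rule integrable_mult_right)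
  moreover have "r powr (- (s - 1)) * f (0 + r * t) = indicator {0<..} t * (t powr (s - 1) * exp (- r * t))" for t
    unfolding eq mult.assoc[symmetric] using r by (simp add: powr_add[symmetric])
  ultimately show "integrable lborel (\<lambda>t. indicator {0<..} t * (t powr (s - 1) * exp (- r * t)))" by (simp only:)
  have "Gamma s = r * (LINT t|lborel. f (0 + r * t))"
    using lborel_integral_real_affine[of r f 0] r fI by simp
  also have "(LINT t|lborel. f (0 + r * t)) = r powr (s - 1) * (LINT t|lborel. indicator {0<..} t * (t powr (s - 1) * exp (- r * t)))"
    unfolding eq by (rule integral_mult_right_zero)
  also have "r * (r powr (s - 1) * (LINT t|lborel. indicator {0<..} t * (t powr (s - 1) * exp (- r * t)))) =
    r powr s * (LINT t|lborel. indicator {0<..} t * (t powr (s - 1) * exp (- r * t)))"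
    using r by (simp add: powr_diff)
  finally show "(LINT t|lborel. indicator {0<..} t * (t powr (s - 1) * exp (- r * t))) = Gamma s * r powr (- s)"
    using r by (simp add: powr_minus field_simps)
qed

lemma norm_powr_cancel:
  fixes \<xi> :: "'a::real_normed_vector"
  assumes "\<xi> \<noteq> 0" "c > 0"
  shows "norm \<xi> powr (2 * s) * (c * (norm \<xi>)\<^sup>2) powr (- s) = c powr (- s)"
proof -
  have "(c * (norm \<xi>)\<^sup>2) powr (- s) = c powr (- s) * ((norm \<xi>)\<^sup>2 powr (- s))"
    by (rule powr_mult)
  also have "(norm \<xi>)\<^sup>2 powr (- s) = norm \<xi> powr (- (2 * s))"
    using powr_powr[of "norm \<xi>" 2 "- s"] by simp
  finally show ?thesis using assms by (simp add: powr_add[symmetric])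
qed

text \<open>Integrating in t first leaves Gamma(s) c^(-s) |h|, so the double integral converges
  although h need not be integrable against the weight alone. The parameter c is 1 for the
  subordination identity and 1/2 for the majorant.\<close>

lemma integrable_subordination:
  fixes h :: "'a::euclidean_space \<Rightarrow> real" and s c :: real
  assumes s: "s > 0" and c: "c > 0" and h: "integrable lborel h"
  shows "integrable (lborel \<Otimes>\<^sub>M lborel) (\<lambda>p. norm (fst p) powr (2 * s) * h (fst p) *
    (indicator {0<..} (snd p) * (snd p powr (s - 1) * exp (- (c * (norm (fst p))\<^sup>2) * snd p))))"
proof (rule lborel_pair.Fubini_integrable)
  note [measurable] = borel_measurable_integrable[OF h]
  show "(\<lambda>p. norm (fst p) powr (2 * s) * h (fst p) *
    (indicator {0<..} (snd p) * (snd p powr (s - 1) * exp (- (c * (norm (fst p))\<^sup>2) * snd p)))) \<in> borel_measurable (lborel \<Otimes>\<^sub>M lborel)"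
    by measurable
  have ne: "AE \<xi> in lborel. \<xi> \<noteq> (0::'a)" by (rule AE_lborel_singleton)
  have r: "c * (norm \<xi>)\<^sup>2 > 0" if "\<xi> \<noteq> 0" for \<xi> :: 'a using that c by simp
  show "AE \<xi> in lborel. integrable lborel (\<lambda>t. norm (fst (\<xi>, t)) powr (2 * s) * h (fst (\<xi>, t)) *
    (indicator {0<..} (snd (\<xi>, t)) * (snd (\<xi>, t) powr (s - 1) * exp (- (c * (norm (fst (\<xi>, t)))\<^sup>2) * snd (\<xi>, t)))))"
    using ne
  proof eventually_elim
    case (elim \<xi>)
    show ?case unfolding fst_conv snd_conv
      by (intro integrable_mult_right powr_exp_integral(1) s r elim)
  qed
  have "integrable lborel (\<lambda>\<xi>. Gamma s * c powr (- s) * \<bar>h \<xi>\<bar>)" using h by simp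
  then show "integrable lborel (\<lambda>\<xi>. LINT t|lborel. norm (norm (fst (\<xi>, t)) powr (2 * s) * h (fst (\<xi>, t)) *
    (indicator {0<..} (snd (\<xi>, t)) * (snd (\<xi>, t) powr (s - 1) * exp (- (c * (norm (fst (\<xi>, t)))\<^sup>2) * snd (\<xi>, t))))))"
  proof (rule integrable_cong_AE_imp)
    show "AE \<xi> in lborel. Gamma s * c powr (- s) * \<bar>h \<xi>\<bar> = (LINT t|lborel. norm (norm (fst (\<xi>, t)) powr (2 * s) * h (fst (\<xi>, t)) *
      (indicator {0<..} (snd (\<xi>, t)) * (snd (\<xi>, t) powr (s - 1) * exp (- (c * (norm (fst (\<xi>, t)))\<^sup>2) * snd (\<xi>, t))))))"
      using ne
    proof eventually_elim
      case (elim \<xi>)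
      have "(LINT t|lborel. norm (norm \<xi> powr (2 * s) * h \<xi> * (indicator {0<..} t * (t powr (s - 1) * exp (- (c * (norm \<xi>)\<^sup>2) * t)))))
        = (LINT t|lborel. (norm \<xi> powr (2 * s) * \<bar>h \<xi>\<bar>) * (indicator {0<..} t * (t powr (s - 1) * exp (- (c * (norm \<xi>)\<^sup>2) * t))))"
        by (intro Bochner_Integration.integral_cong refl) (auto simp: abs_mult)
      also have "\<dots> = (norm \<xi> powr (2 * s) * \<bar>h \<xi>\<bar>) * (Gamma s * (c * (norm \<xi>)\<^sup>2) powr (- s))"
        by (simp only: integral_mult_right_zero powr_exp_integral(2)[OF s r[OF elim]])
      also have "\<dots> = Gamma s * \<bar>h \<xi>\<bar> * (norm \<xi> powr (2 * s) * (c * (norm \<xi>)\<^sup>2) powr (- s))" by (simp only: mult_ac)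
      finally show ?case unfolding fst_conv snd_conv norm_powr_cancel[OF elim c] by (simp only: mult_ac)
    qed
  qed measurable
qed

text \<open>exp (i (y + \<zeta> e) . xi), the exponential at a point of the complex line through y
  in direction e.\<close>

definition wave :: "'a::euclidean_space \<Rightarrow> 'a \<Rightarrow> complex \<Rightarrow> 'a \<Rightarrow> complex" where
  "wave y e \<zeta> \<xi> = exp (\<i> * of_real (y \<bullet> \<xi>) + \<i> * \<zeta> * of_real (e \<bullet> \<xi>))"

lemma wave_of_real: "wave y e (of_real r) \<xi> = wave (y + r *\<^sub>R e) 0 0 \<xi>"
  by (simp add: wave_def inner_add_left algebra_simps)

lemma norm_wave_le:
  assumes "norm e \<le> 1" "cmod \<zeta> \<le> R"
  shows "cmod (wave y e \<zeta> \<xi>) \<le> exp (R * norm \<xi>)"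
proof -
  have "\<bar>Im \<zeta> * (e \<bullet> \<xi>)\<bar> \<le> cmod \<zeta> * (norm e * norm \<xi>)"
    unfolding abs_mult by (intro mult_mono Cauchy_Schwarz_ineq2 abs_Im_le_cmod) auto
  also have "\<dots> \<le> R * (1 * norm \<xi>)"
    using assms order_trans[OF norm_ge_zero assms(2)] by (intro mult_mono) auto
  finally show ?thesis by (simp add: wave_def)
qed

lemma wave_measurable [measurable]: "wave y e \<zeta> \<in> borel_measurable borel"
  unfolding wave_def[abs_def] by (intro borel_measurable_continuous_onI continuous_intros)

text \<open>The heat flow depends on g alone, through its weighted norm; the link with a function u
  is added in a later locale.\<close>

locale frequency_function =
  fixes s :: real and g :: "'a::euclidean_space \<Rightarrow> complex"
  assumes s: "1 < s" "s < 2" "2 * s < DIM('a)"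
    and g_measurable [measurable]: "g \<in> borel_measurable borel"
    and g_finite: "weighted_sq s g < \<infinity>"
begin

text \<open>Cauchy-Schwarz against the dual weight |xi|^(-2 s), which is integrable near 0 because 2
  s < N.\<close>

lemma integrable_g_exp:
  assumes \<tau>: "\<tau> > 0"
  shows "integrable lborel (\<lambda>\<xi>. cmod (g \<xi>) * exp (R * norm \<xi> - \<tau> * (norm \<xi>)\<^sup>2))"
proof -
  define r where "r \<xi> = complex_of_real (exp (R * norm \<xi> - \<tau> * (norm \<xi>)\<^sup>2))" for \<xi> :: 'a
  have [measurable]: "r \<in> borel_measurable borel" unfolding r_def[abs_def] by measurable
  have "weighted_sq (- s) r \<le> (\<integral>\<^sup>+\<xi>. ennreal (exp (R\<^sup>2 / \<tau>)) * ennreal (norm (\<xi>::'a) powr (- (2 * s)) * exp (- \<tau> * (norm \<xi>)\<^sup>2)) \<partial>lborel)"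
    unfolding weighted_sq_def
  proof (rule nn_integral_mono)
    fix \<xi> :: 'a
    \<comment> \<open>The norm squares the exponential, so the exponent doubles; half of the doubled
      Gaussian absorbs the linear term 2 R |xi| at the cost of R^2 / \<tau>.\<close>
    have "0 \<le> (R / sqrt \<tau> - sqrt \<tau> * norm \<xi>)\<^sup>2" by simp
    also have "\<dots> = R\<^sup>2 / \<tau> - 2 * R * norm \<xi> + \<tau> * (norm \<xi>)\<^sup>2"
      using \<tau> by (simp add: power2_diff power_divide power_mult_distrib)
    finally have "2 * (R * norm \<xi> - \<tau> * (norm \<xi>)\<^sup>2) \<le> R\<^sup>2 / \<tau> + - \<tau> * (norm \<xi>)\<^sup>2" by simp
    then have "(cmod (r \<xi>))\<^sup>2 \<le> exp (R\<^sup>2 / \<tau>) * exp (- \<tau> * (norm \<xi>)\<^sup>2)"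
      unfolding exp_add[symmetric] r_def by (simp flip: exp_double)
    then have "norm \<xi> powr (- (2 * s)) * (cmod (r \<xi>))\<^sup>2 \<le> norm \<xi> powr (- (2 * s)) * (exp (R\<^sup>2 / \<tau>) * exp (- \<tau> * (norm \<xi>)\<^sup>2))"
      by (intro mult_left_mono) auto
    then show "ennreal (norm \<xi> powr (2 * - s) * (cmod (r \<xi>))\<^sup>2) \<le> ennreal (exp (R\<^sup>2 / \<tau>)) * ennreal (norm \<xi> powr (- (2 * s)) * exp (- \<tau> * (norm \<xi>)\<^sup>2))"
      by (simp add: ennreal_mult[symmetric] mult_ac ennreal_leI)
  qed
  also have "\<dots> = ennreal (exp (R\<^sup>2 / \<tau>)) * (\<integral>\<^sup>+\<xi>. ennreal (norm (\<xi>::'a) powr (- (2 * s)) * exp (- \<tau> * (norm \<xi>)\<^sup>2)) \<partial>lborel)"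
    by (rule nn_integral_cmult) auto
  also have "\<dots> < \<infinity>"
    using nn_integral_norm_powr_gaussian_finite[of "2 * s" \<tau>, where 'a='a] s \<tau> by (simp add: ennreal_mult_less_top)
  finally have "(\<integral>\<^sup>+\<xi>. ennreal (cmod (g \<xi>) * cmod (r \<xi>)) \<partial>lborel) < \<infinity>"
    by (intro weighted_L1_finite[OF _ _ g_finite]) auto
  then show ?thesis by (intro integrableI_bounded) (auto simp: r_def)
qed

text \<open>One half of the Gaussian absorbs the weight, which is at most (1 + |xi|^2)^2 because s <
  2; the other half is left for \<open>integrable_g_exp\<close>.\<close>

lemma integrable_weight_g_exp:
  assumes \<tau>: "\<tau> > 0"
  shows "integrable lborel (\<lambda>\<xi>. norm \<xi> powr (2 * s) * cmod (g \<xi>) * exp (R * norm \<xi> - \<tau> * (norm \<xi>)\<^sup>2))"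
proof -
  obtain M where M: "M \<ge> 0" "\<And>k. k \<ge> 0 \<Longrightarrow> (1 + k) ^ 2 * exp (- (\<tau> / 2) * k) \<le> M"
    using power_exp_bounded[of "\<tau> / 2" 2] \<tau> by auto
  show ?thesis
  proof (rule Bochner_Integration.integrable_bound)
    show "integrable lborel (\<lambda>\<xi>. M * (cmod (g \<xi>) * exp (R * norm \<xi> - (\<tau> / 2) * (norm \<xi>)\<^sup>2)))"
      using \<tau> by (intro integrable_mult_right integrable_g_exp) auto
    have "norm \<xi> powr (2 * s) * cmod (g \<xi>) * exp (R * norm \<xi> - \<tau> * (norm \<xi>)\<^sup>2) \<le>
      M * (cmod (g \<xi>) * exp (R * norm \<xi> - (\<tau> / 2) * (norm \<xi>)\<^sup>2))" for \<xi>
    proof -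
      have "norm \<xi> powr (2 * s) \<le> (1 + (norm \<xi>)\<^sup>2) ^ 2" using s by (intro norm_powr_le_power) auto
      then have "norm \<xi> powr (2 * s) * exp (- (\<tau> / 2) * (norm \<xi>)\<^sup>2) \<le> (1 + (norm \<xi>)\<^sup>2) ^ 2 * exp (- (\<tau> / 2) * (norm \<xi>)\<^sup>2)"
        by (intro mult_right_mono) auto
      also have "\<dots> \<le> M" by (rule M(2)) simp
      finally have "(norm \<xi> powr (2 * s) * exp (- (\<tau> / 2) * (norm \<xi>)\<^sup>2)) * (cmod (g \<xi>) * exp (R * norm \<xi> - (\<tau> / 2) * (norm \<xi>)\<^sup>2))
        \<le> M * (cmod (g \<xi>) * exp (R * norm \<xi> - (\<tau> / 2) * (norm \<xi>)\<^sup>2))"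
        by (intro mult_right_mono) auto
      moreover have "exp (- (\<tau> / 2) * (norm \<xi>)\<^sup>2) * exp (R * norm \<xi> - (\<tau> / 2) * (norm \<xi>)\<^sup>2) = exp (R * norm \<xi> - \<tau> * (norm \<xi>)\<^sup>2)"
        by (simp add: exp_add[symmetric])
      ultimately show ?thesis by (simp add: mult_ac)
    qed
    then show "AE \<xi> in lborel. norm (norm \<xi> powr (2 * s) * cmod (g \<xi>) * exp (R * norm \<xi> - \<tau> * (norm \<xi>)\<^sup>2)) \<le>
      norm (M * (cmod (g \<xi>) * exp (R * norm \<xi> - (\<tau> / 2) * (norm \<xi>)\<^sup>2)))"
      using M(1) by (intro AE_I2) auto
  qed measurable
qed

definition heat :: "real \<Rightarrow> 'a \<Rightarrow> 'a \<Rightarrow> complex \<Rightarrow> complex" where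
  "heat \<tau> y e \<zeta> = (LINT \<xi>|lborel. g \<xi> * (wave y e \<zeta> \<xi> * of_real (exp (- \<tau> * (norm \<xi>)\<^sup>2))))"

definition heat_frac :: "real \<Rightarrow> 'a \<Rightarrow> 'a \<Rightarrow> complex \<Rightarrow> complex" where
  "heat_frac t y e \<zeta> = (LINT \<xi>|lborel. of_real (norm \<xi> powr (2 * s)) * g \<xi> * (wave y e \<zeta> \<xi> * of_real (exp (- t * (norm \<xi>)\<^sup>2))))"

lemma heat_of_real: "heat \<tau> y e (of_real r) = heat \<tau> (y + r *\<^sub>R e) 0 0"
  by (simp add: heat_def wave_of_real)

lemma heat_integrand_bound:
  assumes "norm e \<le> 1" "cmod \<zeta> \<le> R"
  shows "cmod (wave y e \<zeta> \<xi> * of_real (exp (- t * (norm \<xi>)\<^sup>2))) \<le> exp (R * norm \<xi> - t * (norm \<xi>)\<^sup>2)"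
proof -
  have "cmod (wave y e \<zeta> \<xi>) * exp (- t * (norm \<xi>)\<^sup>2) \<le> exp (R * norm \<xi>) * exp (- t * (norm \<xi>)\<^sup>2)"
    by (intro mult_right_mono norm_wave_le assms) auto
  then show ?thesis by (simp add: norm_mult exp_add[symmetric])
qed

lemma integrable_heat:
  assumes "\<tau> > 0" "norm e \<le> 1"
  shows "integrable lborel (\<lambda>\<xi>. g \<xi> * (wave y e \<zeta> \<xi> * of_real (exp (- \<tau> * (norm \<xi>)\<^sup>2))))"
  by (rule Bochner_Integration.integrable_bound[OF integrable_g_exp[OF assms(1), of "cmod \<zeta>"]])
     (use heat_integrand_bound[OF assms(2) order_refl] in \<open>auto simp: norm_mult intro!: mult_left_mono\<close>)

lemma integrable_heat_frac:
  assumes "t > 0" "norm e \<le> 1"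
  shows "integrable lborel (\<lambda>\<xi>. of_real (norm \<xi> powr (2 * s)) * g \<xi> * (wave y e \<zeta> \<xi> * of_real (exp (- t * (norm \<xi>)\<^sup>2))))"
  by (rule Bochner_Integration.integrable_bound[OF integrable_weight_g_exp[OF assms(1), of "cmod \<zeta>"]])
     (use heat_integrand_bound[OF assms(2) order_refl] in \<open>auto simp: norm_mult intro!: mult_left_mono\<close>)

text \<open>Termwise integration of the exponential series in \<zeta> gives a power series. The
  series of moduli sums to at most |g| exp (|\<zeta>| |xi| - \<tau> |xi|^2), which dominates all
  partial sums; since R is arbitrary, the function is entire.\<close>

lemma heat_holomorphic:
  assumes \<tau>: "\<tau> > 0" and e: "norm e \<le> 1"
  shows "heat \<tau> y e holomorphic_on ball 0 R"
proof -
  define w where "w \<xi> = g \<xi> * (exp (\<i> * of_real (y \<bullet> \<xi>)) * of_real (exp (- \<tau> * (norm \<xi>)\<^sup>2)))" for \<xi>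
  have [measurable]: "(\<lambda>\<xi>. exp (\<i> * complex_of_real (y \<bullet> \<xi>))) \<in> borel_measurable borel"
    by (intro borel_measurable_continuous_onI continuous_intros)
  have [measurable]: "w \<in> borel_measurable borel" unfolding w_def[abs_def] by measurable
  show ?thesis
  proof (rule power_series_holomorphic[where a="\<lambda>n. LINT \<xi>|lborel. w \<xi> * ((\<i> * of_real (e \<bullet> \<xi>)) ^ n /\<^sub>R fact n)"])
  fix \<zeta> :: complex assume "\<zeta> \<in> ball 0 R"
  define f where "f n \<xi> = w \<xi> * ((\<i> * \<zeta> * of_real (e \<bullet> \<xi>)) ^ n /\<^sub>R fact n)" for n \<xi>
  have [measurable]: "f n \<in> borel_measurable borel" for n unfolding f_def[abs_def] by measurable
  have nf: "norm (f n \<xi>) = norm (w \<xi>) * (norm (\<i> * \<zeta> * of_real (e \<bullet> \<xi>)) ^ n /\<^sub>R fact n)" for n \<xi>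
    by (simp add: f_def norm_mult norm_power norm_divide)
  have sums: "(\<lambda>n. f n \<xi>) sums (g \<xi> * (wave y e \<zeta> \<xi> * of_real (exp (- \<tau> * (norm \<xi>)\<^sup>2))))" for \<xi>
  proof -
    have "(\<lambda>n. f n \<xi>) sums (w \<xi> * exp (\<i> * \<zeta> * of_real (e \<bullet> \<xi>)))"
      unfolding f_def by (intro sums_mult exp_converges)
    then show ?thesis by (simp add: w_def wave_def exp_add mult_ac)
  qed
  have nsums: "(\<lambda>n. norm (f n \<xi>)) sums (norm (w \<xi>) * exp (norm (\<i> * \<zeta> * of_real (e \<bullet> \<xi>))))" for \<xi>
    unfolding nf by (intro sums_mult exp_converges)
  have part: "(\<Sum>n<m. norm (f n \<xi>)) \<le> cmod (g \<xi>) * exp (cmod \<zeta> * norm \<xi> - \<tau> * (norm \<xi>)\<^sup>2)" for m \<xi>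
  proof -
    have "(\<Sum>n<m. norm (f n \<xi>)) \<le> (\<Sum>n. norm (f n \<xi>))"
      using nsums[of \<xi>] by (intro sum_le_suminf) (auto simp: sums_iff)
    also have "\<dots> = norm (w \<xi>) * exp (norm (\<i> * \<zeta> * of_real (e \<bullet> \<xi>)))" using nsums[of \<xi>] by (simp add: sums_iff)
    also have "\<dots> \<le> norm (w \<xi>) * exp (cmod \<zeta> * norm \<xi>)"
    proof (intro mult_left_mono)
      have "cmod \<zeta> * \<bar>e \<bullet> \<xi>\<bar> \<le> cmod \<zeta> * (1 * norm \<xi>)"
        using e by (intro mult_left_mono order_trans[OF Cauchy_Schwarz_ineq2] mult_right_mono) auto
      then show "exp (norm (\<i> * \<zeta> * of_real (e \<bullet> \<xi>))) \<le> exp (cmod \<zeta> * norm \<xi>)" by (simp add: norm_mult)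
    qed simp
    also have "\<dots> = cmod (g \<xi>) * (exp (- \<tau> * (norm \<xi>)\<^sup>2) * exp (cmod \<zeta> * norm \<xi>))" by (simp add: w_def norm_mult)
    finally show ?thesis by (simp add: exp_add[symmetric])
  qed
  note ig = integrable_g_exp[OF \<tau>, of "cmod \<zeta>"]
  have fi: "integrable lborel (f n)" for n
  proof (rule Bochner_Integration.integrable_bound[OF ig])
    have "norm (f n \<xi>) \<le> (\<Sum>n<Suc n. norm (f n \<xi>))" for \<xi> by (simp add: sum_nonneg)
    then show "AE \<xi> in lborel. norm (f n \<xi>) \<le> norm (cmod (g \<xi>) * exp (cmod \<zeta> * norm \<xi> - \<tau> * (norm \<xi>)\<^sup>2))"
      using part[of _ "Suc n"] by (intro AE_I2) (metis abs_of_nonneg exp_ge_zero mult_nonneg_nonneg norm_ge_zero order_trans real_norm_def)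
  qed measurable
  have "(\<lambda>n. integral\<^sup>L lborel (f n)) sums (LINT \<xi>|lborel. (\<Sum>n. f n \<xi>))"
  proof (rule sums_integral[OF fi])
    show "AE \<xi> in lborel. summable (\<lambda>n. norm (f n \<xi>))" using nsums by (auto simp: sums_iff)
    show "summable (\<lambda>n. LINT \<xi>|lborel. norm (f n \<xi>))"
    proof (rule summableI_nonneg_bounded)
      fix m
      have "(\<Sum>n<m. LINT \<xi>|lborel. norm (f n \<xi>)) = (LINT \<xi>|lborel. (\<Sum>n<m. norm (f n \<xi>)))"
        using fi by (intro Bochner_Integration.integral_sum[symmetric]) auto
      also have "\<dots> \<le> (LINT \<xi>|lborel. cmod (g \<xi>) * exp (cmod \<zeta> * norm \<xi> - \<tau> * (norm \<xi>)\<^sup>2))"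
        using fi by (intro integral_mono ig part) auto
      finally show "(\<Sum>n<m. LINT \<xi>|lborel. norm (f n \<xi>)) \<le> \<dots>" .
    qed simp
  qed
  also have "(LINT \<xi>|lborel. (\<Sum>n. f n \<xi>)) = heat \<tau> y e \<zeta>"
    unfolding heat_def using sums by (simp add: sums_iff)
  also have "(\<lambda>n. integral\<^sup>L lborel (f n)) = (\<lambda>n. (LINT \<xi>|lborel. w \<xi> * ((\<i> * of_real (e \<bullet> \<xi>)) ^ n /\<^sub>R fact n)) * (\<zeta> - 0) ^ n)"
  proof
    fix n
    have "f n = (\<lambda>\<xi>. (w \<xi> * ((\<i> * of_real (e \<bullet> \<xi>)) ^ n /\<^sub>R fact n)) * \<zeta> ^ n)"
      by (simp add: f_def fun_eq_iff power_mult_distrib scaleR_conv_of_real mult_ac)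
    then show "integral\<^sup>L lborel (f n) = (LINT \<xi>|lborel. w \<xi> * ((\<i> * of_real (e \<bullet> \<xi>)) ^ n /\<^sub>R fact n)) * (\<zeta> - 0) ^ n"
      by (simp only: integral_mult_left_zero diff_zero)
  qed
  finally show "(\<lambda>n. (LINT \<xi>|lborel. w \<xi> * ((\<i> * of_real (e \<bullet> \<xi>)) ^ n /\<^sub>R fact n)) * (\<zeta> - 0) ^ n) sums heat \<tau> y e \<zeta>" .
  qed
qed

lemma heat_frac_measurable [measurable]: "(\<lambda>t. heat_frac t y e \<zeta>) \<in> borel_measurable borel"
  unfolding heat_frac_def by measurable

text \<open>Off the origin, Gamma(s) equals |xi|^(2 s) times the integral of t^(s-1) exp (-t
  |xi|^2). Inserting this and exchanging the integrals produces the weighted flow at time \<tau> +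
  t, and a shift of t by \<tau> gives the stated kernel. The exchange is legitimate because the
  integrand of \<open>heat\<close> is integrable for \<tau> > 0.\<close>

lemma heat_subordination:
  assumes \<tau>: "\<tau> > 0" and e: "norm e \<le> 1"
  shows "of_real (Gamma s) * heat \<tau> y e \<zeta> =
    (LINT t|lborel. of_real (indicator {\<tau><..} t * (t - \<tau>) powr (s - 1)) * heat_frac t y e \<zeta>)"
proof -
  have s0: "s > 0" using s by simp
  define f where "f \<xi> = g \<xi> * (wave y e \<zeta> \<xi> * of_real (exp (- \<tau> * (norm \<xi>)\<^sup>2)))" for \<xi>
  have fi: "integrable lborel f" unfolding f_def[abs_def] by (rule integrable_heat[OF \<tau> e])
  note [measurable] = borel_measurable_integrable[OF fi]
  define K where "K \<xi> t = of_real (norm \<xi> powr (2 * s)) * f \<xi> * of_real (indicator {0<..} t * (t powr (s - 1) * exp (- (1 * (norm \<xi>)\<^sup>2) * t)))" for \<xi> t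
  have "integrable (lborel \<Otimes>\<^sub>M lborel) (case_prod K)"
  proof (rule Bochner_Integration.integrable_bound[OF integrable_subordination[OF s0 zero_less_one integrable_norm[OF fi]]])
    show "case_prod K \<in> borel_measurable (lborel \<Otimes>\<^sub>M lborel)" unfolding K_def by measurable
    show "AE p in lborel \<Otimes>\<^sub>M lborel. norm (case_prod K p) \<le> norm (norm (fst p) powr (2 * s) * cmod (f (fst p)) *
      (indicator {0<..} (snd p) * (snd p powr (s - 1) * exp (- (1 * (norm (fst p))\<^sup>2) * snd p))))"
      by (intro AE_I2) (auto simp: K_def norm_mult abs_mult split: prod.splits)
  qed
  from lborel_pair.Fubini_integral[OF this]
  have "(LINT t|lborel. (LINT \<xi>|lborel. K \<xi> t)) = (LINT \<xi>|lborel. (LINT t|lborel. K \<xi> t))" .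
  also have "(LINT \<xi>|lborel. (LINT t|lborel. K \<xi> t)) = (LINT \<xi>|lborel. of_real (Gamma s) * f \<xi>)"
  proof (rule integral_cong_AE)
    have "AE \<xi> in lborel. \<xi> \<noteq> (0::'a)" by (rule AE_lborel_singleton)
    then show "AE \<xi> in lborel. (LINT t|lborel. K \<xi> t) = of_real (Gamma s) * f \<xi>"
    proof eventually_elim
      case (elim \<xi>)
      then have r: "1 * (norm \<xi>)\<^sup>2 > 0" by simp
      have "(LINT t|lborel. K \<xi> t) = of_real (norm \<xi> powr (2 * s)) * f \<xi> * of_real (LINT t|lborel. indicator {0<..} t * (t powr (s - 1) * exp (- (1 * (norm \<xi>)\<^sup>2) * t)))"
        unfolding K_def integral_mult_right_zero integral_complex_of_real ..
      also have "\<dots> = of_real (Gamma s) * f \<xi> * of_real (norm \<xi> powr (2 * s) * (1 * (norm \<xi>)\<^sup>2) powr (- s))"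
        unfolding powr_exp_integral(2)[OF s0 r] by (simp add: mult_ac)
      also have "\<dots> = of_real (Gamma s) * f \<xi>"
        unfolding norm_powr_cancel[OF elim zero_less_one] by simp
      finally show ?case .
    qed
    show "(\<lambda>\<xi>. LINT t|lborel. K \<xi> t) \<in> borel_measurable lborel" unfolding K_def by measurable
  qed measurable
  also have "\<dots> = of_real (Gamma s) * heat \<tau> y e \<zeta>"
    unfolding integral_mult_right_zero by (simp add: heat_def f_def)
  \<comment> \<open>The two Gaussian factors combine to time t + \<tau>; indicator and power are
    written in the shifted variable so that translation invariance applies next.\<close>
  also have "(\<lambda>t. LINT \<xi>|lborel. K \<xi> t) = (\<lambda>t. of_real (indicator {\<tau><..} (t + \<tau>) * (t + \<tau> - \<tau>) powr (s - 1)) * heat_frac (t + \<tau>) y e \<zeta>)"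
  proof
    fix t
    have "K \<xi> t = of_real (indicator {0<..} t * t powr (s - 1)) *
      (of_real (norm \<xi> powr (2 * s)) * g \<xi> * (wave y e \<zeta> \<xi> * of_real (exp (- (t + \<tau>) * (norm \<xi>)\<^sup>2))))" for \<xi>
    proof -
      have "exp (- (t + \<tau>) * (norm \<xi>)\<^sup>2) = exp (- \<tau> * (norm \<xi>)\<^sup>2) * exp (- (1 * (norm \<xi>)\<^sup>2) * t)"
        by (simp add: exp_add[symmetric] algebra_simps)
      then show ?thesis unfolding K_def f_def by (simp only: of_real_mult mult_ac)
    qed
    then show "(LINT \<xi>|lborel. K \<xi> t) = of_real (indicator {\<tau><..} (t + \<tau>) * (t + \<tau> - \<tau>) powr (s - 1)) * heat_frac (t + \<tau>) y e \<zeta>"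
      unfolding heat_frac_def by (simp only: integral_mult_right_zero) (simp add: indicator_def)
  qed
  also have "(LINT t|lborel. of_real (indicator {\<tau><..} (t + \<tau>) * (t + \<tau> - \<tau>) powr (s - 1)) * heat_frac (t + \<tau>) y e \<zeta>)
    = (LINT t|lborel. of_real (indicator {\<tau><..} t * (t - \<tau>) powr (s - 1)) * heat_frac t y e \<zeta>)"
    by (rule lborel_integral_translate[where f="\<lambda>t. of_real (indicator {\<tau><..} t * (t - \<tau>) powr (s - 1)) * heat_frac t y e \<zeta>"]) measurable
  finally show ?thesis by simp
qed

definition heat_majorant :: "real \<Rightarrow> real \<Rightarrow> real" where
  "heat_majorant R t = (LINT \<xi>|lborel. norm \<xi> powr (2 * s) * cmod (g \<xi>) * exp (R * norm \<xi> - t * (norm \<xi>)\<^sup>2))"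

lemma norm_heat_frac_le:
  assumes t: "t > 0" and e: "norm e \<le> 1" "cmod \<zeta> \<le> R"
  shows "cmod (heat_frac t y e \<zeta>) \<le> heat_majorant R t"
  unfolding heat_frac_def heat_majorant_def
proof (rule order_trans[OF integral_norm_bound integral_mono[OF integrable_norm[OF integrable_heat_frac[OF t e(1)]] integrable_weight_g_exp[OF t]]])
  fix \<xi> :: 'a
  show "norm (of_real (norm \<xi> powr (2 * s)) * g \<xi> * (wave y e \<zeta> \<xi> * of_real (exp (- t * (norm \<xi>)\<^sup>2))))
    \<le> norm \<xi> powr (2 * s) * cmod (g \<xi>) * exp (R * norm \<xi> - t * (norm \<xi>)\<^sup>2)"
    using mult_left_mono[OF heat_integrand_bound[OF e, of y \<xi> t], of "norm \<xi> powr (2 * s) * cmod (g \<xi>)"]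
    by (simp add: norm_mult)
qed

text \<open>For t > 1 one has t >= 1/2 + t/2: one half of the Gaussian tames exp (R |xi|), the other
  supplies the decay in t, which is the subordination integral with c = 1/2.\<close>

lemma heat_majorant_integrable:
  "integrable lborel (\<lambda>t. indicator {1<..} t * (t powr (s - 1) * heat_majorant R t))"
proof -
  have s0: "s > 0" using s by simp
  have half: "(1/2::real) > 0" by simp
  define K where "K \<xi> t = norm \<xi> powr (2 * s) * cmod (g \<xi>) * exp (R * norm \<xi> - t * (norm \<xi>)\<^sup>2) * (indicator {1<..} t * t powr (s - 1))" for \<xi> and t :: real
  have "integrable (lborel \<Otimes>\<^sub>M lborel) (case_prod K)"
  proof (rule Bochner_Integration.integrable_bound[OF integrable_subordination[OF s0 half integrable_g_exp[OF half, of R]]])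
    show "case_prod K \<in> borel_measurable (lborel \<Otimes>\<^sub>M lborel)" unfolding K_def by measurable
    have "norm (K \<xi> t) \<le> norm \<xi> powr (2 * s) * (cmod (g \<xi>) * exp (R * norm \<xi> - 1/2 * (norm \<xi>)\<^sup>2)) *
      (indicator {0<..} t * (t powr (s - 1) * exp (- (1/2 * (norm \<xi>)\<^sup>2) * t)))" for \<xi> t
    proof (cases "t > 1")
      case True
      have "0 \<le> (t - 1) * (norm \<xi>)\<^sup>2" using True by simp
      then have "exp (R * norm \<xi> - t * (norm \<xi>)\<^sup>2) \<le> exp (R * norm \<xi> - 1/2 * (norm \<xi>)\<^sup>2) * exp (- (1/2 * (norm \<xi>)\<^sup>2) * t)"
        by (simp add: exp_add[symmetric] algebra_simps)
      then have "norm \<xi> powr (2 * s) * cmod (g \<xi>) * t powr (s - 1) * exp (R * norm \<xi> - t * (norm \<xi>)\<^sup>2)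
        \<le> norm \<xi> powr (2 * s) * cmod (g \<xi>) * t powr (s - 1) * (exp (R * norm \<xi> - 1/2 * (norm \<xi>)\<^sup>2) * exp (- (1/2 * (norm \<xi>)\<^sup>2) * t))"
        by (intro mult_left_mono) auto
      then show ?thesis using True by (simp add: K_def abs_mult mult_ac)
    qed (auto simp: K_def)
    then show "AE p in lborel \<Otimes>\<^sub>M lborel. norm (case_prod K p) \<le> norm (norm (fst p) powr (2 * s) * (cmod (g (fst p)) * exp (R * norm (fst p) - 1/2 * (norm (fst p))\<^sup>2)) *
      (indicator {0<..} (snd p) * (snd p powr (s - 1) * exp (- (1/2 * (norm (fst p))\<^sup>2) * snd p))))"
      by (intro AE_I2) (auto split: prod.splits intro: order_trans[OF _ abs_ge_self])
  qed
  then have "integrable lborel (\<lambda>t. LINT \<xi>|lborel. K \<xi> t)"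
    by (rule lborel_pair.integrable_snd)
  moreover have "(LINT \<xi>|lborel. K \<xi> t) = indicator {1<..} t * (t powr (s - 1) * heat_majorant R t)" for t
    unfolding K_def integral_mult_left_zero heat_majorant_def by (simp add: mult_ac)
  ultimately show ?thesis by simp
qed

end

text \<open>The weight squared times the dual weight is the weight again. Pairings of g with
  weighted functions thereby fall under the weighted Cauchy-Schwarz inequality.\<close>

lemma weighted_sq_weight_mult:
  fixes f :: "'a::euclidean_space \<Rightarrow> complex"
  shows "weighted_sq (- s) (\<lambda>\<xi>. of_real (norm \<xi> powr (2 * s)) * f \<xi>) = weighted_sq s f"
proof -
  have "norm \<xi> powr (2 * - s) * (cmod (of_real (norm \<xi> powr (2 * s)) * f \<xi>))\<^sup>2 = norm \<xi> powr (2 * s) * (cmod (f \<xi>))\<^sup>2" for \<xi> :: 'a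
  proof -
    have "norm \<xi> powr (2 * - s) * (norm \<xi> powr (2 * s))\<^sup>2 = norm \<xi> powr (2 * s)"
      by (cases "\<xi> = 0") (simp_all add: power2_eq_square powr_add[symmetric])
    then show ?thesis
      by (simp add: norm_mult power_mult_distrib)
  qed
  then show ?thesis unfolding weighted_sq_def by presburger
qed

context frequency_function
begin

text \<open>The flow at a positive time and its limit are integrals of the same function
  \<open>heat_frac\<close> against kernels \<open>an n\<close> below \<open>a\<close>, so their
  distance is at most a constant times the integral of their difference against a majorant
  independent of e and \<zeta>. Dominated convergence in t alone then gives a rate uniform in
  direction and complex parameter.\<close>

lemma heat_uniform_limit:
  assumes M0: "\<And>t e \<zeta>. 0 < t \<Longrightarrow> t \<le> 1 \<Longrightarrow> norm e \<le> 1 \<Longrightarrow> cmod \<zeta> \<le> R \<Longrightarrow> cmod (heat_frac t y e \<zeta>) \<le> M0"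
    and R: "R \<ge> 0"
  obtains U \<epsilon> where "\<epsilon> \<longlonglongrightarrow> (0::real)"
    "\<And>n e \<zeta>. norm e \<le> 1 \<Longrightarrow> cmod \<zeta> \<le> R \<Longrightarrow> cmod (heat (1 / real (Suc n)) y e \<zeta> - U e \<zeta>) \<le> \<epsilon> n"
proof -
  have M00: "M0 \<ge> 0" using M0[of 1 0 0] R order_trans[OF norm_ge_zero] by auto
  define a where "a t = indicator {0<..} t * t powr (s - 1)" for t :: real
  define an where "an n t = indicator {1 / real (Suc n)<..} t * (t - 1 / real (Suc n)) powr (s - 1)" for n and t :: real
  \<comment> \<open>Up to time 1 the bound is the assumed one, later supplied by the equation;
    beyond it the frequency function alone suffices.\<close>
  define Mb where "Mb t = (if t \<le> 1 then M0 else heat_majorant R t)" for t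
  have [measurable]: "heat_majorant R \<in> borel_measurable borel" unfolding heat_majorant_def[abs_def] by measurable
  have [measurable]: "a \<in> borel_measurable borel" "an n \<in> borel_measurable borel" "Mb \<in> borel_measurable borel" for n
    unfolding a_def[abs_def] an_def[abs_def] Mb_def[abs_def] by measurable
  have Mb: "cmod (heat_frac t y e \<zeta>) \<le> Mb t" if "0 < t" "norm e \<le> 1" "cmod \<zeta> \<le> R" for t e \<zeta>
    using M0[of t e \<zeta>] norm_heat_frac_le[of t e \<zeta> R y] that by (simp add: Mb_def)
  have Mb0: "Mb t \<ge> 0" if "t > 0" for t using order_trans[OF norm_ge_zero Mb[OF that, of 0 0]] R by simp
  have a0: "0 \<le> an n t" "an n t \<le> a t" for n t
  proof -
    show "0 \<le> an n t" by (simp add: an_def)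
    show "an n t \<le> a t"
    proof (cases "t > 1 / real (Suc n)")
      case True
      then have "t > 0" using order.strict_trans1[of 0 "1 / real (Suc n)" t] by simp
      \<comment> \<open>The exponent s - 1 is positive, so the shifted kernel lies below the
        limiting one.\<close>
      moreover have "(t - 1 / real (Suc n)) powr (s - 1) \<le> t powr (s - 1)"
        using True s by (intro powr_mono2) auto
      ultimately show ?thesis using True by (simp add: an_def a_def)
    qed (auto simp: an_def a_def)
  qed
  have aM: "integrable lborel (\<lambda>t. a t * Mb t)"
  proof -
    have "integrable lborel (\<lambda>t. M0 * (indicator {0<..1} t * t powr (s - 1)))"
    proof (rule Bochner_Integration.integrable_bound)
      show "integrable lborel (\<lambda>t::real. M0 * indicator {0<..1} t)"
        by (intro integrable_mult_right integrable_real_indicator) auto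
      have "t powr (s - 1) \<le> 1" if "0 < t" "t \<le> 1" for t :: real
        using powr_mono2[of "s - 1" t 1] that s by simp
      then show "AE t in lborel. norm (M0 * (indicator {0<..1} t * t powr (s - 1))) \<le> norm (M0 * indicator {0<..1} t)"
        using M00 by (intro AE_I2) (auto simp: indicator_def mult_left_le)
    qed measurable
    then have "integrable lborel (\<lambda>t. M0 * (indicator {0<..1} t * t powr (s - 1)) + indicator {1<..} t * (t powr (s - 1) * heat_majorant R t))"
      by (intro Bochner_Integration.integrable_add heat_majorant_integrable)
    moreover have "(\<lambda>t. M0 * (indicator {0<..1} t * t powr (s - 1)) + indicator {1<..} t * (t powr (s - 1) * heat_majorant R t)) = (\<lambda>t. a t * Mb t)"
      by (auto simp: fun_eq_iff a_def Mb_def indicator_def)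
    ultimately show ?thesis by simp
  qed
  have an_lim: "(\<lambda>n. an n t) \<longlonglongrightarrow> a t" for t
  proof (cases "t > 0")
    case True
    have z: "(\<lambda>n. 1 / real (Suc n)) \<longlonglongrightarrow> 0" by (rule LIMSEQ_Suc[OF lim_1_over_n])
    then have "\<forall>\<^sub>F n in sequentially. 1 / real (Suc n) < t" using True by (rule order_tendstoD)
    then have "\<forall>\<^sub>F n in sequentially. (t - 1 / real (Suc n)) powr (s - 1) = an n t"
      by eventually_elim (simp add: an_def)
    moreover have "(\<lambda>n. (t - 1 / real (Suc n)) powr (s - 1)) \<longlonglongrightarrow> (t - 0) powr (s - 1)"
      using True by (intro tendsto_powr tendsto_diff tendsto_const z) auto
    ultimately have "(\<lambda>n. an n t) \<longlonglongrightarrow> (t - 0) powr (s - 1)" by (rule Lim_transform_eventually[rotated])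
    then show ?thesis using True by (simp add: a_def)
  next
    case False
    then have "an n t = 0" for n
    proof -
      have "0 < 1 / real (Suc n)" by simp
      then have "\<not> 1 / real (Suc n) < t" using False by linarith
      then show ?thesis by (simp add: an_def)
    qed
    then show ?thesis using False by (simp add: a_def)
  qed
  define \<epsilon> where "\<epsilon> n = (LINT t|lborel. (a t - an n t) * Mb t)" for n
  have "\<epsilon> \<longlonglongrightarrow> (LINT t::real|lborel. 0)"
    unfolding \<epsilon>_def
  proof (rule integral_dominated_convergence[OF _ _ aM])
    show "AE t in lborel. (\<lambda>n. (a t - an n t) * Mb t) \<longlonglongrightarrow> 0"
    proof (rule AE_I2)
      fix t
      have "(\<lambda>n. (a t - an n t) * Mb t) \<longlonglongrightarrow> (a t - a t) * Mb t" by (intro tendsto_intros an_lim)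
      then show "(\<lambda>n. (a t - an n t) * Mb t) \<longlonglongrightarrow> 0" by simp
    qed
    show "AE t in lborel. norm ((a t - an n t) * Mb t) \<le> a t * Mb t" for n
    proof (rule AE_I2)
      fix t
      show "norm ((a t - an n t) * Mb t) \<le> a t * Mb t"
      proof (cases "t > 0")
        case True
        then show ?thesis using a0[of n t] Mb0[OF True] by (simp add: abs_mult mult_right_mono)
      next
        case False
        then have "a t = 0" by (simp add: a_def)
        then show ?thesis using a0[of n t] by simp
      qed
    qed
  qed measurable
  then have \<epsilon>: "\<epsilon> \<longlonglongrightarrow> 0" by simp
  \<comment> \<open>The subordination formula read at time 0.\<close>
  define U where "U e \<zeta> = (LINT t|lborel. of_real (a t) * heat_frac t y e \<zeta>) / of_real (Gamma s)" for e \<zeta>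
  have G: "Gamma s > 0" using s by (intro Gamma_real_pos) auto
  have "cmod (heat (1 / real (Suc n)) y e \<zeta> - U e \<zeta>) \<le> \<epsilon> n / Gamma s" if e: "norm e \<le> 1" "cmod \<zeta> \<le> R" for n e \<zeta>
  proof -
    have i1: "integrable lborel (\<lambda>t. of_real (a t) * heat_frac t y e \<zeta>)"
    proof (rule Bochner_Integration.integrable_bound[OF aM])
      have "norm (of_real (a t) * heat_frac t y e \<zeta>) \<le> a t * Mb t" for t
        using Mb[OF _ e, of t] by (cases "t > 0") (auto simp: norm_mult a_def intro!: mult_left_mono)
      then show "AE t in lborel. norm (of_real (a t) * heat_frac t y e \<zeta>) \<le> norm (a t * Mb t)"
        by (intro AE_I2) (auto intro: order_trans[OF _ abs_ge_self])
    qed measurable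
    have i2: "integrable lborel (\<lambda>t. of_real (an n t) * heat_frac t y e \<zeta>)"
    proof (rule Bochner_Integration.integrable_bound[OF i1])
      show "AE t in lborel. norm (of_real (an n t) * heat_frac t y e \<zeta>) \<le> norm (of_real (a t) * heat_frac t y e \<zeta>)"
        using a0 order_trans[OF a0] by (intro AE_I2) (auto simp: norm_mult intro!: mult_right_mono)
    qed measurable
    have "of_real (Gamma s) * heat (1 / real (Suc n)) y e \<zeta> = (LINT t|lborel. of_real (an n t) * heat_frac t y e \<zeta>)"
      unfolding an_def by (rule heat_subordination[OF _ e(1)]) simp
    then have "of_real (Gamma s) * (U e \<zeta> - heat (1 / real (Suc n)) y e \<zeta>)
      = (LINT t|lborel. of_real (a t) * heat_frac t y e \<zeta>) - (LINT t|lborel. of_real (an n t) * heat_frac t y e \<zeta>)"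
      using G by (simp add: U_def right_diff_distrib)
    also have "\<dots> = (LINT t|lborel. of_real (a t) * heat_frac t y e \<zeta> - of_real (an n t) * heat_frac t y e \<zeta>)"
      by (rule Bochner_Integration.integral_diff[OF i1 i2, symmetric])
    also have "cmod \<dots> \<le> (LINT t|lborel. (a t - an n t) * Mb t)"
    proof (rule order_trans[OF integral_norm_bound integral_mono])
      show "integrable lborel (\<lambda>t. cmod (of_real (a t) * heat_frac t y e \<zeta> - of_real (an n t) * heat_frac t y e \<zeta>))"
        using i1 i2 by auto
      show "integrable lborel (\<lambda>t. (a t - an n t) * Mb t)"
      proof (rule Bochner_Integration.integrable_bound[OF aM])
        show "AE t in lborel. norm ((a t - an n t) * Mb t) \<le> norm (a t * Mb t)"
          using a0[of n] order_trans[OF a0[of n]] by (intro AE_I2) (auto simp: abs_mult intro!: mult_right_mono)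
      qed measurable
      fix t
      have "cmod (of_real (a t) * heat_frac t y e \<zeta> - of_real (an n t) * heat_frac t y e \<zeta>) = (a t - an n t) * cmod (heat_frac t y e \<zeta>)"
        using a0[of n t] by (simp add: left_diff_distrib[symmetric] norm_mult flip: of_real_diff)
      also have "\<dots> \<le> (a t - an n t) * Mb t"
      proof (cases "t > 0")
        case True
        then show ?thesis using Mb[OF True e] a0[of n t] by (intro mult_left_mono) auto
      next
        case False
        then have "a t = 0" by (simp add: a_def)
        then show ?thesis using a0[of n t] by simp
      qed
      finally show "cmod (of_real (a t) * heat_frac t y e \<zeta> - of_real (an n t) * heat_frac t y e \<zeta>) \<le> (a t - an n t) * Mb t" .
    qed
    finally have "Gamma s * cmod (U e \<zeta> - heat (1 / real (Suc n)) y e \<zeta>) \<le> \<epsilon> n"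
      using G by (simp add: norm_mult \<epsilon>_def)
    then show ?thesis using G by (simp add: field_simps norm_minus_commute)
  qed
  moreover have "(\<lambda>n. \<epsilon> n / Gamma s) \<longlonglongrightarrow> 0" using tendsto_divide[OF \<epsilon> tendsto_const, of "Gamma s"] G by simp
  ultimately show ?thesis using that by blast
qed

lemma integrable_weight_fourier:
  assumes "\<phi> \<in> test_functions \<Omega>"
  shows "integrable lborel (\<lambda>\<xi>. of_real (norm \<xi> powr (2 * s)) * g \<xi> * ft (\<lambda>x. of_real (\<phi> x)) \<xi>)"
proof -
  define c where "c = complex_of_real ((2 * pi) powr (- real DIM('a) / 2))"
  have c: "c \<noteq> 0" by (simp add: c_def)
  note [measurable] = fourier_test_measurable[OF assms] 
  have [measurable]: "cnj \<in> borel_measurable borel" by (intro borel_measurable_continuous_onI continuous_intros)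
  define f where "f \<xi> = cnj (fourier \<phi> \<xi>)" for \<xi>
  have [measurable]: "f \<in> borel_measurable borel" unfolding f_def[abs_def] by measurable
  have "weighted_sq s f = weighted_sq s (fourier \<phi>)" by (simp add: weighted_sq_def f_def)
  also have "\<dots> < \<infinity>" using weighted_sq_test[OF assms, of s] s by simp
  finally have "(\<integral>\<^sup>+\<xi>. ennreal (cmod (g \<xi>) * cmod (of_real (norm \<xi> powr (2 * s)) * f \<xi>)) \<partial>lborel) < \<infinity>"
    by (intro weighted_L1_finite[OF _ _ g_finite]) (auto simp: weighted_sq_weight_mult)
  then have "integrable lborel (\<lambda>\<xi>. inverse c * (of_real (norm \<xi> powr (2 * s)) * g \<xi> * f \<xi>))"
    by (intro integrable_mult_right integrableI_bounded) (auto simp: norm_mult mult_ac)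
  moreover have "inverse c * (of_real (norm \<xi> powr (2 * s)) * g \<xi> * f \<xi>) = of_real (norm \<xi> powr (2 * s)) * g \<xi> * ft (\<lambda>x. of_real (\<phi> x)) \<xi>" for \<xi>
    unfolding f_def fourier_eq_ft(2)[OF test_function_measurable[OF assms]] c_def[symmetric]
    using c by (simp add: mult_ac)
  ultimately show ?thesis by simp
qed

end

section \<open>Small times: testing the equation with truncated Gaussians\<close>

text \<open>The imaginary part is the real part after multiplication by -i, which is put into a
  single factor of the product.\<close>

lemma prod_test_function_parts:
  fixes c :: "'a::euclidean_space \<Rightarrow> real \<Rightarrow> complex"
  assumes c: "\<And>b k. b \<in> Basis \<Longrightarrow> Ck_real k (c b)"
    and 0: "\<And>b x. b \<in> Basis \<Longrightarrow> x \<notin> {l \<bullet> b..r \<bullet> b} \<Longrightarrow> c b x = 0"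
    and \<Omega>: "cbox l r \<subseteq> \<Omega>"
  shows "(\<lambda>x. Re (\<Prod>b\<in>Basis. c b (x \<bullet> b))) \<in> test_functions \<Omega>"
    and "(\<lambda>x. Im (\<Prod>b\<in>Basis. c b (x \<bullet> b))) \<in> test_functions \<Omega>"
proof -
  show "(\<lambda>x. Re (\<Prod>b\<in>Basis. c b (x \<bullet> b))) \<in> test_functions \<Omega>"
    by (rule Re_prod_test_function[OF assms])
  obtain b0 :: 'a where b0: "b0 \<in> Basis" using nonempty_Basis by blast
  define c' where "c' b x = (if b = b0 then - \<i> else 1) * c b x" for b x
  have "(\<lambda>x. Re (\<Prod>b\<in>Basis. c' b (x \<bullet> b))) \<in> test_functions \<Omega>"
  proof (rule Re_prod_test_function[OF _ _ \<Omega>])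
    show "Ck_real k (c' b)" if "b \<in> Basis" for b k
      unfolding c'_def by (intro Ck_real_mult Ck_real_const c that)
  qed (use 0 in \<open>auto simp: c'_def\<close>)
  moreover have "(\<Prod>b\<in>Basis. c' b (x \<bullet> b)) = - \<i> * (\<Prod>b\<in>Basis. c b (x \<bullet> b))" for x
    unfolding c'_def prod.distrib using b0 by (simp add: prod.delta)
  ultimately show "(\<lambda>x. Im (\<Prod>b\<in>Basis. c b (x \<bullet> b))) \<in> test_functions \<Omega>" by simp
qed

lemma sum_inner_Basis: "(\<Sum>b\<in>Basis. (x \<bullet> b) * (y \<bullet> b)) = x \<bullet> (y::'a::euclidean_space)"
  by (rule euclidean_inner[symmetric])

lemma Ck_real_gauss_at: "Ck_real n (\<lambda>x. gauss_at k w (x - a))"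
  unfolding gauss_at_def
  by (intro Ck_real_exp Ck_real_mult Ck_real_const Ck_real_power Ck_real_diff Ck_real_of_real Ck_real_ident)

context frequency_function
begin

text \<open>The Gaussian belonging to time t splits into its truncation, which has support in
  \<Omega> and pairs to 0 with the solution, and an error whose normalised transform is at most
  \<open>M * Q \<xi>\<close> for all t <= 1. The error pairs boundedly with the weighted g because
  \<open>Q\<close> has finite weighted norm.\<close>

lemma heat_frac_bounded:
  fixes \<delta> :: real
  defines "\<rho> \<equiv> \<delta> / (2 * real DIM('a))"
  assumes sol: "\<And>\<phi>. \<phi> \<in> test_functions \<Omega> \<Longrightarrow> (LINT \<xi>|lborel. of_real (norm \<xi> powr (2 * s)) * g \<xi> * ft (\<lambda>x. of_real (\<phi> x)) \<xi>) = 0"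
    and \<delta>: "0 < \<delta>" "\<delta> \<le> 1" and box: "cbox (y - (2 * \<delta>) *\<^sub>R One) (y + (2 * \<delta>) *\<^sub>R One) \<subseteq> \<Omega>"
  obtains M0 where "\<And>t e \<zeta>. 0 < t \<Longrightarrow> t \<le> 1 \<Longrightarrow> norm e \<le> 1 \<Longrightarrow> cmod \<zeta> \<le> \<rho> \<Longrightarrow> cmod (heat_frac t y e \<zeta>) \<le> M0"
proof -
  obtain M where M: "M \<ge> 0"
    "\<And>(k::real) w (\<xi>::'a). k \<ge> 1/2 \<Longrightarrow> (\<And>b. b \<in> Basis \<Longrightarrow> cmod (w b) \<le> \<rho>) \<Longrightarrow>
      sqrt (k / (2 * pi)) ^ DIM('a) * cmod ((\<Prod>b\<in>Basis. ft (gauss_at k (w b)) (\<xi> \<bullet> b))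
        - (\<Prod>b\<in>Basis. ft (\<lambda>x. of_real (bump \<delta> x) * gauss_at k (w b) x) (\<xi> \<bullet> b)))
      \<le> M * (\<Prod>b\<in>Basis. inverse ((1 + (\<xi> \<bullet> b)\<^sup>2)\<^sup>2))"
    using product_truncation_bound[OF \<delta>, where 'a='a] unfolding \<rho>_def by blast
  define Q where "Q \<xi> = (\<Prod>b\<in>Basis. inverse ((1 + (\<xi> \<bullet> b)\<^sup>2)\<^sup>2))" for \<xi> :: 'a
  have [measurable]: "Q \<in> borel_measurable borel" unfolding Q_def[abs_def] by measurable
  have Q0: "Q \<xi> \<ge> 0" for \<xi> unfolding Q_def by (intro prod_nonneg) auto
  have Qi: "integrable lborel (\<lambda>\<xi>. norm \<xi> powr (2 * s) * cmod (g \<xi>) * Q \<xi>)"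
  proof -
    \<comment> \<open>With P the product of the 1 + x^2 over the coordinates x, the square of
      \<open>Q\<close> is P^(-4) and the weight takes at most P^2; of the remaining P^(-2) one power
      suffices for integrability.\<close>
    have "weighted_sq s (\<lambda>\<xi>. complex_of_real (Q \<xi>)) \<le> (\<integral>\<^sup>+\<xi>. ennreal (\<Prod>b\<in>Basis. inverse (1 + ((\<xi>::'a) \<bullet> b)\<^sup>2)) \<partial>lborel)"
      unfolding weighted_sq_def
    proof (intro nn_integral_mono ennreal_leI)
      fix \<xi> :: 'a
      have "norm \<xi> powr (2 * s) \<le> (1 + (norm \<xi>)\<^sup>2) ^ 2" using s by (intro norm_powr_le_power) auto
      also have "\<dots> \<le> (\<Prod>b\<in>Basis. 1 + (\<xi> \<bullet> b)\<^sup>2) ^ 2"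
        by (intro power_mono one_plus_norm_sq_le_prod) auto
      finally have "norm \<xi> powr (2 * s) * (Q \<xi>)\<^sup>2 \<le> (\<Prod>b\<in>Basis. 1 + (\<xi> \<bullet> b)\<^sup>2) ^ 2 * (Q \<xi>)\<^sup>2"
        by (intro mult_right_mono) auto
      also have "\<dots> = (\<Prod>b\<in>Basis. (1 + (\<xi> \<bullet> b)\<^sup>2)\<^sup>2 * (inverse ((1 + (\<xi> \<bullet> b)\<^sup>2)\<^sup>2))\<^sup>2)"
        by (simp only: Q_def prod_power_distrib prod.distrib)
      also have "\<dots> \<le> (\<Prod>b\<in>Basis. inverse (1 + (\<xi> \<bullet> b)\<^sup>2))"
      proof (intro prod_mono conjI)
        fix b :: 'a
        define x where "x = 1 + (\<xi> \<bullet> b)\<^sup>2"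
        have x: "x \<ge> 1" by (simp add: x_def)
        have "x\<^sup>2 * (inverse (x\<^sup>2))\<^sup>2 = inverse x * inverse x" using x by (simp add: power2_eq_square field_simps)
        also have "\<dots> \<le> inverse x * 1" using x by (intro mult_left_mono) (auto simp: inverse_le_1_iff)
        finally show "(1 + (\<xi> \<bullet> b)\<^sup>2)\<^sup>2 * (inverse ((1 + (\<xi> \<bullet> b)\<^sup>2)\<^sup>2))\<^sup>2 \<le> inverse (1 + (\<xi> \<bullet> b)\<^sup>2)"
          by (simp add: x_def)
      qed simp
      finally show "norm \<xi> powr (2 * s) * (cmod (complex_of_real (Q \<xi>)))\<^sup>2 \<le> (\<Prod>b\<in>Basis. inverse (1 + (\<xi> \<bullet> b)\<^sup>2))" by simp
    qed
    also have "\<dots> < \<infinity>"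
      using integrable_lborel_prod[of "\<lambda>b::'a. \<lambda>x. inverse (1 + x\<^sup>2)", OF integrable_inverse_1_plus_sq]
      by (subst nn_integral_eq_integral) (auto intro!: prod_nonneg)
    finally have "(\<integral>\<^sup>+\<xi>. ennreal (cmod (g \<xi>) * cmod (of_real (norm \<xi> powr (2 * s)) * complex_of_real (Q \<xi>))) \<partial>lborel) < \<infinity>"
      by (intro weighted_L1_finite[OF _ _ g_finite]) (auto simp: weighted_sq_weight_mult)
    then show ?thesis by (intro integrableI_bounded) (auto simp: norm_mult abs_mult mult_ac Q0)
  qed
  define M0 where "M0 = M * (LINT \<xi>|lborel. norm \<xi> powr (2 * s) * cmod (g \<xi>) * Q \<xi>)"
  show ?thesis
  proof (rule that[of M0])
    fix t :: real and e :: 'a and \<zeta> :: complex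
    assume t: "0 < t" "t \<le> 1" and e: "norm e \<le> 1" and \<zeta>: "cmod \<zeta> \<le> \<rho>"
    \<comment> \<open>The precision for which the one-dimensional transform decays like exp (-t
      xi^2); t <= 1 means k >= 1/2.\<close>
    define k where "k = 1 / (2 * t)"
    have k: "k \<ge> 1/2" "k > 0" using t by (auto simp: k_def field_simps)
    define w where "w b = \<zeta> * of_real (e \<bullet> b)" for b
    have w: "cmod (w b) \<le> \<rho>" if "b \<in> Basis" for b
    proof -
      have "\<bar>e \<bullet> b\<bar> \<le> 1" using Basis_le_norm[OF that, of e] e by linarith
      then have "cmod \<zeta> * \<bar>e \<bullet> b\<bar> \<le> \<rho> * 1" using \<zeta> order_trans[OF norm_ge_zero \<zeta>] by (intro mult_mono) auto
      then show ?thesis by (simp add: w_def norm_mult)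
    qed
    \<comment> \<open>S undoes the factor sqrt (2 pi / k) that each one-dimensional transform
      carries.\<close>
    define S where "S = sqrt (k / (2 * pi)) ^ DIM('a)"
    define a where "a \<xi> = (\<Prod>b\<in>Basis. ft (gauss_at k (w b)) (\<xi> \<bullet> b))" for \<xi> :: 'a
    define a' where "a' \<xi> = (\<Prod>b\<in>Basis. ft (\<lambda>x. of_real (bump \<delta> x) * gauss_at k (w b) x) (\<xi> \<bullet> b))" for \<xi> :: 'a
    define E where "E \<xi> = exp (\<i> * complex_of_real (y \<bullet> \<xi>))" for \<xi>
    have id1: "wave y e \<zeta> \<xi> * of_real (exp (- t * (norm \<xi>)\<^sup>2)) = E \<xi> * of_real S * a \<xi>" for \<xi>
    proof -
      have "a \<xi> = (\<Prod>b\<in>Basis. of_real (sqrt (2 * pi / k)) * exp (\<i> * w b * of_real (\<xi> \<bullet> b) - of_real ((\<xi> \<bullet> b)\<^sup>2 / (2 * k))))"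
        unfolding a_def using k by (intro prod.cong refl ft_gauss_at)
      also have "\<dots> = of_real (sqrt (2 * pi / k) ^ DIM('a)) * exp (\<Sum>b\<in>Basis. \<i> * w b * of_real (\<xi> \<bullet> b) - of_real ((\<xi> \<bullet> b)\<^sup>2 / (2 * k)))"
        by (simp add: prod.distrib exp_sum)
      also have "(\<Sum>b\<in>Basis. \<i> * w b * of_real (\<xi> \<bullet> b) - of_real ((\<xi> \<bullet> b)\<^sup>2 / (2 * k)))
        = \<i> * \<zeta> * of_real (\<Sum>b\<in>Basis. (e \<bullet> b) * (\<xi> \<bullet> b)) - of_real (t * (\<Sum>b\<in>Basis. (\<xi> \<bullet> b)\<^sup>2))"
        using t by (simp add: w_def k_def sum_subtractf sum_distrib_left mult_ac)
      also have "\<dots> = \<i> * \<zeta> * of_real (e \<bullet> \<xi>) - of_real (t * (norm \<xi>)\<^sup>2)"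
        unfolding sum_inner_Basis norm_sq_eq_sum ..
      finally have a: "a \<xi> = of_real (sqrt (2 * pi / k) ^ DIM('a)) * exp (\<i> * \<zeta> * of_real (e \<bullet> \<xi>) - of_real (t * (norm \<xi>)\<^sup>2))" .
      have "S * sqrt (2 * pi / k) ^ DIM('a) = 1"
        using k by (simp add: S_def power_mult_distrib[symmetric] real_sqrt_mult[symmetric])
      then have "complex_of_real S * of_real (sqrt (2 * pi / k) ^ DIM('a)) = 1"
        by (metis of_real_1 of_real_mult)
      then have "E \<xi> * of_real S * a \<xi> = E \<xi> * exp (\<i> * \<zeta> * of_real (e \<bullet> \<xi>) - of_real (t * (norm \<xi>)\<^sup>2))"
        unfolding a by (simp add: mult.assoc[symmetric])
      then show ?thesis
        by (simp add: E_def wave_def exp_add exp_diff exp_minus exp_of_real[symmetric] divide_inverse mult_ac)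
    qed
    \<comment> \<open>The truncated Gaussian is moved to y; in the transform the translation appears
      as the factor \<open>E\<close>.\<close>
    define c where "c b x = of_real (bump \<delta> (x - y \<bullet> b)) * gauss_at k (w b) (x - y \<bullet> b)" for b x
    define v where "v x = (\<Prod>b\<in>Basis. c b (x \<bullet> b))" for x
    have ci: "integrable lborel (c b)" for b
      using lborel_integrable_translate[OF integrable_bump_gauss[OF k(2), of \<delta> "w b"], of "- (y \<bullet> b)"]
      by (simp add: c_def[abs_def])
    have ftv: "ft v \<xi> = E \<xi> * a' \<xi>" for \<xi>
    proof -
      have "ft v \<xi> = (\<Prod>b\<in>Basis. ft (c b) (\<xi> \<bullet> b))"
        unfolding v_def[abs_def] by (rule ft_prod[OF ci])
      also have "\<dots> = (\<Prod>b\<in>Basis. exp (\<i> * of_real ((y \<bullet> b) * (\<xi> \<bullet> b))) * ft (\<lambda>x. of_real (bump \<delta> x) * gauss_at k (w b) x) (\<xi> \<bullet> b))"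
      proof (intro prod.cong refl)
        fix b :: 'a
        show "ft (c b) (\<xi> \<bullet> b) = exp (\<i> * of_real ((y \<bullet> b) * (\<xi> \<bullet> b))) * ft (\<lambda>x. of_real (bump \<delta> x) * gauss_at k (w b) x) (\<xi> \<bullet> b)"
          using ft_translate[OF integrable_bump_gauss[OF k(2), of \<delta> "w b"], of "- (y \<bullet> b)" "\<xi> \<bullet> b"]
          by (simp add: c_def[abs_def])
      qed
      also have "\<dots> = exp (\<Sum>b\<in>Basis. \<i> * of_real ((y \<bullet> b) * (\<xi> \<bullet> b))) * a' \<xi>"
        by (simp add: prod.distrib exp_sum a'_def)
      also have "(\<Sum>b\<in>Basis. \<i> * of_real ((y \<bullet> b) * (\<xi> \<bullet> b))) = \<i> * complex_of_real (\<Sum>b\<in>Basis. (y \<bullet> b) * (\<xi> \<bullet> b))"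
        by (simp add: sum_distrib_left)
      finally show ?thesis by (simp only: sum_inner_Basis E_def)
    qed
    have test: "(\<lambda>x. Re (v x)) \<in> test_functions \<Omega>" "(\<lambda>x. Im (v x)) \<in> test_functions \<Omega>"
    proof -
      have 1: "Ck_real n (c b)" for n b
      proof -
        have "Ck_real n (\<lambda>x. bump \<delta> (x - y \<bullet> b))"
          by (rule Ck_real_compose[OF Ck_real_bump Ck_real_diff[OF Ck_real_ident Ck_real_const]])
        then show ?thesis unfolding c_def[abs_def] by (intro Ck_real_mult Ck_real_of_real Ck_real_gauss_at)
      qed
      have 2: "c b x = 0" if "b \<in> Basis" "x \<notin> {(y - (2 * \<delta>) *\<^sub>R One) \<bullet> b..(y + (2 * \<delta>) *\<^sub>R One) \<bullet> b}" for b x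
      proof -
        have "\<bar>x - y \<bullet> b\<bar> \<ge> 2 * \<delta>" using that by (auto simp: inner_diff_left inner_add_left)
        then show ?thesis using bump_eq_0[OF \<delta>(1)] by (simp add: c_def)
      qed
      show "(\<lambda>x. Re (v x)) \<in> test_functions \<Omega>" "(\<lambda>x. Im (v x)) \<in> test_functions \<Omega>"
        unfolding v_def by (rule prod_test_function_parts[OF 1 2 box]; assumption)+
    qed
    define W where "W f \<xi> = complex_of_real (norm \<xi> powr (2 * s)) * g \<xi> * f \<xi>" for f \<xi>
    note iR = integrable_weight_fourier[OF test(1), folded W_def] and iI = integrable_weight_fourier[OF test(2), folded W_def]
    \<comment> \<open>The equation is available for real test functions only, so the real and
      imaginary parts of \<open>v\<close> are tested separately.\<close>
    have ftsplit: "ft v \<xi> = ft (\<lambda>x. of_real (Re (v x))) \<xi> + \<i> * ft (\<lambda>x. of_real (Im (v x))) \<xi>" for \<xi>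
    proof -
      have "v = (\<lambda>x. of_real (Re (v x)) + \<i> * of_real (Im (v x)))" by (simp add: fun_eq_iff complex_eq)
      then have "ft v \<xi> = ft (\<lambda>x. of_real (Re (v x)) + \<i> * of_real (Im (v x))) \<xi>" by simp
      also have "\<dots> = ft (\<lambda>x. of_real (Re (v x))) \<xi> + ft (\<lambda>x. \<i> * of_real (Im (v x))) \<xi>"
        using test_function_integrable[OF test(1)] test_function_integrable[OF test(2)]
        by (intro ft_add integrable_mult_right) auto
      finally show ?thesis by (simp only: ft_cmult)
    qed
    have Wv: "W (ft v) = (\<lambda>\<xi>. W (ft (\<lambda>x. of_real (Re (v x)))) \<xi> + \<i> * W (ft (\<lambda>x. of_real (Im (v x)))) \<xi>)"
      by (simp add: W_def fun_eq_iff ftsplit algebra_simps)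
    have iv: "integrable lborel (W (ft v))"
      unfolding Wv by (intro Bochner_Integration.integrable_add integrable_mult_right iR iI)
    have v0: "(LINT \<xi>|lborel. W (ft v) \<xi>) = 0"
      unfolding Wv using sol[OF test(1)] sol[OF test(2)] iR iI by (simp add: W_def)
    have D: "cmod (W (\<lambda>\<xi>. E \<xi> * of_real S * (a \<xi> - a' \<xi>)) \<xi>) \<le> M * (norm \<xi> powr (2 * s) * cmod (g \<xi>) * Q \<xi>)" for \<xi>
    proof -
      have S0: "S \<ge> 0" using k by (simp add: S_def)
      have "S * cmod (a \<xi> - a' \<xi>) \<le> M * Q \<xi>"
        unfolding S_def a_def a'_def Q_def by (rule M(2)[OF k(1) w])
      then have "norm \<xi> powr (2 * s) * cmod (g \<xi>) * (S * cmod (a \<xi> - a' \<xi>)) \<le> norm \<xi> powr (2 * s) * cmod (g \<xi>) * (M * Q \<xi>)"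
        by (intro mult_left_mono) auto
      then show ?thesis using S0 by (simp add: W_def norm_mult E_def mult_ac)
    qed
    have [measurable]: "E \<in> borel_measurable borel" unfolding E_def[abs_def] by (intro borel_measurable_continuous_onI continuous_intros)
    \<comment> \<open>The last term integrates to 0 by the equation, so the weighted flow equals the
      integral of the truncation error.\<close>
    have Wsplit: "W (\<lambda>\<xi>. wave y e \<zeta> \<xi> * of_real (exp (- t * (norm \<xi>)\<^sup>2))) \<xi> = W (\<lambda>\<xi>. E \<xi> * of_real S * (a \<xi> - a' \<xi>)) \<xi> + of_real S * W (ft v) \<xi>" for \<xi>
      unfolding W_def id1 ftv by (simp add: algebra_simps)
    have iw: "integrable lborel (W (\<lambda>\<xi>. wave y e \<zeta> \<xi> * of_real (exp (- t * (norm \<xi>)\<^sup>2))))"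
      unfolding W_def[abs_def] by (rule integrable_heat_frac[OF t(1) e])
    have iD: "integrable lborel (W (\<lambda>\<xi>. E \<xi> * of_real S * (a \<xi> - a' \<xi>)))"
    proof -
      have "integrable lborel (\<lambda>\<xi>. W (\<lambda>\<xi>. wave y e \<zeta> \<xi> * of_real (exp (- t * (norm \<xi>)\<^sup>2))) \<xi> - of_real S * W (ft v) \<xi>)"
        by (intro Bochner_Integration.integrable_diff iw integrable_mult_right iv)
      then show ?thesis unfolding Wsplit by simp
    qed
    have "heat_frac t y e \<zeta> = (LINT \<xi>|lborel. W (\<lambda>\<xi>. E \<xi> * of_real S * (a \<xi> - a' \<xi>)) \<xi> + of_real S * W (ft v) \<xi>)"
      unfolding Wsplit[symmetric] by (simp add: W_def heat_frac_def)
    also have "\<dots> = (LINT \<xi>|lborel. W (\<lambda>\<xi>. E \<xi> * of_real S * (a \<xi> - a' \<xi>)) \<xi>) + of_real S * (LINT \<xi>|lborel. W (ft v) \<xi>)"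
      using iD iv by simp
    also have "\<dots> = (LINT \<xi>|lborel. W (\<lambda>\<xi>. E \<xi> * of_real S * (a \<xi> - a' \<xi>)) \<xi>)" by (simp add: v0)
    also have "cmod \<dots> \<le> (LINT \<xi>|lborel. M * (norm \<xi> powr (2 * s) * cmod (g \<xi>) * Q \<xi>))"
      by (rule order_trans[OF integral_norm_bound integral_mono]) (use iD Qi D in auto)
    finally show "cmod (heat_frac t y e \<zeta>) \<le> M0" by (simp add: M0_def)
  qed
qed

end

subsection \<open>Identification of the heat flow limit\<close>

text \<open>The intersection of any box with \<open>cbox l r\<close> is again a box, and tests
  dominated by its indicator are dominated by that of \<open>cbox l r\<close>; hence h cut off
  outside \<open>cbox l r\<close> integrates to 0 over every box.\<close>

lemma test_integrals_0_imp_AE_0_local: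
  fixes h :: "'a::euclidean_space \<Rightarrow> complex"
  assumes hm: "h \<in> borel_measurable borel"
    and h: "set_integrable lborel (cbox l r) h"
    and 0: "\<And>\<eta>. \<eta> \<in> test_functions UNIV \<Longrightarrow> (\<And>x. \<bar>\<eta> x\<bar> \<le> indicator (cbox l r) x) \<Longrightarrow> (LINT x|lborel. h x * complex_of_real (\<eta> x)) = 0"
  shows "AE x in lborel. x \<in> cbox l r \<longrightarrow> h x = 0"
proof -
  note [measurable] = hm
  define H where "H x = indicator (cbox l r) x *\<^sub>R h x" for x
  have [measurable]: "H \<in> borel_measurable borel" unfolding H_def[abs_def] by measurable
  have Hi: "integrable lborel H" using h by (simp add: H_def[abs_def] set_integrable_def)
  have Hs: "set_integrable lborel S H" if "S \<in> sets borel" for S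
    unfolding set_integrable_def using that Hi by (intro integrable_mult_indicator) auto
  have "AE x in lborel. H x = 0"
  proof (rule box_integrals_0_imp_AE_0[OF Hs])
    fix a b :: 'a
    obtain a' b' where ab: "cbox a b \<inter> cbox l r = cbox a' b'" using Int_interval[of a b l r] by blast
    show "(LINT x:cbox a b|lborel. H x) = 0"
    proof -
      have sub: "cbox a' b' \<subseteq> cbox l r" using ab by blast
      have ind: "indicator (cbox a' b') x \<le> (indicator (cbox l r) x :: real)" for x
        using sub by (auto simp: indicator_def)
      have "(LINT x:cbox a' b'|lborel. h x) = 0"
        by (rule test_integrals_0_imp_cbox_integral_0[OF hm set_integrable_subset[OF h _ sub] 0[OF _ order_trans[OF _ ind]]]) auto
      then show ?thesis
        by (simp add: set_lebesgue_integral_def H_def ab[symmetric] indicator_inter_arith)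
    qed
  qed auto
  then show ?thesis by eventually_elim (auto simp: H_def)
qed

section \<open>Gaussian summability and Parseval's identity\<close>

lemma lborel_integral_scale:
  fixes f :: "'a::euclidean_space \<Rightarrow> 'b::{banach, second_countable_topology}"
  assumes c: "c \<noteq> 0" and [measurable]: "f \<in> borel_measurable borel"
  shows "(LINT x|lborel. f x) = \<bar>c\<bar> ^ DIM('a) *\<^sub>R (LINT x|lborel. f (c *\<^sub>R x))"
proof -
  have "(LINT x|lborel. f x) = (LINT x|density (distr lborel borel (\<lambda>x::'a. 0 + c *\<^sub>R x)) (\<lambda>_. ennreal (\<bar>c\<bar> ^ DIM('a))). f x)"
    by (subst lborel_affine[OF c, of 0]) simp
  also have "\<dots> = (LINT x|distr lborel borel (\<lambda>x::'a. 0 + c *\<^sub>R x). \<bar>c\<bar> ^ DIM('a) *\<^sub>R f x)"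
    by (rule integral_density) auto
  also have "\<dots> = (LINT x|lborel. \<bar>c\<bar> ^ DIM('a) *\<^sub>R f (0 + c *\<^sub>R x))"
    by (rule integral_distr) auto
  finally show ?thesis by simp
qed

lemma ft_gaussian:
  fixes \<eta> :: "'a::euclidean_space"
  assumes \<tau>: "\<tau> > 0"
  shows "integrable lborel (\<lambda>\<xi>::'a. complex_of_real (exp (- \<tau> * (norm \<xi>)\<^sup>2)))"
    and "ft (\<lambda>\<xi>. of_real (exp (- \<tau> * (norm \<xi>)\<^sup>2))) \<eta> = of_real (sqrt (pi / \<tau>) ^ DIM('a) * exp (- (norm \<eta>)\<^sup>2 / (4 * \<tau>)))"
proof -
  have g: "gauss_at (2 * \<tau>) 0 x = of_real (exp (- \<tau> * x\<^sup>2))" for x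
    by (simp add: gauss_at_def exp_of_real[symmetric])
  have eq: "complex_of_real (exp (- \<tau> * (norm \<xi>)\<^sup>2)) = (\<Prod>b\<in>Basis. gauss_at (2 * \<tau>) 0 (\<xi> \<bullet> b))" for \<xi> :: 'a
    by (simp add: g norm_sq_eq_sum sum_distrib_left exp_sum sum_negf flip: of_real_prod)
       (simp add: exp_sum[symmetric] sum_negf)
  have i: "integrable lborel (gauss_at (2 * \<tau>) 0)" using \<tau> by (intro integrable_gauss_at) auto
  show "integrable lborel (\<lambda>\<xi>::'a. complex_of_real (exp (- \<tau> * (norm \<xi>)\<^sup>2)))"
    unfolding eq by (intro integrable_lborel_prod i)
  have "ft (\<lambda>\<xi>. of_real (exp (- \<tau> * (norm \<xi>)\<^sup>2))) \<eta> = (\<Prod>b\<in>Basis. ft (gauss_at (2 * \<tau>) 0) (\<eta> \<bullet> b))"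
    unfolding eq by (rule ft_prod[OF i])
  also have "\<dots> = (\<Prod>b\<in>Basis. of_real (sqrt (pi / \<tau>) * exp (- (\<eta> \<bullet> b)\<^sup>2 / (4 * \<tau>))))"
    using \<tau> by (intro prod.cong refl) (simp add: ft_gauss_at exp_of_real[symmetric])
  also have "\<dots> = of_real (sqrt (pi / \<tau>) ^ DIM('a) * (\<Prod>b\<in>Basis. exp (- (\<eta> \<bullet> b)\<^sup>2 / (4 * \<tau>))))"
    by (simp add: prod.distrib flip: of_real_prod)
  also have "(\<Prod>b\<in>Basis. exp (- (\<eta> \<bullet> b)\<^sup>2 / (4 * \<tau>))) = exp (- (norm \<eta>)\<^sup>2 / (4 * \<tau>))"
    by (simp add: exp_sum[symmetric] norm_sq_eq_sum sum_divide_distrib sum_negf)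
  finally show "ft (\<lambda>\<xi>. of_real (exp (- \<tau> * (norm \<xi>)\<^sup>2))) \<eta> = of_real (sqrt (pi / \<tau>) ^ DIM('a) * exp (- (norm \<eta>)\<^sup>2 / (4 * \<tau>)))" .
qed

text \<open>The transform of exp (-|xi|^2); its rescalings are the mollifiers used below.\<close>

definition unit_gauss :: "'a::euclidean_space \<Rightarrow> real" where
  "unit_gauss h = sqrt pi ^ DIM('a) * exp (- (norm h)\<^sup>2 / 4)"

lemma unit_gauss_integral:
  "integrable lborel (unit_gauss :: 'a::euclidean_space \<Rightarrow> real)"
  "(LINT h|lborel. unit_gauss (h::'a)) = (2 * pi) ^ DIM('a)"
proof -
  have q: "(1/4::real) > 0" by simp
  have 1: "integrable lborel (\<lambda>h::'a. complex_of_real (exp (- (1/4) * (norm h)\<^sup>2)))" by (rule ft_gaussian(1)[OF q])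
  then have "integrable lborel (\<lambda>h::'a. exp (- (1/4) * (norm h)\<^sup>2))" using integrable_Re[OF 1] by (simp only: Re_complex_of_real)
  then show "integrable lborel (unit_gauss :: 'a \<Rightarrow> real)" unfolding unit_gauss_def[abs_def] by simp
  have "complex_of_real (LINT h::'a|lborel. exp (- (1/4) * (norm h)\<^sup>2)) = ft (\<lambda>h. of_real (exp (- (1/4) * (norm h)\<^sup>2))) (0::'a)"
    by (simp add: ft_def)
  also have "\<dots> = complex_of_real (sqrt (4 * pi) ^ DIM('a))" by (subst ft_gaussian(2)[OF q]) (simp add: mult.commute)
  finally have "(LINT h::'a|lborel. exp (- (1/4) * (norm h)\<^sup>2)) = sqrt (4 * pi) ^ DIM('a)"
    by (simp only: of_real_eq_iff)
  then have "(LINT h|lborel. unit_gauss (h::'a)) = sqrt pi ^ DIM('a) * sqrt (4 * pi) ^ DIM('a)"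
    by (simp add: unit_gauss_def)
  also have "\<dots> = (2 * pi) ^ DIM('a)"
  proof -
    have "sqrt pi * sqrt (4 * pi) = 2 * pi" by (simp add: real_sqrt_mult)
    then show ?thesis by (simp only: power_mult_distrib[symmetric])
  qed
  finally show "(LINT h|lborel. unit_gauss (h::'a)) = (2 * pi) ^ DIM('a)" .
qed

text \<open>Scaling x - y by sqrt \<tau> turns every mollifier into the same
  \<open>unit_gauss\<close>, so only the argument of \<eta> varies with n; continuity of \<eta> and
  dominated convergence give the limit. The second claim provides the domination for a further
  limit.\<close>

lemma gaussian_mollify_tendsto:
  fixes \<eta> :: "'a::euclidean_space \<Rightarrow> real"
  assumes \<eta>: "\<eta> \<in> test_functions UNIV"
  shows "(\<lambda>n. LINT x|lborel. of_real (\<eta> x) * ft (\<lambda>\<xi>. of_real (exp (- (1 / real (Suc n)) * (norm \<xi>)\<^sup>2))) (x - y)) \<longlonglongrightarrow> of_real ((2 * pi) ^ DIM('a) * \<eta> y)"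
    and "(\<And>x. \<bar>\<eta> x\<bar> \<le> B) \<Longrightarrow> cmod (LINT x|lborel. of_real (\<eta> x) * ft (\<lambda>\<xi>. of_real (exp (- (1 / real (Suc n)) * (norm \<xi>)\<^sup>2))) (x - y)) \<le> B * (2 * pi) ^ DIM('a)"
proof -
  note [measurable] = test_function_measurable[OF \<eta>]
  have [measurable]: "(unit_gauss :: 'a \<Rightarrow> real) \<in> borel_measurable borel" unfolding unit_gauss_def[abs_def] by measurable
  have ub: "norm (\<eta> (y + c *\<^sub>R h) * unit_gauss h) \<le> B * unit_gauss h" if "\<And>x. \<bar>\<eta> x\<bar> \<le> B" for B c and h :: 'a
    using that by (auto simp: abs_mult unit_gauss_def intro!: mult_right_mono)
  have ui: "integrable lborel (\<lambda>h::'a. B * unit_gauss h)" for B by (intro integrable_mult_right unit_gauss_integral)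
  obtain B' where B': "\<And>x. \<bar>\<eta> x\<bar> \<le> B'" using test_function_bounded[OF \<eta>] by metis
  have eq: "(LINT x|lborel. of_real (\<eta> x) * ft (\<lambda>\<xi>. of_real (exp (- (1 / real (Suc n)) * (norm \<xi>)\<^sup>2))) (x - y))
     = complex_of_real (LINT h|lborel. \<eta> (y + (1 / sqrt (Suc n)) *\<^sub>R h) * unit_gauss h)" for n
  proof -
    define \<tau> where "\<tau> = 1 / real (Suc n)"
    have \<tau>: "\<tau> > 0" by (simp add: \<tau>_def)
    define f where "f x = \<eta> (x + y) * (sqrt (pi / \<tau>) ^ DIM('a) * exp (- (norm x)\<^sup>2 / (4 * \<tau>)))" for x
    have [measurable]: "f \<in> borel_measurable borel" unfolding f_def[abs_def] by measurable
    have "(LINT x|lborel. of_real (\<eta> x) * ft (\<lambda>\<xi>. of_real (exp (- \<tau> * (norm \<xi>)\<^sup>2))) (x - y)) = (LINT x|lborel. complex_of_real (f (x + - y)))"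
      by (simp only: ft_gaussian(2)[OF \<tau>] f_def of_real_mult) simp
    also have "\<dots> = complex_of_real (LINT x|lborel. f x)"
      by (simp only: integral_complex_of_real lborel_integral_translate[of f])  (subst lborel_integral_translate, auto)
    also have "(LINT x|lborel. f x) = \<bar>sqrt \<tau>\<bar> ^ DIM('a) *\<^sub>R (LINT h|lborel. f (sqrt \<tau> *\<^sub>R h))"
      using \<tau> by (intro lborel_integral_scale) auto
    also have "\<dots> = (LINT h|lborel. sqrt \<tau> ^ DIM('a) * f (sqrt \<tau> *\<^sub>R h))" using \<tau> by simp
    also have "(\<lambda>h. sqrt \<tau> ^ DIM('a) * f (sqrt \<tau> *\<^sub>R h)) = (\<lambda>h. \<eta> (y + (1 / sqrt (Suc n)) *\<^sub>R h) * unit_gauss h)"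
    proof
      fix h :: 'a
      have "sqrt \<tau> ^ DIM('a) * sqrt (pi / \<tau>) ^ DIM('a) = sqrt pi ^ DIM('a)"
        using \<tau> by (simp add: power_mult_distrib[symmetric] real_sqrt_mult[symmetric])
      moreover have "exp (- (norm (sqrt \<tau> *\<^sub>R h))\<^sup>2 / (4 * \<tau>)) = exp (- (norm h)\<^sup>2 / 4)"
        using \<tau> by (simp add: power_mult_distrib)
      moreover have "sqrt \<tau> = 1 / sqrt (Suc n)" by (simp add: \<tau>_def real_sqrt_divide)
      moreover have "sqrt \<tau> ^ DIM('a) * f (sqrt \<tau> *\<^sub>R h) = \<eta> (y + sqrt \<tau> *\<^sub>R h) *
        ((sqrt \<tau> ^ DIM('a) * sqrt (pi / \<tau>) ^ DIM('a)) * exp (- (norm (sqrt \<tau> *\<^sub>R h))\<^sup>2 / (4 * \<tau>)))"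
        by (simp only: f_def add.commute[of y] mult_ac)
      ultimately show "sqrt \<tau> ^ DIM('a) * f (sqrt \<tau> *\<^sub>R h) = \<eta> (y + (1 / sqrt (Suc n)) *\<^sub>R h) * unit_gauss h"
        by (simp only: unit_gauss_def)
    qed
    finally show ?thesis by (simp add: \<tau>_def)
  qed
  have "(\<lambda>n. LINT h|lborel. \<eta> (y + (1 / sqrt (Suc n)) *\<^sub>R h) * unit_gauss h) \<longlonglongrightarrow> (LINT h|lborel. \<eta> y * unit_gauss (h::'a))"
  proof (rule integral_dominated_convergence[where w="\<lambda>h::'a. B' * unit_gauss h"])
    show "integrable lborel (\<lambda>h::'a. B' * unit_gauss h)" by (rule ui)
    show "(\<lambda>h::'a. \<eta> y * unit_gauss h) \<in> borel_measurable lborel" by measurable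
    show "(\<lambda>h. \<eta> (y + (1 / sqrt (Suc n)) *\<^sub>R h) * unit_gauss h) \<in> borel_measurable lborel" for n by measurable
    show "AE h in lborel. norm (\<eta> (y + (1 / sqrt (Suc n)) *\<^sub>R h) * unit_gauss h) \<le> B' * unit_gauss h" for n
      by (intro AE_I2 ub B')
    show "AE h in lborel. (\<lambda>n. \<eta> (y + (1 / sqrt (Suc n)) *\<^sub>R h) * unit_gauss h) \<longlonglongrightarrow> \<eta> y * unit_gauss h"
    proof (intro AE_I2 tendsto_mult tendsto_const)
      fix h :: 'a
      have "(\<lambda>n. sqrt (1 / real (Suc n))) \<longlonglongrightarrow> sqrt 0"
        by (intro tendsto_real_sqrt LIMSEQ_Suc[OF lim_1_over_n])
      then have "(\<lambda>n. y + (1 / sqrt (Suc n)) *\<^sub>R h) \<longlonglongrightarrow> y + 0 *\<^sub>R h"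
        by (intro tendsto_intros) (simp add: real_sqrt_divide)
      moreover have "isCont \<eta> y" using test_function_continuous[OF \<eta>] by (simp add: continuous_on_eq_continuous_at)
      ultimately show "(\<lambda>n. \<eta> (y + (1 / sqrt (Suc n)) *\<^sub>R h)) \<longlonglongrightarrow> \<eta> y"
        using isCont_tendsto_compose[of y \<eta>] by simp
    qed
  qed
  also have "(LINT h|lborel. \<eta> y * unit_gauss (h::'a)) = (2 * pi) ^ DIM('a) * \<eta> y"
    by (simp add: unit_gauss_integral)
  finally show "(\<lambda>n. LINT x|lborel. of_real (\<eta> x) * ft (\<lambda>\<xi>. of_real (exp (- (1 / real (Suc n)) * (norm \<xi>)\<^sup>2))) (x - y)) \<longlonglongrightarrow> of_real ((2 * pi) ^ DIM('a) * \<eta> y)"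
    unfolding eq by (rule tendsto_of_real)
  assume B: "\<And>x. \<bar>\<eta> x\<bar> \<le> B"
  have "norm (LINT h|lborel. \<eta> (y + (1 / sqrt (Suc n)) *\<^sub>R h) * unit_gauss h) \<le> (LINT h|lborel. B * unit_gauss (h::'a))"
  proof (rule order_trans[OF integral_norm_bound integral_mono[OF _ ui ub[OF B]]])
    show "integrable lborel (\<lambda>h. norm (\<eta> (y + (1 / sqrt (Suc n)) *\<^sub>R h) * unit_gauss h))"
      by (rule Bochner_Integration.integrable_bound[OF ui[of B]]) (use order_trans[OF ub[OF B] abs_ge_self] in auto)
  qed
  then show "cmod (LINT x|lborel. of_real (\<eta> x) * ft (\<lambda>\<xi>. of_real (exp (- (1 / real (Suc n)) * (norm \<xi>)\<^sup>2))) (x - y)) \<le> B * (2 * pi) ^ DIM('a)"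
    unfolding eq norm_of_real by (simp add: unit_gauss_integral)
qed

lemma ft_test_bound:
  assumes "\<eta> \<in> test_functions \<Omega>"
  obtains C where "\<And>\<xi>. cmod (ft (\<lambda>x. of_real (\<eta> x)) \<xi>) \<le> C"
  using ft_test_decay[OF assms, of 0] by auto

lemma ft_test_integrable:
  assumes "\<eta> \<in> test_functions \<Omega>"
  shows "integrable lborel (\<lambda>x. complex_of_real (\<eta> x))"
  using test_function_integrable[OF assms] by simp

text \<open>By Fubini, transforming \<open>f\<eta>\<close> damped by the Gaussian \<open>E n\<close>
  gives a mollification of \<eta>. Letting n tend to infinity removes the damping on one side and
  the mollification on the other, and c^2 (2 pi)^N = 1 fixes the constant.\<close>

lemma test_Parseval:
  fixes \<phi> \<eta> :: "'a::euclidean_space \<Rightarrow> real"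
  assumes \<phi>: "\<phi> \<in> test_functions UNIV" and \<eta>: "\<eta> \<in> test_functions UNIV"
  defines "c \<equiv> complex_of_real ((2 * pi) powr (- real DIM('a) / 2))"
  shows "(LINT x|lborel. complex_of_real (\<phi> x) * complex_of_real (\<eta> x)) = c * (LINT \<xi>|lborel. fourier \<phi> \<xi> * ft (\<lambda>x. of_real (\<eta> x)) \<xi>)"
proof -
  define E where "E n \<xi> = complex_of_real (exp (- (1 / real (Suc n)) * (norm \<xi>)\<^sup>2))" for n and \<xi> :: 'a
  define f\<eta> where "f\<eta> = ft (\<lambda>x. complex_of_real (\<eta> x))"
  note i\<phi> = ft_test_integrable[OF \<phi>] and i\<eta> = ft_test_integrable[OF \<eta>]
  have Ei: "integrable lborel (E n)" for n unfolding E_def[abs_def] by (rule ft_gaussian(1)) simp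
  have E1: "cmod (E n \<xi>) \<le> 1" for n \<xi> by (simp add: E_def)
  note [measurable] = borel_measurable_integrable[OF i\<phi>] borel_measurable_integrable[OF i\<eta>] borel_measurable_integrable[OF Ei]
    fourier_test_measurable[OF \<phi>]
  have [measurable]: "f\<eta> \<in> borel_measurable borel" unfolding f\<eta>_def by (rule ft_measurable[OF i\<eta>])
  obtain C where C: "\<And>\<xi>. cmod (f\<eta> \<xi>) \<le> C" using ft_test_bound[OF \<eta>] unfolding f\<eta>_def by blast
  have cc: "c * c * of_real ((2 * pi) ^ DIM('a)) = 1"
  proof -
    have "(2 * pi) powr (- real DIM('a) / 2) * (2 * pi) powr (- real DIM('a) / 2) * (2 * pi) ^ DIM('a) = 1"
      by (subst powr_realpow[symmetric]) (simp_all only: powr_add[symmetric], simp_all)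
    then show ?thesis unfolding c_def of_real_mult[symmetric] by simp
  qed
  have L1: "(\<lambda>n. c * (LINT \<xi>|lborel. fourier \<phi> \<xi> * (E n \<xi> * f\<eta> \<xi>))) \<longlonglongrightarrow> c * (LINT \<xi>|lborel. fourier \<phi> \<xi> * f\<eta> \<xi>)"
  proof (intro tendsto_mult tendsto_const integral_dominated_convergence[where w="\<lambda>\<xi>. C * cmod (fourier \<phi> \<xi>)"])
    show "integrable lborel (\<lambda>\<xi>. C * cmod (fourier \<phi> \<xi>))" using integrable_fourier_test[OF \<phi>] by simp
    show "AE \<xi> in lborel. norm (fourier \<phi> \<xi> * (E n \<xi> * f\<eta> \<xi>)) \<le> C * cmod (fourier \<phi> \<xi>)" for n
    proof (rule AE_I2)
      fix \<xi>
      have "cmod (E n \<xi>) * cmod (f\<eta> \<xi>) \<le> 1 * C" using C[of \<xi>] E1[of n \<xi>] by (intro mult_mono) auto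
      then have "cmod (fourier \<phi> \<xi>) * (cmod (E n \<xi>) * cmod (f\<eta> \<xi>)) \<le> cmod (fourier \<phi> \<xi>) * C" by (intro mult_left_mono) auto
      then show "norm (fourier \<phi> \<xi> * (E n \<xi> * f\<eta> \<xi>)) \<le> C * cmod (fourier \<phi> \<xi>)" by (simp add: norm_mult mult.commute)
    qed
    show "AE \<xi> in lborel. (\<lambda>n. fourier \<phi> \<xi> * (E n \<xi> * f\<eta> \<xi>)) \<longlonglongrightarrow> fourier \<phi> \<xi> * f\<eta> \<xi>"
    proof (rule AE_I2)
      fix \<xi>
      have "(\<lambda>n. fourier \<phi> \<xi> * (E n \<xi> * f\<eta> \<xi>)) \<longlonglongrightarrow> fourier \<phi> \<xi> * (complex_of_real (exp (- 0 * (norm \<xi>)\<^sup>2)) * f\<eta> \<xi>)"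
        unfolding E_def by (intro tendsto_intros LIMSEQ_Suc[OF lim_1_over_n])
      then show "(\<lambda>n. fourier \<phi> \<xi> * (E n \<xi> * f\<eta> \<xi>)) \<longlonglongrightarrow> fourier \<phi> \<xi> * f\<eta> \<xi>" by simp
    qed
  qed measurable
  \<comment> \<open>The mollified \<eta>, which converges boundedly to (2 pi)^N times
    \<eta>.\<close>
  define A where "A n y = (LINT x|lborel. of_real (\<eta> x) * ft (E n) (x - y))" for n y
  have ftE: "ft (\<lambda>\<xi>. E n \<xi> * f\<eta> \<xi>) (- y) = A n y" for n y
  proof -
    define F where "F \<xi> = exp (\<i> * complex_of_real (\<xi> \<bullet> - y)) * E n \<xi>" for \<xi>
    have Fi: "integrable lborel F" unfolding F_def[abs_def] by (rule integrable_exp_mult[OF Ei])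
    have "ft (\<lambda>\<xi>. E n \<xi> * f\<eta> \<xi>) (- y) = (LINT \<xi>|lborel. f\<eta> \<xi> * F \<xi>)"
      unfolding ft_def[of "\<lambda>\<xi>. E n \<xi> * f\<eta> \<xi>"] F_def by (simp only: mult_ac)
    also have "\<dots> = (LINT \<xi>|lborel. (LINT x|lborel. exp (\<i> * complex_of_real (x \<bullet> \<xi>)) * of_real (\<eta> x)) * F \<xi>)"
      unfolding f\<eta>_def ft_def ..
    also have "\<dots> = (LINT x|lborel. of_real (\<eta> x) * (LINT \<xi>|lborel. exp (\<i> * complex_of_real (x \<bullet> \<xi>)) * F \<xi>))"
      by (rule Fubini_kernel[OF i\<eta> Fi, where B=1])
         (auto intro!: borel_measurable_pair_continuous continuous_intros)
    also have "(\<lambda>x. LINT \<xi>|lborel. exp (\<i> * complex_of_real (x \<bullet> \<xi>)) * F \<xi>) = (\<lambda>x. ft (E n) (x - y))"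
      unfolding ft_def F_def
    proof (intro ext Bochner_Integration.integral_cong refl)
      fix x \<xi>
      have "\<xi> \<bullet> (x - y) = x \<bullet> \<xi> + \<xi> \<bullet> - y" by (simp add: inner_diff_right inner_commute)
      then show "exp (\<i> * complex_of_real (x \<bullet> \<xi>)) * (exp (\<i> * complex_of_real (\<xi> \<bullet> - y)) * E n \<xi>) = exp (\<i> * complex_of_real (\<xi> \<bullet> (x - y))) * E n \<xi>"
        by (simp only: of_real_add distrib_left exp_add mult.assoc)
    qed
    finally show ?thesis unfolding A_def .
  qed
  have Gi: "integrable lborel (\<lambda>\<xi>. E n \<xi> * f\<eta> \<xi>)" for n
  proof -
    have "integrable lborel (\<lambda>\<xi>. complex_of_real C * E n \<xi>)" by (intro integrable_mult_right Ei)
    then show ?thesis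
    proof (rule Bochner_Integration.integrable_bound)
      show "(\<lambda>\<xi>. E n \<xi> * f\<eta> \<xi>) \<in> borel_measurable lborel" by measurable
      show "AE \<xi> in lborel. norm (E n \<xi> * f\<eta> \<xi>) \<le> norm (complex_of_real C * E n \<xi>)"
      proof (rule AE_I2)
        fix \<xi>
        have "cmod (E n \<xi>) * cmod (f\<eta> \<xi>) \<le> cmod (E n \<xi>) * \<bar>C\<bar>"
          by (intro mult_left_mono order_trans[OF C abs_ge_self]) simp
        then show "norm (E n \<xi> * f\<eta> \<xi>) \<le> norm (complex_of_real C * E n \<xi>)"
          by (simp only: norm_mult norm_of_real mult.commute)
      qed
    qed
  qed
  have Am: "A n \<in> borel_measurable borel" for n
  proof -
    have "(\<lambda>y. ft (\<lambda>\<xi>. E n \<xi> * f\<eta> \<xi>) (- y)) \<in> borel_measurable borel"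
      using ft_measurable[OF Gi[of n]] by measurable
    then show ?thesis by (simp add: ftE)
  qed
  \<comment> \<open>The multiplication formula; the second factor c comes from writing
    \<open>fourier\<close> as c times \<open>ft\<close>.\<close>
  have eqA: "c * (LINT \<xi>|lborel. fourier \<phi> \<xi> * (E n \<xi> * f\<eta> \<xi>)) = c * c * (LINT y|lborel. of_real (\<phi> y) * A n y)" for n
  proof -
    have "(LINT \<xi>|lborel. fourier \<phi> \<xi> * (E n \<xi> * f\<eta> \<xi>)) = c * (LINT \<xi>|lborel. ft (\<lambda>x. of_real (\<phi> x)) (- \<xi>) * (E n \<xi> * f\<eta> \<xi>))"
      by (simp add: fourier_eq_ft(1)[OF test_function_measurable[OF \<phi>]] c_def mult.assoc)
    also have "\<dots> = c * (LINT y|lborel. of_real (\<phi> y) * A n y)"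
      by (simp only: ft_swap[OF i\<phi> Gi] ftE)
    finally show ?thesis by simp
  qed
  obtain B where B: "\<And>x. \<bar>\<eta> x\<bar> \<le> B" using test_function_bounded[OF \<eta>] by metis
  have A_lim: "(\<lambda>n. A n y) \<longlonglongrightarrow> of_real ((2 * pi) ^ DIM('a) * \<eta> y)" for y
    unfolding A_def E_def by (rule gaussian_mollify_tendsto(1)[OF \<eta>])
  have A_bound: "cmod (A n y) \<le> B * (2 * pi) ^ DIM('a)" for n y
    unfolding A_def E_def by (rule gaussian_mollify_tendsto(2)[OF \<eta> B])
  have "(\<lambda>n. c * c * (LINT y|lborel. of_real (\<phi> y) * A n y)) \<longlonglongrightarrow> c * c * (LINT y|lborel. of_real (\<phi> y) * of_real ((2 * pi) ^ DIM('a) * \<eta> y))"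
  proof (intro tendsto_mult tendsto_const integral_dominated_convergence[where w="\<lambda>y. (B * (2 * pi) ^ DIM('a)) * \<bar>\<phi> y\<bar>"])
    show "integrable lborel (\<lambda>y. (B * (2 * pi) ^ DIM('a)) * \<bar>\<phi> y\<bar>)" using test_function_integrable[OF \<phi>] by simp
    show "AE y in lborel. (\<lambda>n. of_real (\<phi> y) * A n y) \<longlonglongrightarrow> of_real (\<phi> y) * of_real ((2 * pi) ^ DIM('a) * \<eta> y)"
      by (intro AE_I2 tendsto_mult tendsto_const A_lim)
    show "AE y in lborel. norm (of_real (\<phi> y) * A n y) \<le> (B * (2 * pi) ^ DIM('a)) * \<bar>\<phi> y\<bar>" for n
      using A_bound by (intro AE_I2) (simp add: norm_mult mult.commute mult_left_mono)
    show "(\<lambda>y. of_real (\<phi> y) * A n y) \<in> borel_measurable lborel" for n using Am[of n] by measurable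
  qed (use test_function_measurable[OF \<phi>] test_function_measurable[OF \<eta>] in measurable)
  also have "(LINT y|lborel. of_real (\<phi> y) * of_real ((2 * pi) ^ DIM('a) * \<eta> y)) = of_real ((2 * pi) ^ DIM('a)) * (LINT y|lborel. complex_of_real (\<phi> y) * of_real (\<eta> y))"
    unfolding integral_mult_right_zero[symmetric] of_real_mult by (simp only: mult_ac)
  also have "c * c * (of_real ((2 * pi) ^ DIM('a)) * (LINT y|lborel. complex_of_real (\<phi> y) * of_real (\<eta> y))) = (LINT y|lborel. complex_of_real (\<phi> y) * of_real (\<eta> y))"
    unfolding mult.assoc[symmetric] cc by simp
  finally have "(\<lambda>n. c * c * (LINT y|lborel. of_real (\<phi> y) * A n y)) \<longlonglongrightarrow> (LINT y|lborel. complex_of_real (\<phi> y) * of_real (\<eta> y))" .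
  from LIMSEQ_unique[OF this L1[unfolded eqA]] show ?thesis by (simp add: f\<eta>_def)
qed

text \<open>In the unit ball 2 \<gamma> < N makes the weight integrable; outside, the weight is at
  most 1 and the decay of the transform suffices.\<close>

lemma weighted_sq_neg_ft_test:
  fixes \<eta> :: "'a::euclidean_space \<Rightarrow> real" and \<gamma> :: real
  assumes \<eta>: "\<eta> \<in> test_functions \<Omega>" and \<gamma>: "0 < \<gamma>" "2 * \<gamma> < DIM('a)"
  shows "weighted_sq (- \<gamma>) (ft (\<lambda>x. of_real (\<eta> x))) < \<infinity>"
proof -
  define f where "f = ft (\<lambda>x. complex_of_real (\<eta> x))"
  obtain C where C: "\<And>\<xi>. (1 + (norm \<xi>)\<^sup>2) ^ DIM('a) * cmod (f \<xi>) \<le> C"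
    using ft_test_decay[OF \<eta>, of "DIM('a)"] unfolding f_def by blast
  have "weighted_sq (- \<gamma>) f \<le> (\<integral>\<^sup>+\<xi>. ennreal (C\<^sup>2 * exp 1) * ennreal (norm (\<xi>::'a) powr (- (2 * \<gamma>)) * exp (- 1 * (norm \<xi>)\<^sup>2)) + ennreal (C\<^sup>2 * inverse ((1 + (norm \<xi>)\<^sup>2) ^ DIM('a))) \<partial>lborel)"
    unfolding weighted_sq_def
  proof (rule nn_integral_mono)
    fix \<xi> :: 'a
    define a where "a = (1 + (norm \<xi>)\<^sup>2) ^ DIM('a)"
    have a: "a \<ge> 1" unfolding a_def by (intro one_le_power) simp
    have fa: "cmod (f \<xi>) \<le> C * inverse a" using C[of \<xi>] a by (simp add: a_def[symmetric] field_simps)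
    have C0: "C \<ge> 0" using order_trans[OF _ C[of \<xi>]] a by (simp add: a_def[symmetric])
    have ia: "inverse a \<le> 1" "inverse a \<ge> 0" using a by (auto simp: inverse_le_1_iff)
    have fC: "cmod (f \<xi>) \<le> C" using order_trans[OF fa mult_left_mono[OF ia(1) C0]] by simp
    have "norm \<xi> powr (2 * - \<gamma>) * (cmod (f \<xi>))\<^sup>2 \<le> C\<^sup>2 * exp 1 * (norm \<xi> powr (- (2 * \<gamma>)) * exp (- 1 * (norm \<xi>)\<^sup>2)) + C\<^sup>2 * inverse a"
    proof (cases "norm \<xi> \<le> 1")
      case True
      then have "(norm \<xi>)\<^sup>2 \<le> 1" by (simp add: power_le_one)
      then have "1 \<le> exp 1 * exp (- 1 * (norm \<xi>)\<^sup>2)" by (simp flip: exp_add)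
      then have "C\<^sup>2 * 1 \<le> C\<^sup>2 * (exp 1 * exp (- 1 * (norm \<xi>)\<^sup>2))" by (intro mult_left_mono) auto
      moreover have "(cmod (f \<xi>))\<^sup>2 \<le> C\<^sup>2" by (intro power_mono fC) auto
      ultimately have "(cmod (f \<xi>))\<^sup>2 \<le> C\<^sup>2 * (exp 1 * exp (- 1 * (norm \<xi>)\<^sup>2))" by linarith
      then have "norm \<xi> powr (- (2 * \<gamma>)) * (cmod (f \<xi>))\<^sup>2 \<le> norm \<xi> powr (- (2 * \<gamma>)) * (C\<^sup>2 * (exp 1 * exp (- 1 * (norm \<xi>)\<^sup>2)))"
        by (intro mult_left_mono) auto
      moreover have "C\<^sup>2 * inverse a \<ge> 0" using ia by simp
      ultimately show ?thesis by (simp add: mult_ac)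
    next
      case False
      then have "norm \<xi> powr (- (2 * \<gamma>)) \<le> 1" using powr_mono[of "- (2 * \<gamma>)" 0 "norm \<xi>"] \<gamma> by (auto split: if_splits)
      moreover have "(cmod (f \<xi>))\<^sup>2 \<le> (C * inverse a)\<^sup>2" by (intro power_mono fa) auto
      moreover have "(C * inverse a)\<^sup>2 \<le> C\<^sup>2 * inverse a"
        using ia mult_left_mono[OF mult_left_mono[OF ia(1) ia(2)], of "C\<^sup>2"] by (simp add: power2_eq_square mult_ac)
      ultimately have "norm \<xi> powr (- (2 * \<gamma>)) * (cmod (f \<xi>))\<^sup>2 \<le> 1 * (C\<^sup>2 * inverse a)"
        by (intro mult_mono) auto
      moreover have "0 \<le> C\<^sup>2 * exp 1 * (norm \<xi> powr (- (2 * \<gamma>)) * exp (- 1 * (norm \<xi>)\<^sup>2))" by simp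
      ultimately show ?thesis by (simp only: minus_mult_right[symmetric] mult_minus_right)
    qed
    then have "ennreal (norm \<xi> powr (2 * - \<gamma>) * (cmod (f \<xi>))\<^sup>2) \<le> ennreal (C\<^sup>2 * exp 1 * (norm \<xi> powr (- (2 * \<gamma>)) * exp (- 1 * (norm \<xi>)\<^sup>2)) + C\<^sup>2 * inverse a)"
      by (rule ennreal_leI)
    also have "\<dots> = ennreal (C\<^sup>2 * exp 1) * ennreal (norm \<xi> powr (- (2 * \<gamma>)) * exp (- 1 * (norm \<xi>)\<^sup>2)) + ennreal (C\<^sup>2 * inverse a)"
      using ia by (subst ennreal_plus) (auto simp: ennreal_mult[symmetric])
    finally show "ennreal (norm \<xi> powr (2 * - \<gamma>) * (cmod (f \<xi>))\<^sup>2) \<le> ennreal (C\<^sup>2 * exp 1) * ennreal (norm \<xi> powr (- (2 * \<gamma>)) * exp (- 1 * (norm \<xi>)\<^sup>2)) + ennreal (C\<^sup>2 * inverse ((1 + (norm \<xi>)\<^sup>2) ^ DIM('a)))"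
      by (simp only: a_def)
  qed
  also have "\<dots> = ennreal (C\<^sup>2 * exp 1) * (\<integral>\<^sup>+\<xi>. ennreal (norm (\<xi>::'a) powr (- (2 * \<gamma>)) * exp (- 1 * (norm \<xi>)\<^sup>2)) \<partial>lborel) + (\<integral>\<^sup>+\<xi>. ennreal (C\<^sup>2 * inverse ((1 + (norm (\<xi>::'a))\<^sup>2) ^ DIM('a))) \<partial>lborel)"
    by (simp add: nn_integral_add nn_integral_cmult)
  also have "\<dots> < \<infinity>"
  proof -
    have "(\<integral>\<^sup>+\<xi>. ennreal (C\<^sup>2 * inverse ((1 + (norm (\<xi>::'a))\<^sup>2) ^ DIM('a))) \<partial>lborel) < \<infinity>"
      by (subst nn_integral_eq_integral[OF integrable_mult_right[OF integrable_inverse_norm_power]]) auto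
    then show ?thesis
      using nn_integral_norm_powr_gaussian_finite[of "2 * \<gamma>" 1, where 'a='a] \<gamma>
      by (simp add: ennreal_mult_less_top)
  qed
  finally show ?thesis by (simp add: f_def)
qed

text \<open>A bounded integrable r pairs continuously with L^p for every p > 1, although the limit w
  itself need not be integrable.\<close>

lemma Lp_limit_integral:
  fixes w :: "'a::euclidean_space \<Rightarrow> real"
  assumes \<phi>: "\<And>n. \<phi> n \<in> test_functions UNIV" and wm: "w \<in> borel_measurable borel" and p: "p > 1"
    and lim: "(\<lambda>n. \<integral>\<^sup>+x. ennreal (\<bar>\<phi> n x - w x\<bar> powr p) \<partial>lborel) \<longlonglongrightarrow> 0"
    and r: "integrable lborel r" "\<And>x. \<bar>r x\<bar> \<le> B"
  shows "integrable lborel (\<lambda>x. w x * r x)" "(\<lambda>n. LINT x|lborel. \<phi> n x * r x) \<longlonglongrightarrow> (LINT x|lborel. w x * r x)"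
proof -
  note [measurable] = test_function_measurable[OF \<phi>] wm borel_measurable_integrable[OF r(1)]
  have fin: "(\<integral>\<^sup>+x. ennreal \<bar>r x\<bar> \<partial>lborel) < \<infinity>" using r(1) by (simp add: integrable_iff_bounded)
  have L: "(\<lambda>n. \<integral>\<^sup>+x. ennreal (\<bar>\<phi> n x - w x\<bar> * \<bar>r x\<bar>) \<partial>lborel) \<longlonglongrightarrow> 0"
    by (rule Lp_L1_tendsto_0[OF _ _ _ _ p fin lim, where B=B]) (use r(2) in auto)
  have \<phi>r: "integrable lborel (\<lambda>x. \<phi> n x * r x)" for n
  proof -
    obtain B' where B': "\<And>x. \<bar>\<phi> n x\<bar> \<le> B'" using test_function_bounded[OF \<phi>] by metis
    show ?thesis
      by (rule Bochner_Integration.integrable_bound[OF integrable_mult_right[OF r(1), of B']])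
         (use B' order_trans[OF abs_ge_zero B'] in \<open>auto simp: abs_mult intro!: mult_right_mono\<close>)
  qed
  have "\<forall>\<^sub>F n in sequentially. (\<integral>\<^sup>+x. ennreal (\<bar>\<phi> n x - w x\<bar> * \<bar>r x\<bar>) \<partial>lborel) < \<infinity>"
    using L by (rule order_tendstoD) simp
  then obtain n where "(\<integral>\<^sup>+x. ennreal (\<bar>\<phi> n x - w x\<bar> * \<bar>r x\<bar>) \<partial>lborel) < \<infinity>"
    by (auto simp: eventually_sequentially)
  then have "integrable lborel (\<lambda>x. (\<phi> n x - w x) * r x)"
    by (intro integrableI_bounded) (auto simp: abs_mult)
  then have "integrable lborel (\<lambda>x. \<phi> n x * r x - (\<phi> n x - w x) * r x)"
    by (intro Bochner_Integration.integrable_diff \<phi>r)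
  then show i: "integrable lborel (\<lambda>x. w x * r x)" by (simp add: algebra_simps)
  show "(\<lambda>n. LINT x|lborel. \<phi> n x * r x) \<longlonglongrightarrow> (LINT x|lborel. w x * r x)"
    by (rule tendsto_L1_int[OF \<phi>r i]) (use L in \<open>simp add: left_diff_distrib[symmetric] abs_mult\<close>)
qed

context frequency_function
begin

lemma integrable_g_gauss:
  assumes "\<tau> > 0"
  shows "integrable lborel (\<lambda>\<xi>. g \<xi> * of_real (exp (- \<tau> * (norm \<xi>)\<^sup>2)))"
  using integrable_heat[OF assms, of 0 0 0] by (simp add: wave_def)

lemma heat_eq_ft: "heat \<tau> x 0 0 = ft (\<lambda>\<xi>. g \<xi> * of_real (exp (- \<tau> * (norm \<xi>)\<^sup>2))) x"
  unfolding heat_def ft_def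
  by (intro Bochner_Integration.integral_cong refl) (simp add: wave_def inner_commute)

lemma continuous_on_heat: "\<tau> > 0 \<Longrightarrow> continuous_on UNIV (\<lambda>x. heat \<tau> x 0 0)"
  unfolding heat_eq_ft by (intro continuous_on_ft[unfolded] integrable_g_gauss) 

text \<open>Fubini moves the flow to the frequency side, where the pairing of g with the transform
  of \<eta> is absolutely convergent and dominates the damped integrands.\<close>

lemma heat_weak_limit:
  assumes \<eta>: "\<eta> \<in> test_functions UNIV"
  shows "(\<lambda>n. LINT x|lborel. heat (1 / real (Suc n)) x 0 0 * of_real (\<eta> x)) \<longlonglongrightarrow> (LINT \<xi>|lborel. g \<xi> * ft (\<lambda>x. of_real (\<eta> x)) \<xi>)"
proof -
  define f\<eta> where "f\<eta> = ft (\<lambda>x. complex_of_real (\<eta> x))"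
  note i\<eta> = ft_test_integrable[OF \<eta>]
  have [measurable]: "f\<eta> \<in> borel_measurable borel" unfolding f\<eta>_def by (rule ft_measurable[OF i\<eta>])
  have eq: "(LINT x|lborel. heat (1 / real (Suc n)) x 0 0 * of_real (\<eta> x))
    = (LINT \<xi>|lborel. g \<xi> * of_real (exp (- (1 / real (Suc n)) * (norm \<xi>)\<^sup>2)) * f\<eta> \<xi>)" for n
  proof -
    define f where "f \<xi> = g \<xi> * of_real (exp (- (1 / real (Suc n)) * (norm \<xi>)\<^sup>2))" for \<xi>
    have fi: "integrable lborel f" unfolding f_def[abs_def] by (rule integrable_g_gauss) simp
    have "(LINT x|lborel. (LINT \<xi>|lborel. exp (\<i> * complex_of_real (\<xi> \<bullet> x)) * f \<xi>) * of_real (\<eta> x))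
      = (LINT \<xi>|lborel. f \<xi> * (LINT x|lborel. exp (\<i> * complex_of_real (\<xi> \<bullet> x)) * of_real (\<eta> x)))"
      by (rule Fubini_kernel[OF fi i\<eta>, where B=1])
         (auto intro!: borel_measurable_pair_continuous continuous_intros)
    then show ?thesis by (simp add: heat_eq_ft ft_def f\<eta>_def f_def inner_commute)
  qed
  have gf: "integrable lborel (\<lambda>\<xi>. g \<xi> * f\<eta> \<xi>)"
    using weighted_L1_finite[OF g_measurable _ g_finite, of f\<eta>] weighted_sq_neg_ft_test[OF \<eta>, of s] s
    by (intro integrableI_bounded) (auto simp: norm_mult f\<eta>_def[symmetric])
  show ?thesis unfolding eq f\<eta>_def[symmetric]
  proof (rule integral_dominated_convergence[where w="\<lambda>\<xi>. cmod (g \<xi> * f\<eta> \<xi>)"])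
    show "integrable lborel (\<lambda>\<xi>. cmod (g \<xi> * f\<eta> \<xi>))" by (rule integrable_norm[OF gf])
    show "AE \<xi> in lborel. norm (g \<xi> * of_real (exp (- (1 / real (Suc n)) * (norm \<xi>)\<^sup>2)) * f\<eta> \<xi>) \<le> cmod (g \<xi> * f\<eta> \<xi>)" for n
    proof (rule AE_I2)
      fix \<xi> :: 'a
      have "exp (- (1 / real (Suc n)) * (norm \<xi>)\<^sup>2) \<le> 1" by simp
      then have "cmod (g \<xi> * f\<eta> \<xi>) * exp (- (1 / real (Suc n)) * (norm \<xi>)\<^sup>2) \<le> cmod (g \<xi> * f\<eta> \<xi>) * 1"
        by (intro mult_left_mono) auto
      then show "norm (g \<xi> * of_real (exp (- (1 / real (Suc n)) * (norm \<xi>)\<^sup>2)) * f\<eta> \<xi>) \<le> cmod (g \<xi> * f\<eta> \<xi>)"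
        by (simp add: norm_mult mult_ac)
    qed
    show "AE \<xi> in lborel. (\<lambda>n. g \<xi> * of_real (exp (- (1 / real (Suc n)) * (norm \<xi>)\<^sup>2)) * f\<eta> \<xi>) \<longlonglongrightarrow> g \<xi> * f\<eta> \<xi>"
    proof (rule AE_I2)
      fix \<xi> :: 'a
      have "(\<lambda>n. g \<xi> * complex_of_real (exp (- (1 / real (Suc n)) * (norm \<xi>)\<^sup>2)) * f\<eta> \<xi>) \<longlonglongrightarrow> g \<xi> * complex_of_real (exp (- 0 * (norm \<xi>)\<^sup>2)) * f\<eta> \<xi>"
        by (intro tendsto_intros LIMSEQ_Suc[OF lim_1_over_n])
      then show "(\<lambda>n. g \<xi> * of_real (exp (- (1 / real (Suc n)) * (norm \<xi>)\<^sup>2)) * f\<eta> \<xi>) \<longlonglongrightarrow> g \<xi> * f\<eta> \<xi>" by simp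
    qed
  qed measurable
qed

end

text \<open>A Borel representative u is tied to g by one sequence that converges to u in L^p and
  whose transforms converge to g in the weighted space.\<close>

locale represented_function = frequency_function s g for s :: real and g :: "'a::euclidean_space \<Rightarrow> complex" +
  fixes u :: "'a \<Rightarrow> real" and \<phi> :: "nat \<Rightarrow> 'a \<Rightarrow> real" and p :: real
  assumes u_measurable [measurable]: "u \<in> borel_measurable borel"
    and \<phi>: "\<And>n. \<phi> n \<in> test_functions UNIV" and p: "p > 1"
    and \<phi>_u: "(\<lambda>n. \<integral>\<^sup>+x. ennreal (\<bar>\<phi> n x - u x\<bar> powr p) \<partial>lborel) \<longlonglongrightarrow> 0"
    and \<phi>_g: "(\<lambda>n. weighted_sq s (\<lambda>\<xi>. fourier (\<phi> n) \<xi> - g \<xi>)) \<longlonglongrightarrow> 0"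
begin

definition c :: complex where "c = of_real ((2 * pi) powr (- real DIM('a) / 2))"

lemma c_nonzero: "c \<noteq> 0"
  by (simp add: c_def)

text \<open>The identity for the members of the sequence passes to the limit: on the left by
  convergence in L^p, on the right by convergence in the weighted space.\<close>

lemma Parseval:
  assumes \<eta>: "\<eta> \<in> test_functions UNIV"
  shows "(LINT x|lborel. complex_of_real (u x) * of_real (\<eta> x)) = c * (LINT \<xi>|lborel. g \<xi> * ft (\<lambda>x. of_real (\<eta> x)) \<xi>)"
proof -
  define f\<eta> where "f\<eta> = ft (\<lambda>x. complex_of_real (\<eta> x))"
  note i\<eta> = ft_test_integrable[OF \<eta>]
  have fm[measurable]: "f\<eta> \<in> borel_measurable borel" unfolding f\<eta>_def by (rule ft_measurable[OF i\<eta>])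
  note [measurable] = fourier_test_measurable[OF \<phi>]
  have fin: "weighted_sq (- s) f\<eta> < \<infinity>" using weighted_sq_neg_ft_test[OF \<eta>, of s] s by (simp add: f\<eta>_def)
  obtain B where B: "\<And>x. \<bar>\<eta> x\<bar> \<le> B" using test_function_bounded[OF \<eta>] by metis
  have "(\<lambda>n. complex_of_real (LINT x|lborel. \<phi> n x * \<eta> x)) \<longlonglongrightarrow> of_real (LINT x|lborel. u x * \<eta> x)"
    by (intro tendsto_of_real Lp_limit_integral(2)[OF \<phi> u_measurable p \<phi>_u test_function_integrable[OF \<eta>] B])
  then have 1: "(\<lambda>n. LINT x|lborel. complex_of_real (\<phi> n x) * of_real (\<eta> x)) \<longlonglongrightarrow> (LINT x|lborel. complex_of_real (u x) * of_real (\<eta> x))"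
    by (simp only: integral_complex_of_real[symmetric] of_real_mult)
  have wi: "integrable lborel (\<lambda>\<xi>. w \<xi> * f\<eta> \<xi>)" if "w \<in> borel_measurable borel" "weighted_sq s w < \<infinity>" for w
    using weighted_L1_finite[OF that(1) fm that(2) fin] that(1) by (intro integrableI_bounded) (auto simp: norm_mult)
  have "(\<lambda>n. LINT \<xi>|lborel. fourier (\<phi> n) \<xi> * f\<eta> \<xi>) \<longlonglongrightarrow> (LINT \<xi>|lborel. g \<xi> * f\<eta> \<xi>)"
  proof (rule tendsto_L1_int)
    show "integrable lborel (\<lambda>\<xi>. fourier (\<phi> n) \<xi> * f\<eta> \<xi>)" for n
      using weighted_sq_test[OF \<phi>, of s] s by (intro wi fourier_test_measurable[OF \<phi>]) simp
    show "integrable lborel (\<lambda>\<xi>. g \<xi> * f\<eta> \<xi>)" by (rule wi[OF g_measurable g_finite])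
    have "(\<lambda>n. \<integral>\<^sup>+\<xi>. ennreal (cmod (fourier (\<phi> n) \<xi> - g \<xi>) * cmod (f\<eta> \<xi>)) \<partial>lborel) \<longlonglongrightarrow> 0"
      by (rule weighted_L1_tendsto_0[OF _ fm \<phi>_g fin]) measurable
    then show "(\<lambda>n. \<integral>\<^sup>+\<xi>. ennreal (cmod (fourier (\<phi> n) \<xi> * f\<eta> \<xi> - g \<xi> * f\<eta> \<xi>)) \<partial>lborel) \<longlonglongrightarrow> 0"
      by (simp add: left_diff_distrib[symmetric] norm_mult)
  qed
  then have "(\<lambda>n. c * (LINT \<xi>|lborel. fourier (\<phi> n) \<xi> * f\<eta> \<xi>)) \<longlonglongrightarrow> c * (LINT \<xi>|lborel. g \<xi> * f\<eta> \<xi>)"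
    by (intro tendsto_mult tendsto_const)
  then have "(\<lambda>n. LINT x|lborel. complex_of_real (\<phi> n x) * of_real (\<eta> x)) \<longlonglongrightarrow> c * (LINT \<xi>|lborel. g \<xi> * f\<eta> \<xi>)"
    unfolding c_def f\<eta>_def test_Parseval[OF \<phi> \<eta>] .
  from LIMSEQ_unique[OF 1 this] show ?thesis by (simp add: f\<eta>_def)
qed

text \<open>On a box where the flows converge uniformly, c W and u have the same integrals against
  test functions supported there: the flows converge weakly to both, once by uniformity and once, up
  to the factor c, by Parseval's identity.\<close>

lemma local_identification:
  assumes Wm [measurable]: "W \<in> borel_measurable borel" and \<epsilon>: "\<epsilon> \<longlonglongrightarrow> 0"
    and W: "\<And>n x. x \<in> cbox l r \<Longrightarrow> cmod (heat (1 / real (Suc n)) x 0 0 - W x) \<le> \<epsilon> n"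
  shows "AE x in lborel. x \<in> cbox l r \<longrightarrow> complex_of_real (u x) = c * W x"
proof -
  define C where "C = cbox l r"
  have C[measurable]: "C \<in> sets borel" by (simp add: C_def)
  have iC: "integrable lborel (indicator C :: 'a \<Rightarrow> real)"
    unfolding C_def by (intro integrable_real_indicator) (auto simp: emeasure_lborel_cbox_eq)
  have hm: "(\<lambda>x. heat (1 / real (Suc n)) x 0 0) \<in> borel_measurable borel" for n
    by (intro borel_measurable_continuous_onI continuous_on_heat) simp
  note [measurable] = hm
  \<comment> \<open>Closeness to the first flow, which is bounded, makes W bounded and hence
    integrable on the box.\<close>
  obtain H where H: "\<And>x. cmod (heat (1 / real (Suc 0)) x 0 0) \<le> H"
    using norm_ft_le[OF integrable_g_gauss[of "1 / real (Suc 0)"]] unfolding heat_eq_ft by auto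
  have WH: "cmod (W x) \<le> H + \<epsilon> 0" if "x \<in> C" for x
    using W[of x 0] that H[of x] norm_triangle_ineq2[of "W x" "heat (1 / real (Suc 0)) x 0 0"]
    unfolding C_def by (simp add: norm_minus_commute)
  have ui: "integrable lborel (\<lambda>x. u x * indicator C x)"
    by (rule Lp_limit_integral(1)[OF \<phi> u_measurable p \<phi>_u iC, where B=1]) (auto simp: indicator_def)
  have Wi: "set_integrable lborel C W"
    unfolding set_integrable_def
    by (rule Bochner_Integration.integrable_bound[OF integrable_mult_right[OF iC, of "H + \<epsilon> 0"]])
       (use WH in \<open>auto simp: indicator_def intro: order_trans[OF _ abs_ge_self]\<close>)
  have hi: "set_integrable lborel (cbox l r) (\<lambda>x. complex_of_real (u x) - c * W x)"
  proof -
    have "set_integrable lborel C (\<lambda>x. complex_of_real (u x))"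
      unfolding set_integrable_def using integrable_of_real[OF ui, where 'a=complex]
      by (simp add: scaleR_conv_of_real mult.commute)
    then show ?thesis unfolding C_def[symmetric] using Wi by (intro set_integral_diff set_integrable_mult_right) auto
  qed
  have "AE x in lborel. x \<in> cbox l r \<longrightarrow> complex_of_real (u x) - c * W x = 0"
  proof (rule test_integrals_0_imp_AE_0_local[OF _ hi])
    fix \<eta> :: "'a \<Rightarrow> real" assume \<eta>: "\<eta> \<in> test_functions UNIV" and supp: "\<And>x. \<bar>\<eta> x\<bar> \<le> indicator (cbox l r) x"
    note [measurable] = test_function_measurable[OF \<eta>]
    have \<eta>0: "\<eta> x = 0" if "x \<notin> C" for x using supp[of x] that by (simp add: C_def)
    have \<eta>1: "\<bar>\<eta> x\<bar> \<le> 1" for x by (rule order_trans[OF supp indicator_le_1])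
    have i\<eta>: "integrable lborel (\<lambda>x. \<bar>\<eta> x\<bar>)" using test_function_integrable[OF \<eta>] by simp
    have iu: "integrable lborel (\<lambda>x. complex_of_real (u x) * of_real (\<eta> x))"
      using integrable_of_real[OF Lp_limit_integral(1)[OF \<phi> u_measurable p \<phi>_u test_function_integrable[OF \<eta>] \<eta>1], where 'a=complex]
      by simp
    have iW: "integrable lborel (\<lambda>x. W x * of_real (\<eta> x))"
    proof (rule Bochner_Integration.integrable_bound[OF integrable_mult_right[OF i\<eta>, of "H + \<epsilon> 0"]])
      have "cmod (W x * of_real (\<eta> x)) \<le> (H + \<epsilon> 0) * \<bar>\<eta> x\<bar>" for x
      proof (cases "x \<in> C")
        case True
        show ?thesis unfolding norm_mult norm_of_real by (rule mult_right_mono[OF WH[OF True] abs_ge_zero])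
      qed (simp add: \<eta>0)
      then show "AE x in lborel. norm (W x * of_real (\<eta> x)) \<le> norm ((H + \<epsilon> 0) * \<bar>\<eta> x\<bar>)"
        by (intro AE_I2) (auto intro: order_trans[OF _ abs_ge_self])
    qed measurable
    have "(\<lambda>n. LINT x|lborel. heat (1 / real (Suc n)) x 0 0 * of_real (\<eta> x)) \<longlonglongrightarrow> (LINT x|lborel. W x * of_real (\<eta> x))"
    proof (rule LIM_zero_cancel, rule Lim_null_comparison)
      have "cmod ((LINT x|lborel. heat (1 / real (Suc n)) x 0 0 * of_real (\<eta> x)) - (LINT x|lborel. W x * of_real (\<eta> x)))
        \<le> \<epsilon> n * (LINT x|lborel. \<bar>\<eta> x\<bar>)" for n
      proof -
        have le: "cmod (heat (1 / real (Suc n)) x 0 0 * of_real (\<eta> x) - W x * of_real (\<eta> x)) \<le> \<epsilon> n * \<bar>\<eta> x\<bar>" for x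
        proof (cases "x \<in> C")
          case True
          then show ?thesis unfolding left_diff_distrib[symmetric] norm_mult norm_of_real
            by (intro mult_right_mono[OF W abs_ge_zero]) (simp add: C_def)
        qed (simp add: \<eta>0)
        have id: "integrable lborel (\<lambda>x. heat (1 / real (Suc n)) x 0 0 * of_real (\<eta> x) - W x * of_real (\<eta> x))"
        proof (rule Bochner_Integration.integrable_bound[OF integrable_mult_right[OF i\<eta>, of "\<epsilon> n"]])
          show "AE x in lborel. norm (heat (1 / real (Suc n)) x 0 0 * of_real (\<eta> x) - W x * of_real (\<eta> x)) \<le> norm (\<epsilon> n * \<bar>\<eta> x\<bar>)"
            unfolding real_norm_def by (intro AE_I2 order_trans[OF le abs_ge_self])
        qed measurable
        have ih: "integrable lborel (\<lambda>x. heat (1 / real (Suc n)) x 0 0 * of_real (\<eta> x))"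
          using Bochner_Integration.integrable_add[OF id iW] by simp
        have "cmod ((LINT x|lborel. heat (1 / real (Suc n)) x 0 0 * of_real (\<eta> x)) - (LINT x|lborel. W x * of_real (\<eta> x)))
          = cmod (LINT x|lborel. heat (1 / real (Suc n)) x 0 0 * of_real (\<eta> x) - W x * of_real (\<eta> x))"
          by (simp only: Bochner_Integration.integral_diff[OF ih iW])
        also have "\<dots> \<le> (LINT x|lborel. \<epsilon> n * \<bar>\<eta> x\<bar>)"
          by (rule order_trans[OF integral_norm_bound integral_mono]) (use id i\<eta> le in auto)
        finally show ?thesis by simp
      qed
      then show "\<forall>\<^sub>F n in sequentially. norm ((LINT x|lborel. heat (1 / real (Suc n)) x 0 0 * of_real (\<eta> x)) - (LINT x|lborel. W x * of_real (\<eta> x)))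
        \<le> \<epsilon> n * (LINT x|lborel. \<bar>\<eta> x\<bar>)" by simp
      show "(\<lambda>n. \<epsilon> n * (LINT x|lborel. \<bar>\<eta> x\<bar>)) \<longlonglongrightarrow> 0" by (rule tendsto_mult_left_zero[OF \<epsilon>])
    qed
    from LIMSEQ_unique[OF this heat_weak_limit[OF \<eta>]]
    have "(LINT x|lborel. complex_of_real (u x) * of_real (\<eta> x)) = c * (LINT x|lborel. W x * of_real (\<eta> x))"
      using Parseval[OF \<eta>] by simp
    then have "(LINT x|lborel. complex_of_real (u x) * of_real (\<eta> x) - c * (W x * of_real (\<eta> x))) = 0"
      using iu iW by simp
    then show "(LINT x|lborel. (complex_of_real (u x) - c * W x) * of_real (\<eta> x)) = 0"
      by (simp add: algebra_simps)
  qed measurable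
  then show ?thesis by eventually_elim simp
qed

end

section \<open>Zeros of infinite order\<close>

text \<open>At a zero of finite order n, f factors as z^n h with h 0 nonzero; decay of order n + 1
  along the positive reals alone contradicts this.\<close>

lemma flat_holomorphic_eq_0:
  assumes hol: "f holomorphic_on ball 0 R" and R: "R > 0"
    and flat: "\<And>k::nat. \<exists>C d. d > 0 \<and> (\<forall>r. 0 < r \<longrightarrow> r < d \<longrightarrow> cmod (f (of_real r)) \<le> C * r ^ k)"
    and z: "z \<in> ball 0 R"
  shows "f z = 0"
proof (rule ccontr)
  \<comment> \<open>Continuity turns decay along the positive reals into a value at 0; this serves
    first for f and then for its cofactor.\<close>
  have aux: "h 0 = 0" if h: "isCont h 0" and d: "d > 0" "\<And>r. 0 < r \<Longrightarrow> r < d \<Longrightarrow> cmod (h (of_real r)) \<le> C * r" for h :: "complex \<Rightarrow> complex" and C d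
  proof -
    have "((\<lambda>r. complex_of_real r) \<longlongrightarrow> of_real 0) (at_right 0)" by (intro tendsto_intros)
    then have 1: "((\<lambda>r. h (of_real r)) \<longlongrightarrow> h 0) (at_right 0)"
      using isCont_tendsto_compose[OF h] by simp
    have lim: "((\<lambda>r. C * r) \<longlongrightarrow> C * 0) (at_right 0)" by (intro tendsto_intros)
    have "((\<lambda>r. h (of_real r)) \<longlongrightarrow> 0) (at_right 0)"
    proof (rule Lim_null_comparison[of _ "\<lambda>r. C * r"])
      show "\<forall>\<^sub>F r in at_right 0. cmod (h (of_real r)) \<le> C * r"
        unfolding eventually_at_right_field by (intro exI[of _ d] conjI allI impI d) auto
    qed (use lim in simp)
    from tendsto_unique[OF _ 1 this] show ?thesis by simp
  qed
  assume fz: "f z \<noteq> 0"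
  have contf: "isCont f 0"
    by (rule continuous_on_interior[OF holomorphic_on_imp_continuous_on[OF hol]]) (simp add: R)
  obtain C d where "d > 0" "\<forall>r. 0 < r \<longrightarrow> r < d \<longrightarrow> cmod (f (of_real r)) \<le> C * r ^ 1" using flat[of 1] by blast
  then have f0: "f 0 = 0" using aux[OF contf, of d C] by simp
  have nc: "\<not> f constant_on ball 0 R" using fz f0 z R unfolding constant_on_def by (metis centre_in_ball)
  obtain h r n where h: "0 < n" "0 < r" "h holomorphic_on ball 0 r"
    "\<And>w. w \<in> ball 0 r \<Longrightarrow> f w = (w - 0) ^ n * h w" "\<And>w. w \<in> ball 0 r \<Longrightarrow> h w \<noteq> 0"
    by (rule holomorphic_factor_zero_nonconstant[OF hol open_ball connected_ball _ f0 nc]) (use R in auto)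
  obtain C d where d: "d > 0" "\<And>t. 0 < t \<Longrightarrow> t < d \<Longrightarrow> cmod (f (of_real t)) \<le> C * t ^ Suc n" using flat[of "Suc n"] by blast
  have conth: "isCont h 0"
    by (rule continuous_on_interior[OF holomorphic_on_imp_continuous_on[OF h(3)]]) (simp add: h(2))
  have "h 0 = 0"
  proof (rule aux[OF conth])
    show "min r d > 0" using h d by simp
    fix t assume t: "0 < t" "t < min r d"
    have "t ^ n * cmod (h (of_real t)) \<le> C * t ^ Suc n"
      using d(2)[of t] h(4)[of "of_real t"] t by (simp add: norm_mult norm_power)
    then have "t ^ n * cmod (h (of_real t)) \<le> t ^ n * (C * t)" by (simp add: mult_ac)
    then show "cmod (h (of_real t)) \<le> C * t" using t by simp
  qed
  then show False using h(2,5) by auto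
qed

text \<open>The set where the inequality fails is open; being null, it is empty.\<close>

lemma AE_le_imp_le:
  fixes f g :: "'a::euclidean_space \<Rightarrow> real"
  assumes S: "open S" and f: "continuous_on S f" and g: "continuous_on S g"
    and ae: "AE x in lborel. x \<in> S \<longrightarrow> f x \<le> g x" and x: "x \<in> S"
  shows "f x \<le> g x"
proof -
  define T where "T = {x \<in> S. 0 < f x - g x}"
  have T: "open T"
  proof -
    have "T = S \<inter> (\<lambda>x. f x - g x) -` {0<..}" by (auto simp: T_def)
    then show ?thesis using continuous_open_preimage[OF continuous_on_diff[OF f g] S open_greaterThan] by simp
  qed
  have "AE x in lborel. x \<notin> T" using ae by eventually_elim (auto simp: T_def)
  then have "T \<in> null_sets lborel" using T by (subst AE_iff_null_sets) auto
  then have "negligible T" by (simp add: negligible_iff_null_sets null_sets_completionI)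
  then have "T = {}" using open_not_negligible[OF T] by auto
  then show ?thesis using x by (auto simp: T_def not_less)
qed

lemma norm_le_cube:
  fixes x y :: "'a::euclidean_space"
  assumes "x \<in> cbox (y - \<kappa> *\<^sub>R One) (y + \<kappa> *\<^sub>R One)"
  shows "norm (x - y) \<le> real DIM('a) * \<kappa>"
proof -
  have "norm (x - y) \<le> (\<Sum>b\<in>Basis. \<bar>(x - y) \<bullet> b\<bar>)" by (rule norm_le_l1)
  also have "\<dots> \<le> (\<Sum>b\<in>(Basis::'a set). \<kappa>)"
  proof (rule sum_mono)
    fix b :: 'a assume "b \<in> Basis"
    then show "\<bar>(x - y) \<bullet> b\<bar> \<le> \<kappa>" using assms by (auto simp: mem_box inner_diff_left inner_add_left abs_le_iff dest!: bspec)
  qed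
  finally show ?thesis by simp
qed

lemma ball_subset_cube:
  fixes x y :: "'a::euclidean_space"
  assumes "norm (x - y) \<le> \<kappa>"
  shows "x \<in> cbox (y - \<kappa> *\<^sub>R One) (y + \<kappa> *\<^sub>R One)"
proof -
  have "\<bar>(x - y) \<bullet> b\<bar> \<le> \<kappa>" if "b \<in> Basis" for b
    using Basis_le_norm[OF that, of "x - y"] assms by linarith
  then show ?thesis by (force simp: mem_box inner_diff_left inner_add_left abs_le_iff)
qed

text \<open>The order condition for functions known up to null sets. It also holds at points near
  which u vanishes almost everywhere, so that the local result can be applied again there.\<close>

definition flat_at :: "('a::euclidean_space \<Rightarrow> real) \<Rightarrow> 'a \<Rightarrow> bool" where
  "flat_at u y \<longleftrightarrow> (\<forall>k::nat. \<exists>C d. d > 0 \<and> (AE x in lborel. norm (x - y) < d \<longrightarrow> \<bar>u x\<bar> \<le> C * norm (x - y) ^ k))"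

text \<open>Along each ray from y the limit of the heat flows is holomorphic in the complexified
  parameter and flat at 0, hence 0. The size \<kappa> of the cube depends on \<delta> and N but not
  on y, which the propagation argument relies on.\<close>

lemma (in represented_function) flat_imp_vanishes:
  fixes \<delta> :: real
  defines "\<rho> \<equiv> \<delta> / (2 * real DIM('a))"
  defines "\<kappa> \<equiv> \<rho> / (2 * real DIM('a))"
  assumes sol: "\<And>\<phi>. \<phi> \<in> test_functions \<Omega> \<Longrightarrow> (LINT \<xi>|lborel. of_real (norm \<xi> powr (2 * s)) * g \<xi> * ft (\<lambda>x. of_real (\<phi> x)) \<xi>) = 0"
    and \<delta>: "0 < \<delta>" "\<delta> \<le> 1" and box: "cbox (y - (2 * \<delta>) *\<^sub>R One) (y + (2 * \<delta>) *\<^sub>R One) \<subseteq> \<Omega>"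
    and flat: "flat_at u y"
  shows "AE x in lborel. x \<in> cbox (y - \<kappa> *\<^sub>R One) (y + \<kappa> *\<^sub>R One) \<longrightarrow> u x = 0"
proof -
  have \<rho>: "\<rho> > 0" using \<delta> by (simp add: \<rho>_def)
  then have \<kappa>: "\<kappa> > 0" by (simp add: \<kappa>_def)
  \<comment> \<open>The divisor 2 N in \<kappa> puts the cube inside the ball of radius \<rho> on
    which the flows converge.\<close>
  have cube: "norm (x - y) < \<rho>" if "x \<in> cbox (y - \<kappa> *\<^sub>R One) (y + \<kappa> *\<^sub>R One)" for x
  proof -
    have "norm (x - y) \<le> real DIM('a) * \<kappa>" by (rule norm_le_cube[OF that])
    also have "\<dots> = \<rho> / 2" by (simp add: \<kappa>_def)
    finally show ?thesis using \<rho> by simp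
  qed
  obtain M0 where M0: "\<And>t e \<zeta>. 0 < t \<Longrightarrow> t \<le> 1 \<Longrightarrow> norm e \<le> 1 \<Longrightarrow> cmod \<zeta> \<le> \<rho> \<Longrightarrow> cmod (heat_frac t y e \<zeta>) \<le> M0"
  proof (rule heat_frac_bounded[OF sol \<delta> box, folded \<rho>_def])
    fix M0 assume "\<And>t e \<zeta>. 0 < t \<Longrightarrow> t \<le> 1 \<Longrightarrow> norm e \<le> 1 \<Longrightarrow> cmod \<zeta> \<le> \<rho> \<Longrightarrow> cmod (heat_frac t y e \<zeta>) \<le> M0"
    then show thesis by (rule that)
  qed
  obtain U \<epsilon> where \<epsilon>: "\<epsilon> \<longlonglongrightarrow> (0::real)"
    and U: "\<And>n e \<zeta>. norm e \<le> 1 \<Longrightarrow> cmod \<zeta> \<le> \<rho> \<Longrightarrow> cmod (heat (1 / real (Suc n)) y e \<zeta> - U e \<zeta>) \<le> \<epsilon> n"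
  proof (rule heat_uniform_limit[OF M0 less_imp_le[OF \<rho>]])
    fix U \<epsilon> assume "\<epsilon> \<longlonglongrightarrow> (0::real)"
      "\<And>n e \<zeta>. norm e \<le> 1 \<Longrightarrow> cmod \<zeta> \<le> \<rho> \<Longrightarrow> cmod (heat (1 / real (Suc n)) y e \<zeta> - U e \<zeta>) \<le> \<epsilon> n"
    then show thesis by (rule that)
  qed
  \<comment> \<open>Defined everywhere as a pointwise limit, which makes it measurable; on the ball
    of radius \<rho> it agrees with \<open>U e\<close> along every ray.\<close>
  define W where "W x = lim (\<lambda>n. heat (1 / real (Suc n)) x 0 0)" for x
  have hc: "continuous_on UNIV (\<lambda>x. heat (1 / real (Suc n)) x 0 0)" for n
    by (rule continuous_on_heat) simp
  note [measurable] = borel_measurable_continuous_onI[OF hc]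
  have Wm: "W \<in> borel_measurable borel" unfolding W_def[abs_def] by measurable
  have WU: "W (y + r *\<^sub>R e) = U e (of_real r)" if "norm e \<le> 1" "\<bar>r\<bar> \<le> \<rho>" for e r
  proof -
    have "(\<lambda>n. heat (1 / real (Suc n)) y e (of_real r)) \<longlonglongrightarrow> U e (of_real r)"
      by (rule LIM_zero_cancel, rule Lim_null_comparison[OF _ \<epsilon>]) (use U[OF that(1), of "of_real r"] that(2) in simp)
    then show ?thesis unfolding W_def heat_of_real by (rule limI)
  qed
  have polar: "\<exists>e. norm e = 1 \<and> x = y + norm (x - y) *\<^sub>R e" for x
  proof (cases "x = y")
    case True
    obtain b :: 'a where "b \<in> Basis" using nonempty_Basis by blast
    then show ?thesis using True by (intro exI[of _ b]) simp
  next
    case False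
    then show ?thesis by (intro exI[of _ "sgn (x - y)"]) (simp add: sgn_div_norm)
  qed
  have Wb: "cmod (heat (1 / real (Suc n)) x 0 0 - W x) \<le> \<epsilon> n" if "norm (x - y) \<le> \<rho>" for x n
  proof -
    obtain e where e: "norm e = 1" "x = y + norm (x - y) *\<^sub>R e" using polar by blast
    have "heat (1 / real (Suc n)) x 0 0 = heat (1 / real (Suc n)) y e (of_real (norm (x - y)))"
      unfolding heat_of_real using e(2) by simp
    moreover have "W x = U e (of_real (norm (x - y)))" using WU[of e "norm (x - y)"] e that by simp
    ultimately show ?thesis using U[of e "of_real (norm (x - y))" n] e that by simp
  qed
  have Wc: "continuous_on (ball y \<rho>) W"
  proof (rule uniform_limit_theorem)
    show "\<forall>\<^sub>F n in sequentially. continuous_on (ball y \<rho>) (\<lambda>x. heat (1 / real (Suc n)) x 0 0)"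
      by (intro always_eventually allI continuous_on_subset[OF hc]) simp
    show "uniform_limit (ball y \<rho>) (\<lambda>n x. heat (1 / real (Suc n)) x 0 0) W sequentially"
    proof (rule uniform_limitI)
      fix e :: real assume "e > 0"
      with \<epsilon> have "\<forall>\<^sub>F n in sequentially. \<epsilon> n < e" by (rule order_tendstoD)
      then show "\<forall>\<^sub>F n in sequentially. \<forall>x\<in>ball y \<rho>. dist (heat (1 / real (Suc n)) x 0 0) (W x) < e"
      proof eventually_elim
        case (elim n)
        show ?case
        proof
          fix x assume "x \<in> ball y \<rho>"
          then have "norm (x - y) \<le> \<rho>" by (simp add: dist_norm norm_minus_commute)
          from order.strict_trans1[OF Wb[OF this] elim]
          show "dist (heat (1 / real (Suc n)) x 0 0) (W x) < e" unfolding dist_norm .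
        qed
      qed
    qed
  qed simp
  have id: "AE x in lborel. x \<in> cbox (y - \<kappa> *\<^sub>R One) (y + \<kappa> *\<^sub>R One) \<longrightarrow> complex_of_real (u x) = c * W x"
    by (rule local_identification[OF Wm \<epsilon> Wb]) (use cube in \<open>auto intro: less_imp_le\<close>)
  \<comment> \<open>The flatness of u holds almost everywhere only; since \<open>W\<close> is
    continuous, its estimate holds at every point of a small ball.\<close>
  have Wflat: "\<exists>C d. d > 0 \<and> (\<forall>x. norm (x - y) < d \<longrightarrow> cmod (W x) \<le> C * norm (x - y) ^ k)" for k :: nat
  proof -
    obtain C d where d: "d > 0" and C: "AE x in lborel. norm (x - y) < d \<longrightarrow> \<bar>u x\<bar> \<le> C * norm (x - y) ^ k"
      using flat unfolding flat_at_def by blast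
    define d' where "d' = min d (min \<kappa> \<rho>)"
    have d': "d' > 0" using d \<kappa> \<rho> by (simp add: d'_def)
    have "cmod c * cmod (W x) \<le> C * norm (x - y) ^ k" if x: "x \<in> ball y d'" for x
    proof (rule AE_le_imp_le[OF open_ball _ _ _ x])
      have "ball y d' \<subseteq> ball y \<rho>" by (auto simp: d'_def)
      then show "continuous_on (ball y d') (\<lambda>x. cmod c * cmod (W x))"
        by (intro continuous_intros continuous_on_subset[OF Wc])
      show "continuous_on (ball y d') (\<lambda>x. C * norm (x - y) ^ k)" by (intro continuous_intros)
      show "AE x in lborel. x \<in> ball y d' \<longrightarrow> cmod c * cmod (W x) \<le> C * norm (x - y) ^ k"
        using id C
      proof eventually_elim
        case (elim x)
        show ?case
        proof
          assume "x \<in> ball y d'"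
          then have n: "norm (x - y) < d'" by (simp add: dist_norm norm_minus_commute)
          then have "complex_of_real (u x) = c * W x"
            using elim(1) ball_subset_cube[of x y \<kappa>] by (simp add: d'_def)
          then have "cmod c * cmod (W x) = \<bar>u x\<bar>" by (metis norm_mult norm_of_real)
          then show "cmod c * cmod (W x) \<le> C * norm (x - y) ^ k" using elim(2) n by (simp add: d'_def)
        qed
      qed
    qed
    then have "cmod (W x) \<le> (C / cmod c) * norm (x - y) ^ k" if "norm (x - y) < d'" for x
      using c_nonzero that by (simp add: field_simps dist_norm norm_minus_commute)
    then show ?thesis using d' by blast
  qed
  have W0: "W x = 0" if x: "norm (x - y) < \<rho>" for x
  proof -
    obtain e where e: "norm e = 1" "x = y + norm (x - y) *\<^sub>R e" using polar by blast
    have hol: "U e holomorphic_on ball 0 \<rho>"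
    proof (rule holomorphic_uniform_sequence[OF open_ball])
      show "heat (1 / real (Suc n)) y e holomorphic_on ball 0 \<rho>" for n
        by (rule heat_holomorphic) (use e in auto)
      fix z :: complex assume z: "z \<in> ball 0 \<rho>"
      define d where "d = (\<rho> - cmod z) / 2"
      have d: "d > 0" using z by (simp add: d_def)
      have sub: "cball z d \<subseteq> ball 0 \<rho>"
      proof
        fix w assume "w \<in> cball z d"
        then have "cmod w \<le> cmod z + d" using norm_triangle_sub[of w z] by (simp add: dist_norm norm_minus_commute)
        also have "\<dots> < \<rho>" using z by (simp add: d_def field_simps)
        finally show "w \<in> ball 0 \<rho>" by simp
      qed
      have "uniform_limit (cball z d) (\<lambda>n. heat (1 / real (Suc n)) y e) (U e) sequentially"
      proof (rule uniform_limitI)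
        fix r :: real assume "r > 0"
        with \<epsilon> have "\<forall>\<^sub>F n in sequentially. \<epsilon> n < r" by (rule order_tendstoD)
        then show "\<forall>\<^sub>F n in sequentially. \<forall>x\<in>cball z d. dist (heat (1 / real (Suc n)) y e x) (U e x) < r"
        proof eventually_elim
          case (elim n)
          show ?case
          proof
            fix x assume "x \<in> cball z d"
            then have "cmod x \<le> \<rho>" using sub by force
            then show "dist (heat (1 / real (Suc n)) y e x) (U e x) < r"
              using U[of e x n] e elim by (simp add: dist_norm)
          qed
        qed
      qed
      then show "\<exists>d>0. cball z d \<subseteq> ball 0 \<rho> \<and> uniform_limit (cball z d) (\<lambda>n. heat (1 / real (Suc n)) y e) (U e) sequentially"
        using d sub by blast
    qed
    \<comment> \<open>On the ray through x, \<open>U e\<close> takes the values of \<open>W\<close>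
      at positive reals and inherits its flatness.\<close>
    have "U e (of_real (norm (x - y))) = 0"
    proof (rule flat_holomorphic_eq_0[OF hol \<rho>])
      show "of_real (norm (x - y)) \<in> ball (0::complex) \<rho>" using x by simp
      fix k :: nat
      obtain C d where d: "d > 0" and C: "\<And>x. norm (x - y) < d \<Longrightarrow> cmod (W x) \<le> C * norm (x - y) ^ k"
        using Wflat by blast
      have "cmod (U e (of_real r)) \<le> C * r ^ k" if "0 < r" "r < min d \<rho>" for r
        using C[of "y + r *\<^sub>R e"] WU[of e r] e that by simp
      then show "\<exists>C d. d > 0 \<and> (\<forall>r. 0 < r \<longrightarrow> r < d \<longrightarrow> cmod (U e (of_real r)) \<le> C * r ^ k)"
        using d \<rho> by (intro exI[of _ C] exI[of _ "min d \<rho>"]) auto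
    qed
    then show ?thesis using WU[of e "norm (x - y)"] e x by simp
  qed
  show ?thesis using id
  proof eventually_elim
    case (elim x)
    then show ?case using W0[of x] cube[of x] by auto
  qed
qed

section \<open>From the weak equation to vanishing on the whole domain\<close>

text \<open>The transforms selected by \<open>SOME\<close> are replaced by g and by
  \<open>fourier \<phi>\<close>, and the Lebesgue measure by \<open>lborel\<close>; conjugation
  turns \<open>fourier\<close> into a nonzero multiple of \<open>ft\<close>.\<close>

lemma solution_weak_form:
  fixes s :: real and u :: "'a::euclidean_space \<Rightarrow> real"
  assumes s: "0 < s" "2 * s < DIM('a)" and sol: "frac_laplace_solution s \<Omega> u"
    and gm: "g \<in> borel_measurable borel" and g: "AE \<xi> in lborel. D_fourier s u \<xi> = g \<xi>"
    and \<phi>: "\<phi> \<in> test_functions \<Omega>"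
  shows "(LINT \<xi>|lborel. of_real (norm \<xi> powr (2 * s)) * g \<xi> * ft (\<lambda>x. of_real (\<phi> x)) \<xi>) = 0"
proof -
  define c where "c = complex_of_real ((2 * pi) powr (- real DIM('a) / 2))"
  have c: "c \<noteq> 0" by (simp add: c_def)
  have uD: "u \<in> D_space s" using sol by (simp add: frac_laplace_solution_def)
  have fm: "fourier \<phi> \<in> borel_measurable borel" by (rule fourier_test_measurable[OF \<phi>])
  have m: "D_fourier s u \<in> borel_measurable lebesgue" "D_fourier s \<phi> \<in> borel_measurable lebesgue"
    "g \<in> borel_measurable lebesgue" "fourier \<phi> \<in> borel_measurable lebesgue"
    using D_fourier_measurable[OF uD] D_fourier_measurable[OF test_function_in_D_space[OF \<phi>]] s gm fm
    by (auto intro: measurable_completion)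
  have [measurable]: "cnj \<in> borel_measurable borel" by (intro borel_measurable_continuous_onI continuous_intros)
  have [measurable]: "(\<lambda>\<xi>::'a. norm \<xi> powr (2 * s)) \<in> borel_measurable lebesgue" by (intro measurable_completion) measurable
  note [measurable] = m
  have "0 = freq_inner s (D_fourier s u) (D_fourier s \<phi>)"
    using sol \<phi> by (simp add: frac_laplace_solution_def D_inner_def)
  also have "\<dots> = freq_inner s g (fourier \<phi>)"
    unfolding freq_inner_def
  proof (rule integral_cong_AE)
    have "AE \<xi> in lborel. D_fourier s u \<xi> = g \<xi> \<and> D_fourier s \<phi> \<xi> = fourier \<phi> \<xi>"
      using g D_fourier_test[OF \<phi> s] by eventually_elim simp
    then have "AE \<xi> in lebesgue. D_fourier s u \<xi> = g \<xi> \<and> D_fourier s \<phi> \<xi> = fourier \<phi> \<xi>"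
      by (simp only: AE_completion_iff)
    then show "AE \<xi> in lebesgue. complex_of_real (norm \<xi> powr (2 * s)) * D_fourier s u \<xi> * cnj (D_fourier s \<phi> \<xi>)
      = complex_of_real (norm \<xi> powr (2 * s)) * g \<xi> * cnj (fourier \<phi> \<xi>)" by eventually_elim simp
  qed measurable
  also have "\<dots> = (LINT \<xi>|lborel. c * (of_real (norm \<xi> powr (2 * s)) * g \<xi> * ft (\<lambda>x. of_real (\<phi> x)) \<xi>))"
    unfolding freq_inner_lborel[OF gm fm]
    by (simp only: fourier_eq_ft(2)[OF test_function_measurable[OF \<phi>]]) (simp only: c_def mult_ac)
  also have "\<dots> = c * (LINT \<xi>|lborel. of_real (norm \<xi> powr (2 * s)) * g \<xi> * ft (\<lambda>x. of_real (\<phi> x)) \<xi>)"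
    by (rule integral_mult_right_zero)
  finally show ?thesis using c by simp
qed

text \<open>The points near which u vanishes almost everywhere form a nonempty subset of the
  connected domain that is open and has open complement there.\<close>

lemma strong_unique_continuation:
  fixes s :: real and u :: "'a::euclidean_space \<Rightarrow> real"
  assumes s: "1 < s" "s < 2" "2 * s < DIM('a)"
    and \<Omega>: "open \<Omega>" "connected \<Omega>" and sol: "frac_laplace_solution s \<Omega> u" and x0: "x0 \<in> \<Omega>"
    and vanish: "\<And>k::nat. u \<in> O[at x0](\<lambda>x. norm (x - x0) ^ k)"
  shows "AE x in lebesgue. x \<in> \<Omega> \<longrightarrow> u x = 0"
proof -
  have s0: "0 < s" "0 \<le> s" using s by auto
  have uD: "u \<in> D_space s" using sol by (simp add: frac_laplace_solution_def)
  obtain \<phi> g where D: "D_approx s \<phi> u" and gm: "g \<in> borel_measurable borel"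
    and g: "AE \<xi> in lborel. D_fourier s u \<xi> = g \<xi>" "(\<lambda>n. weighted_sq s (\<lambda>\<xi>. fourier (\<phi> n) \<xi> - g \<xi>)) \<longlonglongrightarrow> 0"
    using D_fourier_approx[OF uD s0(2)] by blast
  have "u \<in> borel_measurable lebesgue" using uD by (simp add: D_space_def)
  from completion_ex_borel_measurable_real[OF this] obtain v where
    v: "v \<in> borel_measurable borel" "AE x in lborel. u x = v x" by auto
  have \<phi>: "\<phi> n \<in> test_functions UNIV" for n using D by (simp add: D_approx_def)
  interpret represented_function s g v \<phi> "2 * real DIM('a) / (real DIM('a) - 2 * s)"
  proof
    show "weighted_sq s g < \<infinity>"
      by (rule weighted_sq_limit_finite[OF fourier_test_measurable[OF \<phi>] gm _ g(2)])
         (use weighted_sq_test[OF \<phi>, of s] s0 in simp)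
    show "2 * real DIM('a) / (real DIM('a) - 2 * s) > 1" using s by (intro Sobolev_exponent_gt_1) auto
    show "(\<lambda>n. \<integral>\<^sup>+x. ennreal (\<bar>\<phi> n x - v x\<bar> powr (2 * real DIM('a) / (real DIM('a) - 2 * s))) \<partial>lborel) \<longlonglongrightarrow> 0"
      by (rule D_approx_Lp[OF D v(2)])
  qed (use s gm v \<phi> g in auto)
  note weak = solution_weak_form[OF s0(1) s(3) sol gm g(1)]
  define N where "N = real DIM('a)"
  have N: "N \<ge> 1" by (simp add: N_def Suc_leI)
  \<comment> \<open>The radius is uniform over all flat points y' near y, and a ball of radius 2
    \<kappa> about y' still contains the ball of radius \<kappa> about y; both make the complement
    of \<open>G\<close> open.\<close>
  have loc: "\<exists>\<kappa>>0. \<forall>y'. norm (y' - y) < \<kappa> \<longrightarrow> flat_at v y' \<longrightarrow> (AE x in lborel. norm (x - y') < 2 * \<kappa> \<longrightarrow> v x = 0)"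
    if y: "y \<in> \<Omega>" for y
  proof -
    obtain R where R: "R > 0" "ball y R \<subseteq> \<Omega>" using \<Omega>(1) y open_contains_ball by blast
    \<comment> \<open>The cube of half side 2 \<delta> about y' lies within distance N (2 \<delta>)
      <= R / 2 of y', and y' lies within R / 2 of y, so the cube stays in the ball of radius
      R.\<close>
    define \<delta> where "\<delta> = min 1 (R / (4 * N))"
    have \<delta>: "0 < \<delta>" "\<delta> \<le> 1" "N * (2 * \<delta>) \<le> R / 2" using R N by (auto simp: \<delta>_def min_def field_simps)
    define \<kappa>' where "\<kappa>' = \<delta> / (2 * N) / (2 * N)"
    have \<kappa>': "\<kappa>' > 0" using \<delta> N by (simp add: \<kappa>'_def)
    define \<kappa> where "\<kappa> = min (\<kappa>' / 2) (R / 2)"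
    have "AE x in lborel. norm (x - y') < 2 * \<kappa> \<longrightarrow> v x = 0" if y': "norm (y' - y) < \<kappa>" and flat: "flat_at v y'" for y'
    proof -
      have "cbox (y' - (2 * \<delta>) *\<^sub>R One) (y' + (2 * \<delta>) *\<^sub>R One) \<subseteq> \<Omega>"
      proof
        fix x assume "x \<in> cbox (y' - (2 * \<delta>) *\<^sub>R One) (y' + (2 * \<delta>) *\<^sub>R One)"
        from norm_le_cube[OF this] have "norm (x - y') \<le> R / 2" using \<delta>(3) by (simp add: N_def)
        then have "norm (x - y) < R" using y' norm_triangle_ineq[of "x - y'" "y' - y"] by (simp add: \<kappa>_def)
        then show "x \<in> \<Omega>" using R(2) by (auto simp: dist_norm norm_minus_commute)
      qed
      from flat_imp_vanishes[OF weak \<delta>(1,2) this flat]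
      have "AE x in lborel. x \<in> cbox (y' - \<kappa>' *\<^sub>R One) (y' + \<kappa>' *\<^sub>R One) \<longrightarrow> v x = 0"
        by (simp add: \<kappa>'_def N_def)
      then show ?thesis
      proof eventually_elim
        case (elim x)
        then show ?case using ball_subset_cube[of x y' \<kappa>'] by (auto simp: \<kappa>_def)
      qed
    qed
    moreover have "\<kappa> > 0" using \<kappa>' R by (simp add: \<kappa>_def)
    ultimately show ?thesis by blast
  qed
  define G where "G = {y \<in> \<Omega>. \<exists>d>0. AE x in lborel. norm (x - y) < d \<longrightarrow> v x = 0}"
  have Gflat: "flat_at v y" if y: "y \<in> G" for y
  proof -
    obtain d where d: "d > 0" "AE x in lborel. norm (x - y) < d \<longrightarrow> v x = 0" using y by (auto simp: G_def)
    have "AE x in lborel. norm (x - y) < d \<longrightarrow> \<bar>v x\<bar> \<le> 0 * norm (x - y) ^ k" for k :: nat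
      using d(2) by eventually_elim simp
    then show ?thesis unfolding flat_at_def using d(1) by blast
  qed
  have flatG: "y \<in> G" if "y \<in> \<Omega>" "flat_at v y" for y
    using loc[OF that(1)] that by (force simp: G_def)
  have "flat_at v x0"
    unfolding flat_at_def
  proof
    fix k :: nat
    obtain C where "C > 0" and ev: "\<forall>\<^sub>F x in at x0. norm (u x) \<le> C * norm (norm (x - x0) ^ k)"
      using landau_o.bigE[OF vanish[of k]] by blast
    then obtain d where d: "d > 0" "\<And>x. x \<noteq> x0 \<Longrightarrow> dist x x0 < d \<Longrightarrow> norm (u x) \<le> C * norm (norm (x - x0) ^ k)"
      unfolding eventually_at by blast
    \<comment> \<open>The filter \<open>at x0\<close> says nothing about x0 itself, which is a null
      set.\<close>
    have "AE x in lborel. norm (x - x0) < d \<longrightarrow> \<bar>v x\<bar> \<le> C * norm (x - x0) ^ k"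
      using v(2) AE_lborel_singleton[of x0]
    proof eventually_elim
      case (elim x)
      then show ?case using d(2)[of x] by (auto simp: dist_norm)
    qed
    then show "\<exists>C d. d > 0 \<and> (AE x in lborel. norm (x - x0) < d \<longrightarrow> \<bar>v x\<bar> \<le> C * norm (x - x0) ^ k)"
      using d(1) by blast
  qed
  then have x0G: "x0 \<in> G" using flatG x0 by blast
  have G_open: "open G"
  proof (rule openI)
    fix y assume yG: "y \<in> G"
    then obtain d where d: "d > 0" "AE x in lborel. norm (x - y) < d \<longrightarrow> v x = 0" by (auto simp: G_def)
    obtain R where R: "R > 0" "ball y R \<subseteq> \<Omega>" using openE[OF \<Omega>(1), of y] yG unfolding G_def by blast
    have "ball y (min R (d / 2)) \<subseteq> G"
    proof
      fix z assume z: "z \<in> ball y (min R (d / 2))"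
      have "AE x in lborel. norm (x - z) < d / 2 \<longrightarrow> v x = 0"
        using d(2)
      proof eventually_elim
        case (elim x)
        then show ?case using z norm_triangle_ineq[of "x - z" "z - y"] by (auto simp: dist_norm norm_minus_commute)
      qed
      then show "z \<in> G" using z R d(1) by (auto simp: G_def intro!: exI[of _ "d / 2"])
    qed
    then show "\<exists>e>0. ball y e \<subseteq> G" using R d by (intro exI[of _ "min R (d / 2)"]) auto
  qed
  have G_compl: "open (\<Omega> - G)"
  proof (rule openI)
    fix y assume y: "y \<in> \<Omega> - G"
    obtain \<kappa> where \<kappa>: "\<kappa> > 0" "\<And>y'. norm (y' - y) < \<kappa> \<Longrightarrow> flat_at v y' \<Longrightarrow> (AE x in lborel. norm (x - y') < 2 * \<kappa> \<longrightarrow> v x = 0)"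
      using loc[of y] y by blast
    obtain R where R: "R > 0" "ball y R \<subseteq> \<Omega>" using \<Omega>(1) y open_contains_ball by blast
    have "z \<in> \<Omega> - G" if z: "z \<in> ball y (min R \<kappa>)" for z
    proof -
      \<comment> \<open>A point z of \<open>G\<close> near y is flat, so v vanishes within 2
        \<kappa> of z and therefore within \<kappa> of y, contrary to y not being in
        \<open>G\<close>.\<close>
      have "z \<notin> G"
      proof
        assume zG: "z \<in> G"
        have zy: "norm (z - y) < \<kappa>" using z by (simp add: dist_norm norm_minus_commute)
        have "AE x in lborel. norm (x - y) < \<kappa> \<longrightarrow> v x = 0"
          using \<kappa>(2)[OF zy Gflat[OF zG]]
        proof eventually_elim
          case (elim x)
          then show ?case using zy norm_triangle_ineq[of "x - y" "y - z"] by (auto simp: norm_minus_commute)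
        qed
        then show False using y \<kappa>(1) by (auto simp: G_def)
      qed
      then show ?thesis using z R by auto
    qed
    then show "\<exists>e>0. ball y e \<subseteq> \<Omega> - G" using R \<kappa> by (intro exI[of _ "min R \<kappa>"]) auto
  qed
  have "G = \<Omega>"
  proof (rule ccontr)
    assume "G \<noteq> \<Omega>"
    then have "\<Omega> - G \<noteq> {}" by (auto simp: G_def)
    then show False
      using connectedD[OF \<Omega>(2) G_open G_compl] x0G x0 by (auto simp: G_def)
  qed
  then have "\<forall>y\<in>\<Omega>. \<exists>d>0. AE x in lborel. norm (x - y) < d \<longrightarrow> v x = 0" by (auto simp: G_def)
  then obtain d where d: "\<And>y. y \<in> \<Omega> \<Longrightarrow> d y > 0" "\<And>y. y \<in> \<Omega> \<Longrightarrow> AE x in lborel. norm (x - y) < d y \<longrightarrow> v x = 0" by metis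
  \<comment> \<open>A countable subcover leaves only countably many exceptional null sets.\<close>
  obtain \<F> where \<F>: "\<F> \<subseteq> (\<lambda>y. ball y (d y)) ` \<Omega>" "countable \<F>" "\<Union>\<F> = \<Union>((\<lambda>y. ball y (d y)) ` \<Omega>)"
    using Lindelof[of "(\<lambda>y. ball y (d y)) ` \<Omega>"] by blast
  have "AE x in lborel. x \<in> B \<longrightarrow> v x = 0" if "B \<in> \<F>" for B
  proof -
    obtain y where y: "y \<in> \<Omega>" "B = ball y (d y)" using \<F>(1) \<open>B \<in> \<F>\<close> by blast
    show ?thesis using d(2)[OF y(1)] by eventually_elim (simp add: y(2) dist_norm norm_minus_commute)
  qed
  then have "AE x in lborel. \<forall>B\<in>\<F>. x \<in> B \<longrightarrow> v x = 0" by (subst AE_ball_countable[OF \<F>(2)]) blast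
  then have "AE x in lborel. x \<in> \<Omega> \<longrightarrow> u x = 0"
    using v(2)
  proof eventually_elim
    case (elim x)
    show ?case
    proof
      assume x: "x \<in> \<Omega>"
      then have "x \<in> \<Union>((\<lambda>y. ball y (d y)) ` \<Omega>)" using d(1) by (intro UN_I[OF x]) auto
      then have "x \<in> \<Union>\<F>" using \<F>(3) by simp
      then show "u x = 0" using elim by auto
    qed
  qed
  then show ?thesis by (simp only: AE_completion_iff)
qed

theorem theorem1p1:
  fixes s :: real and \<Omega> :: "(real ^ 'n) set" and u :: "real ^ 'n \<Rightarrow> real" and x0 :: "real ^ 'n"
  assumes s: "1 < s" "s < 2"
    and dim: "real CARD('n) > 2 * s"
    and \<Omega>: "open \<Omega>" "connected \<Omega>"
    and sol: "frac_laplace_solution s \<Omega> u"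
    and nontrivial: "\<not> (AE x in lebesgue. u x = 0)"
    and dual: "continuous_wrt_test_norm (s - 1)
                 (\<lambda>\<phi>. freq_inner s (D_fourier s u) (fourier \<phi>))"
    and x0: "x0 \<in> \<Omega>"
    and vanish: "\<And>k::nat. u \<in> O[at x0](\<lambda>x. norm (x - x0) ^ k)"
  shows "AE x in lebesgue. x \<in> \<Omega> \<longrightarrow> u x = 0"
  by (rule strong_unique_continuation[OF s _ \<Omega> sol x0 vanish]) (use dim in simp)

end
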